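(* Let $(M^{2n+1},T^{1,0})$ be a CR manifold, and let $p\in\{0,\dots,n+1\}$ and $q\in\{0,\dots,n\}$. Then $H_R^{p,q}(M)$ is isomorphic to the Kohn--Rossi cohomology group $H^{p,q}(M)$ of bidegree $(p,q)$.
   Context: CR manifolds. A CR manifold $(M^{2n+1},T^{1,0})$ is a connected real $(2n+1)$-manifold with a complex rank $n$ distribution $T^{1,0}\subset TM\otimes\mathbb C$ such that, with $T^{0,1}:=\overline{T^{1,0}}$, one has $T^{1,0}\cap T^{0,1}=\{0\}$, $[T^{1,0},T^{1,0}]\subset T^{1,0}$, and, for every real one-form $\theta$ on an open set $U$ with $\ker\theta=H|_U$, where $H:=\operatorname{Re}(T^{1,0}\oplus T^{0,1})$, the Levi form $L(Z,W):=-i\,d\theta(Z,\overline W)$ is a nondegenerate hermitian form on $T^{1,0}|_U$. Such a $\theta$ is called a local contact form; its Reeb vector field $T$ is determined by $\theta(T)=1$, $d\theta(T,\cdot)=0$. Bigraded Rumin complex. Let $\mathscr A^k$ be the sheaf of smooth real $k$-forms. For $k\le n$ put $\mathscr R^k:=\{\omega\in\mathscr A^k:\theta\wedge\omega\wedge d\theta^{n+1-k}=0,\ \theta\wedge d\omega\wedge d\theta^{n-k}=0\}$; for $k\ge n+1$ put $\mathscr R^k:=\{\omega\in\mathscr A^k:\theta\wedge\omega=0,\ \theta\wedge d\omega=0\}$, $\theta$ any local contact form (the choice is irrelevant). Then $d(\mathscr R^k)\subset\mathscr R^{k+1}$. Let $\mathscr R^k_{\mathbb C}:=\mathscr R^k\otimes\mathbb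 C$, $H_{\mathbb C}:=H\otimes\mathbb C$ and $\Lambda^{p,q}:=\Lambda^p(T^{1,0})^*\otimes\Lambda^q(T^{0,1})^*$. For $p\in\{0,\dots,n+1\}$, $q\in\{0,\dots,n\}$ put $\mathscr R^{p,q}:=\{\omega\in\mathscr R^{p+q}_{\mathbb C}:\omega|_{H_{\mathbb C}}\text{ is a section of }\Lambda^{p,q}\}$ if $p+q\le n$, and $\mathscr R^{p,q}:=\{\omega\in\mathscr R^{p+q}_{\mathbb C}:(T\lrcorner\omega)|_{H_{\mathbb C}}\text{ is a section of }\Lambda^{p-1,q}\}$ if $p+q\ge n+1$; put $\mathscr R^{p,q}=0$ for other $p,q$. Then $\mathscr R^k_{\mathbb C}=\bigoplus_{p+q=k}\mathscr R^{p,q}$, with projections $\pi^{p,q}$. Set $\bar\partial_b:=\pi^{p,q+1}\circ d$ on $\mathscr R^{p,q}$; $\bar\partial_b^2=0$. With $\mathcal R^{p,q}$ the global sections, $H_R^{p,q}(M):=\ker(\bar\partial_b\colon\mathcal R^{p,q}\to\mathcal R^{p,q+1})/\operatorname{im}(\bar\partial_b\colon\mathcal R^{p,q-1}\to\mathcal R^{p,q})$. Kohn--Rossi groups (Tanaka's intrinsic definition). Let $\Omega^k_{\mathbb C}M$ be the space of complex-valued $k$-forms on $M$ and $F^p\Omega^k_{\mathbb C}M$ the set of $\omega\in\Omega^k_{\mathbb C}M$ with $\omega(\bar Z_1,\dots,\bar Z_{k+1-p},\cdot,\dots,\cdot)=0$ for all $\bar Z_1,\dots,\bar Z_{k+1-p}\in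 T^{0,1}$. Put $\mathcal C^{p,q}:=F^p\Omega^{p+q}_{\mathbb C}M/F^{p+1}\Omega^{p+q}_{\mathbb C}M$. Since $d(F^p\Omega_{\mathbb C}^kM)\subset F^p\Omega_{\mathbb C}^{k+1}M$, the operator $\bar\partial_b\colon\mathcal C^{p,q}\to\mathcal C^{p,q+1}$, $\bar\partial_b[\omega]:=[d\omega]$, is well-defined and squares to zero. Then $H^{p,q}(M):=\ker(\bar\partial_b\colon\mathcal C^{p,q}\to\mathcal C^{p,q+1})/\operatorname{im}(\bar\partial_b\colon\mathcal C^{p,q-1}\to\mathcal C^{p,q})$. *)

theory Defs
  imports "HOL-Analysis.Analysis" "HOL-Algebra.Module" "HOL-Algebra.AbelCoset"
begin

section \<open>Complexified coordinate vectors and smooth maps\<close>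

definition re_vec :: "complex ^ 'm \<Rightarrow> real ^ 'm" where
  "re_vec z = (\<chi> i. Re (z $ i))"

definition im_vec :: "complex ^ 'm \<Rightarrow> real ^ 'm" where
  "im_vec z = (\<chi> i. Im (z $ i))"

definition cvec :: "real ^ 'm \<Rightarrow> complex ^ 'm" where
  "cvec v = (\<chi> i. complex_of_real (v $ i))"

definition cnj_vec :: "complex ^ 'm \<Rightarrow> complex ^ 'm" where
  "cnj_vec z = (\<chi> i. cnj (z $ i))"

definition cext :: "(real ^ 'm \<Rightarrow> real ^ 'm) \<Rightarrow> complex ^ 'm \<Rightarrow> complex ^ 'm" where
  "cext L z = cvec (L (re_vec z)) + \<i> *s cvec (L (im_vec z))"

fun C_k_on :: "nat \<Rightarrow> 'a::real_normed_vector set \<Rightarrow> ('a \<Rightarrow> 'b::real_normed_vector) \<Rightarrow> bool" where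
  "C_k_on 0 S f \<longleftrightarrow> continuous_on S f"
| "C_k_on (Suc k) S f \<longleftrightarrow>
     (\<forall>x\<in>S. f differentiable (at x)) \<and> (\<forall>v. C_k_on k S (\<lambda>x. frechet_derivative f (at x) v))"

text \<open>Both notions are used for open sets \<open>S\<close> only.\<close>

definition smooth_on :: "'a::real_normed_vector set \<Rightarrow> ('a \<Rightarrow> 'b::real_normed_vector) \<Rightarrow> bool" where
  "smooth_on S f \<longleftrightarrow> (\<forall>k. C_k_on k S f)"

text \<open>The derivative of a complex-valued function of real coordinates in the direction of a
  complex vector, extended complex-linearly in the direction.\<close>

definition cderiv :: "(real ^ 'm \<Rightarrow> complex) \<Rightarrow> real ^ 'm \<Rightarrow> complex ^ 'm \<Rightarrow> complex" where
  "cderiv f x z = frechet_derivative f (at x) (re_vec z) + \<i> * frechet_derivative f (at x) (im_vec z)"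

definition lie_bracket ::
  "(real ^ 'm \<Rightarrow> complex ^ 'm) \<Rightarrow> (real ^ 'm \<Rightarrow> complex ^ 'm) \<Rightarrow> real ^ 'm \<Rightarrow> complex ^ 'm" where
  "lie_bracket Z W x = (\<chi> j. cderiv (\<lambda>y. W y $ j) x (Z x) - cderiv (\<lambda>y. Z y $ j) x (W x))"


section \<open>Alternating forms on the complexified coordinate space\<close>

text \<open>A \<open>k\<close>-covector is a function of lists of vectors that vanishes on lists of length other
  than \<open>k\<close>. Thus its degree need not be passed to the operations below.\<close>

type_synonym 'm covector = "(complex ^ 'm) list \<Rightarrow> complex"

definition alt_covector :: "nat \<Rightarrow> 'm::finite covector \<Rightarrow> bool" where
  "alt_covector k \<alpha> \<longleftrightarrow>
     (\<forall>vs. length vs \<noteq> k \<longrightarrow> \<alpha> vs = 0) \<and>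
     (\<forall>vs i. length vs = k \<longrightarrow> i < k \<longrightarrow> Vector_Spaces.linear (*s) (*) (\<lambda>v. \<alpha> (vs[i := v]))) \<and>
     (\<forall>vs i j. length vs = k \<longrightarrow> i < j \<longrightarrow> j < k \<longrightarrow> vs ! i = vs ! j \<longrightarrow> \<alpha> vs = 0)"

text \<open>The shuffle formula: \<open>S\<close> is the set of positions fed to \<open>\<alpha>\<close>, and the sign is that of the
  permutation listing first \<open>S\<close> and then its complement, both in increasing order.\<close>

definition wedge :: "'m covector \<Rightarrow> 'm covector \<Rightarrow> 'm covector" where
  "wedge \<alpha> \<beta> vs =
     (\<Sum>S\<in>Pow {..<length vs}.
        (-1) ^ card {(i, j). i \<in> S \<and> j \<in> {..<length vs} - S \<and> j < i} * \<alpha> (nths vs S) * \<beta> (nths vs (- S)))"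

primrec wedge_power :: "'m covector \<Rightarrow> nat \<Rightarrow> 'm covector" where
  "wedge_power \<alpha> 0 = (\<lambda>vs. if vs = [] then 1 else 0)"
| "wedge_power \<alpha> (Suc k) = wedge \<alpha> (wedge_power \<alpha> k)"

definition contract :: "complex ^ 'm \<Rightarrow> 'm covector \<Rightarrow> 'm covector" where
  "contract v \<alpha> vs = \<alpha> (v # vs)"

text \<open>The restriction of \<open>\<alpha>\<close> to \<open>V \<oplus> W\<close> lies in the summand \<open>\<Lambda>\<^sup>p V\<^sup>* \<otimes> \<Lambda>\<^sup>q W\<^sup>*\<close> of
  \<open>\<Lambda>\<^sup>p\<^sup>+\<^sup>q (V \<oplus> W)\<^sup>*\<close>, for \<open>\<alpha>\<close> a \<open>(p+q)\<close>-covector: all the components of other bidegrees vanish.\<close>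

definition has_bidegree ::
  "(complex ^ 'm) set \<Rightarrow> (complex ^ 'm) set \<Rightarrow> nat \<Rightarrow> nat \<Rightarrow> 'm covector \<Rightarrow> bool" where
  "has_bidegree V W p q \<alpha> \<longleftrightarrow>
     (\<forall>Zs Ws. set Zs \<subseteq> V \<longrightarrow> set Ws \<subseteq> W \<longrightarrow> (length Zs, length Ws) \<noteq> (p, q) \<longrightarrow> \<alpha> (Zs @ Ws) = 0)"


section \<open>Complex vector spaces, their quotients and isomorphisms\<close>

definition complex_field :: "complex ring" where
  "complex_field = \<lparr>carrier = UNIV, monoid.mult = (*), one = 1, ring.zero = 0, add = (+)\<rparr>"

text \<open>The fields \<open>mult\<close> and \<open>one\<close> play no role in a module; we fill them with zeros.\<close>

definition quot_module :: "(complex, 'b) module \<Rightarrow> 'b set \<Rightarrow> (complex, 'b set) module" where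
  "quot_module M N =
     \<lparr>carrier = a_rcosets\<^bsub>M\<^esub> N, monoid.mult = (\<lambda>_ _. N), one = N, ring.zero = N,
      add = (\<lambda>X Y. X <+>\<^bsub>M\<^esub> Y), smult = (\<lambda>a X. \<Union>x\<in>X. N +>\<^bsub>M\<^esub> (a \<odot>\<^bsub>M\<^esub> x))\<rparr>"

definition module_isomorphic ::
  "('r, 's) ring_scheme \<Rightarrow> ('r, 'b, 'x) module_scheme \<Rightarrow> ('r, 'c, 'y) module_scheme \<Rightarrow> bool" where
  "module_isomorphic R M N \<longleftrightarrow>
     (\<exists>h. bij_betw h (carrier M) (carrier N) \<and>
          (\<forall>x\<in>carrier M. \<forall>y\<in>carrier M. h (x \<oplus>\<^bsub>M\<^esub> y) = h x \<oplus>\<^bsub>N\<^esub> h y) \<and>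
          (\<forall>a\<in>carrier R. \<forall>x\<in>carrier M. h (a \<odot>\<^bsub>M\<^esub> x) = a \<odot>\<^bsub>N\<^esub> h x))"


section \<open>Smooth manifolds and differential forms\<close>

type_synonym ('a, 'm) chart = "'a set \<times> ('a \<Rightarrow> real ^ 'm)"

definition coords :: "('a, 'm) chart \<Rightarrow> 'a set \<Rightarrow> (real ^ 'm) set" where
  "coords c U = snd c ` (fst c \<inter> U)"

definition transition :: "('a, 'm) chart \<Rightarrow> ('a, 'm) chart \<Rightarrow> real ^ 'm \<Rightarrow> real ^ 'm" where
  "transition c c' = snd c' \<circ> inv_into (fst c) (snd c)"

definition dtransition ::
  "('a, 'm::finite) chart \<Rightarrow> ('a, 'm) chart \<Rightarrow> real ^ 'm \<Rightarrow> complex ^ 'm \<Rightarrow> complex ^ 'm" where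
  "dtransition c c' x = cext (frechet_derivative (transition c c') (at x))"

text \<open>A complex differential form is given by its coordinate representations: \<open>\<omega> c x\<close> is the
  covector representing, in the chart \<open>c\<close>, the form at the point with coordinates \<open>x\<close>.
  Complex-valued alternating real-multilinear forms on tangent vectors are identified with their
  complex-multilinear extensions to complexified tangent vectors.\<close>

type_synonym ('a, 'm) dform = "('a, 'm) chart \<Rightarrow> real ^ 'm \<Rightarrow> 'm covector"

definition form_add :: "('a, 'm) dform \<Rightarrow> ('a, 'm) dform \<Rightarrow> ('a, 'm) dform" where
  "form_add \<omega> \<eta> = (\<lambda>c x vs. \<omega> c x vs + \<eta> c x vs)"

definition form_scale :: "complex \<Rightarrow> ('a, 'm) dform \<Rightarrow> ('a, 'm) dform" where
  "form_scale a \<omega> = (\<lambda>c x vs. a * \<omega> c x vs)"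

definition form_zero :: "('a, 'm) dform" where
  "form_zero = (\<lambda>c x vs. 0)"

definition form_module :: "('a, 'm) dform set \<Rightarrow> (complex, ('a, 'm) dform) module" where
  "form_module S =
     \<lparr>carrier = S, monoid.mult = (\<lambda>_ _. form_zero), one = form_zero, ring.zero = form_zero,
      add = form_add, smult = form_scale\<rparr>"

locale smooth_manifold =
  fixes M :: "'a topology" and A :: "('a, 'm::finite) chart set"
  assumes hausdorff: "Hausdorff_space M"
    and second_countable: "second_countable M"
    and cover: "(\<Union>c\<in>A. fst c) = topspace M"
    and chart_open: "c \<in> A \<Longrightarrow> openin M (fst c)"
    and chart_image_open: "c \<in> A \<Longrightarrow> open (snd c ` fst c)"
    and chart_homeomorphic:
      "c \<in> A \<Longrightarrow> homeomorphic_map (subtopology M (fst c)) (top_of_set (snd c ` fst c)) (snd c)"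
    and chart_compatible:
      "c \<in> A \<Longrightarrow> c' \<in> A \<Longrightarrow> smooth_on (coords c (fst c')) (transition c c')"
begin

text \<open>The smooth complex \<open>k\<close>-forms on the open set \<open>U\<close>; representations are extended by zero.\<close>

definition forms :: "nat \<Rightarrow> 'a set \<Rightarrow> ('a, 'm) dform set" where
  "forms k U = {\<omega>.
     (\<forall>c x. \<not> (c \<in> A \<and> x \<in> coords c U) \<longrightarrow> \<omega> c x = (\<lambda>vs. 0)) \<and>
     (\<forall>c\<in>A. \<forall>x\<in>coords c U. alt_covector k (\<omega> c x)) \<and>
     (\<forall>c\<in>A. \<forall>vs. smooth_on (coords c U) (\<lambda>x. \<omega> c x vs)) \<and>
     (\<forall>c\<in>A. \<forall>c'\<in>A. \<forall>x\<in>coords c (U \<inter> fst c'). \<forall>vs.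
        \<omega> c x vs = \<omega> c' (transition c c' x) (map (dtransition c c' x) vs))}"

definition real_forms :: "nat \<Rightarrow> 'a set \<Rightarrow> ('a, 'm) dform set" where
  "real_forms k U = {\<omega> \<in> forms k U. \<forall>c x vs. \<omega> c x (map cvec vs) \<in> \<real>}"

text \<open>In coordinates,
  \<open>d\<omega> (v\<^sub>0, \<dots>, v\<^sub>k) = \<Sum>\<^sub>i (-1)\<^sup>i (\<partial>\<omega> / \<partial>v\<^sub>i) (v\<^sub>0, \<dots>, v\<^sub>i\<^sub>-\<^sub>1, v\<^sub>i\<^sub>+\<^sub>1, \<dots>, v\<^sub>k)\<close> for constant \<open>v\<^sub>i\<close>.\<close>

definition ext_d :: "'a set \<Rightarrow> ('a, 'm) dform \<Rightarrow> ('a, 'm) dform" where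
  "ext_d U \<omega> c x vs =
     (if c \<in> A \<and> x \<in> coords c U
      then \<Sum>i<length vs. (-1) ^ i * cderiv (\<lambda>y. \<omega> c y (take i vs @ drop (Suc i) vs)) x (vs ! i)
      else 0)"

abbreviation dM :: "('a, 'm) dform \<Rightarrow> ('a, 'm) dform" where
  "dM \<equiv> ext_d (topspace M)"

end


section \<open>CR manifolds\<close>

text \<open>\<open>T10 c x\<close> is the fibre of the distribution at the point with \<open>c\<close>-coordinates \<open>x\<close>,
  expressed in the chart \<open>c\<close>. The frames \<open>Z\<close> make it a smooth complex subbundle of rank \<open>n\<close>.\<close>

locale complex_distribution = smooth_manifold M A
  for M :: "'a topology" and A :: "('a, 'm::finite) chart set" +
  fixes n :: nat and T10 :: "('a, 'm) chart \<Rightarrow> real ^ 'm \<Rightarrow> (complex ^ 'm) set"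
  assumes distribution_compatible:
      "c \<in> A \<Longrightarrow> c' \<in> A \<Longrightarrow> x \<in> coords c (fst c') \<Longrightarrow>
       dtransition c c' x ` T10 c x = T10 c' (transition c c' x)"
    and distribution_rank: "c \<in> A \<Longrightarrow> x \<in> coords c (topspace M) \<Longrightarrow> vec.dim (T10 c x) = n"
    and distribution_frame:
      "c \<in> A \<Longrightarrow> x \<in> coords c (topspace M) \<Longrightarrow>
       \<exists>V (Z :: nat \<Rightarrow> real ^ 'm \<Rightarrow> complex ^ 'm).
         open V \<and> x \<in> V \<and> V \<subseteq> coords c (topspace M) \<and> (\<forall>i<n. smooth_on V (Z i)) \<and>
         (\<forall>y\<in>V. T10 c y = vec.span ((\<lambda>i. Z i y) ` {..<n}))"
begin

definition T01 :: "('a, 'm) chart \<Rightarrow> real ^ 'm \<Rightarrow> (complex ^ 'm) set" where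
  "T01 c x = cnj_vec ` T10 c x"

definition H :: "('a, 'm) chart \<Rightarrow> real ^ 'm \<Rightarrow> (real ^ 'm) set" where
  "H c x = {re_vec (Z + W) | Z W. Z \<in> T10 c x \<and> W \<in> T01 c x}"

definition contact_form :: "'a set \<Rightarrow> ('a, 'm) dform \<Rightarrow> bool" where
  "contact_form U \<theta> \<longleftrightarrow>
     openin M U \<and> \<theta> \<in> real_forms 1 U \<and>
     (\<forall>c\<in>A. \<forall>x\<in>coords c U. {v. \<theta> c x [cvec v] = 0} = H c x)"

definition levi_form ::
  "'a set \<Rightarrow> ('a, 'm) dform \<Rightarrow> ('a, 'm) chart \<Rightarrow> real ^ 'm \<Rightarrow> complex ^ 'm \<Rightarrow> complex ^ 'm \<Rightarrow> complex" where
  "levi_form U \<theta> c x Z W = - \<i> * ext_d U \<theta> c x [Z, cnj_vec W]"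

definition reeb ::
  "'a set \<Rightarrow> ('a, 'm) dform \<Rightarrow> ('a, 'm) chart \<Rightarrow> real ^ 'm \<Rightarrow> real ^ 'm" where
  "reeb U \<theta> c x =
     (THE T. \<theta> c x [cvec T] = 1 \<and> (\<forall>v. ext_d U \<theta> c x [cvec T, cvec v] = 0))"

end

locale cr_manifold = complex_distribution M A n T10
  for M :: "'a topology" and A :: "('a, 'm::finite) chart set"
    and n :: nat and T10 :: "('a, 'm) chart \<Rightarrow> real ^ 'm \<Rightarrow> (complex ^ 'm) set" +
  assumes dimension: "CARD('m) = 2 * n + 1"
    and connected: "connected_space M"
    and transversal: "c \<in> A \<Longrightarrow> x \<in> coords c (topspace M) \<Longrightarrow> T10 c x \<inter> T01 c x = {0}"
    and integrable:
      "c \<in> A \<Longrightarrow> open V \<Longrightarrow> V \<subseteq> coords c (topspace M) \<Longrightarrow> smooth_on V X \<Longrightarrow> smooth_on V Y \<Longrightarrow>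
       (\<And>y. y \<in> V \<Longrightarrow> X y \<in> T10 c y \<and> Y y \<in> T10 c y) \<Longrightarrow> x \<in> V \<Longrightarrow>
       lie_bracket X Y x \<in> T10 c x"
    and levi_hermitian:
      "contact_form U \<theta> \<Longrightarrow> c \<in> A \<Longrightarrow> x \<in> coords c U \<Longrightarrow> Z \<in> T10 c x \<Longrightarrow> W \<in> T10 c x \<Longrightarrow>
       levi_form U \<theta> c x W Z = cnj (levi_form U \<theta> c x Z W)"
    and levi_nondegenerate:
      "contact_form U \<theta> \<Longrightarrow> c \<in> A \<Longrightarrow> x \<in> coords c U \<Longrightarrow> Z \<in> T10 c x \<Longrightarrow>
       (\<And>W. W \<in> T10 c x \<Longrightarrow> levi_form U \<theta> c x Z W = 0) \<Longrightarrow> Z = 0"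
begin


section \<open>The bigraded Rumin complex\<close>

definition rumin_real :: "nat \<Rightarrow> ('a, 'm) dform set" where
  "rumin_real k = {\<omega> \<in> real_forms k (topspace M).
     \<forall>U \<theta>. contact_form U \<theta> \<longrightarrow> (\<forall>c\<in>A. \<forall>x\<in>coords c U.
       if k \<le> n then
         wedge (\<theta> c x) (wedge (\<omega> c x) (wedge_power (ext_d U \<theta> c x) (n + 1 - k))) = (\<lambda>vs. 0) \<and>
         wedge (\<theta> c x) (wedge (dM \<omega> c x) (wedge_power (ext_d U \<theta> c x) (n - k))) = (\<lambda>vs. 0)
       else
         wedge (\<theta> c x) (\<omega> c x) = (\<lambda>vs. 0) \<and>
         wedge (\<theta> c x) (dM \<omega> c x) = (\<lambda>vs. 0))}"

definition rumin_complex :: "nat \<Rightarrow> ('a, 'm) dform set" where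
  "rumin_complex k =
     {form_add \<alpha> (form_scale \<i> \<beta>) | \<alpha> \<beta>. \<alpha> \<in> rumin_real k \<and> \<beta> \<in> rumin_real k}"

text \<open>In the second case below \<open>p \<ge> 1\<close>, because \<open>q \<le> n\<close>.\<close>

definition rumin_bi :: "nat \<Rightarrow> nat \<Rightarrow> ('a, 'm) dform set" where
  "rumin_bi p q =
     (if p \<le> n + 1 \<and> q \<le> n then
        if p + q \<le> n then
          {\<omega> \<in> rumin_complex (p + q).
             \<forall>c\<in>A. \<forall>x\<in>coords c (topspace M). has_bidegree (T10 c x) (T01 c x) p q (\<omega> c x)}
        else
          {\<omega> \<in> rumin_complex (p + q).
             \<forall>U \<theta>. contact_form U \<theta> \<longrightarrow> (\<forall>c\<in>A. \<forall>x\<in>coords c U.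
               has_bidegree (T10 c x) (T01 c x) (p - 1) q (contract (cvec (reeb U \<theta> c x)) (\<omega> c x)))}
      else {form_zero})"

text \<open>The projection onto the summand \<open>rumin_bi p q\<close> of
  \<open>rumin_complex (p + q) = (\<Oplus>a\<le>p + q. rumin_bi a (p + q - a))\<close>.\<close>

definition rumin_proj :: "nat \<Rightarrow> nat \<Rightarrow> ('a, 'm) dform \<Rightarrow> ('a, 'm) dform" where
  "rumin_proj p q \<omega> =
     (THE \<eta>. \<exists>f. (\<forall>a\<le>p + q. f a \<in> rumin_bi a (p + q - a)) \<and>
                 \<omega> = (\<lambda>c x vs. \<Sum>a\<le>p + q. f a c x vs) \<and> \<eta> = f p)"

definition rumin_dbar :: "nat \<Rightarrow> nat \<Rightarrow> ('a, 'm) dform \<Rightarrow> ('a, 'm) dform" where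
  "rumin_dbar p q \<omega> = rumin_proj p (q + 1) (dM \<omega>)"

text \<open>For \<open>q = 0\<close> the incoming operator, defined on the zero space of bidegree \<open>(p, -1)\<close>,
  has image zero; likewise in \<open>kohn_rossi_im\<close>.\<close>

definition rumin_im :: "nat \<Rightarrow> nat \<Rightarrow> ('a, 'm) dform set" where
  "rumin_im p q = (case q of 0 \<Rightarrow> {form_zero} | Suc r \<Rightarrow> rumin_dbar p r ` rumin_bi p r)"

definition rumin_cohomology :: "nat \<Rightarrow> nat \<Rightarrow> (complex, ('a, 'm) dform set) module" where
  "rumin_cohomology p q =
     quot_module
       (form_module
          (a_kernel (form_module (rumin_bi p q)) (form_module (rumin_bi p (q + 1))) (rumin_dbar p q)))
       (rumin_im p q)"


section \<open>Kohn--Rossi cohomology\<close>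

text \<open>Used for \<open>p \<le> k + 1\<close> only, so that the subtraction is not truncated.\<close>

definition filtration :: "nat \<Rightarrow> nat \<Rightarrow> ('a, 'm) dform set" where
  "filtration p k = {\<omega> \<in> forms k (topspace M).
     \<forall>c\<in>A. \<forall>x\<in>coords c (topspace M). \<forall>Zs vs.
       length Zs = k + 1 - p \<longrightarrow> set Zs \<subseteq> T01 c x \<longrightarrow> \<omega> c x (Zs @ vs) = 0}"

definition kohn_rossi_space :: "nat \<Rightarrow> nat \<Rightarrow> (complex, ('a, 'm) dform set) module" where
  "kohn_rossi_space p q =
     quot_module (form_module (filtration p (p + q))) (filtration (p + 1) (p + q))"

text \<open>The class of \<open>d \<omega>\<close> for any representative \<open>\<omega>\<close> of \<open>X\<close>; it does not depend on \<open>\<omega>\<close>.\<close>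

definition kohn_rossi_dbar :: "nat \<Rightarrow> nat \<Rightarrow> ('a, 'm) dform set \<Rightarrow> ('a, 'm) dform set" where
  "kohn_rossi_dbar p q X =
     (\<Union>\<omega>\<in>X. filtration (p + 1) (p + q + 1) +>\<^bsub>form_module (filtration p (p + q + 1))\<^esub> dM \<omega>)"

definition kohn_rossi_im :: "nat \<Rightarrow> nat \<Rightarrow> ('a, 'm) dform set set" where
  "kohn_rossi_im p q =
     (case q of 0 \<Rightarrow> {\<zero>\<^bsub>kohn_rossi_space p 0\<^esub>}
      | Suc r \<Rightarrow> kohn_rossi_dbar p r ` carrier (kohn_rossi_space p r))"

definition kohn_rossi_cohomology :: "nat \<Rightarrow> nat \<Rightarrow> (complex, ('a, 'm) dform set set) module" where
  "kohn_rossi_cohomology p q =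
     quot_module
       ((kohn_rossi_space p q)
          \<lparr>carrier := a_kernel (kohn_rossi_space p q) (kohn_rossi_space p (q + 1)) (kohn_rossi_dbar p q)\<rparr>)
       (kohn_rossi_im p q)"

end

end

theory Submission
  imports Defs "HOL-Library.Function_Algebras"
begin

text \<open>Write \<open>k = p + q\<close>. A form lies in the \<open>p\<close>-th step \<open>F\<^sup>p\<close> of the filtration of \<open>k\<close>-forms iff it is
  killed by \<open>q + 1\<close> vectors of type \<open>(0,1)\<close>; integrability gives \<open>d F\<^sup>p \<subseteq> F\<^sup>p\<close>. The isomorphism is induced by
  the inclusion \<open>R\<^sup>p\<^sup>,\<^sup>q \<subseteq> F\<^sup>p\<close>, and \<open>R\<^sup>p\<^sup>,\<^sup>q \<inter> F\<^sup>p\<^sup>+\<^sup>1 = 0\<close>. For \<open>\<omega>\<close> in \<open>F\<^sup>p\<close>, the Lefschetz isomorphisms for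
  \<open>d\<theta>\<close> on horizontal covectors give two facts: a unique \<open>\<eta>\<close> in \<open>F\<^sup>p\<close> of a special shape
  \<open>\<theta> \<and> d\<theta>\<^bsup>j\<^esup> \<and> \<gamma>\<close> makes the leading part (of type \<open>(p,q)\<close>) of \<open>\<omega> - d\<eta>\<close> primitive; and if the leading parts of
  \<open>\<omega>\<close> and of \<open>d\<omega>\<close> are primitive, then \<open>\<omega>\<close> is congruent modulo \<open>F\<^sup>p\<^sup>+\<^sup>1\<close> to a unique element of \<open>R\<^sup>p\<^sup>,\<^sup>q\<close>.
  By uniqueness the local solutions glue. Iterating the second fact over \<open>p\<close> decomposes the Rumin complex
  compatibly with the filtration, so that \<open>g\<close> in \<open>R\<^sup>p\<^sup>,\<^sup>q\<^sup>+\<^sup>1\<close> equals the Rumin differential of \<open>f\<close> in \<open>R\<^sup>p\<^sup>,\<^sup>q\<close>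
  iff \<open>d f - g\<close> lies in \<open>F\<^sup>p\<^sup>+\<^sup>1\<close>; the first fact then yields surjectivity and injectivity on cohomology.\<close>


section \<open>Calculus of smooth functions\<close>

text \<open>Modulo \<open>F^(p+1)\<close> a form of bidegree (p,q) carries a horizontal part of type
  (p,q) and a \<theta>-part of type (p-1,q), more than a Rumin form does. For horizontal X the
  horizontal part of d(\<theta> \<and> X) is d\<theta> \<and> X, so the surplus is governed by L =
  d\<theta> \<and> _. With X = d\<theta>^j \<and> \<gamma>, primitivity of the corrected leading
  part becomes a single equation L^m \<gamma> = L^i \<alpha>, with degrees for which L^m is a
  Lefschetz isomorphism; this dictates the shape of \<eta>. Solutions have to be smooth in the
  point, and spaces of smooth fields allow no dimension count. The Lefschetz isomorphism is
  therefore derived from the commutator relation alone, and is applied both to covectors at a point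
  and to fields of them. A contact form is available only locally, and the Reeb field and the
  splitting of forms change with it. The conditions used for gluing are therefore stated without
  Reeb field or frame, and survive the replacement of \<theta>, d\<theta> by g \<theta>, g d\<theta>
  + \<mu> \<and> \<theta>.\<close>

lemma frechet_derivative_eq:
  "(f has_derivative f') (at x) ==> frechet_derivative f (at x) v = f' v"
  using frechet_derivative_at[of f f' x] by simp

lemma frechet_cong_open:
  assumes "open S" "x \<in> S" "\<And>y. y \<in> S ==> f y = g y"
  shows "f differentiable (at x) \<longleftrightarrow> g differentiable (at x)"
    and "f differentiable (at x) ==> frechet_derivative f (at x) = frechet_derivative g (at x)"
proof -
  have 1: "(f has_derivative f') (at x) \<longleftrightarrow> (g has_derivative f') (at x)" for f'
    using has_derivative_transform_within_open[OF _ assms(1,2)] assms(3) by (metis (no_types))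
  then show "f differentiable (at x) \<longleftrightarrow> g differentiable (at x)"
    unfolding differentiable_def by blast
  show "frechet_derivative f (at x) = frechet_derivative g (at x)" if "f differentiable (at x)"
    using that 1 frechet_derivative_works frechet_derivative_at by metis
qed

section \<open>Closure of \<open>C_k_on\<close> under restriction, algebraic operations and
  composition\<close>

lemma C_k_on_cong:
  assumes "open S" "\<And>y. y \<in> S ==> f y = g y" "C_k_on k S f"
  shows "C_k_on k S g"
  using assms(2,3)
proof (induction k arbitrary: f g)
  case 0
  then show ?case using continuous_on_cong[of S S f g] by simp
next
  case (Suc k)
  note d = frechet_cong_open[OF assms(1) _ Suc.prems(1)]
  show ?case
    using Suc.prems(2) d
    by (auto intro!: Suc.IH[of "\<lambda>x. frechet_derivative f (at x) v" "\<lambda>x. frechet_derivative g (at x) v" for v])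
qed

lemma C_k_on_SucD: "C_k_on (Suc k) S f ==> C_k_on k S f"
proof (induction k arbitrary: f)
  case 0
  then show ?case
    by (auto intro!: continuous_at_imp_continuous_on differentiable_imp_continuous_within)
next
  case (Suc k)
  then show ?case
    by (metis C_k_on.simps(2))
qed

lemma C_k_on_subset: "C_k_on k S f ==> T \<subseteq> S ==> C_k_on k T f"
  by (induction k arbitrary: f) (auto intro: continuous_on_subset)

text \<open>Continuity and derivatives at a point see only a neighbourhood of it. Glued forms are
  shown to be smooth through this.\<close>

lemma C_k_on_local:
  "(\<And>x. x \<in> S ==> \<exists>V. open V \<and> x \<in> V \<and> C_k_on k V f) ==> C_k_on k S f"
proof (induction k arbitrary: f)
  case 0
  then show ?case
    by (metis C_k_on.simps(1) continuous_at_imp_continuous_on continuous_on_eq_continuous_at)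
next
  case (Suc k)
  have "C_k_on k S (\<lambda>x. frechet_derivative f (at x) v)" for v
    by (rule Suc.IH) (metis Suc.prems C_k_on.simps(2))
  moreover have "f differentiable (at x)" if "x \<in> S" for x
    using Suc.prems[OF that] by auto
  ultimately show ?case by simp
qed

lemma C_k_on_const: "C_k_on k S (\<lambda>x. c)"
  by (induction k arbitrary: c) (auto simp: frechet_derivative_const)

lemma C_k_on_add:
  assumes "open S"
  shows "C_k_on k S f ==> C_k_on k S g ==> C_k_on k S (\<lambda>x. f x + g x)"
proof (induction k arbitrary: f g)
  case 0
  then show ?case by (auto intro: continuous_intros)
next
  case (Suc k)
  have "C_k_on k S (\<lambda>x. frechet_derivative (\<lambda>x. f x + g x) (at x) v)" for v
  proof (rule C_k_on_cong[OF assms(1)])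
    show "C_k_on k S (\<lambda>x. frechet_derivative f (at x) v + frechet_derivative g (at x) v)"
      using Suc by auto
    show "frechet_derivative f (at y) v + frechet_derivative g (at y) v =
        frechet_derivative (\<lambda>x. f x + g x) (at y) v" if "y \<in> S" for y
      by (rule frechet_derivative_eq[symmetric])
        (use Suc.prems that in \<open>auto intro!: has_derivative_add simp: frechet_derivative_works\<close>)
  qed
  then show ?case using Suc.prems by auto
qed

text \<open>By the Leibniz rule the derivative contains the factors themselves next to their
  derivatives; \<open>C_k_on_SucD\<close> lowers their order so that the induction hypothesis
  applies to both summands.\<close>

lemma (in bounded_bilinear) C_k_on_prod:
  assumes "open S"
  shows "C_k_on k S f ==> C_k_on k S g ==> C_k_on k S (\<lambda>x. prod (f x) (g x))"
proof (induction k arbitrary: f g)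
  case 0
  then show ?case by (auto intro: continuous_on)
next
  case (Suc k)
  have "C_k_on k S (\<lambda>x. frechet_derivative (\<lambda>x. prod (f x) (g x)) (at x) v)" for v
  proof (rule C_k_on_cong[OF assms(1)])
    show "C_k_on k S (\<lambda>x. prod (f x) (frechet_derivative g (at x) v) + prod (frechet_derivative f (at x) v) (g x))"
      using Suc.prems Suc.prems[THEN C_k_on_SucD] by (intro C_k_on_add assms Suc.IH) auto
    show "prod (f y) (frechet_derivative g (at y) v) + prod (frechet_derivative f (at y) v) (g y) =
        frechet_derivative (\<lambda>x. prod (f x) (g x)) (at y) v" if "y \<in> S" for y
      by (rule frechet_derivative_eq[symmetric, OF FDERIV])
        (use Suc.prems that in \<open>auto simp: frechet_derivative_works\<close>)
  qed
  moreover have "(\<lambda>x. prod (f x) (g x)) differentiable (at x)" if "x \<in> S" for x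
    unfolding differentiable_def
    by (rule exI, rule FDERIV) (use Suc.prems that in \<open>auto simp: frechet_derivative_works\<close>)
  ultimately show ?case by simp
qed

lemma C_k_on_bounded_linear:
  assumes "open S" "bounded_linear h"
  shows "C_k_on k S f ==> C_k_on k S (\<lambda>x. h (f x))"
proof (induction k arbitrary: f)
  case 0
  then show ?case by (auto intro: bounded_linear.continuous_on[OF assms(2)])
next
  case (Suc k)
  have D: "((\<lambda>x. h (f x)) has_derivative (\<lambda>v. h (frechet_derivative f (at y) v))) (at y)" if "y \<in> S" for y
    using Suc.prems that by (intro bounded_linear.has_derivative[OF assms(2)]) (auto simp: frechet_derivative_works)
  have "C_k_on k S (\<lambda>x. frechet_derivative (\<lambda>x. h (f x)) (at x) v)" for v
    by (rule C_k_on_cong[OF assms(1), of "\<lambda>x. h (frechet_derivative f (at x) v)"])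
      (use Suc frechet_derivative_eq[OF D] in auto)
  then show ?case using D unfolding C_k_on.simps differentiable_def by blast
qed

text \<open>In the chain rule \<open>g\<close> is differentiated in a direction that varies with the
  point, whereas \<open>C_k_on\<close> speaks of fixed directions. Expanding the direction in an
  orthonormal basis leaves a finite sum of products with fixed directions; hence the euclidean space
  in the middle.\<close>

lemma C_k_on_compose:
  fixes f :: "'a::real_normed_vector => 'b::euclidean_space" and g :: "'b => 'c::real_normed_vector"
  assumes "open S" "open T" "f ` S \<subseteq> T" "C_k_on k S f" "C_k_on k T g"
  shows "C_k_on k S (\<lambda>x. g (f x))"
  using assms(4,5)
proof (induction k arbitrary: g)
  case 0
  then show ?case using assms(3) by (auto intro: continuous_on_compose2)
next
  case (Suc k)
  have D: "((\<lambda>x. g (f x)) has_derivative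
      (\<lambda>v. frechet_derivative g (at (f y)) (frechet_derivative f (at y) v))) (at y)" if "y \<in> S" for y
    using Suc.prems that assms(3) diff_chain_at[of f _ y g]
    by (auto simp: frechet_derivative_works image_subset_iff o_def)
  have "C_k_on k S (\<lambda>x. frechet_derivative (\<lambda>x. g (f x)) (at x) v)" for v
  proof (rule C_k_on_cong[OF assms(1)])
    have "C_k_on k S (\<lambda>x. (frechet_derivative f (at x) v \<bullet> b) *\<^sub>R frechet_derivative g (at (f x)) b)" for b
      using Suc.prems C_k_on_SucD[OF Suc.prems(1)]
      by (intro bounded_bilinear.C_k_on_prod[OF bounded_bilinear_scaleR] assms
        C_k_on_bounded_linear[OF assms(1) bounded_linear_inner_left] Suc.IH) auto
    moreover have "finite B ==> (\<And>b. C_k_on k S (F b)) ==> C_k_on k S (\<lambda>x. \<Sum>b\<in>B. F b x)"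
      for B :: "'b set" and F :: "'b => 'a => 'c"
      by (induction B rule: finite_induct) (auto intro: C_k_on_const C_k_on_add[OF assms(1)])
    ultimately show "C_k_on k S (\<lambda>x. \<Sum>b\<in>Basis. (frechet_derivative f (at x) v \<bullet> b) *\<^sub>R frechet_derivative g (at (f x)) b)"
      by auto
    show "(\<Sum>b\<in>Basis. (frechet_derivative f (at y) v \<bullet> b) *\<^sub>R frechet_derivative g (at (f y)) b) =
        frechet_derivative (\<lambda>x. g (f x)) (at y) v" if "y \<in> S" for y
    proof -
      have "linear (frechet_derivative g (at (f y)))"
        using Suc.prems that assms(3) by (intro linear_frechet_derivative) auto
      then show ?thesis
        by (simp add: frechet_derivative_eq[OF D[OF that]] euclidean_representation
            flip: linear_scale[of "frechet_derivative g (at (f y))"] linear_sum[of "frechet_derivative g (at (f y))"])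
    qed
  qed
  then show ?case using D unfolding C_k_on.simps differentiable_def by blast
qed

text \<open>The derivative is a product of the derivative of \<open>f\<close> with two copies of the
  inverse, to which the induction hypothesis applies.\<close>

lemma C_k_on_inverse:
  fixes f :: "'a::real_normed_vector => 'b::real_normed_field"
  assumes "open S" "\<And>x. x \<in> S ==> f x \<noteq> 0"
  shows "C_k_on k S f ==> C_k_on k S (\<lambda>x. inverse (f x))"
proof (induction k)
  case 0
  then show ?case using assms by (auto intro!: continuous_on_inverse)
next
  case (Suc k)
  have D: "((\<lambda>x. inverse (f x)) has_derivative
      (\<lambda>v. - (inverse (f y) * frechet_derivative f (at y) v * inverse (f y)))) (at y)" if "y \<in> S" for y
    using Suc.prems that assms(2) by (intro Deriv.has_derivative_inverse) (auto simp: frechet_derivative_works)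
  have "C_k_on k S (\<lambda>x. frechet_derivative (\<lambda>x. inverse (f x)) (at x) v)" for v
  proof (rule C_k_on_cong[OF assms(1), of "\<lambda>x. - (inverse (f x) * frechet_derivative f (at x) v * inverse (f x))"])
    show "C_k_on k S (\<lambda>x. - (inverse (f x) * frechet_derivative f (at x) v * inverse (f x)))"
      using Suc C_k_on_SucD[OF Suc.prems]
      by (intro C_k_on_bounded_linear[OF assms(1) bounded_linear_minus[OF bounded_linear_ident]]
          bounded_bilinear.C_k_on_prod[OF bounded_bilinear_mult assms(1)]) auto
  qed (use frechet_derivative_eq[OF D] in auto)
  then show ?case using D unfolding C_k_on.simps differentiable_def by blast
qed

section \<open>The same closure properties for smooth maps\<close>

lemma smooth_on_cong:
  "open S ==> (\<And>y. y \<in> S ==> f y = g y) ==> smooth_on S f ==> smooth_on S g"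
  unfolding smooth_on_def using C_k_on_cong by blast

lemma smooth_on_subset: "smooth_on S f ==> T \<subseteq> S ==> smooth_on T f"
  unfolding smooth_on_def using C_k_on_subset by blast

lemma smooth_on_local:
  "(\<And>x. x \<in> S ==> \<exists>V. open V \<and> x \<in> V \<and> smooth_on V f) ==> smooth_on S f"
  unfolding smooth_on_def using C_k_on_local[of S] by (metis (no_types, lifting))

lemma smooth_on_const [intro!, simp]: "smooth_on S (\<lambda>x. c)"
  unfolding smooth_on_def using C_k_on_const by blast

lemma smooth_on_add: "open S ==> smooth_on S f ==> smooth_on S g ==> smooth_on S (\<lambda>x. f x + g x)"
  unfolding smooth_on_def using C_k_on_add by blast

lemma smooth_on_bounded_linear:
  "open S ==> bounded_linear h ==> smooth_on S f ==> smooth_on S (\<lambda>x. h (f x))"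
  unfolding smooth_on_def using C_k_on_bounded_linear by blast

lemma smooth_on_mult:
  fixes f g :: "'a::real_normed_vector => 'b::real_normed_algebra"
  shows "open S ==> smooth_on S f ==> smooth_on S g ==> smooth_on S (\<lambda>x. f x * g x)"
  unfolding smooth_on_def using bounded_bilinear.C_k_on_prod[OF bounded_bilinear_mult] by blast

lemma smooth_on_inverse:
  fixes f :: "'a::real_normed_vector => 'b::real_normed_field"
  shows "open S ==> (\<And>x. x \<in> S ==> f x \<noteq> 0) ==> smooth_on S f ==> smooth_on S (\<lambda>x. inverse (f x))"
  unfolding smooth_on_def using C_k_on_inverse by blast

lemma smooth_on_divide:
  fixes f :: "'a::real_normed_vector => 'b::real_normed_field"
  shows "open S ==> (\<And>x. x \<in> S ==> g x \<noteq> 0) ==> smooth_on S f ==> smooth_on S g ==> smooth_on S (\<lambda>x. f x / g x)"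
  unfolding divide_inverse by (intro smooth_on_mult smooth_on_inverse)

lemma smooth_on_uminus: "open S ==> smooth_on S f ==> smooth_on S (\<lambda>x. - f x)"
  by (rule smooth_on_bounded_linear[OF _ bounded_linear_minus[OF bounded_linear_ident]])

lemma smooth_on_diff: "open S ==> smooth_on S f ==> smooth_on S g ==> smooth_on S (\<lambda>x. f x - g x)"
  using smooth_on_add[of S f "\<lambda>x. - g x"] smooth_on_uminus[of S g] by simp

lemma smooth_on_sum:
  "open S ==> (\<And>i. i \<in> I ==> smooth_on S (f i)) ==> smooth_on S (\<lambda>x. \<Sum>i\<in>I. f i x)"
  by (induction I rule: infinite_finite_induct) (auto intro: smooth_on_add)

lemma smooth_on_prod:
  fixes f :: "'i => 'a::real_normed_vector => 'b::{real_normed_algebra,comm_ring_1}"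
  shows "open S ==> (\<And>i. i \<in> I ==> smooth_on S (f i)) ==> smooth_on S (\<lambda>x. \<Prod>i\<in>I. f i x)"
  by (induction I rule: infinite_finite_induct) (auto intro: smooth_on_mult)

lemma smooth_on_compose:
  fixes f :: "'a::real_normed_vector => 'b::euclidean_space"
  shows "open S ==> open T ==> f ` S \<subseteq> T ==> smooth_on S f ==> smooth_on T g ==> smooth_on S (\<lambda>x. g (f x))"
  unfolding smooth_on_def using C_k_on_compose by blast

lemma smooth_on_differentiable: "smooth_on S f ==> x \<in> S ==> f differentiable (at x)"
  unfolding smooth_on_def by (metis C_k_on.simps(2))

lemma smooth_on_has_derivative:
  "smooth_on S f ==> x \<in> S ==> (f has_derivative frechet_derivative f (at x)) (at x)"
  using smooth_on_differentiable frechet_derivative_works by blast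

lemma smooth_on_continuous: "smooth_on S f ==> continuous_on S f"
  unfolding smooth_on_def by (metis C_k_on.simps(1))

lemma smooth_on_frechet: "smooth_on S f ==> smooth_on S (\<lambda>x. frechet_derivative f (at x) v)"
  unfolding smooth_on_def by (metis C_k_on.simps(2))

lemma smooth_on_vec:
  fixes f :: "'a::real_normed_vector => 'b::euclidean_space ^ 'm::finite"
  assumes "open S" "\<And>i. smooth_on S (\<lambda>x. f x $ i)"
  shows "smooth_on S f"
proof -
  have "bounded_linear (axis i :: 'b => 'b ^ 'm)" for i
    unfolding linear_conv_bounded_linear[symmetric]
    by (rule linearI) (auto simp: axis_def vec_eq_iff)
  then have "smooth_on S (\<lambda>x. axis i (f x $ i))" for i
    by (rule smooth_on_bounded_linear[OF assms(1) _ assms(2)])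
  then have "smooth_on S (\<lambda>x. \<Sum>i\<in>UNIV. axis i (f x $ i))"
    by (intro smooth_on_sum assms(1))
  moreover have "(\<Sum>i\<in>UNIV. axis i (f x $ i)) = f x" for x
    by (simp add: vec_eq_iff axis_def)
  ultimately show ?thesis by simp
qed

lemma smooth_on_nth:
  fixes f :: "'a::real_normed_vector => 'b::euclidean_space ^ 'm::finite"
  assumes "open S" "smooth_on S f"
  shows "smooth_on S (\<lambda>x. f x $ i)"
  by (rule smooth_on_bounded_linear[OF assms(1) bounded_linear_vec_nth assms(2)])

section \<open>Symmetry of second derivatives\<close>

lemma line_derivative:
  assumes "smooth_on S f" "x + s *\<^sub>R v + a \<in> S"
  shows "((\<lambda>s. f (x + s *\<^sub>R v + a)) has_derivative
    (\<lambda>h. h *\<^sub>R frechet_derivative f (at (x + s *\<^sub>R v + a)) v)) (at s)"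
proof -
  have "((\<lambda>s. x + s *\<^sub>R v + a) has_derivative (\<lambda>h. h *\<^sub>R v)) (at s)"
    by (auto intro!: derivative_eq_intros)
  then have "((\<lambda>s. f (x + s *\<^sub>R v + a)) has_derivative
    (\<lambda>h. frechet_derivative f (at (x + s *\<^sub>R v + a)) (h *\<^sub>R v))) (at s)"
    using diff_chain_at[of "\<lambda>s. x + s *\<^sub>R v + a" _ s f] smooth_on_has_derivative[OF assms]
    by (simp add: o_def)
  moreover have "linear (frechet_derivative f (at (x + s *\<^sub>R v + a)))"
    by (intro linear_frechet_derivative smooth_on_differentiable[OF assms])
  ultimately show ?thesis by (simp add: linear_scale)
qed

text \<open>Two applications of the mean value theorem: in direction v to the increment in direction
  w, then in direction w to the derivative in direction v. The second difference is symmetric in v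
  and w, while the order of differentiation is not.\<close>

lemma second_difference:
  fixes f :: "'a::real_normed_vector => real"
  assumes f: "smooth_on S f" and d: "0 < d"
    and S: "\<And>s t. 0 \<le> s ==> s \<le> d ==> 0 \<le> t ==> t \<le> d ==> x + s *\<^sub>R v + t *\<^sub>R w \<in> S"
  obtains s t where "0 < s" "s < d" "0 < t" "t < d"
    "f (x + d *\<^sub>R v + d *\<^sub>R w) - f (x + d *\<^sub>R v) - f (x + d *\<^sub>R w) + f x =
     d * d * frechet_derivative (\<lambda>y. frechet_derivative f (at y) v) (at (x + s *\<^sub>R v + t *\<^sub>R w)) w"
proof -
  define g where "g s = f (x + s *\<^sub>R v + d *\<^sub>R w) - f (x + s *\<^sub>R v)" for s
  have g: "(g has_derivative (\<lambda>h. h * (frechet_derivative f (at (x + s *\<^sub>R v + d *\<^sub>R w)) v -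
      frechet_derivative f (at (x + s *\<^sub>R v)) v))) (at s)" if "0 \<le> s" "s \<le> d" for s
    unfolding g_def right_diff_distrib
    using line_derivative[OF f, of x s v "d *\<^sub>R w"] line_derivative[OF f, of x s v 0] S[of s d] S[of s 0] that d
    by (intro has_derivative_diff) auto
  obtain s where s: "0 < s" "s < d" "g d - g 0 = d * (frechet_derivative f (at (x + s *\<^sub>R v + d *\<^sub>R w)) v -
      frechet_derivative f (at (x + s *\<^sub>R v)) v)"
    using mvt_simple[OF d, of g "\<lambda>s h. h * (frechet_derivative f (at (x + s *\<^sub>R v + d *\<^sub>R w)) v -
      frechet_derivative f (at (x + s *\<^sub>R v)) v)"] g has_derivative_at_withinI by force
  define k where "k t = frechet_derivative f (at (x + s *\<^sub>R v + t *\<^sub>R w)) v" for t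
  have k: "(k has_derivative (\<lambda>h. h * frechet_derivative (\<lambda>y. frechet_derivative f (at y) v)
      (at (x + s *\<^sub>R v + t *\<^sub>R w)) w)) (at t)" if "0 \<le> t" "t \<le> d" for t
    using line_derivative[OF smooth_on_frechet[OF f, of v], of x t w "s *\<^sub>R v"] S[of s t] that s
    unfolding k_def by (simp add: algebra_simps)
  obtain t where t: "0 < t" "t < d" "k d - k 0 = d * frechet_derivative (\<lambda>y. frechet_derivative f (at y) v)
      (at (x + s *\<^sub>R v + t *\<^sub>R w)) w"
    using mvt_simple[OF d, of k "\<lambda>t h. h * frechet_derivative (\<lambda>y. frechet_derivative f (at y) v)
      (at (x + s *\<^sub>R v + t *\<^sub>R w)) w"] k has_derivative_at_withinI by force
  show thesis
    using that[OF s(1,2) t(1,2)] s(3) t(3) by (simp add: g_def k_def algebra_simps)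
qed

text \<open>Evaluating the second difference in both orders makes the two mixed derivatives agree at
  two points near \<open>x\<close>. If they differed at \<open>x\<close>, continuity would keep them
  apart.\<close>

lemma frechet_derivative_symmetric_real:
  fixes f :: "'a::real_normed_vector => real"
  assumes "open S" "smooth_on S f" "x \<in> S"
  shows "frechet_derivative (\<lambda>y. frechet_derivative f (at y) v) (at x) w =
         frechet_derivative (\<lambda>y. frechet_derivative f (at y) w) (at x) v" (is "?A v w x = ?A w v x")
proof (rule ccontr)
  assume ne: "?A v w x \<noteq> ?A w v x"
  define e where "e = \<bar>?A v w x - ?A w v x\<bar> / 2"
  have e: "0 < e" using ne by (simp add: e_def)
  have cont: "isCont (?A v w) x" for v w
    using smooth_on_continuous[OF smooth_on_frechet[OF smooth_on_frechet[OF assms(2)]]]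
      continuous_on_eq_continuous_at assms by blast
  obtain r1 r2 r3 where r: "0 < r1" "\<And>y. dist y x < r1 ==> dist (?A v w y) (?A v w x) < e"
      "0 < r2" "\<And>y. dist y x < r2 ==> dist (?A w v y) (?A w v x) < e" "0 < r3" "ball x r3 \<subseteq> S"
    using cont[of v w] cont[of w v] assms(1,3) e unfolding continuous_at_eps_delta openE open_contains_ball
    by metis
  define r where "r = min r1 (min r2 r3)"
  \<comment> \<open>This keeps the parallelogram spanned by d v and d w within distance r of x; the
    summand 1 covers v = w = 0.\<close>
  define d where "d = r / (2 * (norm v + norm w + 1))"
  have pos: "0 < r" using r by (auto simp: r_def)
  have nn: "0 < norm v + norm w + 1" by (simp add: add_nonneg_pos)
  have d: "0 < d" using pos nn by (simp add: d_def)
  have near: "dist (x + s *\<^sub>R v' + t *\<^sub>R w') x < r" "dist (x + s *\<^sub>R v' + t *\<^sub>R w') x < r1" "dist (x + s *\<^sub>R v' + t *\<^sub>R w') x < r2" "x + s *\<^sub>R v' + t *\<^sub>R w' \<in> S"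
    if "0 \<le> s" "s \<le> d" "0 \<le> t" "t \<le> d" "(v', w') \<in> {(v, w), (w, v)}" for s t v' w'
  proof -
    have "norm (s *\<^sub>R v' + t *\<^sub>R w') \<le> d * norm v' + d * norm w'"
      using that by (intro norm_triangle_le add_mono) (auto intro: mult_right_mono)
    also have "\<dots> = d * (norm v + norm w)" using that by (auto simp: algebra_simps)
    also have "\<dots> < d * (2 * (norm v + norm w + 1))"
    proof (rule mult_strict_left_mono[OF _ d])
      have "0 \<le> norm v" "0 \<le> norm w" by simp_all
      then show "norm v + norm w < 2 * (norm v + norm w + 1)" by (simp add: add_nonneg_pos)
    qed
    also have "\<dots> = r" using nn by (simp add: d_def)
    finally show 1: "dist (x + s *\<^sub>R v' + t *\<^sub>R w') x < r" by (simp add: dist_norm add.assoc)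
    then show "dist (x + s *\<^sub>R v' + t *\<^sub>R w') x < r1" "dist (x + s *\<^sub>R v' + t *\<^sub>R w') x < r2" "x + s *\<^sub>R v' + t *\<^sub>R w' \<in> S"
      using r(6) by (auto simp: r_def dist_commute)
  qed
  obtain s t where st: "0 < s" "s < d" "0 < t" "t < d"
    "f (x + d *\<^sub>R v + d *\<^sub>R w) - f (x + d *\<^sub>R v) - f (x + d *\<^sub>R w) + f x = d * d * ?A v w (x + s *\<^sub>R v + t *\<^sub>R w)"
    by (rule second_difference[OF assms(2) d]) (use near in auto)
  obtain s' t' where st': "0 < s'" "s' < d" "0 < t'" "t' < d"
    "f (x + d *\<^sub>R w + d *\<^sub>R v) - f (x + d *\<^sub>R w) - f (x + d *\<^sub>R v) + f x = d * d * ?A w v (x + s' *\<^sub>R w + t' *\<^sub>R v)"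
    by (rule second_difference[OF assms(2) d]) (use near in auto)
  have "?A v w (x + s *\<^sub>R v + t *\<^sub>R w) = ?A w v (x + s' *\<^sub>R w + t' *\<^sub>R v)"
    using st(5) st'(5) d by (simp add: algebra_simps)
  moreover have "dist (?A v w (x + s *\<^sub>R v + t *\<^sub>R w)) (?A v w x) < e"
    using st near by (intro r) auto
  moreover have "dist (?A w v (x + s' *\<^sub>R w + t' *\<^sub>R v)) (?A w v x) < e"
    using st' near by (intro r) auto
  ultimately show False unfolding e_def dist_real_def by argo
qed

lemma frechet_derivative_bounded_linear:
  assumes "bounded_linear h" "f differentiable (at x)"
  shows "frechet_derivative (\<lambda>x. h (f x)) (at x) v = h (frechet_derivative f (at x) v)"
  by (rule frechet_derivative_eq, rule bounded_linear.has_derivative[OF assms(1)])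
    (use assms(2) frechet_derivative_works in blast)

text \<open>The mean value theorem is about real values, so the claim is tested on the real and
  imaginary parts, which commute with differentiation.\<close>

lemma frechet_derivative_symmetric:
  fixes f :: "'a::real_normed_vector => complex"
  assumes "open S" "smooth_on S f" "x \<in> S"
  shows "frechet_derivative (\<lambda>y. frechet_derivative f (at y) v) (at x) w =
         frechet_derivative (\<lambda>y. frechet_derivative f (at y) w) (at x) v"
proof -
  have "h (frechet_derivative (\<lambda>y. frechet_derivative f (at y) v) (at x) w) =
      frechet_derivative (\<lambda>y. frechet_derivative (\<lambda>y. h (f y)) (at y) v) (at x) w"
    if h: "bounded_linear h" for h :: "complex => real" and v w
  proof -
    have "h (frechet_derivative (\<lambda>y. frechet_derivative f (at y) v) (at x) w) =
        frechet_derivative (\<lambda>y. h (frechet_derivative f (at y) v)) (at x) w"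
      using frechet_derivative_bounded_linear[OF h]
        smooth_on_differentiable[OF smooth_on_frechet[OF assms(2)] assms(3)] by metis
    also have "\<dots> = frechet_derivative (\<lambda>y. frechet_derivative (\<lambda>y. h (f y)) (at y) v) (at x) w"
      using frechet_derivative_bounded_linear[OF h smooth_on_differentiable[OF assms(2)]]
        smooth_on_differentiable[OF smooth_on_frechet[OF smooth_on_bounded_linear[OF assms(1) h assms(2)]] assms(3)]
      by (subst frechet_cong_open(2)[OF assms(1,3), of _ "\<lambda>y. frechet_derivative (\<lambda>y. h (f y)) (at y) v"])
        (auto simp: frechet_cong_open(1)[OF assms(1,3), of _ "\<lambda>y. frechet_derivative (\<lambda>y. h (f y)) (at y) v"])
    finally show ?thesis .
  qed
  note 1 = this
  have "h (frechet_derivative (\<lambda>y. frechet_derivative f (at y) v) (at x) w) =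
      h (frechet_derivative (\<lambda>y. frechet_derivative f (at y) w) (at x) v)"
    if h: "bounded_linear h" for h :: "complex => real"
    unfolding 1[OF h]
    by (rule frechet_derivative_symmetric_real[OF assms(1) smooth_on_bounded_linear[OF assms(1) h assms(2)] assms(3)])
  from this[OF bounded_linear_Re] this[OF bounded_linear_Im] show ?thesis by (rule complex_eqI)
qed

section \<open>Derivatives in complexified directions\<close>

lemma re_vec_simps [simp]:
  "re_vec (z + w) = re_vec z + re_vec w" "im_vec (z + w) = im_vec z + im_vec w"
  "re_vec (a *s z) = Re a *\<^sub>R re_vec z - Im a *\<^sub>R im_vec z"
  "im_vec (a *s z) = Re a *\<^sub>R im_vec z + Im a *\<^sub>R re_vec z"
  "re_vec 0 = 0" "im_vec 0 = 0"
  "re_vec (cvec v) = v" "im_vec (cvec v) = 0"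
  "re_vec (cnj_vec z) = re_vec z" "im_vec (cnj_vec z) = - im_vec z"
  by (auto simp: re_vec_def im_vec_def cvec_def cnj_vec_def vec_eq_iff)

lemma cvec_re_im: "cvec (re_vec z) + \<i> *s cvec (im_vec z) = z"
  by (auto simp: re_vec_def im_vec_def cvec_def vec_eq_iff complex_eq_iff)

lemma cvec_simps [simp]:
  "cvec (v + w) = cvec v + cvec w" "cvec (v - w) = cvec v - cvec w" "cvec (r *\<^sub>R v) = complex_of_real r *s cvec v"
  "cvec (- v) = - cvec v" "cvec 0 = 0"
  by (auto simp: cvec_def vec_eq_iff)

lemma cnj_vec_simps [simp]:
  "cnj_vec (z + w) = cnj_vec z + cnj_vec w" "cnj_vec (z - w) = cnj_vec z - cnj_vec w"
  "cnj_vec (a *s z) = cnj a *s cnj_vec z" "cnj_vec 0 = 0"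
  "cnj_vec (cnj_vec z) = z" "cnj_vec (cvec v) = cvec v" "cnj_vec z $ i = cnj (z $ i)"
  by (auto simp: cnj_vec_def cvec_def vec_eq_iff)

lemma smooth_on_cnj: "open S ==> smooth_on S f ==> smooth_on S (\<lambda>x. cnj (f x))"
  by (rule smooth_on_bounded_linear[OF _ bounded_linear_cnj])

lemma smooth_on_cnj_vec:
  fixes f :: "'a::real_normed_vector => complex ^ 'm::finite"
  shows "open S ==> smooth_on S f ==> smooth_on S (\<lambda>x. cnj_vec (f x))"
  by (rule smooth_on_vec) (auto intro: smooth_on_cnj smooth_on_nth)

lemma cderiv_cong:
  assumes "open S" "x \<in> S" "\<And>y. y \<in> S ==> f y = g y" "smooth_on S f"
  shows "cderiv f x z = cderiv g x z"
  unfolding cderiv_def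
  using frechet_cong_open(2)[OF assms(1-3) smooth_on_differentiable[OF assms(4,2)]] by simp

lemma cderiv_add_vec:
  "f differentiable (at x) ==> cderiv f x (z + w) = cderiv f x z + cderiv f x w"
  unfolding cderiv_def using linear_frechet_derivative[of f "at x"]
  by (simp add: linear_add algebra_simps)

lemma cderiv_scale_vec:
  "f differentiable (at x) ==> cderiv f x (a *s z) = a * cderiv f x z"
  unfolding cderiv_def using linear_frechet_derivative[of f "at x"]
  by (simp add: linear_add linear_diff linear_scale complex_eq_iff algebra_simps)

lemma vec_basis_sum: "(\<Sum>i\<in>UNIV. (z $ i) *s axis i 1) = (z :: 'a::semiring_1 ^ 'm::finite)"
  by (simp add: vec_eq_iff axis_def if_distrib[of "\<lambda>x. _ * x"] cong: if_cong)

lemma cderiv_const [simp]: "cderiv (\<lambda>y. c) x z = 0"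
  by (simp add: cderiv_def frechet_derivative_const)

lemma cderiv_add:
  "f differentiable (at x) ==> g differentiable (at x) ==>
    cderiv (\<lambda>y. f y + g y) x z = cderiv f x z + cderiv g x z"
  unfolding cderiv_def frechet_derivative_works
  by (subst (1 2) frechet_derivative_eq[OF has_derivative_add]) (auto simp: algebra_simps)

lemma cderiv_mult:
  "f differentiable (at x) ==> g differentiable (at x) ==>
    cderiv (\<lambda>y. f y * g y) x z = cderiv f x z * g x + f x * cderiv g x z"
  unfolding cderiv_def frechet_derivative_works
  by (subst (1 2) frechet_derivative_eq[OF has_derivative_mult]) (auto simp: algebra_simps)

lemma cderiv_cmult:
  "f differentiable (at x) ==> cderiv (\<lambda>y. c * f y) x z = c * cderiv f x z"
  using cderiv_mult[of "\<lambda>y. c" x f z] by simp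

lemma cderiv_uminus: "f differentiable (at x) ==> cderiv (\<lambda>y. - f y) x z = - cderiv f x z"
  using cderiv_cmult[of f x "-1" z] by simp

lemma cderiv_diff:
  "f differentiable (at x) ==> g differentiable (at x) ==>
    cderiv (\<lambda>y. f y - g y) x z = cderiv f x z - cderiv g x z"
  using cderiv_add[of f x "\<lambda>y. - g y" z] by (simp add: cderiv_uminus)

lemma cderiv_sum:
  "(\<And>i. i \<in> I ==> f i differentiable (at x)) ==>
    cderiv (\<lambda>y. \<Sum>i\<in>I. f i y) x z = (\<Sum>i\<in>I. cderiv (f i) x z)"
  by (induction I rule: infinite_finite_induct) (auto simp: cderiv_add)

lemma cderiv_cnj:
  assumes "f differentiable (at x)"
  shows "cderiv (\<lambda>y. cnj (f y)) x z = cnj (cderiv f x (cnj_vec z))"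
  unfolding cderiv_def using linear_frechet_derivative[OF assms]
  by (simp add: frechet_derivative_bounded_linear[OF bounded_linear_cnj assms] linear_neg)

lemma smooth_on_cderiv:
  fixes f :: "real ^ 'm::finite => complex"
  assumes "open S" "smooth_on S f"
  shows "smooth_on S (\<lambda>x. cderiv f x z)"
  unfolding cderiv_def
  by (intro smooth_on_add smooth_on_mult smooth_on_const smooth_on_frechet assms)

lemma cderiv_symmetric:
  fixes f :: "real ^ 'm::finite => complex"
  assumes "open S" "smooth_on S f" "x \<in> S"
  shows "cderiv (\<lambda>y. cderiv f y z) x w = cderiv (\<lambda>y. cderiv f y w) x z"
proof -
  have *: "cderiv (\<lambda>y. cderiv f y z) x w =
      cderiv (\<lambda>y. frechet_derivative f (at y) (re_vec z)) x w + \<i> * cderiv (\<lambda>y. frechet_derivative f (at y) (im_vec z)) x w" for z w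
    unfolding cderiv_def[of f]
    using smooth_on_differentiable[OF smooth_on_frechet[OF assms(2)] assms(3)]
    by (subst cderiv_add) (auto simp: cderiv_cmult)
  show ?thesis
    unfolding * unfolding cderiv_def using frechet_derivative_symmetric[OF assms]
    by (simp add: algebra_simps)
qed

lemma cderiv_compose:
  fixes \<phi> :: "real ^ 'm::finite => real ^ 'm"
  assumes "\<phi> differentiable (at x)" "g differentiable (at (\<phi> x))"
  shows "cderiv (\<lambda>y. g (\<phi> y)) x z = cderiv g (\<phi> x) (cext (frechet_derivative \<phi> (at x)) z)"
proof -
  have "((\<lambda>y. g (\<phi> y)) has_derivative
      (\<lambda>v. frechet_derivative g (at (\<phi> x)) (frechet_derivative \<phi> (at x) v))) (at x)"
    using diff_chain_at[of \<phi> _ x g] assms unfolding frechet_derivative_works by (simp add: o_def)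
  then show ?thesis
    by (simp add: cderiv_def cext_def frechet_derivative_eq)
qed

section \<open>The algebra of covectors\<close>

definition cscale :: "complex => 'm covector => 'm covector" where
  "cscale a \<alpha> = (\<lambda>vs. a * \<alpha> vs)"

text \<open>The parity involution, with the degree read off the length of the argument list. Sign
  rules phrased with it hold for all functions on lists, not only for homogeneous ones.\<close>

definition grade_sign :: "'m covector => 'm covector" where
  "grade_sign \<alpha> = (\<lambda>vs. (-1) ^ length vs * \<alpha> vs)"

definition pullback :: "(complex ^ 'm => complex ^ 'm) => 'm covector => 'm covector" where
  "pullback F \<alpha> = (\<lambda>vs. \<alpha> (map F vs))"

text \<open>This is the sum of (-1)^i \<open>f\<close> v_i (the list without v_i), in a recursive
  form that suits inductions over arguments. The exterior derivative, the product with a one-form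
  and the derivation induced by an endomorphism all have this shape.\<close>

primrec altsum :: "('b => 'b list => complex) => 'b list => complex" where
  "altsum f [] = 0"
| "altsum f (v # vs) = f v vs - altsum (\<lambda>u us. f u (v # us)) vs"

text \<open>Identities between covectors are proved by induction on the argument list, with the
  contractions of both sides in the induction step.\<close>

lemma covector_eqI:
  assumes "\<alpha> [] = \<beta> []" "\<And>v. contract v \<alpha> = contract v \<beta>"
  shows "\<alpha> = \<beta>"
proof
  show "\<alpha> vs = \<beta> vs" for vs
    using assms by (cases vs) (auto simp: contract_def fun_eq_iff)
qed

lemma contract_simps [simp]:
  "contract v (\<alpha> + \<beta>) = contract v \<alpha> + contract v \<beta>"
  "contract v (\<alpha> - \<beta>) = contract v \<alpha> - contract v \<beta>"
  "contract v (- \<alpha>) = - contract v \<alpha>"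
  "contract v 0 = 0"
  "contract v (cscale a \<alpha>) = cscale a (contract v \<alpha>)"
  "contract v (grade_sign \<alpha>) = - grade_sign (contract v \<alpha>)"
  "contract v (pullback F \<alpha>) = pullback F (contract (F v) \<alpha>)"
  by (auto simp: contract_def cscale_def grade_sign_def pullback_def fun_eq_iff)

lemma contract_sum: "contract v (\<Sum>i\<in>I. \<alpha> i) = (\<Sum>i\<in>I. contract v (\<alpha> i))"
  by (induction I rule: infinite_finite_induct) (simp_all del: plus_fun_apply zero_fun_apply)

lemma cscale_simps [simp]:
  "cscale a (\<alpha> + \<beta>) = cscale a \<alpha> + cscale a \<beta>"
  "cscale a (\<alpha> - \<beta>) = cscale a \<alpha> - cscale a \<beta>"
  "cscale a (- \<alpha>) = - cscale a \<alpha>" "cscale (- a) \<alpha> = - cscale a \<alpha>"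
  "cscale a 0 = 0" "cscale 0 \<alpha> = 0" "cscale 1 \<alpha> = \<alpha>"
  "cscale a (cscale b \<alpha>) = cscale (a * b) \<alpha>"
  by (auto simp: cscale_def fun_eq_iff algebra_simps)

lemma cscale_add_left: "cscale (a + b) \<alpha> = cscale a \<alpha> + cscale b \<alpha>"
  by (auto simp: cscale_def fun_eq_iff algebra_simps)

lemma cscale_diff_left: "cscale (a - b) \<alpha> = cscale a \<alpha> - cscale b \<alpha>"
  by (auto simp: cscale_def fun_eq_iff algebra_simps)

lemma cscale_apply: "cscale a \<alpha> vs = a * \<alpha> vs" by (simp add: cscale_def)

lemma cscale_eq_0 [simp]: "cscale a \<alpha> = 0 \<longleftrightarrow> a = 0 \<or> \<alpha> = 0"
  by (auto simp: cscale_def fun_eq_iff)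

lemma cscale_sum: "cscale a (\<Sum>i\<in>I. \<alpha> i) = (\<Sum>i\<in>I. cscale a (\<alpha> i))"
  by (induction I rule: infinite_finite_induct) (simp_all del: plus_fun_apply zero_fun_apply)

lemma sum_apply: "(\<Sum>i\<in>I. f i) x = (\<Sum>i\<in>I. f i x)"
  by (induction I rule: infinite_finite_induct) simp_all

lemma grade_sign_simps [simp]:
  "grade_sign (grade_sign \<alpha>) = \<alpha>" "grade_sign (\<alpha> + \<beta>) = grade_sign \<alpha> + grade_sign \<beta>"
  "grade_sign (\<alpha> - \<beta>) = grade_sign \<alpha> - grade_sign \<beta>"
  "grade_sign (- \<alpha>) = - grade_sign \<alpha>" "grade_sign 0 = 0"
  "grade_sign (cscale a \<alpha>) = cscale a (grade_sign \<alpha>)"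
  by (auto simp: grade_sign_def cscale_def fun_eq_iff algebra_simps simp flip: power_add mult.assoc)

lemma pullback_simps [simp]:
  "pullback F (\<alpha> + \<beta>) = pullback F \<alpha> + pullback F \<beta>"
  "pullback F (\<alpha> - \<beta>) = pullback F \<alpha> - pullback F \<beta>"
  "pullback F (- \<alpha>) = - pullback F \<alpha>" "pullback F 0 = 0"
  "pullback F (cscale a \<alpha>) = cscale a (pullback F \<alpha>)"
  "pullback F (grade_sign \<alpha>) = grade_sign (pullback F \<alpha>)"
  by (auto simp: pullback_def grade_sign_def cscale_def fun_eq_iff)

lemma pullback_pullback: "pullback F (pullback G \<alpha>) = pullback (G \<circ> F) \<alpha>"
  by (auto simp: pullback_def fun_eq_iff)

lemma pullback_id: "(\<And>v. F v = v) ==> pullback F \<alpha> = \<alpha>"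
  by (auto simp: pullback_def fun_eq_iff map_idI)

subsection \<open>The wedge product\<close>

lemma wedge_Nil: "wedge \<alpha> \<beta> [] = \<alpha> [] * \<beta> []"
  by (simp add: wedge_def)

lemma Pow_lessThan_Suc_split:
  "(\<Sum>S\<in>Pow {..<Suc n}. f S) = (\<Sum>S\<in>Pow {..<n}. f (insert 0 (Suc ` S)) + f (Suc ` S))"
proof -
  have "Pow {..<Suc n} = (\<lambda>S. insert 0 (Suc ` S)) ` Pow {..<n} \<union> (\<lambda>S. Suc ` S) ` Pow {..<n}"
    unfolding lessThan_Suc_eq_insert_0 Pow_insert image_Pow_surj[OF refl, symmetric] image_image
    by blast
  moreover have "inj_on (\<lambda>S. insert 0 (Suc ` S)) (Pow {..<n})" "inj_on (\<lambda>S. Suc ` S) (Pow {..<n})"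
    by (auto intro!: inj_onI)
  moreover have "(\<lambda>S. insert 0 (Suc ` S)) ` Pow {..<n} \<inter> (\<lambda>S. Suc ` S) ` Pow {..<n} = {}"
    by auto
  ultimately show ?thesis
    by (simp add: sum.union_disjoint sum.reindex sum.distrib)
qed

lemma length_nths_subset: "S \<subseteq> {..<length vs} ==> length (nths vs S) = card S"
  by (simp add: length_nths) (metis (no_types, lifting) Collect_cong Collect_mem_eq lessThan_iff subset_iff)

text \<open>The sets of positions are split by whether they contain the first one. If not, v goes to
  \<beta> and all entries fed to \<alpha> have to pass it; these \<open>card S\<close> inversions
  are the sign in \<open>grade_sign\<close>.\<close>

lemma contract_wedge:
  "contract v (wedge \<alpha> \<beta>) = wedge (contract v \<alpha>) \<beta> + wedge (grade_sign \<alpha>) (contract v \<beta>)"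
proof
  fix vs :: "(complex ^ 'a) list"
  define n where "n = length vs"
  define I where "I m S = {(i, j). i \<in> S \<and> j \<in> {..<m} - S \<and> j < (i::nat)}" for m S
  have I0: "card (I (Suc n) (insert 0 (Suc ` S))) = card (I n S)" for S
  proof -
    have "I (Suc n) (insert 0 (Suc ` S)) = (\<lambda>(i, j). (Suc i, Suc j)) ` I n S"
      unfolding I_def by (auto simp: image_iff less_Suc_eq_0_disj Bex_def)
    moreover have "inj_on (\<lambda>(i, j). (Suc i, Suc j)) (I n S)" by (auto simp: inj_on_def)
    ultimately show ?thesis by (simp only: card_image)
  qed
  have I1: "card (I (Suc n) (Suc ` S)) = card S + card (I n S)" if "S \<subseteq> {..<n}" for S
  proof -
    have fin: "finite S" using that finite_subset by blast
    have "I (Suc n) (Suc ` S) = (\<lambda>i. (Suc i, 0)) ` S \<union> (\<lambda>(i, j). (Suc i, Suc j)) ` I n S"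
      unfolding I_def using that by (auto simp: image_iff less_Suc_eq_0_disj Bex_def)
    moreover have "finite (I n S)"
      by (rule finite_subset[of _ "S \<times> {..<n}"]) (use fin in \<open>auto simp: I_def\<close>)
    moreover have "(\<lambda>i. (Suc i, 0)) ` S \<inter> (\<lambda>(i, j). (Suc i, Suc j)) ` I n S = {}" by auto
    moreover have "inj_on (\<lambda>(i, j). (Suc i, Suc j)) (I n S)" "inj_on (\<lambda>i. (Suc i, 0::nat)) S"
      by (auto simp: inj_on_def)
    ultimately show ?thesis using fin by (simp only: card_Un_disjoint card_image finite_imageI)
  qed
  have N: "nths (v # vs) (insert 0 (Suc ` S)) = v # nths vs S" "nths (v # vs) (Suc ` S) = nths vs S"
    "nths (v # vs) (- insert 0 (Suc ` S)) = nths vs (- S)" "nths (v # vs) (- Suc ` S) = v # nths vs (- S)" for S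
    by (auto simp: nths_Cons intro!: arg_cong[of _ _ "nths vs"])
  show "contract v (wedge \<alpha> \<beta>) vs = (wedge (contract v \<alpha>) \<beta> + wedge (grade_sign \<alpha>) (contract v \<beta>)) vs"
    unfolding contract_def wedge_def plus_fun_def grade_sign_def I_def[symmetric] length_Cons
      Pow_lessThan_Suc_split n_def[symmetric] N sum.distrib[symmetric]
    by (rule sum.cong[OF refl]) (auto simp: I0[unfolded n_def] I1[unfolded n_def] power_add length_nths_subset n_def algebra_simps)
qed

lemma wedge_simps [simp]:
  "wedge (\<alpha> + \<beta>) \<gamma> = wedge \<alpha> \<gamma> + wedge \<beta> \<gamma>" "wedge \<gamma> (\<alpha> + \<beta>) = wedge \<gamma> \<alpha> + wedge \<gamma> \<beta>"
  "wedge (cscale a \<alpha>) \<gamma> = cscale a (wedge \<alpha> \<gamma>)" "wedge \<gamma> (cscale a \<alpha>) = cscale a (wedge \<gamma> \<alpha>)"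
  "wedge 0 \<gamma> = 0" "wedge \<gamma> 0 = 0"
  by (auto simp: wedge_def cscale_def fun_eq_iff sum_distrib_left algebra_simps simp flip: sum.distrib)

lemma wedge_uminus [simp]: "wedge (- \<alpha>) \<gamma> = - wedge \<alpha> \<gamma>" "wedge \<gamma> (- \<alpha>) = - wedge \<gamma> \<alpha>"
  using wedge_simps(3)[of "- 1" \<alpha> \<gamma>] wedge_simps(4)[of \<gamma> "- 1" \<alpha>] by simp_all

lemma wedge_diff [simp]: "wedge (\<alpha> - \<beta>) \<gamma> = wedge \<alpha> \<gamma> - wedge \<beta> \<gamma>" "wedge \<gamma> (\<alpha> - \<beta>) = wedge \<gamma> \<alpha> - wedge \<gamma> \<beta>"
  using wedge_simps(1)[of \<alpha> "- \<beta>" \<gamma>] wedge_simps(2)[of \<gamma> \<alpha> "- \<beta>"] by simp_all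

lemma wedge_sum:
  "wedge (\<Sum>i\<in>I. f i) \<gamma> = (\<Sum>i\<in>I. wedge (f i) \<gamma>)" "wedge \<gamma> (\<Sum>i\<in>I. f i) = (\<Sum>i\<in>I. wedge \<gamma> (f i))"
  by (induction I rule: infinite_finite_induct) auto

lemma grade_sign_wedge: "grade_sign (wedge \<alpha> \<beta> :: 'm::finite covector) = wedge (grade_sign \<alpha>) (grade_sign \<beta>)"
proof
  show "grade_sign (wedge \<alpha> \<beta>) vs = wedge (grade_sign \<alpha>) (grade_sign \<beta>) vs" for vs
  proof (induction vs arbitrary: \<alpha> \<beta>)
    case Nil
    then show ?case by (simp add: grade_sign_def wedge_Nil)
  next
    case (Cons v vs)
    have "contract v (grade_sign (wedge \<alpha> \<beta>)) vs = contract v (wedge (grade_sign \<alpha>) (grade_sign \<beta>)) vs"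
      by (simp add: contract_wedge Cons)
    then show ?case by (simp only: contract_def)
  qed
qed

lemma wedge_assoc: "wedge (wedge \<alpha> \<beta>) (\<gamma> :: 'm::finite covector) = wedge \<alpha> (wedge \<beta> \<gamma>)"
proof
  show "wedge (wedge \<alpha> \<beta>) \<gamma> vs = wedge \<alpha> (wedge \<beta> \<gamma>) vs" for vs
  proof (induction vs arbitrary: \<alpha> \<beta> \<gamma>)
    case Nil
    then show ?case by (simp add: wedge_Nil)
  next
    case (Cons v vs)
    have "contract v (wedge (wedge \<alpha> \<beta>) \<gamma>) vs = contract v (wedge \<alpha> (wedge \<beta> \<gamma>)) vs"
      by (simp add: contract_wedge Cons grade_sign_wedge)
    then show ?case by (simp only: contract_def)
  qed
qed

text \<open>Contraction exchanges even and odd \<alpha>, so both parities are treated in one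
  induction over the argument list. The parity of \<beta> is accounted for by
  \<open>grade_sign\<close>.\<close>

lemma wedge_commute:
  fixes \<alpha> \<beta> :: "'m::finite covector"
  shows "grade_sign \<alpha> = \<alpha> ==> wedge \<alpha> \<beta> = wedge \<beta> \<alpha>"
  "grade_sign \<alpha> = - \<alpha> ==> wedge \<alpha> \<beta> = wedge (grade_sign \<beta>) \<alpha>"
proof -
  have "(grade_sign \<alpha> = \<alpha> --> wedge \<alpha> \<beta> vs = wedge \<beta> \<alpha> vs) \<and>
      (grade_sign \<alpha> = - \<alpha> --> wedge \<alpha> \<beta> vs = wedge (grade_sign \<beta>) \<alpha> vs)" for vs
  proof (induction vs arbitrary: \<alpha> \<beta>)
    case Nil
    then show ?case by (simp add: wedge_Nil grade_sign_def)
  next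
    case (Cons v vs)
    have 1: "grade_sign (contract v \<alpha>) = - contract v (grade_sign \<alpha>)" by simp
    show ?case
    proof (intro conjI impI)
      assume a: "grade_sign \<alpha> = \<alpha>"
      then have "wedge (contract v \<alpha>) \<beta> vs = wedge (grade_sign \<beta>) (contract v \<alpha>) vs"
        "wedge \<alpha> (contract v \<beta>) vs = wedge (contract v \<beta>) \<alpha> vs"
        using Cons.IH 1 by metis+
      then have "contract v (wedge \<alpha> \<beta>) vs = contract v (wedge \<beta> \<alpha>) vs"
        by (simp add: contract_wedge a)
      then show "wedge \<alpha> \<beta> (v # vs) = wedge \<beta> \<alpha> (v # vs)" by (simp add: contract_def)
    next
      assume a: "grade_sign \<alpha> = - \<alpha>"
      then have "wedge (contract v \<alpha>) \<beta> vs = wedge \<beta> (contract v \<alpha>) vs"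
        "wedge \<alpha> (contract v \<beta>) vs = wedge (grade_sign (contract v \<beta>)) \<alpha> vs"
        using Cons.IH 1 by (metis contract_simps(3) minus_minus)+
      then have "contract v (wedge \<alpha> \<beta>) vs = contract v (wedge (grade_sign \<beta>) \<alpha>) vs"
        by (simp add: contract_wedge a)
      then show "wedge \<alpha> \<beta> (v # vs) = wedge (grade_sign \<beta>) \<alpha> (v # vs)" by (simp add: contract_def)
    qed
  qed
  then show "grade_sign \<alpha> = \<alpha> ==> wedge \<alpha> \<beta> = wedge \<beta> \<alpha>"
    "grade_sign \<alpha> = - \<alpha> ==> wedge \<alpha> \<beta> = wedge (grade_sign \<beta>) \<alpha>" by auto
qed

lemma pullback_wedge: "pullback F (wedge \<alpha> \<beta>) = wedge (pullback F \<alpha>) (pullback F \<beta>)"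
  by (auto simp: pullback_def wedge_def fun_eq_iff nths_map)

lemma wedge_unit: "wedge (\<lambda>vs. if vs = [] then c else 0) (\<beta> :: 'm::finite covector) = cscale c \<beta>"
proof
  show "wedge (\<lambda>vs. if vs = [] then c else 0) \<beta> vs = cscale c \<beta> vs" for vs
  proof (induction vs arbitrary: \<beta>)
    case (Cons v vs)
    have 1: "contract v (\<lambda>vs. if vs = [] then c else 0) = 0"
      "grade_sign (\<lambda>vs. if vs = [] then c else 0) = (\<lambda>vs. if vs = [] then c else 0)"
      by (auto simp: contract_def grade_sign_def fun_eq_iff)
    have "contract v (wedge (\<lambda>vs. if vs = [] then c else 0) \<beta>) vs = contract v (cscale c \<beta>) vs"
      by (simp only: contract_wedge 1 wedge_simps add_0 Cons contract_simps)
    then show ?case by (simp add: contract_def cscale_def)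
  qed (simp add: wedge_Nil cscale_def)
qed

lemma wedge_power_funpow: "wedge (wedge_power \<alpha> k) (\<beta> :: 'm::finite covector) = (wedge \<alpha> ^^ k) \<beta>"
  by (induction k) (simp_all only: wedge_power.simps wedge_unit wedge_assoc cscale_simps funpow.simps o_apply id_apply)

lemma pullback_wedge_power: "pullback F (wedge_power \<alpha> k) = wedge_power (pullback F \<alpha>) k"
  by (induction k) (auto simp: pullback_wedge, simp add: pullback_def)

lemma grade_sign_wedge_power: "grade_sign \<alpha> = (\<alpha> :: 'm::finite covector) ==> grade_sign (wedge_power \<alpha> k) = wedge_power \<alpha> k"
proof (induction k)
  case (Suc k)
  then show ?case by (simp only: wedge_power.simps grade_sign_wedge)
qed (auto simp: grade_sign_def)

subsection \<open>Alternating covectors\<close>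

text \<open>A recursive version of \<open>alt_covector\<close>, shown equivalent in
  \<open>alt_covector_iff_alternating\<close>. It follows the pattern of the inductions below, which
  contract with the first argument. In degree 0 it leaves only the value on the empty list.\<close>

primrec alternating :: "nat => 'm::finite covector => bool" where
  "alternating 0 \<alpha> \<longleftrightarrow> (\<forall>v. contract v \<alpha> = 0)"
| "alternating (Suc k) \<alpha> \<longleftrightarrow> \<alpha> [] = 0 \<and> (\<forall>v. alternating k (contract v \<alpha>)) \<and>
     (\<forall>v w a. contract (v + a *s w) \<alpha> = contract v \<alpha> + cscale a (contract w \<alpha>)) \<and>
     (\<forall>v. contract v (contract v \<alpha>) = 0)"

lemma alternating_length: "alternating k \<alpha> ==> length vs \<noteq> k ==> \<alpha> vs = 0"
proof (induction k arbitrary: \<alpha> vs)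
  case 0
  then show ?case by (cases vs) (auto simp: contract_def fun_eq_iff)
next
  case (Suc k)
  show ?case
  proof (cases vs)
    case (Cons v us)
    with Suc.prems Suc.IH[of "contract v \<alpha>" us] have "contract v \<alpha> us = 0" by simp
    then show ?thesis by (simp add: contract_def Cons)
  qed (use Suc in simp)
qed

lemma alternating_contract_linear:
  assumes "alternating k \<alpha>"
  shows "contract (v + a *s w) \<alpha> = contract v \<alpha> + cscale a (contract w \<alpha>)"
  using assms by (cases k) auto

lemma alternating_contract:
  assumes "alternating k \<alpha>"
  shows "contract (v + w) \<alpha> = contract v \<alpha> + contract w \<alpha>"
    "contract (a *s w) \<alpha> = cscale a (contract w \<alpha>)" "contract 0 \<alpha> = 0"
    "contract v (contract v \<alpha>) = 0"
proof -
  show 0: "contract 0 \<alpha> = 0"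
    using alternating_contract_linear[OF assms, of 0 1 0] by simp
  show "contract (v + w) \<alpha> = contract v \<alpha> + contract w \<alpha>"
    using alternating_contract_linear[OF assms, of v 1 w] by simp
  show "contract (a *s w) \<alpha> = cscale a (contract w \<alpha>)"
    using alternating_contract_linear[OF assms, of 0 a w] 0 by simp
  show "contract v (contract v \<alpha>) = 0"
    using assms by (cases k) auto
qed

lemma alternating_contract_diff:
  "alternating k \<alpha> ==> contract (v - w) \<alpha> = contract v \<alpha> - contract w \<alpha>"
  using alternating_contract(1)[of k \<alpha> "v - w" w] by (simp add: algebra_simps)

lemma alternating_contract_sum:
  "alternating k \<alpha> ==> contract (\<Sum>i\<in>I. a i *s v i) \<alpha> = (\<Sum>i\<in>I. cscale (a i) (contract (v i) \<alpha>))"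
  by (induction I rule: infinite_finite_induct) (auto simp: alternating_contract)

lemma alternating_contract_alternating:
  "alternating k \<alpha> ==> alternating (k - 1) (contract v \<alpha>)"
  by (cases k) (auto simp: contract_def fun_eq_iff zero_fun_def)

lemma alternating_contract_swap:
  assumes "alternating k \<alpha>"
  shows "contract v (contract w \<alpha>) = - contract w (contract v \<alpha>)"
proof -
  have "contract (v + w) (contract (v + w) \<alpha>) = 0" by (rule alternating_contract[OF assms])
  then have "contract v (contract w \<alpha>) + contract w (contract v \<alpha>) = 0"
    using alternating_contract[OF alternating_contract_alternating[OF assms]]
    by (simp add: alternating_contract[OF assms] add.commute)
  then show ?thesis by (simp add: eq_neg_iff_add_eq_0)
qed

lemma alternating_repeat: "alternating k \<alpha> ==> v \<in> set vs ==> \<alpha> (v # vs) = 0"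
proof (induction vs arbitrary: \<alpha> k)
  case (Cons w us)
  show ?case
  proof (cases "w = v")
    case True
    then show ?thesis using alternating_contract(4)[OF Cons.prems(1), of v] by (simp add: contract_def fun_eq_iff)
  next
    case False
    then have "contract w \<alpha> (v # us) = 0"
      using Cons.IH[OF alternating_contract_alternating[OF Cons.prems(1)]] Cons.prems(2) by simp
    then show ?thesis using alternating_contract_swap[OF Cons.prems(1), of w v]
      by (simp add: contract_def fun_eq_iff)
  qed
qed simp

lemma alternating_not_distinct: "alternating k \<alpha> ==> \<not> distinct vs ==> \<alpha> vs = 0"
proof (induction vs arbitrary: \<alpha> k)
  case (Cons v vs)
  show ?case
  proof (cases "v \<in> set vs")
    case False
    then have "contract v \<alpha> vs = 0"
      using Cons alternating_contract_alternating by (metis distinct.simps(2))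
    then show ?thesis by (simp add: contract_def)
  qed (use Cons alternating_repeat in blast)
qed simp

lemma alternating_update_linear:
  "alternating k \<alpha> ==> i < length vs ==> \<alpha> (vs[i := v + a *s w]) = \<alpha> (vs[i := v]) + a * \<alpha> (vs[i := w])"
proof (induction vs arbitrary: \<alpha> k i)
  case (Cons u us)
  show ?case
  proof (cases i)
    case 0
    then show ?thesis using alternating_contract_linear[OF Cons.prems(1), of v a w]
      by (simp add: contract_def cscale_def fun_eq_iff)
  next
    case (Suc j)
    then show ?thesis
      using Cons.IH[OF alternating_contract_alternating[OF Cons.prems(1), of u], of j] Cons.prems(2)
      by (simp add: contract_def)
  qed
qed simp

lemma linear_cvec_iff:
  "Vector_Spaces.linear (*s) (*) (f :: complex ^ 'm => complex) \<longleftrightarrow> (\<forall>v w a. f (v + a *s w) = f v + a * f w)"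
proof
  assume *: "\<forall>v w a. f (v + a *s w) = f v + a * f w"
  have 0: "f 0 = 0" using *[rule_format, of 0 1 0] by simp
  show "Vector_Spaces.linear (*s) (*) f"
    using *[rule_format, of _ 1] *[rule_format, of 0] 0
    by unfold_locales (simp_all add: algebra_simps)
next
  assume "Vector_Spaces.linear (*s) (*) f"
  then interpret Vector_Spaces.linear "(*s)" "(*)" f .
  show "\<forall>v w a. f (v + a *s w) = f v + a * f w" by (simp add: add scale)
qed

lemma alt_covector_iff_alternating: "alt_covector k \<alpha> \<longleftrightarrow> alternating k \<alpha>"
proof
  assume a: "alternating k \<alpha>"
  have "\<alpha> vs = 0" if "length vs = k" "i < j" "j < k" "vs ! i = vs ! j" for vs i j
    using that by (intro alternating_not_distinct[OF a]) (metis distinct_conv_nth less_trans nat_less_le)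
  then show "alt_covector k \<alpha>"
    unfolding alt_covector_def linear_cvec_iff
    using alternating_length[OF a] alternating_update_linear[OF a] by blast
next
  show "alt_covector k \<alpha> ==> alternating k \<alpha>"
  proof (induction k arbitrary: \<alpha>)
    case 0
    then show ?case by (auto simp: alt_covector_def contract_def fun_eq_iff)
  next
    case (Suc k)
    note a = Suc.prems[unfolded alt_covector_def linear_cvec_iff]
    have len: "\<alpha> vs = 0" if "length vs \<noteq> Suc k" for vs using a that by blast
    have lin: "\<alpha> (vs[i := v + c *s w]) = \<alpha> (vs[i := v]) + c * \<alpha> (vs[i := w])"
      if "length vs = Suc k" "i < Suc k" for vs i v w c
      using a that by blast
    have rep: "\<alpha> vs = 0" if "length vs = Suc k" "i < j" "j < Suc k" "vs ! i = vs ! j" for vs i j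
      using a that by blast
    have "alt_covector k (contract v \<alpha>)" for v
      unfolding alt_covector_def linear_cvec_iff contract_def
    proof (intro conjI allI impI)
      show "length vs \<noteq> k ==> \<alpha> (v # vs) = 0" for vs by (rule len) simp
      show "\<alpha> (v # vs[i := u + c *s w]) = \<alpha> (v # vs[i := u]) + c * \<alpha> (v # vs[i := w])"
        if "length vs = k" "i < k" for vs i u w c
        using lin[of "v # vs" "Suc i"] that by simp
      show "\<alpha> (v # vs) = 0" if "length vs = k" "i < j" "j < k" "vs ! i = vs ! j" for vs i j
        using rep[of "v # vs" "Suc i" "Suc j"] that by simp
    qed
    then have "alternating k (contract v \<alpha>)" for v by (rule Suc.IH)
    moreover have "contract (v + c *s w) \<alpha> vs = (contract v \<alpha> + cscale c (contract w \<alpha>)) vs" for v w c vs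
      using lin[of "v # vs" 0 v c w] len[of "_ # vs"]
      by (cases "length vs = k") (auto simp: contract_def cscale_def)
    moreover have "contract v (contract v \<alpha>) vs = 0 vs" for v vs
      using rep[of "v # v # vs" 0 1] len[of "v # v # vs"]
      by (cases "Suc (length vs) = k") (auto simp: contract_def)
    ultimately show ?case using len[of "[]"] by (simp add: fun_eq_iff)
  qed
qed

lemma alternating_0 [simp]: "alternating k 0"
proof (induction k)
  case (Suc k)
  have "(0 :: 'a covector) [] = 0" by simp
  with Suc show ?case by (simp del: zero_fun_apply)
qed (simp del: zero_fun_apply)

lemma alternating_add: "alternating k \<alpha> ==> alternating k \<beta> ==> alternating k (\<alpha> + \<beta>)"
  by (induction k arbitrary: \<alpha> \<beta>) (auto simp: algebra_simps)

lemma alternating_cscale: "alternating k \<alpha> ==> alternating k (cscale a \<alpha>)"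
  by (induction k arbitrary: \<alpha>) (auto simp: algebra_simps cscale_apply)

lemma alternating_uminus: "alternating k \<alpha> ==> alternating k (- \<alpha>)"
  using alternating_cscale[of k \<alpha> "-1"] by simp

lemma alternating_diff: "alternating k \<alpha> ==> alternating k \<beta> ==> alternating k (\<alpha> - \<beta>)"
  using alternating_add[of k \<alpha> "- \<beta>"] alternating_uminus[of k \<beta>] by simp

lemma alternating_sum: "(\<And>i. i \<in> I ==> alternating k (f i)) ==> alternating k (\<Sum>i\<in>I. f i)"
  by (induction I rule: infinite_finite_induct) (auto intro: alternating_add)

lemma grade_sign_alternating: "alternating k \<alpha> ==> grade_sign \<alpha> = cscale ((-1) ^ k) \<alpha>"
  using alternating_length[of k \<alpha>] by (fastforce simp: grade_sign_def cscale_def fun_eq_iff)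

lemma alternating_pullback:
  assumes "\<And>v w a. F (v + a *s w) = F v + a *s F w"
  shows "alternating k \<alpha> ==> alternating k (pullback F \<alpha>)"
  by (induction k arbitrary: \<alpha>) (auto simp: assms, simp add: pullback_def)

lemma alternating_wedge: "alternating j \<alpha> ==> alternating k \<beta> ==> alternating (j + k) (wedge \<alpha> \<beta>)"
proof (induction "j + k" arbitrary: j k \<alpha> \<beta>)
  case 0
  then show ?case by (simp add: contract_wedge)
next
  case (Suc l)
  have d: "alternating l (wedge (contract v \<alpha>) \<beta>)" "alternating l (wedge (grade_sign \<alpha>) (contract v \<beta>))" for v
  proof -
    show "alternating l (wedge (contract v \<alpha>) \<beta>)"
    proof (cases j)
      case (Suc i)
      then show ?thesis
        using Suc.hyps(1)[of i k "contract v \<alpha>" \<beta>] Suc.hyps(2) Suc.prems by simp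
    qed (use Suc.prems in simp)
    show "alternating l (wedge (grade_sign \<alpha>) (contract v \<beta>))"
    proof (cases k)
      case (Suc i)
      then show ?thesis
        using Suc.hyps(1)[of j i "grade_sign \<alpha>" "contract v \<beta>"] Suc.hyps(2) Suc.prems
        by (simp add: grade_sign_alternating alternating_cscale)
    qed (use Suc.prems in simp)
  qed
  have "\<alpha> [] * \<beta> [] = 0"
    using Suc.hyps(2) alternating_length[OF Suc.prems(1), of "[]"] alternating_length[OF Suc.prems(2), of "[]"]
    by (cases j) auto
  moreover have "contract (v + a *s w) (wedge \<alpha> \<beta>) = contract v (wedge \<alpha> \<beta>) + cscale a (contract w (wedge \<alpha> \<beta>))" for v w a
    by (simp add: contract_wedge alternating_contract_linear[OF Suc.prems(1)] alternating_contract_linear[OF Suc.prems(2)] algebra_simps)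
  moreover have "contract v (contract v (wedge \<alpha> \<beta>)) = 0" for v
    by (simp add: contract_wedge alternating_contract[OF Suc.prems(1)] alternating_contract[OF Suc.prems(2)])
  ultimately show ?case
    unfolding Suc.hyps(2)[symmetric] alternating.simps
    using d by (simp only: contract_wedge wedge_Nil) (auto intro: alternating_add)
qed

lemma alternating_wedge_power:
  assumes "alternating 2 \<alpha>" shows "alternating (2 * k) (wedge_power \<alpha> k)"
proof (induction k)
  case 0
  then show ?case by (simp add: contract_def fun_eq_iff)
next
  case (Suc k)
  then show ?case using alternating_wedge[OF assms Suc] by simp
qed

lemma alternating_wedge_funpow:
  assumes "alternating 2 \<alpha>" "alternating k \<beta>" shows "alternating (k + 2 * m) ((wedge \<alpha> ^^ m) \<beta>)"
  using alternating_wedge[OF alternating_wedge_power[OF assms(1)] assms(2), of m]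
  by (simp add: wedge_power_funpow add.commute)

lemma alternating_move: "alternating k \<alpha> ==> \<alpha> (us @ v # vs) = (-1) ^ length us * \<alpha> (v # us @ vs)"
proof (induction us arbitrary: \<alpha> k)
  case (Cons u us)
  have "\<alpha> (u # us @ v # vs) = contract u \<alpha> (us @ v # vs)" by (simp add: contract_def)
  also have "\<dots> = (-1) ^ length us * contract v (contract u \<alpha>) (us @ vs)"
    using Cons.IH[OF alternating_contract_alternating[OF Cons.prems, of u]] by (simp add: contract_def)
  also have "\<dots> = (-1) ^ length (u # us) * \<alpha> (v # u # us @ vs)"
    unfolding alternating_contract_swap[OF Cons.prems, of v u] by (simp add: contract_def)
  finally show ?case by simp
qed simp

text \<open>A permutation of the arguments changes only the sign. Recording just the vanishing
  spares all sign computations and suffices for the conditions of filtration and bidegree.\<close>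

lemma alternating_mset_eq:
  "alternating k \<alpha> ==> mset vs = mset us ==> \<alpha> vs = 0 \<longleftrightarrow> \<alpha> us = 0"
proof (induction vs arbitrary: us \<alpha> k)
  case (Cons v vs)
  then obtain as bs where us: "us = as @ v # bs"
    by (metis list.set_intros(1) set_mset_mset split_list)
  then have "mset vs = mset (as @ bs)" using Cons.prems(2) by simp
  then have "contract v \<alpha> vs = 0 \<longleftrightarrow> contract v \<alpha> (as @ bs) = 0"
    using Cons.IH[OF alternating_contract_alternating[OF Cons.prems(1)]] by blast
  then show ?case using alternating_move[OF Cons.prems(1)] by (simp add: us contract_def)
qed simp

lemma alternating_span:
  assumes "alternating k \<alpha>" "\<And>vs. set vs \<subseteq> B ==> \<alpha> vs = 0" "set vs \<subseteq> vec.span B"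
  shows "\<alpha> vs = 0"
  using assms
proof (induction vs arbitrary: k \<alpha>)
  case (Cons v vs)
  have B: "contract b \<alpha> vs = 0" if "b \<in> B" for b
    using Cons.IH[OF alternating_contract_alternating[OF Cons.prems(1)], of b] Cons.prems(2,3) that
    by (simp add: contract_def)
  have "contract v \<alpha> vs = 0"
    using Cons.prems(3)
    by (intro vec.span_induct[of v B "\<lambda>v. contract v \<alpha> vs = 0"])
      (auto intro!: vec.subspaceI simp: B alternating_contract[OF Cons.prems(1)] cscale_apply)
  then show ?case by (simp add: contract_def)
qed (use assms in simp)

section \<open>Products with one-forms and alternating sums\<close>

lemma alternating_0_eq: "alternating 0 \<alpha> ==> \<alpha> = (\<lambda>vs. if vs = [] then \<alpha> [] else 0)"
  using alternating_length[of 0 \<alpha>] by fastforce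

lemma wedge_1_contract:
  assumes "alternating 1 \<theta>"
  shows "contract v (wedge \<theta> \<beta>) = cscale (\<theta> [v]) \<beta> - wedge \<theta> (contract v \<beta>)"
proof -
  have "contract v \<theta> = (\<lambda>vs. if vs = [] then \<theta> [v] else 0)"
    using alternating_0_eq[of "contract v \<theta>"] alternating_contract_alternating[OF assms, of v]
    unfolding contract_def[of v \<theta> "[]"] by simp
  then show ?thesis
    by (simp add: contract_wedge wedge_unit grade_sign_alternating[OF assms])
qed

lemma wedge_1_altsum: "alternating 1 \<theta> ==> wedge \<theta> \<beta> vs = altsum (\<lambda>v us. \<theta> [v] * \<beta> us) vs"
proof (induction vs arbitrary: \<beta>)
  case Nil
  then show ?case by (simp add: wedge_Nil alternating_length)
next
  case (Cons v vs)
  have "wedge \<theta> \<beta> (v # vs) = contract v (wedge \<theta> \<beta>) vs" by (simp add: contract_def)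
  also have "\<dots> = \<theta> [v] * \<beta> vs - wedge \<theta> (contract v \<beta>) vs"
    using wedge_1_contract[OF Cons.prems] by (simp add: cscale_def)
  finally show ?case using Cons.IH[OF Cons.prems] by (simp add: contract_def)
qed

lemma wedge_1_1: "alternating 1 \<theta> ==> wedge \<theta> (wedge \<theta> \<beta>) = 0"
proof
  show "alternating 1 \<theta> ==> wedge \<theta> (wedge \<theta> \<beta>) vs = 0 vs" for vs
  proof (induction vs arbitrary: \<beta>)
    case Nil
    then show ?case by (simp add: wedge_Nil alternating_length)
  next
    case (Cons v vs)
    have "contract v (wedge \<theta> (wedge \<theta> \<beta>)) vs = 0"
      using Cons by (simp add: wedge_1_contract)
    then show ?case by (simp add: contract_def)
  qed
qed

lemma altsum_cong: "(\<And>u us. length vs = Suc (length us) ==> f u us = g u us) ==> altsum f vs = altsum g vs"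
proof (induction vs arbitrary: f g)
  case (Cons v vs)
  have "altsum (\<lambda>u us. f u (v # us)) vs = altsum (\<lambda>u us. g u (v # us)) vs"
    by (rule Cons.IH) (simp add: Cons.prems)
  then show ?case using Cons.prems by simp
qed simp

lemma altsum_add: "altsum (\<lambda>u us. f u us + g u us) vs = altsum f vs + altsum g vs"
  by (induction vs arbitrary: f g) auto

lemma altsum_cmult: "altsum (\<lambda>u us. c * f u us) vs = c * altsum f vs"
  by (induction vs arbitrary: f) (auto simp: algebra_simps)

lemma altsum_uminus: "altsum (\<lambda>u us. - f u us) vs = - altsum f vs"
  using altsum_cmult[of "-1" f vs] by simp

lemma altsum_diff: "altsum (\<lambda>u us. f u us - g u us) vs = altsum f vs - altsum g vs"
  using altsum_add[of f "\<lambda>u us. - g u us" vs] by (simp add: altsum_uminus)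

lemma altsum_zero [simp]: "altsum (\<lambda>u us. 0) vs = 0"
  by (induction vs) auto

lemma altsum_map: "altsum f (map F vs) = altsum (\<lambda>u us. f (F u) (map F us)) vs"
  by (induction vs arbitrary: f) auto

lemma altsum_const: "altsum (\<lambda>u us. f (u # us)) vs = (\<Sum>i<length vs. (-1) ^ i * f (vs ! i # take i vs @ drop (Suc i) vs))"
proof (induction vs arbitrary: f)
  case (Cons v vs)
  have "altsum (\<lambda>u us. f (u # us)) (v # vs) = f (v # vs) - (\<Sum>i<length vs. (-1) ^ i * f (vs ! i # v # take i vs @ drop (Suc i) vs))"
    using Cons[of "\<lambda>ws. f (hd ws # v # tl ws)"] by simp
  also have "\<dots> = (\<Sum>i<length (v # vs). (-1) ^ i * f ((v # vs) ! i # take i (v # vs) @ drop (Suc i) (v # vs)))"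
    unfolding length_Cons sum.lessThan_Suc_shift by (simp add: sum_negf)
  finally show ?case .
qed simp

text \<open>Removing u before w and removing w before u occur with opposite signs and cancel if
  \<open>g\<close> is symmetric. Through this the symmetry of second derivatives makes d commute
  with pullbacks.\<close>

lemma altsum_double:
  assumes "\<And>u w ws. g u w ws = g w u ws"
  shows "altsum (\<lambda>u us. altsum (g u) us) vs = 0"
  using assms
proof (induction vs arbitrary: g)
  case (Cons v vs)
  have 1: "altsum (\<lambda>u us. altsum (\<lambda>w ws. g u w (v # ws)) us) vs = 0"
    by (rule Cons.IH) (simp add: Cons.prems)
  have "altsum (\<lambda>u us. g u v us) vs = altsum (g v) vs"
    by (rule altsum_cong) (rule Cons.prems)
  then show ?case using 1 by (simp add: altsum_diff)
qed simp

text \<open>Moving the i-th argument back to its place costs (-1)^i, so each of the k terms is the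
  value of \<alpha>.\<close>

lemma altsum_alternating: "alternating k \<alpha> ==> altsum (\<lambda>v us. \<alpha> (v # us)) vs = of_nat k * \<alpha> vs"
proof (induction vs arbitrary: \<alpha> k)
  case Nil
  then show ?case by (cases k) (auto)
next
  case (Cons v vs)
  have "altsum (\<lambda>u us. \<alpha> (u # v # us)) vs = - altsum (\<lambda>u us. contract v \<alpha> (u # us)) vs"
    unfolding altsum_uminus[symmetric]
    using alternating_contract_swap[OF Cons.prems, of v]
    by (intro altsum_cong) (simp add: contract_def fun_eq_iff)
  also have "\<dots> = - of_nat (k - 1) * \<alpha> (v # vs)"
    using Cons.IH[OF alternating_contract_alternating[OF Cons.prems]] by (simp add: contract_def)
  finally show ?case
    using alternating_length[OF Cons.prems, of "v # vs"]
    by (cases k) (auto simp: algebra_simps)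
qed

text \<open>The degree operator in a frame. The vectors \<open>w j\<close> need to reproduce v only
  after contraction into u, so a frame may leave out a direction that u annihilates, such as the
  Reeb direction.\<close>

lemma euler_alternating:
  assumes u: "alternating k u" and e: "\<And>j. j \<in> J ==> alternating 1 (e j)"
    and id: "\<And>v. contract (\<Sum>j\<in>J. e j [v] *s w j) u = contract v u"
  shows "(\<Sum>j\<in>J. wedge (e j) (contract (w j) u)) = cscale (of_nat k) u"
proof
  fix vs
  have "(\<Sum>j\<in>J. wedge (e j) (contract (w j) u)) vs = (\<Sum>j\<in>J. altsum (\<lambda>v us. e j [v] * u (w j # us)) vs)"
    unfolding sum_apply by (intro sum.cong refl) (simp add: wedge_1_altsum[OF e] contract_def)
  also have "\<dots> = altsum (\<lambda>v us. \<Sum>j\<in>J. e j [v] * u (w j # us)) vs"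
    by (induction J rule: infinite_finite_induct) (auto simp: altsum_add)
  also have "\<dots> = altsum (\<lambda>v us. u (v # us)) vs"
  proof (rule altsum_cong)
    show "(\<Sum>j\<in>J. e j [v] * u (w j # us)) = u (v # us)" for v us
      using alternating_contract_sum[OF u, where I=J and a="\<lambda>j. e j [v]" and v=w] id[of v]
      by (simp add: contract_def fun_eq_iff sum_apply cscale_apply)
  qed
  finally show "(\<Sum>j\<in>J. wedge (e j) (contract (w j) u)) vs = cscale (of_nat k) u vs"
    by (simp add: altsum_alternating[OF u] cscale_def)
qed

section \<open>Evaluation rules for covectors of degree one and two\<close>

lemma alternating_1_linear:
  assumes "alternating 1 \<alpha>" shows "\<alpha> [v + a *s w] = \<alpha> [v] + a * \<alpha> [w]"
  using fun_cong[OF alternating_contract_linear[OF assms, of v a w], of "[]"] by (simp add: contract_def cscale_def)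

lemma alternating_1_simps:
  assumes "alternating 1 \<theta>"
  shows "\<theta> [v + w] = \<theta> [v] + \<theta> [w]" "\<theta> [a *s v] = a * \<theta> [v]" "\<theta> [0] = 0" "\<theta> [v - w] = \<theta> [v] - \<theta> [w]"
    "\<theta> [\<Sum>i\<in>I. f i] = (\<Sum>i\<in>I. \<theta> [f i])"
proof -
  note l = alternating_1_linear[OF assms]
  show 0: "\<theta> [0] = 0" using l[of 0 1 0] by simp
  show add: "\<theta> [v + w] = \<theta> [v] + \<theta> [w]" for v w using l[of v 1 w] by simp
  show "\<theta> [a *s v] = a * \<theta> [v]" "\<theta> [v - w] = \<theta> [v] - \<theta> [w]" using l[of v "-1" w] l[of 0 a v] 0 by simp_all
  show "\<theta> [\<Sum>i\<in>I. f i] = (\<Sum>i\<in>I. \<theta> [f i])"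
    by (induction I rule: infinite_finite_induct) (auto simp: 0 add)
qed

lemma alternating_2_swap: "alternating 2 \<sigma> ==> \<sigma> [u, v] = - \<sigma> [v, u]"
  using alternating_contract_swap[of 2 \<sigma> v u, THEN fun_cong, of "[]"] by (simp add: contract_def)

lemma alternating_2_simps:
  assumes "alternating 2 \<sigma>"
  shows "\<sigma> [v + w, u] = \<sigma> [v, u] + \<sigma> [w, u]" "\<sigma> [a *s v, u] = a * \<sigma> [v, u]" "\<sigma> [0, u] = 0"
    "\<sigma> [u, v + w] = \<sigma> [u, v] + \<sigma> [u, w]" "\<sigma> [u, a *s v] = a * \<sigma> [u, v]" "\<sigma> [u, 0] = 0"
    "\<sigma> [v - w, u] = \<sigma> [v, u] - \<sigma> [w, u]" "\<sigma> [u, v - w] = \<sigma> [u, v] - \<sigma> [u, w]"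
    "\<sigma> [u, \<Sum>i\<in>I. f i] = (\<Sum>i\<in>I. \<sigma> [u, f i])" "\<sigma> [\<Sum>i\<in>I. f i, u] = (\<Sum>i\<in>I. \<sigma> [f i, u])"
proof -
  have "alternating 1 (contract u \<sigma>)" using alternating_contract_alternating[OF assms, of u] by simp
  note r = alternating_1_simps[OF this, unfolded contract_def]
  show "\<sigma> [u, v + w] = \<sigma> [u, v] + \<sigma> [u, w]" "\<sigma> [u, a *s v] = a * \<sigma> [u, v]" "\<sigma> [u, 0] = 0"
    "\<sigma> [u, v - w] = \<sigma> [u, v] - \<sigma> [u, w]" "\<sigma> [u, \<Sum>i\<in>I. f i] = (\<Sum>i\<in>I. \<sigma> [u, f i])" by (rule r)+
  show "\<sigma> [v + w, u] = \<sigma> [v, u] + \<sigma> [w, u]" "\<sigma> [a *s v, u] = a * \<sigma> [v, u]" "\<sigma> [0, u] = 0"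
    "\<sigma> [v - w, u] = \<sigma> [v, u] - \<sigma> [w, u]" "\<sigma> [\<Sum>i\<in>I. f i, u] = (\<Sum>i\<in>I. \<sigma> [f i, u])"
    unfolding alternating_2_swap[OF assms, of _ u] r by (simp_all add: sum_negf)
qed

section \<open>The Lefschetz isomorphism\<close>

text \<open>The sl2 relation on an abstract graded space, without finiteness of dimension. It is
  interpreted for horizontal covectors at a point and for smooth fields of them; in the second case
  surjectivity yields smooth solutions.\<close>

locale lefschetz = vector_space scale
  for scale :: "complex => 'v::ab_group_add => 'v" +
  fixes L Lam :: "'v => 'v" and H :: "nat => 'v set" and n :: nat
  assumes subspace_H: "subspace (H k)"
    and L_add: "L (u + v) = L u + L v" and L_scale: "L (scale a u) = scale a (L u)"
    and Lam_add: "Lam (u + v) = Lam u + Lam v" and Lam_scale: "Lam (scale a u) = scale a (Lam u)"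
    and L_H: "u \<in> H k ==> L u \<in> H (k + 2)" and Lam_H: "u \<in> H (k + 2) ==> Lam u \<in> H k"
    and Lam_low: "u \<in> H k ==> k < 2 ==> Lam u = 0"
    and H_top: "u \<in> H k ==> 2 * n < k ==> u = 0"
    and commutator: "u \<in> H k ==> Lam (L u) = L (Lam u) + scale (of_nat n - of_nat k) u"
begin

lemma L_0: "L 0 = 0" and Lam_0: "Lam 0 = 0"
  using L_scale[of 0 0] Lam_scale[of 0 0] by simp_all

lemma L_diff: "L (u - v) = L u - L v"
  using L_add[of "u - v" v] by (simp add: algebra_simps)

lemma L_pow_0: "(L ^^ m) 0 = 0"
  by (induction m) (auto simp: L_0)

lemma L_pow_add: "(L ^^ m) (u + v) = (L ^^ m) u + (L ^^ m) v"
  by (induction m) (auto simp: L_add)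

lemma L_pow_scale: "(L ^^ m) (scale a u) = scale a ((L ^^ m) u)"
  by (induction m) (auto simp: L_scale)

lemma L_pow_H: "u \<in> H k ==> (L ^^ m) u \<in> H (k + 2 * m)"
  by (induction m) (auto dest: L_H)

lemma Lam_pow_H: "u \<in> H k ==> 2 * m \<le> k ==> (Lam ^^ m) u \<in> H (k - 2 * m)"
proof (induction m)
  case (Suc m)
  moreover from Suc.prems have "k - 2 * m = k - 2 * Suc m + 2" by simp
  ultimately have "(Lam ^^ m) u \<in> H (k - 2 * Suc m + 2)" by simp
  then show ?case using Lam_H by simp
qed simp

text \<open>The scalar is the sum of the commutator weights n - (k + 2 j) for j = 0, ..., r.\<close>

lemma Lam_L_pow:
  assumes "u \<in> H k"
  shows "Lam ((L ^^ Suc r) u) = (L ^^ Suc r) (Lam u) +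
    scale (of_nat (Suc r) * (of_nat n - of_nat k - of_nat r)) ((L ^^ r) u)"
proof (induction r)
  case 0
  then show ?case using commutator[OF assms] by simp
next
  case (Suc r)
  have "Lam ((L ^^ Suc (Suc r)) u) = L (Lam ((L ^^ Suc r) u)) +
      scale (of_nat n - of_nat (k + 2 * Suc r)) ((L ^^ Suc r) u)"
    using commutator[OF L_pow_H[OF assms, of "Suc r"]] by simp
  also have "L (Lam ((L ^^ Suc r) u)) = (L ^^ Suc (Suc r)) (Lam u) +
      scale (of_nat (Suc r) * (of_nat n - of_nat k - of_nat r)) ((L ^^ Suc r) u)"
    unfolding Suc by (simp add: L_add L_scale)
  finally have "Lam ((L ^^ Suc (Suc r)) u) = (L ^^ Suc (Suc r)) (Lam u) +
      scale (of_nat (Suc r) * (of_nat n - of_nat k - of_nat r) + (of_nat n - of_nat (k + 2 * Suc r))) ((L ^^ Suc r) u)"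
    by (simp only: scale_left_distrib add.assoc)
  moreover have "of_nat (Suc r) * (of_nat n - of_nat k - of_nat r) + (of_nat n - of_nat (k + 2 * Suc r)) =
      (of_nat (Suc (Suc r)) * (of_nat n - of_nat k - of_nat (Suc r)) :: complex)"
    by (simp add: algebra_simps)
  ultimately show ?case by (simp only:)
qed

text \<open>The scalar is the sum of the weights n - (k - 2 j) for j = 0, ..., r; the bound on r
  keeps the degrees k - 2 j from being truncated.\<close>

lemma L_Lam_pow:
  assumes "u \<in> H k" "2 * Suc r \<le> k"
  shows "L ((Lam ^^ Suc r) u) = (Lam ^^ Suc r) (L u) -
    scale (of_nat (Suc r) * (of_nat n - of_nat k + of_nat r)) ((Lam ^^ r) u)"
  using assms(2)
proof (induction r)
  case 0
  then show ?case using commutator[OF assms(1)] by simp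
next
  case (Suc r)
  define c where "c j = (of_nat (Suc j) * (of_nat n - of_nat k + of_nat j) :: complex)" for j
  have k: "(of_nat (k - 2 * Suc r) :: complex) = of_nat k - 2 * of_nat (Suc r)"
    using Suc.prems by (subst of_nat_diff) auto
  have "L ((Lam ^^ Suc (Suc r)) u) =
      Lam (L ((Lam ^^ Suc r) u)) - scale (of_nat n - (of_nat k - 2 * of_nat (Suc r))) ((Lam ^^ Suc r) u)"
    using commutator[OF Lam_pow_H[OF assms(1), of "Suc r"]] Suc.prems unfolding k by simp
  also have "L ((Lam ^^ Suc r) u) = (Lam ^^ Suc r) (L u) - scale (c r) ((Lam ^^ r) u)"
    using Suc unfolding c_def by simp
  also have "Lam \<dots> = (Lam ^^ Suc (Suc r)) (L u) - scale (c r) ((Lam ^^ Suc r) u)"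
    using Lam_add[of "(Lam ^^ Suc r) (L u) - scale (c r) ((Lam ^^ r) u)" "scale (c r) ((Lam ^^ r) u)"]
    by (simp add: Lam_scale algebra_simps)
  finally have "L ((Lam ^^ Suc (Suc r)) u) = (Lam ^^ Suc (Suc r)) (L u) -
      scale (c r + (of_nat n - (of_nat k - 2 * of_nat (Suc r)))) ((Lam ^^ Suc r) u)"
    by (simp only: scale_left_distrib diff_diff_eq)
  moreover have "c r + (of_nat n - (of_nat k - 2 * of_nat (Suc r))) = c (Suc r)"
    by (simp add: c_def algebra_simps)
  ultimately show ?case unfolding c_def[symmetric] by (simp only:)
qed

text \<open>At r = n - k the scalar of \<open>Lam_L_pow\<close> vanishes, so L^(n-k+1) kills
  \<open>Lam u\<close>, and the induction hypothesis in degree k - 2 gives \<open>Lam u\<close> = 0.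
  For such u the scalars with r < n - k are nonzero, and the powers of L can be removed one by
  one.\<close>

lemma L_pow_inj:
  assumes "u \<in> H k" "k \<le> n" "(L ^^ (n - k)) u = 0"
  shows "u = 0"
  using assms
proof (induction k arbitrary: u rule: less_induct)
  case (less k)
  have "Lam u = 0"
  proof (cases "k < 2")
    case False
    have "(L ^^ Suc (n - k)) u = 0" using less.prems by (simp add: L_0)
    then have "(L ^^ Suc (n - k)) (Lam u) = 0"
      using Lam_L_pow[OF less.prems(1), of "n - k"] less.prems(2) by (simp add: Lam_0 of_nat_diff)
    then have "(L ^^ Suc (Suc (n - k))) (Lam u) = 0" by (simp add: L_0)
    moreover have "Suc (Suc (n - k)) = n - (k - 2)" "k - 2 + 2 = k" using False less.prems by auto
    ultimately show ?thesis
      using less.IH[of "k - 2" "Lam u"] Lam_H[of u "k - 2"] less.prems False by (simp only:)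
  qed (use Lam_low less.prems in blast)
  have "(L ^^ r) u = 0 ==> r \<le> n - k ==> u = 0" for r
  proof (induction r)
    case (Suc r)
    have "(of_nat n - of_nat k - of_nat r :: complex) \<noteq> 0"
      using Suc.prems(2) by (simp add: algebra_simps flip: of_nat_add)
    then have "(L ^^ r) u = 0"
      using Lam_L_pow[OF less.prems(1), of r] Suc.prems \<open>Lam u = 0\<close>
      by (simp add: Lam_0 L_0 L_pow_0 del: of_nat_Suc)
    then show ?case using Suc by simp
  qed simp
  then show ?case using less.prems by blast
qed

lemma L_pow_inj':
  assumes "u \<in> H k" "k + m \<le> n" "(L ^^ m) u = 0"
  shows "u = 0"
proof (rule L_pow_inj[OF assms(1)])
  have "(L ^^ (n - k - m + m)) u = 0"
    unfolding funpow_add using assms(3) by (simp add: L_pow_0)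
  then show "(L ^^ (n - k)) u = 0" using assms(2) by simp
qed (use assms in simp)

text \<open>After subtracting L^(n-k+1) w for a suitable w, the remainder v' is annihilated by L. On
  such elements L^r Lam^r acts as a nonzero scalar for all r up to n - k, and r = n - k exhibits v'
  as an image.\<close>

lemma L_pow_surj:
  assumes "v \<in> H (2 * n - k)" "k \<le> n"
  shows "\<exists>u\<in>H k. (L ^^ (n - k)) u = v"
  using assms
proof (induction k arbitrary: v rule: less_induct)
  case (less k)
  \<comment> \<open>L v has degree 2 n - (k - 2), so the induction hypothesis writes it as L^(n-k+2)
    w. For k < 2 it exceeds the top degree and w = 0 works.\<close>
  obtain w where w: "L w \<in> H k" "(L ^^ (n - k)) (L w) \<in> H (2 * n - k)" "L ((L ^^ (n - k)) (L w)) = L v"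
  proof (cases "k < 2")
    case True
    then have "L v = 0"
      using L_H[OF less.prems(1)] less.prems(2) by (intro H_top) auto
    then show thesis
      using that[of 0] subspace_0[OF subspace_H] by (simp add: L_0 L_pow_0)
  next
    case False
    then have "2 * n - k + 2 = 2 * n - (k - 2)" using less.prems(2) by simp
    then have "L v \<in> H (2 * n - (k - 2))" using L_H[OF less.prems(1)] by simp
    then obtain w where w: "w \<in> H (k - 2)" "(L ^^ (n - (k - 2))) w = L v"
    proof -
      have "k - 2 < k" "k - 2 \<le> n" using False less.prems(2) by linarith+
      then show thesis using less.IH[of "k - 2" "L v"] \<open>L v \<in> H (2 * n - (k - 2))\<close> that by blast
    qed
    have "k - 2 + 2 = k" using False by simp
    then have 1: "L w \<in> H k" using L_H[OF w(1)] by simp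
    have "n - (k - 2) = Suc (Suc (n - k))" using False less.prems by simp
    moreover have "k + 2 * (n - k) = 2 * n - k" using less.prems by simp
    ultimately show thesis using that[OF 1] w(2) L_pow_H[OF 1, of "n - k"] by (simp add: funpow_swap1)
  qed
  define v' where "v' = v - (L ^^ (n - k)) (L w)"
  have v': "v' \<in> H (2 * n - k)" "L v' = 0"
    using w less.prems(1) subspace_diff[OF subspace_H] by (auto simp: v'_def L_diff)
  have "\<exists>c. c \<noteq> 0 \<and> (L ^^ r) ((Lam ^^ r) v') = scale c v'" if "r \<le> n - k" for r
    using that
  proof (induction r)
    case 0
    then show ?case by (intro exI[of _ 1]) simp
  next
    case (Suc r)
    then obtain c where c: "c \<noteq> 0" "(L ^^ r) ((Lam ^^ r) v') = scale c v'" by auto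
    define d where "d = - (of_nat (Suc r) * (of_nat n - of_nat (2 * n - k) + of_nat r) :: complex)"
    have "(Lam ^^ Suc r) 0 = 0" by (induction r) (auto simp: Lam_0)
    then have "L ((Lam ^^ Suc r) v') = scale d ((Lam ^^ r) v')"
      using L_Lam_pow[OF v'(1), of r] Suc.prems less.prems(2) v'(2) by (simp add: d_def del: of_nat_Suc)
    then have "(L ^^ Suc r) ((Lam ^^ Suc r) v') = scale (d * c) v'"
      using c(2) by (simp add: funpow_swap1 L_pow_scale)
    \<comment> \<open>With n = k + r + s + 1 the bracket equals -(s + 1).\<close>
    moreover have "d \<noteq> 0"
    proof -
      obtain s where "n = k + r + Suc s"
        using Suc.prems less.prems(2) that[of "n - Suc (k + r)"] by linarith
      moreover from this have "of_nat n - of_nat (2 * n - k) + of_nat r = - (of_nat (Suc s) :: complex)"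
        by (simp add: of_nat_diff)
      ultimately show ?thesis by (simp add: d_def del: of_nat_Suc)
    qed
    ultimately show ?case using c(1) by (intro exI[of _ "d * c"]) simp
  qed
  then obtain c where c: "c \<noteq> 0" "(L ^^ (n - k)) ((Lam ^^ (n - k)) v') = scale c v'" by auto
  have "2 * n - k - 2 * (n - k) = k" using less.prems by simp
  then have "(Lam ^^ (n - k)) v' \<in> H k"
    using Lam_pow_H[OF v'(1), of "n - k"] less.prems by simp
  then have "L w + scale (1 / c) ((Lam ^^ (n - k)) v') \<in> H k"
    using w(1) subspace_H subspace_add subspace_scale by blast
  moreover have "(L ^^ (n - k)) (L w + scale (1 / c) ((Lam ^^ (n - k)) v')) = v"
    using c by (simp add: L_pow_add L_pow_scale v'_def)
  ultimately show ?case by blast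
qed

end

section \<open>Linear algebra of a nondegenerate CR structure at a point\<close>

lemma vector_space_cscale: "vector_space (cscale :: _ => 'm::finite covector => _)"
  by unfold_locales (auto simp: cscale_add_left)

text \<open>\<open>T\<close> stands for the Reeb vector of the contact form \<open>\<theta>\<close>, \<open>\<sigma>\<close> for \<open>d\<theta>\<close>, and \<open>W\<close> is the
  frame of \<open>T\<^sup>0\<^sup>,\<^sup>1\<close> that is \<open>\<sigma>\<close>-dual to the frame \<open>Z\<close> of \<open>T\<^sup>1\<^sup>,\<^sup>0\<close>.\<close>

locale cr_point =
  fixes n :: nat and V10 V01 :: "(complex ^ 'm::finite) set" and \<theta> \<sigma> :: "'m covector"
    and T :: "complex ^ 'm" and Z W :: "nat => complex ^ 'm"
  assumes theta: "alternating 1 \<theta>" and sigma: "alternating 2 \<sigma>"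
    and V10: "V10 = vec.span (Z ` {..<n})" and V01: "V01 = vec.span (W ` {..<n})"
    and theta_T: "\<theta> [T] = 1" and theta_Z: "i < n ==> \<theta> [Z i] = 0" and theta_W: "i < n ==> \<theta> [W i] = 0"
    and sigma_T: "\<sigma> [T, v] = 0"
    and sigma_ZZ: "i < n ==> j < n ==> \<sigma> [Z i, Z j] = 0"
    and sigma_WW: "i < n ==> j < n ==> \<sigma> [W i, W j] = 0"
    and sigma_ZW: "i < n ==> j < n ==> \<sigma> [Z i, W j] = (if i = j then 1 else 0)"
    and frame: "v = \<theta> [v] *s T + (\<Sum>i<n. \<sigma> [v, W i] *s Z i) + (\<Sum>i<n. \<sigma> [Z i, v] *s W i)"
begin
lemma cscale_diff_left: "cscale (a - b) \<alpha> = cscale a \<alpha> - cscale b \<alpha>"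
  by (auto simp: cscale_def fun_eq_iff algebra_simps)

text \<open>It kills T, fixes V10 and multiplies V01 by t. At t = 1 it is the projection along T to
  the horizontal space, so that \<open>PH\<close> is restriction to this space, extended by zero on
  T.\<close>

definition dil :: "complex => complex ^ 'm => complex ^ 'm" where
  "dil t v = (\<Sum>i<n. \<sigma> [v, W i] *s Z i) + t *s (\<Sum>i<n. \<sigma> [Z i, v] *s W i)"

abbreviation "L \<equiv> wedge \<sigma>"

text \<open>The dual Lefschetz operator, written in the two frames that \<sigma> pairs to the
  identity matrix.\<close>

definition Lam :: "'m covector => 'm covector" where
  "Lam u = (\<Sum>i<n. contract (W i) (contract (Z i) u))"

definition hor :: "nat => 'm covector set" where
  "hor k = {u. alternating k u \<and> contract T u = 0}"

abbreviation PH :: "'m covector => 'm covector" where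
  "PH \<equiv> pullback (dil 1)"

definition weight :: "(complex ^ 'm) list => nat" where
  "weight vs = length (filter (\<lambda>v. v \<in> V01) vs)"

text \<open>\<open>dil t\<close> acts on covectors of bidegree \<open>(p, q)\<close> as \<open>t\<^sup>q\<close>, so that averaging over the \<open>N\<close>-th roots of unity
  extracts the part with \<open>q = b\<close> of a covector of degree less than \<open>N\<close>.\<close>

definition bproj :: "nat => nat => 'm covector => 'm covector" where
  "bproj N b u = cscale (1 / of_nat N) (\<Sum>j<N. cscale (cis (- 2 * pi * real j * real b / real N))
     (pullback (dil (cis (2 * pi * real j / real N))) u))"

definition KK :: "nat => 'm covector => bool" where
  "KK j u \<longleftrightarrow> (\<forall>Ws vs. length Ws = j --> set Ws \<subseteq> V01 --> u (Ws @ vs) = 0)"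

text \<open>For k > n the truncated exponent n + 1 - k is 0, so in both cases the power n + 1 - k of
  L annihilates u. The frame-free \<open>prim_part\<close> relies on this uniform reading.\<close>

definition prim :: "nat => 'm covector => bool" where
  "prim k u \<longleftrightarrow> (if k \<le> n then (L ^^ (n + 1 - k)) u = 0 else u = 0)"

lemmas theta_linear = alternating_1_simps(1-3)[OF theta] and theta_sum = alternating_1_simps(5)[OF theta]
  and sigma_linear = alternating_2_simps(1-6)[OF sigma] and sigma_sum = alternating_2_simps(9,10)[OF sigma]
  and sigma_swap = alternating_2_swap[OF sigma]

lemma sigma_even: "grade_sign \<sigma> = \<sigma>"
  by (simp add: grade_sign_alternating[OF sigma])

lemma theta_V: "v \<in> V10 ==> \<theta> [v] = 0" "v \<in> V01 ==> \<theta> [v] = 0"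
proof -
  have "\<theta> [v] = 0" if "v \<in> vec.span B" "\<And>b. b \<in> B ==> \<theta> [b] = 0" for B
    using that(1) by (rule vec.span_induct) (auto intro!: vec.subspaceI simp: theta_linear that)
  then show "v \<in> V10 ==> \<theta> [v] = 0" "v \<in> V01 ==> \<theta> [v] = 0"
    unfolding V10 V01 using theta_Z theta_W by blast+
qed

lemma Z_in: "i < n ==> Z i \<in> V10" and W_in: "i < n ==> W i \<in> V01"
  unfolding V10 V01 by (auto intro: vec.span_base)

lemma sigma_V:
  "v \<in> V10 ==> j < n ==> \<sigma> [Z j, v] = 0" "v \<in> V01 ==> j < n ==> \<sigma> [v, W j] = 0"
  "v \<in> V10 ==> w \<in> V10 ==> \<sigma> [v, w] = 0" "v \<in> V01 ==> w \<in> V01 ==> \<sigma> [v, w] = 0"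
proof -
  have 1: "\<sigma> [v, w] = 0" if "w \<in> vec.span B" "\<And>b. b \<in> B ==> \<sigma> [v, b] = 0" for v w B
    using that(1) by (rule vec.span_induct) (auto intro!: vec.subspaceI simp: sigma_linear that)
  have 2: "\<sigma> [v, w] = 0" if "v \<in> vec.span B" "\<And>b. b \<in> B ==> \<sigma> [b, w] = 0" for v w B
    using that(1) by (rule vec.span_induct) (auto intro!: vec.subspaceI simp: sigma_linear that)
  show a: "\<sigma> [Z j, v] = 0" if "v \<in> V10" "j < n" for v j
    using that(1)[unfolded V10] by (rule 1) (use that sigma_ZZ in auto)
  show b: "\<sigma> [v, W j] = 0" if "v \<in> V01" "j < n" for v j
    using that(1)[unfolded V01] by (rule 2) (use that sigma_WW in auto)
  show "\<sigma> [v, w] = 0" if "v \<in> V10" "w \<in> V10"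
    using that(1)[unfolded V10] by (rule 2) (use that a in auto)
  show "\<sigma> [v, w] = 0" if "v \<in> V01" "w \<in> V01"
    using that(2)[unfolded V01] by (rule 1) (use that b in auto)
qed

lemma dil_linear: "dil t (v + a *s w) = dil t v + a *s dil t w"
  by (simp add: dil_def sigma_linear vec.scale_left_distrib vec.scale_right_distrib sum.distrib
      vec.scale_sum_right mult.commute mult.left_commute algebra_simps)

lemma dil_T: "dil t T = 0"
  by (simp add: dil_def sigma_T sigma_swap[of _ T])

lemma dil_Z: "v \<in> V10 ==> dil t v = v"
  using frame[of v, symmetric] by (simp add: dil_def theta_V sigma_V)

lemma dil_W: "v \<in> V01 ==> dil t v = t *s v"
  using frame[of v, symmetric] by (simp add: dil_def theta_V sigma_V)

lemma frame_dil: "v = \<theta> [v] *s T + dil 1 v"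
  using frame[of v, symmetric] by (simp add: dil_def add.assoc)

lemma theta_dil: "\<theta> [dil t v] = 0"
  by (simp add: dil_def theta_linear theta_sum theta_Z theta_W)

lemma T_notin: "T \<notin> V10" "T \<notin> V01"
  using theta_V[of T] theta_T by auto

lemma sigma_dil_left: "\<sigma> [dil 1 v, w] = \<sigma> [v, w]"
  using arg_cong[OF frame_dil[of v], of "\<lambda>x. \<sigma> [x, w]"] by (simp add: sigma_linear sigma_T)

lemma dil_coeff: "i < n ==> \<sigma> [dil t v, W i] = \<sigma> [v, W i]" "i < n ==> \<sigma> [Z i, dil t v] = t * \<sigma> [Z i, v]"
  by (simp_all add: dil_def sigma_linear sigma_sum sigma_ZW sigma_WW sigma_ZZ if_distrib[of "\<lambda>x. _ * x"] cong: if_cong)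

lemma dil_dil: "dil s (dil t v) = dil (s * t) v"
proof -
  have "dil s (dil t v) = (\<Sum>i<n. \<sigma> [v, W i] *s Z i) + s *s (\<Sum>i<n. (t * \<sigma> [Z i, v]) *s W i)"
    unfolding dil_def[of s] by (simp add: dil_coeff)
  then show ?thesis by (simp add: dil_def[of "s * t"] vec.scale_sum_right mult.assoc)
qed

lemma sigma_expand: "\<sigma> [v, w] = (\<Sum>i<n. \<sigma> [v, W i] * \<sigma> [Z i, w]) - (\<Sum>i<n. \<sigma> [Z i, v] * \<sigma> [w, W i])"
proof -
  have "\<sigma> [v, w] = \<sigma> [dil 1 v, w]" by (simp add: sigma_dil_left)
  also have "\<dots> = (\<Sum>i<n. \<sigma> [v, W i] * \<sigma> [Z i, w]) + (\<Sum>i<n. \<sigma> [Z i, v] * \<sigma> [W i, w])"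
    by (simp add: dil_def sigma_linear sigma_sum)
  also have "\<dots> = (\<Sum>i<n. \<sigma> [v, W i] * \<sigma> [Z i, w]) + (\<Sum>i<n. \<sigma> [Z i, v] * - \<sigma> [w, W i])"
    by (intro arg_cong2[of _ _ _ _ "(+)"] arg_cong2[of _ _ _ _ "(*)"] sum.cong refl sigma_swap)
  finally show ?thesis by (simp add: sum_negf)
qed

lemma sigma_dil: "\<sigma> [dil t v, dil t w] = t * \<sigma> [v, w]"
proof -
  have "\<sigma> [dil t v, dil t w] = t * ((\<Sum>i<n. \<sigma> [v, W i] * \<sigma> [Z i, w]) - (\<Sum>i<n. \<sigma> [Z i, v] * \<sigma> [w, W i]))"
    by (subst sigma_expand) (simp add: dil_coeff sum_distrib_left right_diff_distrib mult.assoc mult.left_commute)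
  then show ?thesis using sigma_expand[of v w] by metis
qed

lemma pullback_dil_theta: "pullback (dil t) \<theta> = 0"
proof
  show "pullback (dil t) \<theta> vs = 0 vs" for vs
  proof (cases vs)
    case (Cons v us)
    then show ?thesis by (cases us) (auto simp: pullback_def theta_dil alternating_length[OF theta])
  qed (simp add: pullback_def alternating_length[OF theta])
qed

lemma pullback_dil_sigma: "pullback (dil t) \<sigma> = cscale t \<sigma>"
proof
  fix vs
  show "pullback (dil t) \<sigma> vs = cscale t \<sigma> vs"
  proof (cases "length vs = 2")
    case True
    then obtain v w where "vs = [v, w]" by (auto simp: length_Suc_conv numeral_2_eq_2)
    then show ?thesis by (simp add: pullback_def cscale_def sigma_dil)
  qed (simp add: pullback_def cscale_def alternating_length[OF sigma])
qed

lemma alternating_pullback_dil: "alternating k u ==> alternating k (pullback (dil t) u)"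
  by (rule alternating_pullback) (rule dil_linear)

lemma contract_T_pullback_dil: "alternating k u ==> contract T (pullback (dil t) u) = 0"
  by (simp add: dil_T alternating_contract)

lemma pullback_dil_hor: "alternating k u ==> pullback (dil t) u \<in> hor k"
  by (simp add: hor_def alternating_pullback_dil contract_T_pullback_dil del: contract_simps)

lemma pullback_dil_L: "pullback (dil t) ((L ^^ m) u) = cscale (t ^ m) ((L ^^ m) (pullback (dil t) u))"
  by (induction m) (simp_all add: pullback_wedge pullback_dil_sigma mult.commute)

lemma PH_L: "PH ((L ^^ m) u) = (L ^^ m) (PH u)"
  by (simp add: pullback_dil_L)

lemma pullback_dil_PH: "pullback (dil t) (PH u) = pullback (dil t) u"
  by (simp add: pullback_pullback o_def dil_dil)

text \<open>The first argument v is a multiple of T plus a horizontal vector w. Since contracting T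
  twice gives zero, the contractions of v and of w into u have the same contraction with T, and the
  induction hypothesis is needed for w only.\<close>

lemma hor_decomp:
  assumes "alternating k u" shows "u = PH u + wedge \<theta> (contract T u)"
proof
  show "u vs = (PH u + wedge \<theta> (contract T u)) vs" for vs
    using assms
  proof (induction vs arbitrary: u k)
    case Nil
    then show ?case by (simp add: pullback_def wedge_Nil alternating_length[OF theta])
  next
    case (Cons v vs)
    note a = Cons.prems
    define w where "w = dil 1 v"
    have v: "v = \<theta> [v] *s T + w" unfolding w_def by (rule frame_dil)
    have cv: "contract v u = cscale (\<theta> [v]) (contract T u) + contract w u"
      by (subst v) (simp only: alternating_contract(1,2)[OF a])
    have TT: "contract T (contract v u) = contract T (contract w u)"
      unfolding cv by (simp add: alternating_contract[OF a])
    have "contract v u vs = \<theta> [v] * contract T u vs + contract w u vs"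
      unfolding cv by (simp add: cscale_def)
    also have "contract w u vs = (PH (contract w u) + wedge \<theta> (contract T (contract w u))) vs"
      by (rule Cons.IH[OF alternating_contract_alternating[OF a]])
    also have "\<dots> = PH (contract w u) vs + wedge \<theta> (contract T (contract v u)) vs"
      unfolding TT by simp
    also have "wedge \<theta> (contract T (contract v u)) vs = - wedge \<theta> (contract v (contract T u)) vs"
      by (subst alternating_contract_swap[OF a]) (simp only: wedge_uminus uminus_apply)
    finally have "contract v u vs = contract v (PH u + wedge \<theta> (contract T u)) vs"
      by (simp add: wedge_1_contract[OF theta] cscale_def w_def)
    then show ?case unfolding contract_def[of v] .
  qed
qed

lemma PH_hor: "u \<in> hor k ==> PH u = u"
  using hor_decomp[of k u, symmetric] by (simp add: hor_def)

lemma PH_wedge_theta: "PH (wedge \<theta> u) = 0" "pullback (dil t) (wedge \<theta> u) = 0"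
  by (simp_all add: pullback_wedge pullback_dil_theta)

text \<open>By \<open>hor_decomp\<close> the factor \<theta> absorbs everything but the horizontal
  part. The Rumin conditions are thereby statements about horizontal covectors.\<close>

lemma wedge_theta_eq_0_iff:
  assumes "alternating k u" shows "wedge \<theta> u = 0 \<longleftrightarrow> PH u = 0"
proof
  assume "PH u = 0"
  then have "u = wedge \<theta> (contract T u)" using hor_decomp[OF assms] by simp
  then show "wedge \<theta> u = 0" using wedge_1_1[OF theta] by metis
next
  assume "wedge \<theta> u = 0"
  then have "contract T (wedge \<theta> u) = 0" by simp
  then have "u = wedge \<theta> (contract T u)" by (simp add: wedge_1_contract[OF theta] theta_T)
  then show "PH u = 0" using PH_wedge_theta by metis
qed

lemma contract_T_wedge_theta: "contract T u = 0 ==> contract T (wedge \<theta> u) = u"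
  by (simp add: wedge_1_contract[OF theta] theta_T)

subsection \<open>The Lefschetz operators\<close>

lemma contract_T_sigma: "contract T \<sigma> = 0"
proof
  fix vs
  show "contract T \<sigma> vs = 0 vs"
    using sigma_T alternating_length[OF sigma, of "T # vs"]
    by (cases "length vs = 1") (auto simp: contract_def length_Suc_conv)
qed

lemma Lam_add: "Lam (u + v) = Lam u + Lam v" and Lam_cscale: "Lam (cscale a u) = cscale a (Lam u)"
  by (simp_all add: Lam_def sum.distrib cscale_sum)

text \<open>Contracting Z_i and W_i into \<sigma> \<and> u produces, besides L of the contractions,
  a copy of u for each i because \<sigma>(Z_i, W_i) = 1, and minus the degree operator of the
  horizontal frame. The copies add up to n u, the degree operator to k u.\<close>

lemma L_commutator:
  assumes u: "u \<in> hor k"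
  shows "Lam (L u) = L (Lam u) + cscale (of_nat n - of_nat k) u"
proof -
  \<comment> \<open>\<open>ze i\<close> and \<open>om i\<close> are the coframe: v = \<theta>(v) T
    plus the sum of \<open>ze i\<close>(v) Z_i + \<open>om i\<close>(v) W_i.\<close>
  define om where "om i = contract (Z i) \<sigma>" for i
  define ze where "ze i = - contract (W i) \<sigma>" for i
  have om: "alternating 1 (om i)" and ze: "alternating 1 (ze i)" for i
    using alternating_contract_alternating[OF sigma] by (auto simp: om_def ze_def intro!: alternating_uminus)
  have ev: "om i [v] = \<sigma> [Z i, v]" "ze i [v] = \<sigma> [v, W i]" for i v
    using sigma_swap[of v "W i"] by (simp_all add: om_def ze_def contract_def)
  have a: "alternating k u" and T: "contract T u = 0" using u by (auto simp: hor_def)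
  have 1: "contract (W i) (contract (Z i) (L u)) = L (contract (W i) (contract (Z i) u)) + u
      - wedge (om i) (contract (W i) u) - wedge (ze i) (contract (Z i) u)" if "i < n" for i
  proof -
    have "contract (Z i) (L u) = wedge (om i) u + L (contract (Z i) u)"
      by (simp add: contract_wedge sigma_even om_def)
    moreover have "contract (W i) (wedge (om i) u) = u - wedge (om i) (contract (W i) u)"
      using that by (simp add: wedge_1_contract[OF om] ev sigma_ZW)
    moreover have "contract (W i) (L (contract (Z i) u)) =
        - wedge (ze i) (contract (Z i) u) + L (contract (W i) (contract (Z i) u))"
      by (simp add: contract_wedge sigma_even ze_def)
    ultimately show ?thesis by (simp add: algebra_simps)
  qed
  \<comment> \<open>Both frames are merged into one family over a disjoint sum. The T-component of v
    disappears because u is horizontal.\<close>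
  have "(\<Sum>j\<in>{..<n} <+> {..<n}. wedge (case_sum ze om j) (contract (case_sum Z W j) u)) = cscale (of_nat k) u"
  proof (rule euler_alternating[OF a])
    show "alternating 1 (case_sum ze om j)" for j by (cases j) (auto simp: om[simplified] ze[simplified])
    fix v
    have "v = \<theta> [v] *s T + (\<Sum>j\<in>{..<n} <+> {..<n}. case_sum ze om j [v] *s case_sum Z W j)"
      using frame[of v] by (simp only: sum.Plus finite_lessThan ev sum.case old.sum.case o_def add.assoc)
    then have "contract v u = contract (\<theta> [v] *s T + (\<Sum>j\<in>{..<n} <+> {..<n}. case_sum ze om j [v] *s case_sum Z W j)) u"
      by (rule arg_cong)
    then show "contract (\<Sum>j\<in>{..<n} <+> {..<n}. case_sum ze om j [v] *s case_sum Z W j) u = contract v u"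
      by (simp add: alternating_contract(1,2)[OF a] T)
  qed
  then have 2: "(\<Sum>i<n. wedge (ze i) (contract (Z i) u)) + (\<Sum>i<n. wedge (om i) (contract (W i) u)) = cscale (of_nat k) u"
    by (simp add: sum.Plus)
  have 3: "(\<Sum>i<m. u) = cscale (of_nat m) u" for m
  proof (induction m)
    case (Suc m)
    then show ?case by (simp only: sum.lessThan_Suc of_nat_Suc cscale_add_left cscale_simps add.commute)
  qed (simp only: lessThan_0 sum.empty of_nat_0 cscale_simps)
  have "Lam (L u) = (\<Sum>i<n. (L (contract (W i) (contract (Z i) u)) + u)
      - (wedge (ze i) (contract (Z i) u) + wedge (om i) (contract (W i) u)))"
    unfolding Lam_def by (rule sum.cong) (simp_all only: 1 lessThan_iff diff_diff_eq add.commute)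
  also have "\<dots> = (L (Lam u) + cscale (of_nat n) u) - cscale (of_nat k) u"
    by (simp only: sum_subtractf sum.distrib 2 3 Lam_def wedge_sum)
  finally show ?thesis by (simp only: cscale_diff_left add_diff_eq)
qed

lemma span_frame: "vec.span (insert T (V10 \<union> V01)) = UNIV"
proof -
  have "v \<in> vec.span (insert T (V10 \<union> V01))" for v
    by (subst frame[of v], intro vec.span_add vec.span_scale vec.span_sum)
      (auto intro: vec.span_base Z_in W_in)
  then show ?thesis by blast
qed

lemma span_frame': "vec.span (insert T (Z ` {..<n} \<union> W ` {..<n})) = UNIV"
proof -
  have "v \<in> vec.span (insert T (Z ` {..<n} \<union> W ` {..<n}))" for v
    by (subst frame[of v], intro vec.span_add vec.span_scale vec.span_sum) (auto intro: vec.span_base)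
  then show ?thesis by blast
qed

lemma alternating_mem_0:
  assumes "alternating k u" "contract v u = 0" "v \<in> set vs" shows "u vs = 0"
proof -
  obtain as bs where "vs = as @ v # bs" using assms(3) by (meson split_list)
  then show ?thesis
    using alternating_move[OF assms(1), of as v bs] fun_cong[OF assms(2), of "as @ bs"] by (simp add: contract_def)
qed

text \<open>A list of more than 2 n vectors from the frame contains T or repeats an entry.\<close>

lemma hor_top:
  assumes u: "u \<in> hor k" and k: "2 * n < k" shows "u = 0"
proof
  fix vs
  have a: "alternating k u" and T: "contract T u = 0" using u by (auto simp: hor_def)
  show "u vs = 0 vs"
    unfolding zero_fun_apply
  proof (rule alternating_span[OF a, of "insert T (Z ` {..<n} \<union> W ` {..<n})"])
    fix ws assume ws: "set ws \<subseteq> insert T (Z ` {..<n} \<union> W ` {..<n})"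
    consider "T \<in> set ws" | "length ws \<noteq> k" | "T \<notin> set ws" "length ws = k" by blast
    then show "u ws = 0"
    proof cases
      case 3
      have "card (set ws) \<le> card (Z ` {..<n} \<union> W ` {..<n})"
        using ws 3 by (intro card_mono) auto
      also have "\<dots> \<le> card (Z ` {..<n}) + card (W ` {..<n})" by (rule card_Un_le)
      also have "\<dots> \<le> n + n"
        using card_image_le[of "{..<n}" Z] card_image_le[of "{..<n}" W] by simp
      finally have "\<not> distinct ws" using 3 k distinct_card[of ws] by auto
      then show ?thesis by (rule alternating_not_distinct[OF a])
    qed (use alternating_mem_0[OF a T] alternating_length[OF a] in blast)+
  qed (simp add: span_frame')
qed

lemma L_hor: "u \<in> hor k ==> L u \<in> hor (k + 2)"
  using alternating_wedge[OF sigma, of k u]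
  by (simp add: hor_def contract_wedge contract_T_sigma sigma_even add.commute)

lemma subspace_hor: "module.subspace cscale (hor k)"
proof -
  interpret vector_space "cscale :: _ => 'm covector => _" by (rule vector_space_cscale)
  show ?thesis by (rule subspaceI) (auto simp: hor_def alternating_add alternating_cscale)
qed

lemma Lam_hor:
  assumes "u \<in> hor (k + 2)" shows "Lam u \<in> hor k"
proof -
  have a: "alternating (k + 2) u" and T: "contract T u = 0" using assms by (auto simp: hor_def)
  have "alternating k (contract (W i) (contract (Z i) u))" for i
    using alternating_contract_alternating[OF alternating_contract_alternating[OF a]] by simp
  moreover have "contract T (contract (W i) (contract (Z i) u)) = 0" for i
    using alternating_contract_swap[OF a, of T "Z i"]
      alternating_contract_swap[OF alternating_contract_alternating[OF a], of T "W i" "Z i"] T by simp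
  ultimately show ?thesis
    unfolding hor_def Lam_def by (simp add: alternating_sum contract_sum)
qed

lemma Lam_low: "u \<in> hor k ==> k < 2 ==> Lam u = 0"
proof -
  assume u: "u \<in> hor k" and k: "k < 2"
  have "contract (W i) (contract (Z i) u) vs = 0" for i vs
    using alternating_length[of k u "Z i # W i # vs"] u k by (simp add: hor_def contract_def)
  then show "Lam u = 0" by (auto simp: Lam_def fun_eq_iff sum_apply)
qed

lemma lefschetz: "lefschetz (cscale :: _ => 'm covector => _) L Lam hor n"
  by (intro lefschetz.intro lefschetz_axioms.intro vector_space_cscale)
    (fact subspace_hor wedge_simps Lam_add Lam_cscale L_hor Lam_hor Lam_low hor_top L_commutator)+

lemmas L_pow_inj = lefschetz.L_pow_inj'[OF lefschetz]
lemmas L_pow_hor = lefschetz.L_pow_H[OF lefschetz]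

end

declare plus_fun_apply [simp del] zero_fun_apply [simp del] minus_apply [simp del] uminus_apply [simp del]

lemmas fun_apply = plus_fun_apply zero_fun_apply minus_apply uminus_apply

subsection \<open>Bidegrees and the filtration\<close>

text \<open>Moved to the end, the arguments in the span of B are the only variables, so
  \<open>alternating_span\<close> reduces them to elements of B, where some entry must
  repeat.\<close>

lemma alternating_too_many:
  assumes "alternating k u" "finite B" "card B < length Zs" "set Zs \<subseteq> vec.span B"
  shows "u (Zs @ vs) = 0"
proof -
  have "alternating (k - length ws) (\<lambda>us. u (ws @ us))" for ws
    using assms(1)
  proof (induction ws arbitrary: u k)
    case (Cons w ws)
    then show ?case
      using Cons.IH[OF alternating_contract_alternating[OF Cons.prems, of w]] by (simp add: contract_def)
  qed (simp add: eta_contract_eq)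
  then have a: "alternating (k - length vs) (\<lambda>us. u (vs @ us))" .
  have "u (vs @ Zs) = 0"
  proof (cases "length (vs @ Zs) = k")
    case True
    show ?thesis
    proof (rule alternating_span[OF a _ assms(4)])
      fix ws assume "set ws \<subseteq> B"
      then show "u (vs @ ws) = 0"
        using alternating_length[OF assms(1), of "vs @ ws"] alternating_not_distinct[OF assms(1), of "vs @ ws"]
          card_mono[OF assms(2), of "set ws"] distinct_card[of ws] assms(3) True by fastforce
    qed
  qed (use alternating_length[OF assms(1)] in blast)
  then show ?thesis using alternating_mset_eq[OF assms(1), of "Zs @ vs" "vs @ Zs"] by simp
qed

text \<open>Orthogonality of the characters of the cyclic group of order N; exponents below N are
  congruent only if equal.\<close>

lemma root_of_unity_sum:
  assumes "r < N" "b < N"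
  shows "(\<Sum>j<N. cis (- 2 * pi * real j * real b / real N) * cis (2 * pi * real j / real N) ^ r) = (if r = b then of_nat N else 0)"
proof -
  define x where "x = cis (2 * pi * (real r - real b) / real N)"
  have "cis (- 2 * pi * real j * real b / real N) * cis (2 * pi * real j / real N) ^ r = x ^ j" for j
    unfolding x_def Complex.DeMoivre cis_mult
    by (rule arg_cong[of _ _ cis]) (simp add: algebra_simps diff_divide_distrib)
  then have sum: "(\<Sum>j<N. cis (- 2 * pi * real j * real b / real N) * cis (2 * pi * real j / real N) ^ r) = (\<Sum>j<N. x ^ j)"
    by simp
  show ?thesis
  proof (cases "r = b")
    case False
    have N: "real N \<noteq> 0" using assms by simp
    have "x ^ N = cis (2 * pi * (real r - real b))"
      using N by (simp add: x_def Complex.DeMoivre)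
    also have "\<dots> = 1"
      using cis_multiple_2pi[of "of_int (int r - int b)"] by simp
    finally have "x ^ N = 1" .
    moreover have "x \<noteq> 1"
    proof
      have e: "exp (2 * of_real pi * \<i> * of_nat j / of_nat N) = cis (2 * pi * real j / real N)" for j
        by (simp add: cis_conv_exp algebra_simps)
      assume "x = 1"
      moreover have "x = cis (2 * pi * real r / real N) / cis (2 * pi * real b / real N)"
        by (simp add: x_def cis_divide right_diff_distrib diff_divide_distrib)
      ultimately show False
        using complex_root_unity_eq[of N r b] assms False by (simp add: e cis_neq_zero)
    qed
    ultimately show ?thesis using False unfolding sum by (simp add: geometric_sum)
  next
    case True
    then show ?thesis unfolding sum by (simp add: x_def)
  qed
qed

context cr_point
begin

lemma V_Int: "v \<in> V10 ==> v \<in> V01 ==> v = 0"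
  using dil_Z[of v 0] dil_W[of v 0] by simp

lemma weight_le: "weight vs \<le> length vs"
  by (simp add: weight_def)

lemma weight_Cons: "weight (v # vs) = (if v \<in> V01 then Suc (weight vs) else weight vs)"
  by (simp add: weight_def)

section \<open>The bidegree projections \<open>bproj\<close>\<close>

lemma dil_eval:
  "alternating k u ==> set vs \<subseteq> V10 \<union> V01 ==> u (map (dil t) vs) = t ^ weight vs * u vs"
proof (induction vs arbitrary: u k)
  case (Cons v vs)
  have IH: "contract w u (map (dil t) vs) = t ^ weight vs * contract w u vs" for w
    using Cons.IH[OF alternating_contract_alternating[OF Cons.prems(1)]] Cons.prems(2) by simp
  show ?case
  proof (cases "v \<in> V01")
    case True
    have "u (t *s v # map (dil t) vs) = t * u (v # map (dil t) vs)"
      using fun_cong[OF alternating_contract(2)[OF Cons.prems(1), of t v], of "map (dil t) vs"]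
      by (simp add: contract_def cscale_def)
    then show ?thesis using IH[of v] True by (simp add: contract_def weight_Cons dil_W)
  next
    case False
    then show ?thesis using IH[of v] Cons.prems(2) by (simp add: contract_def weight_Cons dil_Z)
  qed
qed (simp add: weight_def)

text \<open>On vectors of V10 and V01 the dilation acts by t to the power \<open>weight vs\<close>,
  and averaging selects the weight b. The bound k < N keeps different weights distinct modulo
  N.\<close>

lemma bproj_eval:
  assumes "alternating k u" "k < N" "b < N" "set vs \<subseteq> V10 \<union> V01"
  shows "bproj N b u vs = (if weight vs = b then u vs else 0)"
proof (cases "length vs = k")
  case True
  then have w: "weight vs < N" using weight_le[of vs] assms(2) by simp
  have "bproj N b u vs = 1 / of_nat N * (\<Sum>j<N. cis (- 2 * pi * real j * real b / real N) *
      cis (2 * pi * real j / real N) ^ weight vs * u vs)"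
    by (simp add: bproj_def cscale_def sum_apply pullback_def dil_eval[OF assms(1,4)] mult.assoc)
  also have "\<dots> = 1 / of_nat N * ((if weight vs = b then of_nat N else 0) * u vs)"
    unfolding sum_distrib_right[symmetric] root_of_unity_sum[OF w assms(3)] ..
  finally show ?thesis using assms(2) by simp
next
  case False
  then show ?thesis
    using alternating_length[OF assms(1)] by (simp add: bproj_def cscale_def sum_apply pullback_def)
qed

lemma bproj_hor: "alternating k u ==> bproj N b u \<in> hor k"
  unfolding bproj_def
  by (auto simp: hor_def contract_sum contract_T_pullback_dil simp del: contract_simps(7)
      intro!: alternating_cscale alternating_sum alternating_pullback_dil)

lemma hor_alternating: "u \<in> hor k ==> alternating k u" and hor_T: "u \<in> hor k ==> contract T u = 0"
  by (auto simp: hor_def)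

lemma hor_0 [simp]: "0 \<in> hor k"
  by (simp add: hor_def)

lemma hor_diff: "u \<in> hor k ==> v \<in> hor k ==> u - v \<in> hor k"
  by (simp add: hor_def alternating_diff)

lemma bproj_add: "bproj N b (u + v) = bproj N b u + bproj N b v"
  by (simp add: bproj_def sum.distrib)

lemma bproj_diff: "bproj N b (u - v) = bproj N b u - bproj N b v"
  by (simp add: bproj_def sum_subtractf)

lemma bproj_cscale: "bproj N b (cscale a u) = cscale a (bproj N b u)"
  by (simp add: bproj_def cscale_sum mult_ac)

lemma bproj_0 [simp]: "bproj N b 0 = 0"
  using bproj_cscale[of N b 0 0] by simp

lemma bproj_theta: "bproj N b (wedge \<theta> u) = 0"
  by (simp add: bproj_def PH_wedge_theta)

lemma bproj_PH: "bproj N b (PH u) = bproj N b u"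
  by (simp add: bproj_def pullback_dil_PH)

text \<open>\<sigma> has type (1,1): the dilation multiplies it by t, which shifts the selected
  character by one.\<close>

lemma bproj_L: "0 < N ==> bproj N (Suc b) (L u) = L (bproj N b u)"
proof -
  assume N: "0 < N"
  have "cis (- (2 * pi * real j * real (Suc b)) / real N) * cis (2 * pi * real j / real N) =
      cis (- (2 * pi * real j * real b) / real N)" for j
    using N by (simp add: cis_mult field_simps)
  then show ?thesis
    by (simp add: bproj_def pullback_wedge pullback_dil_sigma wedge_sum)
qed

lemma bproj_L_pow: "0 < N ==> bproj N (b + m) ((L ^^ m) u) = (L ^^ m) (bproj N b u)"
  by (induction m) (simp_all add: bproj_L)

lemma hor_eq_0_pure:
  assumes "u \<in> hor k" "\<And>vs. set vs \<subseteq> V10 \<union> V01 ==> u vs = 0"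
  shows "u = 0"
proof
  fix vs
  have a: "alternating k u" and T: "contract T u = 0" using assms(1) by (auto simp: hor_def)
  show "u vs = 0 vs"
    unfolding zero_fun_apply
  proof (rule alternating_span[OF a, of "insert T (V10 \<union> V01)"])
    fix ws assume "set ws \<subseteq> insert T (V10 \<union> V01)"
    then show "u ws = 0"
      using assms(2)[of ws] alternating_mem_0[OF a T, of ws] by (cases "T \<in> set ws") auto
  qed (simp add: span_frame)
qed

lemma hor_eqI:
  assumes "u \<in> hor k" "v \<in> hor k" "\<And>vs. set vs \<subseteq> V10 \<union> V01 ==> u vs = v vs"
  shows "u = v"
  using hor_eq_0_pure[OF hor_diff[OF assms(1,2)]] assms(3) by (simp add: fun_apply)

lemma hor_eq_0_bproj:
  assumes "u \<in> hor k" "k < N" "\<And>b. b \<le> k ==> bproj N b u = 0"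
  shows "u = 0"
proof (rule hor_eq_0_pure[OF assms(1)])
  fix vs assume vs: "set vs \<subseteq> V10 \<union> V01"
  show "u vs = 0"
  proof (cases "length vs = k")
    case True
    then have w: "weight vs < N" "weight vs \<le> k" using weight_le[of vs] assms(2) by auto
    then show ?thesis
      using bproj_eval[OF hor_alternating[OF assms(1)] assms(2) w(1) vs] assms(3)[OF w(2)] by (simp add: fun_apply)
  qed (use alternating_length hor_alternating[OF assms(1)] in blast)
qed

lemma PH_eval: "alternating k u ==> set vs \<subseteq> V10 \<union> V01 ==> PH u vs = u vs"
  using dil_eval[of k u vs 1] by (simp add: pullback_def)

lemma bproj_eqI:
  assumes "alternating k u" "alternating k \<alpha>" "k < N" "b < N"
    and "\<And>vs. set vs \<subseteq> V10 \<union> V01 ==> \<alpha> vs = (if weight vs = b then u vs else 0)"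
  shows "bproj N b u = PH \<alpha>"
  by (rule hor_eqI[OF bproj_hor[OF assms(1)] pullback_dil_hor[OF assms(2)]])
    (simp add: bproj_eval[OF assms(1,3,4)] PH_eval[OF assms(2)] assms(5))

lemma bproj_bproj:
  assumes "alternating k u" "k < N" "b < N" "c < N"
  shows "bproj N c (bproj N b u) = (if c = b then bproj N b u else 0)"
  by (rule hor_eqI[OF bproj_hor[OF hor_alternating[OF bproj_hor[OF assms(1)]]]])
    (auto simp: fun_apply bproj_hor[OF assms(1)] bproj_eval[OF hor_alternating[OF bproj_hor[OF assms(1)]] assms(2,4)]
       bproj_eval[OF assms(1,2,3)])

section \<open>The filtration at a point\<close>

lemma KK_simps:
  "KK j 0" "KK j u ==> KK j v ==> KK j (u + v)" "KK j u ==> KK j v ==> KK j (u - v)"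
  "KK j u ==> KK j (cscale a u)"
  by (auto simp: KK_def cscale_def fun_apply)

lemma KK_0_iff: "KK 0 u \<longleftrightarrow> u = 0"
  by (auto simp: KK_def fun_eq_iff fun_apply)

lemma KK_mono: "KK j u ==> j \<le> i ==> KK i u"
  unfolding KK_def
proof (intro allI impI)
  fix Ws vs assume *: "\<forall>Ws vs. length Ws = j --> set Ws \<subseteq> V01 --> u (Ws @ vs) = 0" "j \<le> i" "length Ws = i" "set Ws \<subseteq> V01"
  then have "u (take j Ws @ (drop j Ws @ vs)) = 0"
    using set_take_subset[of j Ws] by (metis length_take min_absorb2 subset_trans)
  then show "u (Ws @ vs) = 0" by (metis append.assoc append_take_drop_id)
qed

lemma KK_Suc: "KK (Suc j) u \<longleftrightarrow> (\<forall>w\<in>V01. KK j (contract w u))"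
proof
  assume *: "KK (Suc j) u"
  show "\<forall>w\<in>V01. KK j (contract w u)"
    unfolding KK_def contract_def
  proof (intro ballI allI impI)
    fix w Ws vs assume "w \<in> V01" "length Ws = j" "set Ws \<subseteq> V01"
    then show "u (w # Ws @ vs) = 0"
      using *[unfolded KK_def, rule_format, of "w # Ws" vs] by simp
  qed
next
  assume *: "\<forall>w\<in>V01. KK j (contract w u)"
  show "KK (Suc j) u"
    unfolding KK_def
  proof (intro allI impI)
    fix Ws vs assume "length Ws = Suc j" "set Ws \<subseteq> V01"
    then show "u (Ws @ vs) = 0"
      using * unfolding KK_def contract_def by (cases Ws) auto
  qed
qed

lemma KK_Suc_frame:
  assumes a: "alternating k u" and W: "\<And>i. i < n ==> KK j (contract (W i) u)"
  shows "KK (Suc j) u"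
  unfolding KK_Suc
proof
  fix w assume "w \<in> V01"
  then have "w \<in> vec.span (W ` {..<n})" by (simp only: V01)
  then show "KK j (contract w u)"
    by (rule vec.span_induct)
      (auto intro!: vec.subspaceI simp: W alternating_contract[OF a] KK_simps)
qed

lemma KK_theta: "KK j u ==> KK j (wedge \<theta> u)"
proof (induction j arbitrary: u)
  case (Suc j)
  have "KK j (contract w (wedge \<theta> u))" if "w \<in> V01" for w
    using Suc.IH[of "cscale (- 1) (contract w u)"] Suc.prems that KK_simps(4)[of j "contract w u" "-1"]
    by (simp add: KK_Suc wedge_1_contract[OF theta] theta_V(2))
  then show ?case by (simp add: KK_Suc)
qed (simp add: KK_0_iff)

text \<open>Membership in the filtration is read off tuples from T, V10 and V01 in any order,
  because the entries of V01 can be brought to the front without affecting vanishing.\<close>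

lemma KK_iff_weight:
  assumes a: "alternating k u"
  shows "KK j u \<longleftrightarrow> (\<forall>vs. set vs \<subseteq> insert T (V10 \<union> V01) --> j \<le> weight vs --> u vs = 0)"
proof
  assume *: "KK j u"
  show "\<forall>vs. set vs \<subseteq> insert T (V10 \<union> V01) --> j \<le> weight vs --> u vs = 0"
  proof (intro allI impI)
    fix vs assume "j \<le> weight vs"
    then have "u (filter (\<lambda>v. v \<in> V01) vs @ filter (\<lambda>v. v \<notin> V01) vs) = 0"
      using KK_mono[OF *, unfolded KK_def] by (force simp: weight_def)
    then show "u vs = 0"
      using alternating_mset_eq[OF a, of vs "filter (\<lambda>v. v \<in> V01) vs @ filter (\<lambda>v. v \<notin> V01) vs"] by simp
  qed
next
  assume *: "\<forall>vs. set vs \<subseteq> insert T (V10 \<union> V01) --> j \<le> weight vs --> u vs = 0"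
  then show "KK j u"
    using a
  proof (induction j arbitrary: u k)
    case 0
    have "u vs = 0" for vs
      by (rule alternating_span[OF 0(2), of "insert T (V10 \<union> V01)"]) (use 0 in \<open>auto simp: span_frame\<close>)
    then show ?case by (simp add: KK_def)
  next
    case (Suc j)
    have "KK j (contract w u)" if "w \<in> V01" for w
    proof (rule Suc.IH[OF _ alternating_contract_alternating[OF Suc.prems(2)]], intro allI impI)
      fix vs assume "set vs \<subseteq> insert T (V10 \<union> V01)" "j \<le> weight vs"
      then show "contract w u vs = 0"
        using Suc.prems(1)[rule_format, of "w # vs"] that by (simp add: contract_def weight_Cons)
    qed
    then show ?case by (simp add: KK_Suc)
  qed
qed

text \<open>A tuple from T, V10 and V01 either avoids T or contains it; in the second case the
  remaining k - 1 entries carry the whole weight. This explains the two families of projections and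
  the bound b < k in the second.\<close>

lemma KK_intro:
  assumes a: "alternating k u" and k: "k < N"
    and "\<And>b. j \<le> b ==> b \<le> k ==> bproj N b u = 0"
    and "\<And>b. j \<le> b ==> b < k ==> bproj N b (contract T u) = 0"
  shows "KK j u"
  unfolding KK_iff_weight[OF a]
proof (intro allI impI)
  fix vs assume vs: "set vs \<subseteq> insert T (V10 \<union> V01)" and w: "j \<le> weight vs"
  note ta = alternating_contract_alternating[OF a, of T]
  show "u vs = 0"
  proof (cases "length vs = k")
    case True
    then have wk: "weight vs \<le> k" and wN: "weight vs < N" using weight_le[of vs] k by auto
    show ?thesis
    proof (cases "T \<in> set vs")
      case True
      then obtain as bs where ab: "vs = as @ T # bs" by (meson split_list)
      have wt: "weight (as @ bs) = weight vs" using T_notin by (simp add: weight_def ab)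
      have wk': "weight vs < k" using weight_le[of "as @ bs"] wt True \<open>length vs = k\<close> by (simp add: ab)
      have "contract T u (as @ bs) = 0"
      proof (cases "T \<in> set (as @ bs)")
        case True
        then show ?thesis by (rule alternating_mem_0[OF ta alternating_contract(4)[OF a]])
      next
        case False
        then have "set (as @ bs) \<subseteq> V10 \<union> V01" using vs by (auto simp: ab)
        then show ?thesis
          using bproj_eval[OF ta _ wN, of "as @ bs"] assms(4)[OF w wk'] k wt by (simp add: fun_apply)
      qed
      then show ?thesis using alternating_move[OF a, of as T bs] by (simp add: ab contract_def)
    next
      case False
      then have "set vs \<subseteq> V10 \<union> V01" using vs by auto
      then show ?thesis using bproj_eval[OF a k wN, of vs] assms(3)[OF w wk] by (simp add: fun_apply)
    qed
  qed (rule alternating_length[OF a])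
qed

lemma KK_contract: "alternating k u ==> KK j u ==> KK j (contract v u)"
  unfolding KK_def contract_def
proof (intro allI impI)
  fix Ws vs
  assume a: "alternating k u" and "\<forall>Ws vs. length Ws = j --> set Ws \<subseteq> V01 --> u (Ws @ vs) = 0"
    "length Ws = j" "set Ws \<subseteq> V01"
  then have "u (Ws @ v # vs) = 0" by blast
  then show "u (v # Ws @ vs) = 0" using alternating_mset_eq[OF a, of "v # Ws @ vs" "Ws @ v # vs"] by simp
qed

lemma KK_bproj:
  assumes "alternating k u" "k < N" "KK j u" "j \<le> b" "b < N"
  shows "bproj N b u = 0"
  by (rule hor_eq_0_pure[OF bproj_hor[OF assms(1)]])
    (use assms(3-5) in \<open>auto simp: bproj_eval[OF assms(1,2,5)] KK_iff_weight[OF assms(1)]\<close>)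

lemma KK_bproj_T:
  assumes "alternating k u" "k < N" "KK j u" "j \<le> b" "b < N"
  shows "bproj N b (contract T u) = 0"
  using assms(2) by (intro KK_bproj[OF alternating_contract_alternating[OF assms(1)] _ KK_contract[OF assms(1,3)] assms(4,5)]) simp

text \<open>V01 is spanned by n vectors, and an alternating covector vanishes on more than n
  arguments from it.\<close>

lemma KK_top: "alternating k u ==> n < j ==> KK j u"
  unfolding KK_def
proof (intro allI impI)
  fix Ws vs assume a: "alternating k u" and *: "n < j" "length Ws = j" "set Ws \<subseteq> V01"
  show "u (Ws @ vs) = 0"
    by (rule alternating_too_many[OF a, of "W ` {..<n}"])
      (use * card_image_le[of "{..<n}" W] in \<open>auto simp: V01\<close>)
qed

text \<open>With q entries in V01 and at most one equal to T, more than n entries lie in V10, which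
  n vectors span. Hence \<open>F^p\<close> and \<open>F^(p+1)\<close> coincide for p > n +
  1.\<close>

lemma KK_top10:
  assumes a: "alternating k u" and "n + 1 + q < k" "KK (Suc q) u"
  shows "KK q u"
  unfolding KK_iff_weight[OF a]
proof (intro allI impI)
  fix vs assume vs: "set vs \<subseteq> insert T (V10 \<union> V01)" and w: "q \<le> weight vs"
  consider "Suc q \<le> weight vs" | "length vs \<noteq> k" | "\<not> distinct vs" | "weight vs = q" "length vs = k" "distinct vs"
    using w by linarith
  then show "u vs = 0"
  proof cases
    case 1
    then show ?thesis using assms(3) vs unfolding KK_iff_weight[OF a] by blast
  next
    case 4
    let ?P = "\<lambda>v. v \<notin> V01 \<and> v \<noteq> T"
    have "length (filter (\<lambda>v. v \<notin> V01 \<and> v = T) vs) \<le> 1"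
    proof -
      have "distinct (filter (\<lambda>v. v \<notin> V01 \<and> v = T) vs)" using 4 by simp
      moreover have "set (filter (\<lambda>v. v \<notin> V01 \<and> v = T) vs) \<subseteq> {T}" by auto
      ultimately show ?thesis by (metis card.empty card_insert_disjoint card_mono distinct_card
        empty_iff finite.intros One_nat_def)
    qed
    moreover have "length vs = length (filter (\<lambda>v. v \<in> V01) vs) + length (filter (\<lambda>v. v \<notin> V01 \<and> v = T) vs) + length (filter ?P vs)"
      by (induction vs) auto
    ultimately have "n < length (filter ?P vs)" using 4 assms(2) by (simp add: weight_def)
    then have "u (filter ?P vs @ filter (\<lambda>v. \<not> ?P v) vs) = 0"
      by (intro alternating_too_many[OF a, of "Z ` {..<n}"])
        (use vs card_image_le[of "{..<n}" Z] in \<open>auto simp: V10[symmetric]\<close>)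
    then show ?thesis using alternating_mset_eq[OF a, of vs "filter ?P vs @ filter (\<lambda>v. \<not> ?P v) vs"] by simp
  qed (use alternating_length[OF a] alternating_not_distinct[OF a] in blast)+
qed

text \<open>Sorting the arguments turns block lengths into weights. V10 and V01 meet only in 0, and
  a zero argument makes the value vanish anyway.\<close>

lemma has_bidegree_iff:
  assumes a: "alternating (p + q) u"
  shows "has_bidegree V10 V01 p q u \<longleftrightarrow> (\<forall>vs. set vs \<subseteq> V10 \<union> V01 --> weight vs \<noteq> q --> u vs = 0)"
proof
  assume *: "has_bidegree V10 V01 p q u"
  show "\<forall>vs. set vs \<subseteq> V10 \<union> V01 --> weight vs \<noteq> q --> u vs = 0"
  proof (intro allI impI)
    fix vs assume vs: "set vs \<subseteq> V10 \<union> V01" "weight vs \<noteq> q"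
    then have "u (filter (\<lambda>v. \<not> v \<in> V01) vs @ filter (\<lambda>v. v \<in> V01) vs) = 0"
      by (intro *[unfolded has_bidegree_def, rule_format]) (auto simp: weight_def)
    then show "u vs = 0"
      using alternating_mset_eq[OF a, of vs "filter (\<lambda>v. \<not> v \<in> V01) vs @ filter (\<lambda>v. v \<in> V01) vs"] by simp
  qed
next
  assume *: "\<forall>vs. set vs \<subseteq> V10 \<union> V01 --> weight vs \<noteq> q --> u vs = 0"
  show "has_bidegree V10 V01 p q u"
    unfolding has_bidegree_def
  proof (intro allI impI)
    fix Zs Ws assume ZW: "set Zs \<subseteq> V10" "set Ws \<subseteq> V01" "(length Zs, length Ws) \<noteq> (p, q)"
    consider "length (Zs @ Ws) \<noteq> p + q" | "0 \<in> set (Zs @ Ws)" | "length (Zs @ Ws) = p + q" "0 \<notin> set Zs" by fastforce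
    then show "u (Zs @ Ws) = 0"
    proof cases
      case 3
      have "filter (\<lambda>v. v \<in> V01) Zs = []" using V_Int ZW 3 by (auto simp: filter_empty_conv)
      moreover have "filter (\<lambda>v. v \<in> V01) Ws = Ws" using ZW by (auto simp: filter_id_conv)
      ultimately have "weight (Zs @ Ws) = length Ws" by (simp add: weight_def)
      moreover have "length Ws \<noteq> q" using ZW(3) 3 by auto
      moreover have "set (Zs @ Ws) \<subseteq> V10 \<union> V01" using ZW by auto
      ultimately show ?thesis using * by metis
    qed (use alternating_length[OF a] alternating_mem_0[OF a alternating_contract(3)[OF a]] in blast)+
  qed
qed

lemma has_bidegree_bproj:
  assumes a: "alternating (p + q) u" and N: "p + q < N"
  shows "has_bidegree V10 V01 p q u \<longleftrightarrow> (\<forall>b<N. b \<noteq> q --> bproj N b u = 0)"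
proof
  assume *: "has_bidegree V10 V01 p q u"
  show "\<forall>b<N. b \<noteq> q --> bproj N b u = 0"
    using * unfolding has_bidegree_iff[OF a]
    by (auto intro!: hor_eq_0_pure[OF bproj_hor[OF a]] simp: bproj_eval[OF a N])
next
  assume *: "\<forall>b<N. b \<noteq> q --> bproj N b u = 0"
  show "has_bidegree V10 V01 p q u"
    unfolding has_bidegree_iff[OF a]
  proof (intro allI impI)
    fix vs assume vs: "set vs \<subseteq> V10 \<union> V01" "weight vs \<noteq> q"
    show "u vs = 0"
    proof (cases "length vs = p + q")
      case True
      then have "weight vs < N" using weight_le[of vs] N by simp
      then show ?thesis using * bproj_eval[OF a N _ vs(1), of "weight vs"] vs(2) by (simp add: fun_apply)
    qed (rule alternating_length[OF a])
  qed
qed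

lemma L_pow_diff: "(L ^^ m) (u - v) = (L ^^ m) u - (L ^^ m) v"
  by (induction m) simp_all

lemma L_pow_add: "(L ^^ m) (u + v) = (L ^^ m) u + (L ^^ m) v"
  by (induction m) simp_all

lemma L_pow_0: "(L ^^ m) 0 = 0"
  by (induction m) simp_all

lemma prim_simps:
  "prim k 0" "prim k u ==> prim k v ==> prim k (u + v)" "prim k u ==> prim k v ==> prim k (u - v)"
  by (auto simp: prim_def L_pow_diff L_pow_add L_pow_0)

text \<open>Powers of L commute with the projections up to a shift of the index, so the components
  of a primitive covector are primitive.\<close>

lemma prim_bproj:
  assumes "0 < N" "prim k (PH u)" shows "prim k (bproj N b u)"
proof -
  have "(L ^^ m) (bproj N b u) = bproj N (b + m) ((L ^^ m) (PH u))" for m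
    by (simp only: bproj_L_pow[OF assms(1)] bproj_PH)
  moreover have "bproj N b u = bproj N b (PH u)" by (simp only: bproj_PH)
  ultimately show ?thesis using assms(2) by (simp add: prim_def split: if_splits)
qed

text \<open>The factor \<theta> leaves only horizontal parts, and n + 1 - k and n - k are the
  primitivity exponents in the degrees k and k + 1. At k = n the exponent 0 agrees with the fact
  that primitive covectors of degree n + 1 are zero.\<close>

lemma rumin_condition_iff:
  assumes "alternating k u" "alternating (k + 1) v"
  shows "(if k \<le> n then wedge \<theta> (wedge u (wedge_power \<sigma> (n + 1 - k))) = (\<lambda>vs. 0) \<and>
            wedge \<theta> (wedge v (wedge_power \<sigma> (n - k))) = (\<lambda>vs. 0)
          else wedge \<theta> u = (\<lambda>vs. 0) \<and> wedge \<theta> v = (\<lambda>vs. 0)) \<longleftrightarrow> prim k (PH u) \<and> prim (k + 1) (PH v)"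
proof -
  have "wedge u (wedge_power \<sigma> m) = (L ^^ m) u" for u m
    using wedge_commute(1)[OF grade_sign_wedge_power[OF sigma_even], of m u] by (simp add: wedge_power_funpow)
  moreover have "wedge \<theta> ((L ^^ m) u) = 0 \<longleftrightarrow> (L ^^ m) (PH u) = 0" if "alternating j u" for u m j
    using wedge_theta_eq_0_iff[OF alternating_wedge_funpow[OF sigma that]] by (simp add: PH_L)
  moreover have "n + 1 - (k + 1) = n - k" by simp
  moreover have "(L ^^ (n - k)) (PH v) = PH v" if "\<not> k + 1 \<le> n"
    using that by simp
  ultimately show ?thesis
    using wedge_theta_eq_0_iff[OF assms(1)] wedge_theta_eq_0_iff[OF assms(2)] assms
    unfolding zero_fun_def[symmetric] prim_def
    by (cases "k \<le> n"; cases "k + 1 \<le> n") (simp_all only: if_True if_False not_False_eq_True simp_thms)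
qed

end

section \<open>Exterior calculus in coordinates\<close>

text \<open>Smooth dependence for each fixed list of vectors, with no alternation required. The
  rules for d are proved in this generality, where an induction by contraction with constant vectors
  has no degrees to track.\<close>

definition sfam :: "(real ^ 'm::finite) set => (real ^ 'm => 'm covector) => bool" where
  "sfam V \<omega> \<longleftrightarrow> (\<forall>vs. smooth_on V (\<lambda>x. \<omega> x vs))"

definition lform :: "nat => (real ^ 'm::finite) set => (real ^ 'm => 'm covector) => bool" where
  "lform k V \<omega> \<longleftrightarrow> (\<forall>x\<in>V. alternating k (\<omega> x)) \<and> sfam V \<omega>"

definition ld :: "(real ^ 'm::finite => 'm covector) => real ^ 'm => 'm covector" where
  "ld \<omega> x vs = altsum (\<lambda>v us. cderiv (\<lambda>y. \<omega> y us) x v) vs"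

definition DD :: "complex ^ 'm::finite => (real ^ 'm => 'm covector) => real ^ 'm => 'm covector" where
  "DD z \<omega> x vs = cderiv (\<lambda>y. \<omega> y vs) x z"

definition vderiv :: "(real ^ 'm::finite => complex ^ 'm) => real ^ 'm => complex ^ 'm => complex ^ 'm" where
  "vderiv X x z = (\<chi> j. cderiv (\<lambda>y. X y $ j) x z)"

text \<open>The Lie derivative of forms, introduced through Cartan's formula; \<open>lie_eq\<close>
  recovers the usual coordinate expression.\<close>

definition lie :: "(real ^ 'm::finite => complex ^ 'm) => (real ^ 'm => 'm covector) => real ^ 'm => 'm covector" where
  "lie X \<alpha> x = contract (X x) (ld \<alpha> x) + ld (\<lambda>y. contract (X y) (\<alpha> y)) x"

lemma ld_altsum: "ld \<omega> x vs = altsum (\<lambda>v us. DD v \<omega> x us) vs"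
  by (simp add: ld_def DD_def)

lemma ld_Nil: "ld \<omega> x [] = 0"
  by (simp add: ld_def)

lemma DD_contract: "DD z (\<lambda>y. contract v (\<omega> y)) x = contract v (DD z \<omega> x)"
  by (auto simp: DD_def contract_def)

text \<open>Cartan's formula for a constant vector field, whose Lie derivative is
  \<open>DD v\<close>. It drives the inductions over argument lists below.\<close>

lemma contract_ld: "contract v (ld \<omega> x) = DD v \<omega> x - ld (\<lambda>y. contract v (\<omega> y)) x"
  by (auto simp: fun_eq_iff contract_def ld_def DD_def fun_apply)

lemma smooth_on_altsum:
  "open V ==> (\<And>u us. smooth_on V (\<lambda>x. f x u us)) ==> smooth_on V (\<lambda>x. altsum (f x) vs)"
  by (induction vs arbitrary: f) (auto intro!: smooth_on_diff)

lemma cderiv_altsum: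
  "open V ==> x \<in> V ==> (\<And>u us. smooth_on V (\<lambda>x. f x u us)) ==>
    cderiv (\<lambda>y. altsum (f y) vs) x z = altsum (\<lambda>u us. cderiv (\<lambda>y. f y u us) x z) vs"
proof (induction vs arbitrary: f)
  case (Cons v vs)
  have "smooth_on V (\<lambda>y. altsum (\<lambda>u us. f y u (v # us)) vs)"
    by (rule smooth_on_altsum) (use Cons.prems in auto)
  then show ?case
    using Cons.IH[of "\<lambda>y u us. f y u (v # us)"] Cons.prems
    by (simp add: cderiv_diff[OF smooth_on_differentiable smooth_on_differentiable, of V _ x V])
qed simp

context
  fixes V :: "(real ^ 'm::finite) set"
  assumes V: "open V"
begin

lemma sfam_add: "sfam V \<alpha> ==> sfam V \<beta> ==> sfam V (\<lambda>x. \<alpha> x + \<beta> x)"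
  by (auto simp: sfam_def fun_apply intro!: smooth_on_add V)

lemma sfam_diff: "sfam V \<alpha> ==> sfam V \<beta> ==> sfam V (\<lambda>x. \<alpha> x - \<beta> x)"
  by (auto simp: sfam_def fun_apply intro!: smooth_on_diff V)

lemma sfam_uminus: "sfam V \<alpha> ==> sfam V (\<lambda>x. - \<alpha> x)"
  by (auto simp: sfam_def fun_apply intro!: smooth_on_uminus V)

lemma sfam_0: "sfam V (\<lambda>x. 0)"
  by (auto simp: sfam_def fun_apply)

lemma sfam_sum: "(\<And>i. i \<in> I ==> sfam V (\<alpha> i)) ==> sfam V (\<lambda>x. \<Sum>i\<in>I. \<alpha> i x)"
  by (auto simp: sfam_def sum_apply intro!: smooth_on_sum V)

lemma sfam_cscale: "smooth_on V g ==> sfam V \<alpha> ==> sfam V (\<lambda>x. cscale (g x) (\<alpha> x))"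
  by (auto simp: sfam_def cscale_def intro!: smooth_on_mult V)

lemma sfam_contract: "sfam V \<alpha> ==> sfam V (\<lambda>x. contract v (\<alpha> x))"
  by (auto simp: sfam_def contract_def)

lemma sfam_grade_sign: "sfam V \<alpha> ==> sfam V (\<lambda>x. grade_sign (\<alpha> x))"
  by (auto simp: sfam_def grade_sign_def intro!: smooth_on_mult V)

lemma sfam_wedge: "sfam V \<alpha> ==> sfam V \<beta> ==> sfam V (\<lambda>x. wedge (\<alpha> x) (\<beta> x))"
  by (auto simp: sfam_def wedge_def intro!: smooth_on_sum smooth_on_mult V)

lemma sfam_DD: "sfam V \<alpha> ==> sfam V (DD v \<alpha>)"
  by (auto simp: sfam_def DD_def intro!: smooth_on_cderiv V)

lemma sfam_ld: "sfam V \<alpha> ==> sfam V (ld \<alpha>)"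
  by (auto simp: sfam_def ld_def intro!: smooth_on_altsum smooth_on_cderiv V)

lemma sfam_cong: "(\<And>x. x \<in> V ==> \<alpha> x = \<beta> x) ==> sfam V \<alpha> ==> sfam V \<beta>"
  unfolding sfam_def using smooth_on_cong[OF V, of "\<lambda>x. \<alpha> x vs" "\<lambda>x. \<beta> x vs" for vs] by simp

lemma sfam_differentiable: "sfam V \<alpha> ==> x \<in> V ==> (\<lambda>y. \<alpha> y vs) differentiable (at x)"
  by (rule smooth_on_differentiable) (auto simp: sfam_def)

lemma DD_cong:
  assumes "\<And>y. y \<in> V ==> \<alpha> y = \<beta> y" "sfam V \<alpha>" "x \<in> V"
  shows "DD z \<alpha> x = DD z \<beta> x"
proof
  show "DD z \<alpha> x vs = DD z \<beta> x vs" for vs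
    unfolding DD_def by (rule cderiv_cong[OF V]) (use assms in \<open>auto simp: sfam_def\<close>)
qed

lemma ld_cong:
  assumes "\<And>y. y \<in> V ==> \<alpha> y = \<beta> y" "sfam V \<alpha>" "x \<in> V"
  shows "ld \<alpha> x = ld \<beta> x"
proof
  have "DD v \<alpha> x = DD v \<beta> x" for v by (rule DD_cong[OF assms])
  then show "ld \<alpha> x vs = ld \<beta> x vs" for vs by (simp only: ld_altsum)
qed

lemma DD_add: "sfam V \<alpha> ==> sfam V \<beta> ==> x \<in> V ==> DD z (\<lambda>y. \<alpha> y + \<beta> y) x = DD z \<alpha> x + DD z \<beta> x"
  by (simp add: fun_eq_iff DD_def fun_apply cderiv_add sfam_differentiable)

lemma DD_diff: "sfam V \<alpha> ==> sfam V \<beta> ==> x \<in> V ==> DD z (\<lambda>y. \<alpha> y - \<beta> y) x = DD z \<alpha> x - DD z \<beta> x"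
  by (simp add: fun_eq_iff DD_def fun_apply cderiv_diff sfam_differentiable)

lemma DD_cmult: "sfam V \<alpha> ==> x \<in> V ==> DD z (\<lambda>y. cscale a (\<alpha> y)) x = cscale a (DD z \<alpha> x)"
  by (simp add: fun_eq_iff DD_def cscale_def cderiv_cmult sfam_differentiable)

lemma DD_0: "DD z (\<lambda>y. 0) x = 0"
  by (simp add: fun_eq_iff DD_def fun_apply)

lemma DD_grade_sign: "sfam V \<alpha> ==> x \<in> V ==> DD z (\<lambda>y. grade_sign (\<alpha> y)) x = grade_sign (DD z \<alpha> x)"
  by (simp add: fun_eq_iff DD_def grade_sign_def cderiv_cmult sfam_differentiable)

lemma DD_vec:
  assumes "sfam V \<alpha>" "x \<in> V" shows "DD (v + a *s w) \<alpha> x = DD v \<alpha> x + cscale a (DD w \<alpha> x)"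
  using sfam_differentiable[OF assms]
  by (simp add: fun_eq_iff DD_def fun_apply cscale_def cderiv_add_vec cderiv_scale_vec)

lemma DD_wedge:
  assumes "sfam V \<alpha>" "sfam V \<beta>" "x \<in> V"
  shows "DD z (\<lambda>y. wedge (\<alpha> y) (\<beta> y)) x = wedge (DD z \<alpha> x) (\<beta> x) + wedge (\<alpha> x) (DD z \<beta> x)"
proof
  fix vs
  have d: "(\<lambda>y. \<alpha> y us) differentiable (at x)" "(\<lambda>y. \<beta> y us) differentiable (at x)" for us
    using sfam_differentiable assms by auto
  have "smooth_on V (\<lambda>y. c * \<alpha> y us * \<beta> y ws)" for c us ws
    using assms by (auto simp: sfam_def intro!: smooth_on_mult V)
  then have d2: "(\<lambda>y. c * \<alpha> y us * \<beta> y ws) differentiable (at x)" for c us ws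
    using smooth_on_differentiable assms(3) by blast
  have "smooth_on V (\<lambda>y. c * \<alpha> y us)" for c us
    using assms by (auto simp: sfam_def intro!: smooth_on_mult V)
  then have d3: "(\<lambda>y. c * \<alpha> y us) differentiable (at x)" for c us
    using smooth_on_differentiable assms(3) by blast
  have "cderiv (\<lambda>y. c * \<alpha> y us * \<beta> y ws) x z =
      c * cderiv (\<lambda>y. \<alpha> y us) x z * \<beta> x ws + c * \<alpha> x us * cderiv (\<lambda>y. \<beta> y ws) x z" for c us ws
    by (subst cderiv_mult[OF d3 d(2)]) (simp add: cderiv_cmult[OF d(1)])
  then show "DD z (\<lambda>y. wedge (\<alpha> y) (\<beta> y)) x vs = (wedge (DD z \<alpha> x) (\<beta> x) + wedge (\<alpha> x) (DD z \<beta> x)) vs"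
    by (simp only: DD_def wedge_def fun_apply cderiv_sum[OF d2] sum.distrib)
qed

lemma ld_add: "sfam V \<alpha> ==> sfam V \<beta> ==> x \<in> V ==> ld (\<lambda>y. \<alpha> y + \<beta> y) x = ld \<alpha> x + ld \<beta> x"
  by (simp add: fun_eq_iff ld_altsum fun_apply DD_add altsum_add)

lemma ld_diff: "sfam V \<alpha> ==> sfam V \<beta> ==> x \<in> V ==> ld (\<lambda>y. \<alpha> y - \<beta> y) x = ld \<alpha> x - ld \<beta> x"
  by (simp add: fun_eq_iff ld_altsum fun_apply DD_diff altsum_diff)

lemma ld_cmult: "sfam V \<alpha> ==> x \<in> V ==> ld (\<lambda>y. cscale a (\<alpha> y)) x = cscale a (ld \<alpha> x)"
  by (simp add: fun_eq_iff ld_altsum DD_cmult cscale_apply altsum_cmult)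

lemma ld_0: "ld (\<lambda>y. 0) x = 0"
  by (simp add: fun_eq_iff ld_altsum DD_0 fun_apply)

lemma ld_grade_sign:
  assumes "sfam V \<alpha>" "x \<in> V" shows "ld (\<lambda>y. grade_sign (\<alpha> y)) x = - grade_sign (ld \<alpha> x)"
proof
  fix vs
  have "ld (\<lambda>y. grade_sign (\<alpha> y)) x vs = altsum (\<lambda>v us. - ((-1) ^ length vs) * DD v \<alpha> x us) vs"
    unfolding ld_altsum DD_grade_sign[OF assms] by (rule altsum_cong) (simp add: grade_sign_def)
  then show "ld (\<lambda>y. grade_sign (\<alpha> y)) x vs = (- grade_sign (ld \<alpha> x)) vs"
    unfolding altsum_cmult by (simp add: grade_sign_def ld_altsum fun_apply)
qed

text \<open>By \<open>contract_ld\<close> and \<open>contract_wedge\<close>, contracting both sides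
  leaves wedge products of contracted families, to which the induction hypothesis applies; the terms
  with \<open>DD v\<close> follow the ungraded product rule.\<close>

lemma ld_wedge:
  assumes "sfam V \<alpha>" "sfam V \<beta>" "x \<in> V"
  shows "ld (\<lambda>y. wedge (\<alpha> y) (\<beta> y)) x = wedge (ld \<alpha> x) (\<beta> x) + wedge (grade_sign (\<alpha> x)) (ld \<beta> x)"
proof
  show "ld (\<lambda>y. wedge (\<alpha> y) (\<beta> y)) x vs = (wedge (ld \<alpha> x) (\<beta> x) + wedge (grade_sign (\<alpha> x)) (ld \<beta> x)) vs" for vs
    using assms(1,2)
  proof (induction vs arbitrary: \<alpha> \<beta>)
    case Nil
    then show ?case by (simp add: ld_Nil wedge_Nil fun_apply)
  next
    case (Cons v vs)
    note s = Cons.prems sfam_contract[OF Cons.prems(1), of v] sfam_contract[OF Cons.prems(2), of v]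
      sfam_grade_sign[OF Cons.prems(1)]
    have IH1: "ld (\<lambda>y. wedge (contract v (\<alpha> y)) (\<beta> y)) x vs =
        wedge (ld (\<lambda>y. contract v (\<alpha> y)) x) (\<beta> x) vs + wedge (grade_sign (contract v (\<alpha> x))) (ld \<beta> x) vs"
      using Cons.IH[OF s(3,2)] by (simp add: fun_apply)
    have IH2: "ld (\<lambda>y. wedge (grade_sign (\<alpha> y)) (contract v (\<beta> y))) x vs =
        wedge (ld (\<lambda>y. grade_sign (\<alpha> y)) x) (contract v (\<beta> x)) vs + wedge (\<alpha> x) (ld (\<lambda>y. contract v (\<beta> y)) x) vs"
      using Cons.IH[OF s(5,4)] by (simp add: fun_apply)
    have "contract v (ld (\<lambda>y. wedge (\<alpha> y) (\<beta> y)) x) =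
        wedge (DD v \<alpha> x) (\<beta> x) + wedge (\<alpha> x) (DD v \<beta> x) -
        (ld (\<lambda>y. wedge (contract v (\<alpha> y)) (\<beta> y)) x + ld (\<lambda>y. wedge (grade_sign (\<alpha> y)) (contract v (\<beta> y))) x)"
      by (simp add: contract_ld DD_wedge s assms(3) contract_wedge ld_add sfam_wedge)
    then have "contract v (ld (\<lambda>y. wedge (\<alpha> y) (\<beta> y)) x) vs =
        contract v (wedge (ld \<alpha> x) (\<beta> x) + wedge (grade_sign (\<alpha> x)) (ld \<beta> x)) vs"
      by (simp add: contract_wedge contract_ld IH1 IH2 ld_grade_sign[OF s(1) assms(3)] fun_apply)
    then show ?case unfolding contract_def[of v] .
  qed
qed

lemma DD_ld: "sfam V \<alpha> ==> x \<in> V ==> DD z (ld \<alpha>) x = ld (DD z \<alpha>) x"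
proof
  fix vs
  assume a: "sfam V \<alpha>" and x: "x \<in> V"
  have "DD z (ld \<alpha>) x vs = altsum (\<lambda>u us. cderiv (\<lambda>y. cderiv (\<lambda>y. \<alpha> y us) y u) x z) vs"
    unfolding DD_def[of z "ld \<alpha>"] ld_def
    by (rule cderiv_altsum[OF V x]) (use a in \<open>auto simp: sfam_def intro!: smooth_on_cderiv V\<close>)
  also have "\<dots> = altsum (\<lambda>u us. cderiv (\<lambda>y. cderiv (\<lambda>y. \<alpha> y us) y z) x u) vs"
    by (rule altsum_cong, rule cderiv_symmetric[OF V _ x]) (use a in \<open>auto simp: sfam_def\<close>)
  finally show "DD z (ld \<alpha>) x vs = ld (DD z \<alpha>) x vs" by (simp add: ld_def DD_def)
qed

text \<open>Contraction with v turns d d \<alpha> into D_v d \<alpha> - d D_v \<alpha> plus d d of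
  the contraction of v into \<alpha>. The first two terms cancel by symmetry of second derivatives,
  the last one is covered by induction.\<close>

lemma ld_ld:
  assumes "sfam V \<alpha>" "x \<in> V" shows "ld (ld \<alpha>) x = 0"
proof
  show "ld (ld \<alpha>) x vs = 0 vs" for vs
    using assms(1)
  proof (induction vs arbitrary: \<alpha>)
    case Nil
    then show ?case by (simp add: ld_Nil fun_apply)
  next
    case (Cons v vs)
    note s = Cons.prems sfam_contract[OF Cons.prems, of v]
    have "ld (\<lambda>y. contract v (ld \<alpha> y)) x = ld (\<lambda>y. DD v \<alpha> y - ld (\<lambda>y. contract v (\<alpha> y)) y) x"
      by (simp add: contract_ld)
    also have "\<dots> = ld (DD v \<alpha>) x - ld (ld (\<lambda>y. contract v (\<alpha> y))) x"
      by (rule ld_diff[OF _ _ assms(2)]) (auto intro: sfam_DD sfam_ld s)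
    finally have "contract v (ld (ld \<alpha>) x) vs = 0"
      using Cons.IH[OF s(2)] by (simp add: contract_ld[of v "ld \<alpha>"] DD_ld[OF s(1) assms(2)] fun_apply)
    then show ?case by (simp add: contract_def fun_apply)
  qed
qed

lemma lform_sfam: "lform k V \<alpha> ==> sfam V \<alpha>" and lform_alternating: "lform k V \<alpha> ==> x \<in> V ==> alternating k (\<alpha> x)"
  by (auto simp: lform_def)

lemma lform_contract: "lform k V \<alpha> ==> lform (k - 1) V (\<lambda>x. contract v (\<alpha> x))"
  by (auto simp: lform_def simp del: One_nat_def intro!: sfam_contract alternating_contract_alternating)

lemma lform_add: "lform k V \<alpha> ==> lform k V \<beta> ==> lform k V (\<lambda>x. \<alpha> x + \<beta> x)"
  by (auto simp: lform_def intro: sfam_add alternating_add)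

lemma lform_diff: "lform k V \<alpha> ==> lform k V \<beta> ==> lform k V (\<lambda>x. \<alpha> x - \<beta> x)"
  by (auto simp: lform_def intro: sfam_diff alternating_diff)

lemma lform_uminus: "lform k V \<alpha> ==> lform k V (\<lambda>x. - \<alpha> x)"
  by (auto simp: lform_def intro: sfam_uminus alternating_uminus)

lemma lform_0: "lform k V (\<lambda>x. 0)"
  by (auto simp: lform_def intro: sfam_0)

lemma lform_sum: "(\<And>i. i \<in> I ==> lform k V (\<alpha> i)) ==> lform k V (\<lambda>x. \<Sum>i\<in>I. \<alpha> i x)"
  by (auto simp: lform_def intro!: sfam_sum alternating_sum)

lemma lform_cscale: "smooth_on V g ==> lform k V \<alpha> ==> lform k V (\<lambda>x. cscale (g x) (\<alpha> x))"
  by (auto simp: lform_def intro: sfam_cscale alternating_cscale)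

lemma lform_wedge: "lform j V \<alpha> ==> lform k V \<beta> ==> lform (j + k) V (\<lambda>x. wedge (\<alpha> x) (\<beta> x))"
  by (auto simp: lform_def intro: sfam_wedge alternating_wedge)

lemma lform_wedge_pow: "lform 2 V \<sigma> ==> lform k V \<beta> ==> lform (k + 2 * m) V (\<lambda>x. (wedge (\<sigma> x) ^^ m) (\<beta> x))"
proof (induction m)
  case (Suc m)
  then show ?case using lform_wedge[OF Suc.prems(1) Suc.IH] by simp
qed simp

lemma lform_cong: "(\<And>x. x \<in> V ==> \<alpha> x = \<beta> x) ==> lform k V \<alpha> ==> lform k V \<beta>"
  by (auto simp: lform_def intro: sfam_cong)

lemma lform_DD: "lform k V \<alpha> ==> lform k V (DD z \<alpha>)"
proof (induction k arbitrary: \<alpha>)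
  case 0
  have "contract v (DD z \<alpha> x) = 0" if "x \<in> V" for x v
    unfolding DD_contract[symmetric]
    by (rule trans[OF DD_cong DD_0]) (use 0 that in \<open>auto simp: lform_def intro: sfam_contract\<close>)
  with 0 show ?case by (auto simp: lform_def intro: sfam_DD)
next
  case (Suc k)
  note s = lform_sfam[OF Suc.prems]
  have "alternating (Suc k) (DD z \<alpha> x)" if x: "x \<in> V" for x
    unfolding alternating.simps
  proof (intro conjI allI)
    show "DD z \<alpha> x [] = 0"
      unfolding DD_def
      by (rule trans[OF cderiv_cong[OF V x, of "\<lambda>y. \<alpha> y []" "\<lambda>y. 0"] cderiv_const])
        (use Suc.prems in \<open>auto simp: lform_def sfam_def\<close>)
    show "alternating k (contract v (DD z \<alpha> x))" for v
      using lform_alternating[OF Suc.IH[of "\<lambda>x. contract v (\<alpha> x)"] x] lform_contract[OF Suc.prems, of v]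
      by (simp add: DD_contract)
    show "contract v (contract v (DD z \<alpha> x)) = 0" for v
      unfolding DD_contract[symmetric]
      by (rule trans[OF DD_cong[OF _ _ x] DD_0])
        (use Suc.prems in \<open>auto simp: lform_def intro!: sfam_contract\<close>)
    show "contract (v + a *s w) (DD z \<alpha> x) = contract v (DD z \<alpha> x) + cscale a (contract w (DD z \<alpha> x))" for v w a
    proof -
      have "contract (v + a *s w) (DD z \<alpha> x) = DD z (\<lambda>y. contract v (\<alpha> y) + cscale a (contract w (\<alpha> y))) x"
        unfolding DD_contract[symmetric]
        by (rule DD_cong[OF _ _ x]) (use Suc.prems in \<open>auto simp: lform_def intro!: sfam_contract\<close>)
      also have "\<dots> = contract v (DD z \<alpha> x) + cscale a (contract w (DD z \<alpha> x))"
        by (simp add: DD_add[OF sfam_contract[OF s] sfam_cscale[OF smooth_on_const sfam_contract[OF s]] x]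
            DD_cmult[OF sfam_contract[OF s] x] DD_contract)
      finally show ?thesis .
    qed
  qed
  with s show ?case by (auto simp: lform_def intro: sfam_DD)
qed

text \<open>Contracting v into d \<alpha> gives D_v \<alpha> minus d of a form of lower degree, so
  alternation follows by induction. In degree 0 the contracted form vanishes rather than having
  degree -1, hence the separate base case.\<close>

lemma lform_ld: "lform k V \<alpha> ==> lform (Suc k) V (ld \<alpha>)"
proof (induction k arbitrary: \<alpha>)
  have step: "lform (Suc k) V (ld \<alpha>)"
    if a: "lform k V \<alpha>" and c: "\<And>v x. x \<in> V ==> alternating k (contract v (ld \<alpha> x))" for k \<alpha>
  proof -
    note s = lform_sfam[OF a]
    have "alternating (Suc k) (ld \<alpha> x)" if x: "x \<in> V" for x
      unfolding alternating.simps
    proof (intro conjI allI)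
      show "contract (v + b *s w) (ld \<alpha> x) = contract v (ld \<alpha> x) + cscale b (contract w (ld \<alpha> x))" for v w b
      proof -
        have "ld (\<lambda>y. contract (v + b *s w) (\<alpha> y)) x = ld (\<lambda>y. contract v (\<alpha> y) + cscale b (contract w (\<alpha> y))) x"
          by (rule ld_cong[OF _ sfam_contract[OF s] x]) (rule alternating_contract_linear[OF lform_alternating[OF a]])
        also have "\<dots> = ld (\<lambda>y. contract v (\<alpha> y)) x + cscale b (ld (\<lambda>y. contract w (\<alpha> y)) x)"
          by (simp add: ld_add[OF sfam_contract[OF s] sfam_cscale[OF smooth_on_const sfam_contract[OF s]] x]
              ld_cmult[OF sfam_contract[OF s] x])
        finally show ?thesis by (simp add: contract_ld DD_vec[OF s x])
      qed
      show "contract v (contract v (ld \<alpha> x)) = 0" for v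
      proof -
        have "ld (\<lambda>y. contract v (contract v (\<alpha> y))) x = ld (\<lambda>y. 0) x"
          by (rule ld_cong[OF _ sfam_contract[OF sfam_contract[OF s]] x]) (rule alternating_contract[OF lform_alternating[OF a]])
        then show ?thesis by (simp add: contract_ld DD_contract ld_0)
      qed
    qed (auto simp: ld_Nil c x)
    with s show ?thesis by (auto simp: lform_def intro: sfam_ld)
  qed
  {
    case 0
    show ?case
    proof (rule step[OF 0])
      fix v x assume x: "x \<in> V"
      have "ld (\<lambda>y. contract v (\<alpha> y)) x = ld (\<lambda>y. 0) x"
        by (rule ld_cong[OF _ sfam_contract[OF lform_sfam[OF 0]] x]) (use lform_alternating[OF 0] in auto)
      then show "alternating 0 (contract v (ld \<alpha> x))"
        using lform_alternating[OF lform_DD[OF 0] x] by (simp only: contract_ld ld_0 diff_0_right)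
    qed
  next
    case (Suc k)
    show ?case
    proof (rule step[OF Suc.prems])
      fix v x assume x: "x \<in> V"
      have "alternating (Suc k) (ld (\<lambda>y. contract v (\<alpha> y)) x)"
        using lform_alternating[OF Suc.IH x] lform_contract[OF Suc.prems, of v] by simp
      then show "alternating (Suc k) (contract v (ld \<alpha> x))"
        unfolding contract_ld by (rule alternating_diff[OF lform_alternating[OF lform_DD[OF Suc.prems] x]])
    qed
  }
qed

text \<open>The Leibniz rule with the function \<open>g\<close> viewed as a form of degree 0; \<mu>
  is its differential. This governs how d\<theta> changes with the contact form.\<close>

lemma ld_scale:
  assumes "smooth_on V g" "sfam V \<alpha>" "x \<in> V"
  obtains \<mu> where "alternating 1 \<mu>" "ld (\<lambda>y. cscale (g y) (\<alpha> y)) x = wedge \<mu> (\<alpha> x) + cscale (g x) (ld \<alpha> x)"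
proof -
  define u where "u y = (\<lambda>vs :: (complex ^ 'm) list. if vs = [] then g y else 0)" for y :: "real ^ 'm"
  have u: "lform 0 V u"
    unfolding lform_def sfam_def
  proof (intro conjI ballI allI)
    show "alternating 0 (u x)" for x by (auto simp: u_def contract_def fun_eq_iff fun_apply)
    show "smooth_on V (\<lambda>x. u x vs)" for vs using assms(1) by (cases "vs = []") (simp_all add: u_def)
  qed
  have "grade_sign (u x) = u x" by (auto simp: grade_sign_def u_def fun_eq_iff)
  then have "ld (\<lambda>y. cscale (g y) (\<alpha> y)) x = wedge (ld u x) (\<alpha> x) + cscale (g x) (ld \<alpha> x)"
    using ld_wedge[OF lform_sfam[OF u] assms(2,3)] by (simp add: u_def wedge_unit)
  then show thesis using that[of "ld u x"] lform_alternating[OF lform_ld[OF u] assms(3)] by simp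
qed

subsection \<open>Vector fields\<close>

lemma alternating_basis:
  "alternating k \<alpha> ==> contract z \<alpha> = (\<Sum>i\<in>UNIV. cscale (z $ i) (contract (axis i 1) \<alpha>))"
  using alternating_contract_sum[where I=UNIV and a="\<lambda>i. z $ i" and v="\<lambda>i. axis i 1"] by (simp add: vec_basis_sum)

lemma lform_field:
  assumes "lform k V \<alpha>" "smooth_on V X"
  shows "lform (k - 1) V (\<lambda>x. contract (X x) (\<alpha> x))"
proof -
  have "sfam V (\<lambda>x. \<Sum>i\<in>UNIV. cscale (X x $ i) (contract (axis i 1) (\<alpha> x)))"
    by (intro sfam_sum sfam_cscale smooth_on_nth V assms sfam_contract lform_sfam[OF assms(1)])
  then have "sfam V (\<lambda>x. contract (X x) (\<alpha> x))"
    by (rule sfam_cong[rotated]) (rule alternating_basis[OF lform_alternating[OF assms(1)], symmetric])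
  then show ?thesis
    using assms(1) by (auto simp: lform_def alternating_contract_alternating simp del: One_nat_def)
qed

text \<open>Expanding the field in constant coordinate vectors separates its coefficients from the
  contraction, so the product rule for functions applies.\<close>

lemma DD_field:
  assumes "lform k V \<alpha>" "smooth_on V X" "x \<in> V"
  shows "DD z (\<lambda>y. contract (X y) (\<alpha> y)) x = contract (X x) (DD z \<alpha> x) + contract (vderiv X x z) (\<alpha> x)"
proof -
  have sX: "smooth_on V (\<lambda>y. X y $ i)" for i by (rule smooth_on_nth[OF V assms(2)])
  have s: "sfam V (\<lambda>y. \<Sum>i\<in>UNIV. cscale (X y $ i) (contract (axis i 1) (\<alpha> y)))"
    by (intro sfam_sum sfam_cscale sX sfam_contract lform_sfam[OF assms(1)])
  have "DD z (\<lambda>y. contract (X y) (\<alpha> y)) x = DD z (\<lambda>y. \<Sum>i\<in>UNIV. cscale (X y $ i) (contract (axis i 1) (\<alpha> y))) x"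
    by (rule DD_cong[symmetric, OF _ s assms(3)]) (rule alternating_basis[OF lform_alternating[OF assms(1)], symmetric])
  also have "\<dots> = (\<Sum>i\<in>UNIV. cscale (X x $ i) (contract (axis i 1) (DD z \<alpha> x))) +
      (\<Sum>i\<in>UNIV. cscale (vderiv X x z $ i) (contract (axis i 1) (\<alpha> x)))"
  proof
    fix vs
    have d: "(\<lambda>y. X y $ i) differentiable (at x)" "(\<lambda>y. \<alpha> y us) differentiable (at x)" for i us
      using smooth_on_differentiable[OF sX assms(3)] sfam_differentiable[OF lform_sfam[OF assms(1)] assms(3)] by auto
    have "(\<lambda>y. X y $ i * \<alpha> y us) differentiable (at x)" for i us
      by (rule smooth_on_differentiable[OF _ assms(3)])
        (use lform_sfam[OF assms(1)] in \<open>auto simp: sfam_def intro!: smooth_on_mult V sX\<close>)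
    then show "DD z (\<lambda>y. \<Sum>i\<in>UNIV. cscale (X y $ i) (contract (axis i 1) (\<alpha> y))) x vs =
      ((\<Sum>i\<in>UNIV. cscale (X x $ i) (contract (axis i 1) (DD z \<alpha> x))) +
      (\<Sum>i\<in>UNIV. cscale (vderiv X x z $ i) (contract (axis i 1) (\<alpha> x)))) vs"
      by (simp add: DD_def sum_apply fun_apply cscale_def contract_def vderiv_def cderiv_sum cderiv_mult d
          sum.distrib algebra_simps)
  qed
  also have "\<dots> = contract (X x) (DD z \<alpha> x) + contract (vderiv X x z) (\<alpha> x)"
    by (simp only: alternating_basis[OF lform_alternating[OF assms(1,3)], of "vderiv X x z"]
        alternating_basis[OF lform_alternating[OF lform_DD[OF assms(1)] assms(3)], of "X x"])
  finally show ?thesis .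
qed

text \<open>The terms of d(X contracted into \<alpha>) that differentiate \<alpha> cancel against
  those of X contracted into d \<alpha>. What remains is the derivative along X and the derivation
  induced by the derivative of X.\<close>

lemma lie_eq:
  assumes "lform k V \<alpha>" "smooth_on V X" "x \<in> V"
  shows "lie X \<alpha> x = DD (X x) \<alpha> x + (\<lambda>vs. altsum (\<lambda>v us. \<alpha> x (vderiv X x v # us)) vs)"
proof
  fix vs
  have "ld (\<lambda>y. contract (X y) (\<alpha> y)) x vs =
      altsum (\<lambda>v us. DD v \<alpha> x (X x # us)) vs + altsum (\<lambda>v us. \<alpha> x (vderiv X x v # us)) vs"
    unfolding ld_altsum DD_field[OF assms] altsum_add[symmetric]
    by (rule altsum_cong) (simp add: fun_apply contract_def)
  moreover have "contract (X x) (ld \<alpha> x) vs = DD (X x) \<alpha> x vs - altsum (\<lambda>v us. DD v \<alpha> x (X x # us)) vs"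
    by (simp add: contract_def ld_altsum)
  ultimately show "lie X \<alpha> x vs = (DD (X x) \<alpha> x + (\<lambda>vs. altsum (\<lambda>v us. \<alpha> x (vderiv X x v # us)) vs)) vs"
    by (simp add: lie_def fun_apply)
qed

lemma lie_bracket_vderiv: "lie_bracket X Y x = vderiv Y x (X x) - vderiv X x (Y x)"
  by (simp add: lie_bracket_def vderiv_def vec_eq_iff)

text \<open>In the form of \<open>lie_eq\<close>, the two sides differ by the derivative of Y along
  X and that of X along Y, which assemble to the bracket.\<close>

lemma contract_lie:
  assumes a: "lform k V \<alpha>" and X: "smooth_on V X" and Y: "smooth_on V Y" and x: "x \<in> V"
  shows "contract (Y x) (lie X \<alpha> x) = lie X (\<lambda>y. contract (Y y) (\<alpha> y)) x - contract (lie_bracket X Y x) (\<alpha> x)"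
proof
  fix vs
  have ax: "alternating k (\<alpha> x)" by (rule lform_alternating[OF a x])
  have sw: "\<alpha> x (v # w # us) = - \<alpha> x (w # v # us)" for v w us
    using fun_cong[OF alternating_contract_swap[OF ax, of w v], of us] by (simp add: contract_def fun_apply)
  have "contract (Y x) (lie X \<alpha> x) vs = DD (X x) \<alpha> x (Y x # vs) + \<alpha> x (vderiv X x (Y x) # vs)
      + altsum (\<lambda>v us. \<alpha> x (Y x # vderiv X x v # us)) vs"
    unfolding lie_eq[OF a X x] contract_def fun_apply altsum.simps sw[of "vderiv X x _" "Y x"] altsum_uminus by simp
  moreover have "lie X (\<lambda>y. contract (Y y) (\<alpha> y)) x vs = DD (X x) \<alpha> x (Y x # vs) + \<alpha> x (vderiv Y x (X x) # vs)
      + altsum (\<lambda>v us. \<alpha> x (Y x # vderiv X x v # us)) vs"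
    unfolding lie_eq[OF lform_field[OF a Y] X x] DD_field[OF a Y x] by (simp add: fun_apply contract_def)
  moreover have "contract (lie_bracket X Y x) (\<alpha> x) vs = \<alpha> x (vderiv Y x (X x) # vs) - \<alpha> x (vderiv X x (Y x) # vs)"
    unfolding lie_bracket_vderiv alternating_contract_diff[OF ax] by (simp add: fun_apply contract_def)
  ultimately show "contract (Y x) (lie X \<alpha> x) vs =
      (lie X (\<lambda>y. contract (Y y) (\<alpha> y)) x - contract (lie_bracket X Y x) (\<alpha> x)) vs"
    by (simp add: fun_apply)
qed

subsection \<open>Pullbacks\<close>

lemma lform_pullback_field:
  assumes "lform k V \<alpha>" "\<And>v. smooth_on V (\<lambda>x. F x v)" "\<And>x v a w. x \<in> V ==> F x (v + a *s w) = F x v + a *s F x w"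
  shows "lform k V (\<lambda>x. pullback (F x) (\<alpha> x))"
proof -
  have "smooth_on V (\<lambda>x. \<alpha> x (map (F x) vs))" for vs
    using assms(1)
  proof (induction vs arbitrary: \<alpha> k)
    case Nil
    then show ?case by (auto simp: lform_def sfam_def)
  next
    case (Cons v vs)
    then show ?case using Cons.IH[OF lform_field[OF Cons.prems assms(2), of v]] by (simp add: contract_def)
  qed
  then show ?thesis
    using assms(1,3) by (auto simp: lform_def sfam_def pullback_def intro!: alternating_pullback[unfolded pullback_def])
qed

text \<open>Besides \<alpha>, each slot contributes the derivative of \<open>F\<close> at its
  argument. Writing these contributions with the slot moved to the front yields the alternating
  sum.\<close>

lemma DD_pullback_field:
  assumes "lform k V \<alpha>" "\<And>v. smooth_on V (\<lambda>x. F x v)" "x \<in> V"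
  shows "DD z (\<lambda>y. pullback (F y) (\<alpha> y)) x vs = DD z \<alpha> x (map (F x) vs) +
    altsum (\<lambda>u us. \<alpha> x (vderiv (\<lambda>y. F y u) x z # map (F x) us)) vs"
  using assms(1)
proof (induction vs arbitrary: \<alpha> k)
  case Nil
  then show ?case by (simp add: DD_def pullback_def)
next
  case (Cons u us)
  have sw: "\<alpha> x (v # w # us) = - \<alpha> x (w # v # us)" for v w us
    using fun_cong[OF alternating_contract_swap[OF lform_alternating[OF Cons.prems assms(3)], of w v], of us]
    by (simp add: contract_def fun_apply)
  have "DD z (\<lambda>y. pullback (F y) (\<alpha> y)) x (u # us) = DD z (\<lambda>y. pullback (F y) (contract (F y u) (\<alpha> y))) x us"
    by (simp add: DD_def pullback_def contract_def)
  also have "\<dots> = DD z (\<lambda>y. contract (F y u) (\<alpha> y)) x (map (F x) us) +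
      altsum (\<lambda>w us. contract (F x u) (\<alpha> x) (vderiv (\<lambda>y. F y w) x z # map (F x) us)) us"
    by (rule Cons.IH[OF lform_field[OF Cons.prems assms(2)]])
  also have "altsum (\<lambda>w us. contract (F x u) (\<alpha> x) (vderiv (\<lambda>y. F y w) x z # map (F x) us)) us =
      - altsum (\<lambda>w us. \<alpha> x (vderiv (\<lambda>y. F y w) x z # F x u # map (F x) us)) us"
    unfolding contract_def sw[of "F x u"] altsum_uminus ..
  finally show ?case
    unfolding DD_field[OF Cons.prems assms(2,3)] by (simp add: fun_apply contract_def)
qed

end

lemma cext_nth:
  assumes "\<phi> differentiable (at y)"
  shows "cext (frechet_derivative \<phi> (at y)) u $ j = cderiv (\<lambda>y. complex_of_real (\<phi> y $ j)) y u"
proof -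
  have "frechet_derivative (\<lambda>y. complex_of_real (\<phi> y $ j)) (at y) v = complex_of_real (frechet_derivative \<phi> (at y) v $ j)" for v
    by (rule frechet_derivative_bounded_linear[OF _ assms])
      (rule bounded_linear_compose[OF bounded_linear_of_real bounded_linear_vec_nth])
  then show ?thesis by (simp add: cext_def cvec_def cderiv_def)
qed

lemma cext_linear:
  assumes "linear L"
  shows "cext L (v + a *s w) = cext L v + a *s cext L w"
  using assms by (simp add: cext_def vec_eq_iff cvec_def linear_add linear_diff linear_scale complex_eq_iff algebra_simps)

context
  fixes V V' :: "(real ^ 'm::finite) set" and \<phi> :: "real ^ 'm => real ^ 'm"
  assumes V: "open V" and V': "open V'" and phi: "smooth_on V \<phi>" and phi_V: "\<phi> ` V \<subseteq> V'"
begin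

lemma smooth_on_cext: "smooth_on V (\<lambda>x. cext (frechet_derivative \<phi> (at x)) v)"
proof (rule smooth_on_vec[OF V])
  have s: "smooth_on V (\<lambda>y. complex_of_real (\<phi> y $ j))" for j
    by (rule smooth_on_bounded_linear[OF V _ phi]) (rule bounded_linear_compose[OF bounded_linear_of_real bounded_linear_vec_nth])
  show "smooth_on V (\<lambda>x. cext (frechet_derivative \<phi> (at x)) v $ j)" for j
    by (rule smooth_on_cong[OF V _ smooth_on_cderiv[OF V s]]) (simp add: cext_nth[OF smooth_on_differentiable[OF phi]])
qed

lemma cext_frechet_linear:
  "x \<in> V ==> cext (frechet_derivative \<phi> (at x)) (v + a *s w) =
    cext (frechet_derivative \<phi> (at x)) v + a *s cext (frechet_derivative \<phi> (at x)) w"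
  by (rule cext_linear, rule linear_frechet_derivative, rule smooth_on_differentiable[OF phi])

lemma lform_compose: "lform k V' \<alpha> ==> lform k V (\<lambda>x. \<alpha> (\<phi> x))"
  using phi_V by (auto simp: lform_def sfam_def intro: smooth_on_compose[OF V V' phi_V phi])

lemma lform_pullback: "lform k V' \<alpha> ==> lform k V (\<lambda>x. pullback (cext (frechet_derivative \<phi> (at x))) (\<alpha> (\<phi> x)))"
  by (rule lform_pullback_field[OF V lform_compose smooth_on_cext cext_frechet_linear])

text \<open>The additional terms contain the second derivatives of \<phi> in two of the arguments.
  These are symmetric, and \<open>altsum_double\<close> makes them vanish.\<close>

lemma ld_pullback:
  assumes a: "lform k V' \<alpha>" and x: "x \<in> V"
  shows "ld (\<lambda>y. pullback (cext (frechet_derivative \<phi> (at y))) (\<alpha> (\<phi> y))) x =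
    pullback (cext (frechet_derivative \<phi> (at x))) (ld \<alpha> (\<phi> x))"
proof
  fix vs
  define F where "F y = cext (frechet_derivative \<phi> (at y))" for y
  have s: "smooth_on V (\<lambda>y. complex_of_real (\<phi> y $ j))" for j
    by (rule smooth_on_bounded_linear[OF V _ phi]) (rule bounded_linear_compose[OF bounded_linear_of_real bounded_linear_vec_nth])
  have "vderiv (\<lambda>y. F y u) x v $ j = cderiv (\<lambda>y. cderiv (\<lambda>y. complex_of_real (\<phi> y $ j)) y u) x v" for u v j
    unfolding vderiv_def vec_lambda_beta
    by (rule cderiv_cong[OF V x _ smooth_on_nth[OF V smooth_on_cext[folded F_def]]])
      (simp add: F_def cext_nth[OF smooth_on_differentiable[OF phi]])
  then have sym: "vderiv (\<lambda>y. F y u) x v = vderiv (\<lambda>y. F y v) x u" for u v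
    using cderiv_symmetric[OF V s x] by (simp add: vec_eq_iff)
  have D: "DD v (\<lambda>y. \<alpha> (\<phi> y)) x us = DD (F x v) \<alpha> (\<phi> x) us" for v us
    unfolding DD_def F_def
    by (rule cderiv_compose) (use a x phi phi_V in \<open>auto simp: lform_def sfam_def intro: smooth_on_differentiable\<close>)
  have "ld (\<lambda>y. pullback (F y) (\<alpha> (\<phi> y))) x vs = altsum (\<lambda>v us. DD (F x v) \<alpha> (\<phi> x) (map (F x) us)) vs +
      altsum (\<lambda>v us. altsum (\<lambda>u us. \<alpha> (\<phi> x) (vderiv (\<lambda>y. F y u) x v # map (F x) us)) us) vs"
    unfolding ld_altsum DD_pullback_field[OF V lform_compose[OF a] smooth_on_cext[folded F_def] x] D altsum_add ..
  also have "altsum (\<lambda>v us. altsum (\<lambda>u us. \<alpha> (\<phi> x) (vderiv (\<lambda>y. F y u) x v # map (F x) us)) us) vs = 0"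
    by (rule altsum_double) (simp add: sym)
  finally show "ld (\<lambda>y. pullback (cext (frechet_derivative \<phi> (at y))) (\<alpha> (\<phi> y))) x vs =
      pullback (cext (frechet_derivative \<phi> (at x))) (ld \<alpha> (\<phi> x)) vs"
    unfolding F_def[symmetric] by (simp add: pullback_def ld_altsum altsum_map)
qed

end

section \<open>Local analysis near a point of a CR manifold\<close>

text \<open>The structure of \<open>cr_point\<close> in smooth families over a coordinate domain.
  Integrability appears as closure under brackets of the frame W, since by
  \<open>KK_Suc_frame\<close> the filtration is tested by contractions with this frame.\<close>

locale cr_local =
  fixes V :: "(real ^ 'm::finite) set" and n :: nat and V10 V01 :: "real ^ 'm => (complex ^ 'm) set"
    and \<theta> :: "real ^ 'm => 'm covector" and T :: "real ^ 'm => complex ^ 'm"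
    and Z W :: "nat => real ^ 'm => complex ^ 'm"
  assumes V: "open V" and theta_form: "lform 1 V \<theta>" and smooth_T: "smooth_on V T"
    and smooth_Z: "i < n ==> smooth_on V (Z i)" and smooth_W: "i < n ==> smooth_on V (W i)"
    and point: "x \<in> V ==> cr_point n (V10 x) (V01 x) (\<theta> x) (ld \<theta> x) (T x) (\<lambda>i. Z i x) (\<lambda>i. W i x)"
    and involutive: "x \<in> V ==> i < n ==> j < n ==> lie_bracket (W i) (W j) x \<in> V01 x"
begin

abbreviation "L x \<equiv> wedge (ld \<theta> x)"
abbreviation "dil x \<equiv> cr_point.dil n (ld \<theta> x) (\<lambda>i. Z i x) (\<lambda>i. W i x)"
abbreviation "PH x \<equiv> pullback (dil x 1)"
abbreviation "bproj x \<equiv> cr_point.bproj n (ld \<theta> x) (\<lambda>i. Z i x) (\<lambda>i. W i x)"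
abbreviation "KK x \<equiv> cr_point.KK (V01 x)"
abbreviation "prim x \<equiv> cr_point.prim n (ld \<theta> x)"
abbreviation "hor x \<equiv> cr_point.hor (T x)"
abbreviation "Lam x u \<equiv> (\<Sum>i<n. contract (W i x) (contract (Z i x) u))"

lemma sigma_form: "lform 2 V (ld \<theta>)"
  using lform_ld[OF V theta_form] by (simp add: numeral_2_eq_2)

lemma W_mem: "x \<in> V ==> i < n ==> W i x \<in> V01 x"
  using cr_point.W_in[OF point] .

lemma smooth_dil: "smooth_on V (\<lambda>x. dil x t v)"
proof (rule smooth_on_cong[OF V])
  have "smooth_on V (\<lambda>x. contract (W i x) (contract v (ld \<theta> x)) [])" if "i < n" for i
    using lform_field[OF V lform_contract[OF V sigma_form] smooth_W[OF that]] by (auto simp: lform_def sfam_def)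
  moreover have "smooth_on V (\<lambda>x. contract (Z i x) (ld \<theta> x) [v])" if "i < n" for i
    using lform_field[OF V sigma_form smooth_Z[OF that]] by (auto simp: lform_def sfam_def)
  ultimately show "smooth_on V (\<lambda>x. (\<Sum>i<n. ld \<theta> x [v, W i x] *s Z i x) + t *s (\<Sum>i<n. ld \<theta> x [Z i x, v] *s W i x))"
    by (intro smooth_on_vec[OF V])
      (auto simp: contract_def intro!: smooth_on_add smooth_on_mult smooth_on_sum V smooth_on_nth smooth_Z smooth_W)
  show "(\<Sum>i<n. ld \<theta> x [v, W i x] *s Z i x) + t *s (\<Sum>i<n. ld \<theta> x [Z i x, v] *s W i x) = dil x t v"
    if "x \<in> V" for x
    by (rule cr_point.dil_def[OF point[OF that], symmetric])
qed

lemma lform_pullback_dil: "lform k V \<omega> ==> lform k V (\<lambda>x. pullback (dil x t) (\<omega> x))"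
  by (rule lform_pullback_field[OF V _ smooth_dil]) (auto intro: cr_point.dil_linear[OF point])

lemma lform_bproj: "lform k V \<omega> ==> lform k V (\<lambda>x. bproj x N b (\<omega> x))"
  by (rule lform_cong[OF V cr_point.bproj_def[OF point, symmetric]])
    (auto intro!: lform_cscale lform_sum lform_pullback_dil V)

lemma lform_T: "lform k V \<omega> ==> lform (k - 1) V (\<lambda>x. contract (T x) (\<omega> x))"
  by (rule lform_field[OF V _ smooth_T])

lemma lform_theta: "lform (k - 1) V \<omega> ==> 0 < k ==> lform k V (\<lambda>x. wedge (\<theta> x) (\<omega> x))"
  using lform_wedge[OF V theta_form, of "k - 1" \<omega>] by simp

lemma ld_theta_wedge:
  assumes "lform k V \<omega>" "x \<in> V"
  shows "ld (\<lambda>y. wedge (\<theta> y) (\<omega> y)) x = L x (\<omega> x) - wedge (\<theta> x) (ld \<omega> x)"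
  using ld_wedge[OF V lform_sfam[OF V theta_form] lform_sfam[OF V assms(1)] assms(2)]
    grade_sign_alternating[OF lform_alternating[OF V theta_form assms(2)]] by simp

text \<open>In d(\<theta> \<and> \<omega>) = d\<theta> \<and> \<omega> - \<theta> \<and> d\<omega>
  the last term has no horizontal part, and d\<theta> raises the second degree by one.\<close>

lemma bproj_ld_theta:
  assumes "lform k V \<omega>" "x \<in> V" "0 < N"
  shows "bproj x N (Suc b) (ld (\<lambda>y. wedge (\<theta> y) (\<omega> y)) x) = L x (bproj x N b (\<omega> x))"
  using cr_point.bproj_L[OF point[OF assms(2)] assms(3)] cr_point.bproj_theta[OF point[OF assms(2)]]
  by (simp add: ld_theta_wedge[OF assms(1,2)] cr_point.bproj_diff[OF point[OF assms(2)]])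

lemma PH_ld_theta:
  assumes "lform k V \<omega>" "x \<in> V" "contract (T x) (\<omega> x) = 0"
  shows "PH x (ld (\<lambda>y. wedge (\<theta> y) (\<omega> y)) x) = L x (\<omega> x)"
proof -
  interpret p: cr_point n "V10 x" "V01 x" "\<theta> x" "ld \<theta> x" "T x" "\<lambda>i. Z i x" "\<lambda>i. W i x" by (rule point[OF assms(2)])
  have "\<omega> x \<in> hor x k" using lform_alternating[OF V assms(1,2)] assms(3) by (simp add: p.hor_def)
  then show ?thesis
    using p.PH_L[of 1 "\<omega> x"] by (simp add: ld_theta_wedge[OF assms(1,2)] p.PH_wedge_theta p.PH_hor)
qed

text \<open>Fields are set to 0 outside V so that equality on V is equality of functions, as the
  equations of the \<open>lefschetz\<close> locale require.\<close>

definition Hs :: "nat => (real ^ 'm => 'm covector) set" where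
  "Hs k = {\<omega>. lform k V \<omega> \<and> (\<forall>x\<in>V. contract (T x) (\<omega> x) = 0) \<and> (\<forall>x. x \<notin> V --> \<omega> x = 0)}"

lemma Hs_hor: "\<omega> \<in> Hs k ==> x \<in> V ==> \<omega> x \<in> hor x k"
  using cr_point.hor_def[OF point] by (auto simp: Hs_def lform_def)

lemma lefschetz_local:
  "lefschetz (\<lambda>a \<omega> x. cscale a (\<omega> x)) (\<lambda>\<omega> x. L x (\<omega> x)) (\<lambda>\<omega> x. Lam x (\<omega> x)) Hs n"
proof -
  interpret vector_space "\<lambda>a \<omega> (x :: real ^ 'm). cscale a (\<omega> x :: 'm covector)"
    by unfold_locales (auto simp: fun_eq_iff fun_apply cscale_def algebra_simps)
  have e: "(0 :: real ^ 'm => 'm covector) = (\<lambda>x. 0)" "u + v = (\<lambda>x. u x + v x)" for u v :: "real ^ 'm => 'm covector"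
    by (simp_all add: fun_eq_iff fun_apply)
  show ?thesis
  proof unfold_locales
    show "subspace (Hs k)" for k
      by (rule subspaceI) (auto simp: Hs_def e intro: lform_0[OF V] lform_add[OF V] lform_cscale[OF V])
    show "(\<lambda>x. L x ((u + v) x)) = (\<lambda>x. L x (u x)) + (\<lambda>x. L x (v x))"
      "(\<lambda>x. Lam x ((u + v) x)) = (\<lambda>x. Lam x (u x)) + (\<lambda>x. Lam x (v x))" for u v :: "real ^ 'm => 'm covector"
      by (auto simp: e sum.distrib)
    show "(\<lambda>x. L x (cscale a (u x))) = (\<lambda>x. cscale a (L x (u x)))"
      "(\<lambda>x. Lam x (cscale a (u x))) = (\<lambda>x. cscale a (Lam x (u x)))" for a and u :: "real ^ 'm => 'm covector"
      by (auto simp: cscale_sum)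
    show "(\<lambda>x. L x (u x)) \<in> Hs (k + 2)" if "u \<in> Hs k" for u k
      using that lform_wedge[OF V sigma_form, of k u] cr_point.hor_T[OF point cr_point.L_hor[OF point Hs_hor[OF that]]]
      by (auto simp: Hs_def add.commute)
    show "(\<lambda>x. Lam x (u x)) \<in> Hs k" if "u \<in> Hs (k + 2)" for u k
    proof -
      have "lform (k + 2) V u" using that by (simp add: Hs_def)
      then have "lform k V (\<lambda>x. Lam x (u x))"
        using lform_field[OF V lform_field[OF V _ smooth_Z] smooth_W, of "k + 2" u]
        by (intro lform_sum V) auto
      then show ?thesis
        using that cr_point.hor_T[OF point cr_point.Lam_hor[OF point Hs_hor[OF that]]]
        by (auto simp: Hs_def cr_point.Lam_def[OF point])
    qed
    show "(\<lambda>x. Lam x (u x)) = 0" if "u \<in> Hs k" "k < 2" for u k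
    proof
      fix x show "Lam x (u x) = 0 x"
        using cr_point.Lam_low[OF point[of x] Hs_hor[OF that(1), of x] that(2)] that
        by (cases "x \<in> V") (auto simp: fun_apply Hs_def cr_point.Lam_def[OF point])
    qed
    show "u = 0" if "u \<in> Hs k" "2 * n < k" for u k
    proof
      fix x show "u x = 0 x"
        using cr_point.hor_top[OF point[of x] Hs_hor[OF that(1), of x] that(2)] that
        by (cases "x \<in> V") (auto simp: fun_apply Hs_def)
    qed
    show "(\<lambda>x. Lam x (L x (u x))) = (\<lambda>x. L x (Lam x (u x))) + (\<lambda>x. cscale (of_nat n - of_nat k) (u x))"
      if "u \<in> Hs k" for u k
    proof
      fix x show "Lam x (L x (u x)) = ((\<lambda>x. L x (Lam x (u x))) + (\<lambda>x. cscale (of_nat n - of_nat k) (u x))) x"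
        using cr_point.L_commutator[OF point[of x] Hs_hor[OF that(1), of x]] that
        by (cases "x \<in> V") (auto simp: e Hs_def cr_point.Lam_def[OF point])
    qed
  qed
qed

text \<open>Applied to the space of fields, Lefschetz surjectivity delivers a preimage that is
  smooth on V; pointwise preimages alone would not suffice.\<close>

lemma L_surj_local:
  assumes v: "lform (n + m) V v" "\<And>x. x \<in> V ==> contract (T x) (v x) = 0" and m: "m \<le> n"
  obtains u where "lform (n - m) V u" "\<And>x. x \<in> V ==> contract (T x) (u x) = 0"
    "\<And>x. x \<in> V ==> (L x ^^ m) (u x) = v x"
proof -
  define v' where "v' x = (if x \<in> V then v x else 0)" for x
  \<comment> \<open>For m \<le> n the degree n + m is 2 n - (n - m), as \<open>L_pow_surj\<close>
    expects.\<close>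
  have "v' \<in> Hs (2 * n - (n - m))"
    using v m lform_cong[OF V _ v(1), of v'] by (auto simp: Hs_def v'_def)
  then obtain u where u: "u \<in> Hs (n - m)" "((\<lambda>\<omega> x. L x (\<omega> x)) ^^ (n - (n - m))) u = v'"
    using lefschetz.L_pow_surj[OF lefschetz_local, of v' "n - m"] by auto
  have "((\<lambda>\<omega> x. L x (\<omega> x)) ^^ j) u x = (L x ^^ j) (u x)" for j x
    by (induction j) auto
  then have "(L x ^^ m) (u x) = v x" if "x \<in> V" for x
    using u(2) m that by (auto simp: fun_eq_iff[where g=v'] v'_def)
  with u(1) show thesis using that by (auto simp: Hs_def)
qed

subsection \<open>The filtration is preserved by the exterior derivative\<close>

text \<open>Contracting a second frame field into the Lie derivative gives the Lie derivative of a
  contracted form, handled by induction, minus the contraction with a bracket. By integrability the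
  bracket is of type (0,1) and counts as one of the j + 1 vectors that kill \<omega>.\<close>

lemma KK_lie:
  assumes "lform k V \<omega>" "\<And>x. x \<in> V ==> KK x j (\<omega> x)" "i < n" "x \<in> V"
  shows "KK x j (lie (W i) \<omega> x)"
  using assms(1,2)
proof (induction j arbitrary: k \<omega>)
  case 0
  then have z: "\<omega> y = 0" if "y \<in> V" for y using cr_point.KK_0_iff[OF point] that by blast
  have s: "sfam V \<omega>" using 0(1) by (simp add: lform_def)
  have "ld \<omega> x = ld (\<lambda>x. 0) x" by (rule ld_cong[OF V z s assms(4)])
  moreover have "ld (\<lambda>y. contract (W i y) (\<omega> y)) x = ld (\<lambda>x. 0) x"
    by (rule ld_cong[OF V _ lform_sfam[OF V lform_field[OF V 0(1) smooth_W[OF assms(3)]]] assms(4)]) (simp add: z)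
  ultimately show ?case
    by (simp add: lie_def ld_0[OF V] cr_point.KK_0_iff[OF point[OF assms(4)]])
next
  case (Suc j)
  interpret p: cr_point n "V10 x" "V01 x" "\<theta> x" "ld \<theta> x" "T x" "\<lambda>i. Z i x" "\<lambda>i. W i x" by (rule point[OF assms(4)])
  have sW: "smooth_on V (W i)" by (rule smooth_W[OF assms(3)])
  have "alternating k (lie (W i) \<omega> x)"
  proof -
    have "alternating k (contract (W i x) (ld \<omega> x))"
      using alternating_contract_alternating[OF lform_alternating[OF V lform_ld[OF V Suc.prems(1)] assms(4)]] by simp
    moreover have "alternating k (ld (\<lambda>y. contract (W i y) (\<omega> y)) x)"
    proof (cases k)
      case 0
      have "ld (\<lambda>y. contract (W i y) (\<omega> y)) x = ld (\<lambda>x. 0) x"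
        by (rule ld_cong[OF V _ lform_sfam[OF V lform_field[OF V Suc.prems(1) sW]] assms(4)])
          (use lform_alternating[OF V Suc.prems(1)] 0 in auto)
      then show ?thesis by (simp add: ld_0[OF V])
    next
      case (Suc l)
      then show ?thesis
        using lform_alternating[OF V lform_ld[OF V lform_field[OF V Suc.prems(1) sW]] assms(4)] by simp
    qed
    ultimately show ?thesis unfolding lie_def by (rule alternating_add)
  qed
  then show ?case
  proof (rule p.KK_Suc_frame)
    fix l assume l: "l < n"
    have sWl: "smooth_on V (W l)" by (rule smooth_W[OF l])
    have "KK x j (lie (W i) (\<lambda>y. contract (W l y) (\<omega> y)) x)"
      by (rule Suc.IH[OF lform_field[OF V Suc.prems(1) sWl]])
        (use Suc.prems(2) W_mem[OF _ l] cr_point.KK_Suc[OF point] in blast)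
    moreover have "KK x j (contract (lie_bracket (W i) (W l) x) (\<omega> x))"
      using Suc.prems(2)[OF assms(4)] involutive[OF assms(4,3) l] by (simp add: p.KK_Suc)
    ultimately show "KK x j (contract (W l x) (lie (W i) \<omega> x))"
      unfolding contract_lie[OF V Suc.prems(1) sW sWl assms(4)] by (rule p.KK_simps(3))
  qed
qed

text \<open>By Cartan's formula, contracting W_l into d\<omega> gives a Lie derivative, covered by
  \<open>KK_lie\<close>, minus d of a contraction, covered by induction. For k = p + q and j = q + 1
  this is the inclusion of d \<open>F^p\<close> in \<open>F^p\<close>.\<close>

lemma KK_ld:
  assumes "lform k V \<omega>" "\<And>x. x \<in> V ==> KK x j (\<omega> x)" "x \<in> V"
  shows "KK x (Suc j) (ld \<omega> x)"
  using assms(1,2)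
proof (induction j arbitrary: k \<omega>)
  case 0
  then have z: "\<omega> y = 0" if "y \<in> V" for y using cr_point.KK_0_iff[OF point] that by blast
  have "ld \<omega> x = ld (\<lambda>x. 0) x" by (rule ld_cong[OF V z lform_sfam[OF V 0(1)] assms(3)])
  then show ?case by (simp add: ld_0[OF V] cr_point.KK_simps[OF point[OF assms(3)]])
next
  case (Suc j)
  interpret p: cr_point n "V10 x" "V01 x" "\<theta> x" "ld \<theta> x" "T x" "\<lambda>i. Z i x" "\<lambda>i. W i x" by (rule point[OF assms(3)])
  show ?case
  proof (rule p.KK_Suc_frame[OF lform_alternating[OF V lform_ld[OF V Suc.prems(1)] assms(3)]])
    fix l assume l: "l < n"
    have sWl: "smooth_on V (W l)" by (rule smooth_W[OF l])
    have "KK x (Suc j) (ld (\<lambda>y. contract (W l y) (\<omega> y)) x)"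
      by (rule Suc.IH[OF lform_field[OF V Suc.prems(1) sWl]])
        (use Suc.prems(2) W_mem[OF _ l] cr_point.KK_Suc[OF point] in blast)
    moreover have "contract (W l x) (ld \<omega> x) = lie (W l) \<omega> x - ld (\<lambda>y. contract (W l y) (\<omega> y)) x"
      by (simp add: lie_def)
    ultimately show "KK x (Suc j) (contract (W l x) (ld \<omega> x))"
      using KK_lie[OF Suc.prems l assms(3)] p.KK_simps(3) by presburger
  qed
qed

end

section \<open>Conditions at a point that do not depend on the contact form\<close>

definition rumin_cond :: "nat => nat => 'm covector => 'm covector => 'm covector => 'm::finite covector => bool" where
  "rumin_cond n k \<theta> \<sigma> \<omega> \<omega>' \<longleftrightarrow>
     (if k \<le> n then wedge \<theta> (wedge \<omega> (wedge_power \<sigma> (n + 1 - k))) = (\<lambda>vs. 0) \<and>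
        wedge \<theta> (wedge \<omega>' (wedge_power \<sigma> (n - k))) = (\<lambda>vs. 0)
      else wedge \<theta> \<omega> = (\<lambda>vs. 0) \<and> wedge \<theta> \<omega>' = (\<lambda>vs. 0))"

text \<open>Only values on V10 and V01 are prescribed; those involving other vectors stay free.
  Unlike \<open>bproj\<close>, this description of the type (k - q, q) part does not involve the
  Reeb vector.\<close>

definition has_part :: "nat => (complex ^ 'm) set => (complex ^ 'm) set => 'm covector => 'm::finite covector => bool" where
  "has_part q V10 V01 \<omega> \<alpha> \<longleftrightarrow>
     (\<forall>vs. set vs \<subseteq> V10 \<union> V01 --> \<alpha> vs = (if length (filter (\<lambda>v. v \<in> V01) vs) = q then \<omega> vs else 0))"

text \<open>The part of bidegree \<open>(k - q, q)\<close> of the restriction of the \<open>k\<close>-covector \<open>\<omega>\<close> is primitive, which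
  means that it vanishes if \<open>k > n\<close>.\<close>

definition prim_part :: "nat => nat => nat => (complex ^ 'm) set => (complex ^ 'm) set =>
    'm covector => 'm covector => 'm::finite covector => bool" where
  "prim_part n k q V10 V01 \<theta> \<sigma> \<omega> \<longleftrightarrow>
     (\<exists>\<alpha>. alternating k \<alpha> \<and> has_part q V10 V01 \<omega> \<alpha> \<and> wedge \<theta> (wedge (wedge_power \<sigma> (n + 1 - k)) \<alpha>) = 0)"

text \<open>The form \<open>\<eta> = \<theta> \<and> \<sigma>\<^bsup>j\<^esup> \<and> \<gamma>\<close> is chosen such that the part of \<open>\<omega> - d\<eta>\<close> considered above is
  primitive. The two truncated subtractions treat the cases \<open>k \<le> n\<close> and \<open>k > n\<close> simultaneously, and
  the degree \<open>n - m\<close> of \<open>\<gamma>\<close> is such that \<open>\<sigma>\<^bsup>m\<^esup>\<close> is the Lefschetz isomorphism on it.\<close>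

definition corrects :: "nat => nat => nat => (complex ^ 'm) set => (complex ^ 'm) set =>
    'm covector => 'm covector => 'm covector => 'm::finite covector => bool" where
  "corrects n k q V10 V01 \<theta> \<sigma> \<omega> \<eta> \<longleftrightarrow>
     (let i = n + 1 - k; j = k - n - 1; m = i + j + 1 in
      \<exists>\<gamma> \<alpha>. alternating k \<alpha> \<and> has_part q V10 V01 \<omega> \<alpha> \<and>
        (if n < m then \<gamma> = 0 else alternating (n - m) \<gamma>) \<and>
        \<eta> = wedge \<theta> (wedge (wedge_power \<sigma> j) \<gamma>) \<and>
        wedge \<theta> (wedge (wedge_power \<sigma> i) (\<alpha> - wedge (wedge_power \<sigma> (j + 1)) \<gamma>)) = 0)"

text \<open>Above the middle degree, contraction with every vector takes the place of contraction
  with the Reeb vector, so no contact form enters. By \<open>bideg_T\<close> the two agree on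
  covectors without horizontal part.\<close>

definition bideg :: "nat => nat => nat => (complex ^ 'm) set => (complex ^ 'm) set => 'm::finite covector => bool" where
  "bideg n p q V10 V01 \<omega> \<longleftrightarrow>
     (if p + q \<le> n then has_bidegree V10 V01 p q \<omega> else \<forall>v. has_bidegree V10 V01 (p - 1) q (contract v \<omega>))"

definition kills :: "nat => (complex ^ 'm) set => 'm::finite covector => bool" where
  "kills j V01 \<omega> \<longleftrightarrow> (\<forall>Ws vs. length Ws = j --> set Ws \<subseteq> V01 --> \<omega> (Ws @ vs) = 0)"

section \<open>The pointwise conditions under a change of contact form\<close>

context
  fixes \<theta> \<sigma> \<mu> :: "'m::finite covector" and g :: complex
  assumes theta: "alternating 1 \<theta>" and sigma: "alternating 2 \<sigma>" and mu: "alternating 1 \<mu>" and g: "g \<noteq> 0"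
begin

lemma scaled_sigma_even: "grade_sign (cscale g \<sigma> + wedge \<mu> \<theta>) = cscale g \<sigma> + wedge \<mu> \<theta>"
  using grade_sign_alternating[OF sigma] grade_sign_alternating[OF mu] grade_sign_alternating[OF theta]
  by (simp add: grade_sign_wedge)

text \<open>Every term containing \<mu> \<and> \<theta> dies against the outer \<theta>, and only
  the factor g per power of \<sigma> survives.\<close>

lemma wedge_theta_power_scale:
  "wedge \<theta> (wedge (wedge_power (cscale g \<sigma> + wedge \<mu> \<theta>) m) u) = cscale (g ^ m) (wedge \<theta> (wedge (wedge_power \<sigma> m) u))"
proof (induction m)
  case 0
  then show ?case by (simp add: wedge_unit)
next
  case (Suc m)
  let ?s = "cscale g \<sigma> + wedge \<mu> \<theta>"
  have odd: "grade_sign \<theta> = - \<theta>" "grade_sign \<mu> = - \<mu>"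
    using grade_sign_alternating[OF theta] grade_sign_alternating[OF mu] by simp_all
  have even: "grade_sign \<sigma> = \<sigma>" using grade_sign_alternating[OF sigma] by simp
  have 1: "wedge \<theta> (wedge \<sigma> Y) = wedge \<sigma> (wedge \<theta> Y)" for Y
    using wedge_commute(1)[OF even, of \<theta>] by (metis wedge_assoc)
  have 2: "wedge \<theta> (wedge \<mu> (wedge \<theta> Y)) = 0" for Y
  proof -
    have "wedge \<theta> \<mu> = - wedge \<mu> \<theta>" using wedge_commute(2)[OF odd(1), of \<mu>] odd by simp
    then have "wedge \<theta> (wedge \<mu> (wedge \<theta> Y)) = - wedge \<mu> (wedge \<theta> (wedge \<theta> Y))"
      by (metis wedge_assoc wedge_uminus(1))
    then show ?thesis by (simp add: wedge_1_1[OF theta])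
  qed
  have "wedge \<theta> (wedge (wedge_power ?s (Suc m)) u) =
      cscale g (wedge \<sigma> (wedge \<theta> (wedge (wedge_power ?s m) u)))"
    by (simp add: wedge_assoc 1 2)
  also have "\<dots> = cscale (g ^ Suc m) (wedge \<theta> (wedge (wedge_power \<sigma> (Suc m)) u))"
    unfolding Suc by (simp add: wedge_assoc 1)
  finally show ?case .
qed

lemma rumin_cond_scale:
  assumes "rumin_cond n k \<theta> \<sigma> u v"
  shows "rumin_cond n k (cscale g \<theta>) (cscale g \<sigma> + wedge \<mu> \<theta>) u v"
proof -
  have even: "grade_sign \<sigma> = \<sigma>" using grade_sign_alternating[OF sigma] by simp
  note c = wedge_commute(1)[OF grade_sign_wedge_power[OF even], symmetric]
    wedge_commute(1)[OF grade_sign_wedge_power[OF scaled_sigma_even], symmetric]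
  show ?thesis
    using assms g unfolding rumin_cond_def zero_fun_def[symmetric]
    by (simp only: c wedge_simps wedge_theta_power_scale cscale_eq_0 split: if_splits) simp_all
qed

lemma corrects_scale:
  assumes "corrects n k q V10 V01 \<theta> \<sigma> \<omega> \<eta>"
  shows "corrects n k q V10 V01 (cscale g \<theta>) (cscale g \<sigma> + wedge \<mu> \<theta>) \<omega> \<eta>"
proof -
  let ?s = "cscale g \<sigma> + wedge \<mu> \<theta>"
  define i j m where "i = n + 1 - k" and "j = k - n - 1" and "m = i + j + 1"
  obtain \<gamma> \<alpha> where *: "alternating k \<alpha>" "has_part q V10 V01 \<omega> \<alpha>"
    "if n < m then \<gamma> = 0 else alternating (n - m) \<gamma>" "\<eta> = wedge \<theta> (wedge (wedge_power \<sigma> j) \<gamma>)"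
    "wedge \<theta> (wedge (wedge_power \<sigma> i) (\<alpha> - wedge (wedge_power \<sigma> (j + 1)) \<gamma>)) = 0"
    using assms unfolding corrects_def Let_def i_def j_def m_def by blast
  \<comment> \<open>The divisor offsets the factor g from \<theta> and g^j from \<sigma>^j, so
    \<eta> is unchanged. The two terms of the primitivity equation then acquire the same factor
    g^(i+1).\<close>
  define \<gamma>' where "\<gamma>' = cscale (1 / g ^ (j + 1)) \<gamma>"
  have pow: "wedge (wedge_power s i) (wedge (wedge_power s (j + 1)) u) = wedge (wedge_power s m) u" for s u :: "'m covector"
    by (simp only: wedge_power_funpow m_def add.assoc funpow_add o_apply)
  have "\<eta> = wedge (cscale g \<theta>) (wedge (wedge_power ?s j) \<gamma>')"
    using g by (simp add: *(4) wedge_theta_power_scale \<gamma>'_def)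
  moreover have "if n < m then \<gamma>' = 0 else alternating (n - m) \<gamma>'"
    using *(3) by (auto simp: \<gamma>'_def alternating_cscale)
  moreover have "wedge (cscale g \<theta>) (wedge (wedge_power ?s i) (\<alpha> - wedge (wedge_power ?s (j + 1)) \<gamma>')) = 0"
  proof -
    have "wedge (cscale g \<theta>) (wedge (wedge_power ?s i) (\<alpha> - wedge (wedge_power ?s (j + 1)) \<gamma>')) =
      cscale (g * g ^ i) (wedge \<theta> (wedge (wedge_power \<sigma> i) \<alpha>)) - cscale (g * g ^ m) (wedge \<theta> (wedge (wedge_power \<sigma> m) \<gamma>'))"
      by (simp only: wedge_simps wedge_diff pow wedge_theta_power_scale cscale_simps)
    also have "\<dots> = cscale (g * g ^ i) (wedge \<theta> (wedge (wedge_power \<sigma> i) (\<alpha> - wedge (wedge_power \<sigma> (j + 1)) \<gamma>)))"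
      using g by (simp only: wedge_diff pow \<gamma>'_def wedge_simps cscale_simps) (simp add: m_def power_add)
    finally show ?thesis by (simp only: *(5) cscale_simps)
  qed
  ultimately show ?thesis
    using *(1,2) unfolding corrects_def Let_def i_def[symmetric] j_def[symmetric] m_def[symmetric] by blast
qed

end

section \<open>The pointwise conditions under linear isomorphisms\<close>

context
  fixes F :: "complex ^ 'm::finite => complex ^ 'm" and V10 V01 V10' V01' :: "(complex ^ 'm) set"
  assumes lin: "\<And>v a w. F (v + a *s w) = F v + a *s F w" and inj: "inj F"
    and F10: "F ` V10 = V10'" and F01: "F ` V01 = V01'"
begin

lemma rumin_cond_pullback:
  "rumin_cond n k \<theta> \<sigma> u v ==> rumin_cond n k (pullback F \<theta>) (pullback F \<sigma>) (pullback F u) (pullback F v)"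
  unfolding rumin_cond_def zero_fun_def[symmetric]
  by (auto simp: pullback_wedge[symmetric] pullback_wedge_power[symmetric])

text \<open>Injectivity ensures that a vector with image in \<open>V01'\<close> lies in V01, so
  weights are preserved.\<close>

lemma filter_map_F: "length (filter (\<lambda>v. v \<in> V01') (map F vs)) = length (filter (\<lambda>v. v \<in> V01) vs)"
  using inj F01 by (auto simp: filter_map o_def inj_image_mem_iff)

lemma has_part_pullback: "has_part q V10' V01' \<omega> \<alpha> ==> has_part q V10 V01 (pullback F \<omega>) (pullback F \<alpha>)"
  unfolding has_part_def
proof (intro allI impI)
  fix vs assume *: "\<forall>vs. set vs \<subseteq> V10' \<union> V01' --> \<alpha> vs = (if length (filter (\<lambda>v. v \<in> V01') vs) = q then \<omega> vs else 0)"
    "set vs \<subseteq> V10 \<union> V01"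
  then have "set (map F vs) \<subseteq> V10' \<union> V01'" using F10 F01 by auto
  then show "pullback F \<alpha> vs = (if length (filter (\<lambda>v. v \<in> V01) vs) = q then pullback F \<omega> vs else 0)"
    using *(1) by (simp only: pullback_def filter_map_F)
qed

lemma corrects_pullback:
  assumes "corrects n k q V10' V01' \<theta> \<sigma> \<omega> \<eta>"
  shows "corrects n k q V10 V01 (pullback F \<theta>) (pullback F \<sigma>) (pullback F \<omega>) (pullback F \<eta>)"
proof -
  define i j m where "i = n + 1 - k" and "j = k - n - 1" and "m = i + j + 1"
  obtain \<gamma> \<alpha> where *: "alternating k \<alpha>" "has_part q V10' V01' \<omega> \<alpha>"
    "if n < m then \<gamma> = 0 else alternating (n - m) \<gamma>" "\<eta> = wedge \<theta> (wedge (wedge_power \<sigma> j) \<gamma>)"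
    "wedge \<theta> (wedge (wedge_power \<sigma> i) (\<alpha> - wedge (wedge_power \<sigma> (j + 1)) \<gamma>)) = 0"
    using assms unfolding corrects_def Let_def i_def j_def m_def by blast
  have "pullback F (wedge \<theta> (wedge (wedge_power \<sigma> i) (\<alpha> - wedge (wedge_power \<sigma> (j + 1)) \<gamma>))) = 0"
    by (simp only: *(5) pullback_simps)
  then have "wedge (pullback F \<theta>) (wedge (wedge_power (pullback F \<sigma>) i) (pullback F \<alpha> - wedge (wedge_power (pullback F \<sigma>) (j + 1)) (pullback F \<gamma>))) = 0"
    by (simp only: pullback_wedge pullback_wedge_power pullback_simps)
  moreover have "if n < m then pullback F \<gamma> = 0 else alternating (n - m) (pullback F \<gamma>)"
    using *(3) by (auto simp: alternating_pullback[OF lin])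
  moreover have "pullback F \<eta> = wedge (pullback F \<theta>) (wedge (wedge_power (pullback F \<sigma>) j) (pullback F \<gamma>))"
    by (simp only: *(4) pullback_wedge pullback_wedge_power)
  ultimately show ?thesis
    using has_part_pullback[OF *(2)] alternating_pullback[OF lin *(1)]
    unfolding corrects_def Let_def i_def[symmetric] j_def[symmetric] m_def[symmetric] by blast
qed

lemma has_bidegree_pullback: "has_bidegree V10' V01' p q u ==> has_bidegree V10 V01 p q (pullback F u)"
  unfolding has_bidegree_def pullback_def
proof (intro allI impI)
  fix Zs Ws
  assume *: "\<forall>Zs Ws. set Zs \<subseteq> V10' --> set Ws \<subseteq> V01' --> (length Zs, length Ws) \<noteq> (p, q) --> u (Zs @ Ws) = 0"
    "set Zs \<subseteq> V10" "set Ws \<subseteq> V01" "(length Zs, length Ws) \<noteq> (p, q)"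
  show "u (map F (Zs @ Ws)) = 0"
    using *(1)[rule_format, of "map F Zs" "map F Ws"] *(2-4) F10 F01 by auto
qed

lemma bideg_pullback: "bideg n p q V10' V01' u ==> bideg n p q V10 V01 (pullback F u)"
  unfolding bideg_def using has_bidegree_pullback by (auto split: if_splits)

lemma kills_pullback: "kills j V01' u ==> kills j V01 (pullback F u)"
  unfolding kills_def pullback_def
proof (intro allI impI)
  fix Ws vs assume *: "\<forall>Ws vs. length Ws = j --> set Ws \<subseteq> V01' --> u (Ws @ vs) = 0" "length Ws = j" "set Ws \<subseteq> V01"
  show "u (map F (Ws @ vs)) = 0"
    using *(1)[rule_format, of "map F Ws" "map F vs"] *(2,3) F01 by auto
qed

end

section \<open>The pointwise conditions in terms of a frame\<close>

context cr_point
begin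

lemma kills_KK: "kills j V01 u \<longleftrightarrow> KK j u"
  by (simp add: kills_def KK_def)

lemma rumin_cond_prim:
  "alternating k u ==> alternating (k + 1) v ==> rumin_cond n k \<theta> \<sigma> u v \<longleftrightarrow> prim k (PH u) \<and> prim (k + 1) (PH v)"
  unfolding rumin_cond_def by (rule rumin_condition_iff)

lemma has_part_PH:
  assumes "alternating k u" "alternating k \<alpha>" "k < N" "q < N"
  shows "has_part q V10 V01 u \<alpha> ==> PH \<alpha> = bproj N q u"
  using bproj_eqI[OF assms] unfolding has_part_def weight_def[symmetric] by simp

lemma has_part_bproj: "alternating k u ==> k < N ==> q < N ==> has_part q V10 V01 u (bproj N q u)"
  unfolding has_part_def weight_def[symmetric] by (simp add: bproj_eval)

lemma bproj_alternating: "alternating k u ==> alternating k (bproj N b u)"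
  using bproj_hor hor_alternating by blast

lemma wedge_theta_L_pow_iff: "alternating k u ==> wedge \<theta> (wedge (wedge_power \<sigma> m) u) = 0 \<longleftrightarrow> (L ^^ m) (PH u) = 0"
  using wedge_theta_eq_0_iff[OF alternating_wedge_funpow[OF sigma], of k u m] by (simp add: PH_L wedge_power_funpow)

text \<open>All admissible \<alpha> share the horizontal part \<open>bproj N q u\<close>, and the
  product with \<theta> depends on nothing else.\<close>

lemma prim_part_iff:
  assumes "alternating k u" "k < N" "q < N"
  shows "prim_part n k q V10 V01 \<theta> \<sigma> u \<longleftrightarrow> prim k (bproj N q u)"
proof -
  have p: "prim k w \<longleftrightarrow> (L ^^ (n + 1 - k)) w = 0" for w
    by (simp add: prim_def)
  show ?thesis
  proof
    assume "prim_part n k q V10 V01 \<theta> \<sigma> u"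
    then obtain \<alpha> where *: "alternating k \<alpha>" "has_part q V10 V01 u \<alpha>" "wedge \<theta> (wedge (wedge_power \<sigma> (n + 1 - k)) \<alpha>) = 0"
      unfolding prim_part_def by blast
    then show "prim k (bproj N q u)"
      unfolding p using wedge_theta_L_pow_iff[OF *(1)] has_part_PH[OF assms(1) *(1) assms(2,3) *(2)] by simp
  next
    assume "prim k (bproj N q u)"
    then have "wedge \<theta> (wedge (wedge_power \<sigma> (n + 1 - k)) (bproj N q u)) = 0"
      unfolding p wedge_theta_L_pow_iff[OF bproj_alternating[OF assms(1)]] PH_hor[OF bproj_hor[OF assms(1)]] .
    then show "prim_part n k q V10 V01 \<theta> \<sigma> u"
      unfolding prim_part_def using bproj_alternating[OF assms(1)] has_part_bproj[OF assms] by blast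
  qed
qed

text \<open>Replacing \<gamma> by its horizontal part changes \<gamma> by a multiple of \<theta>.
  This affects neither \<eta> nor the primitivity equation, both of which contain a factor
  \<theta>.\<close>

lemma correctsE:
  assumes "corrects n k q V10 V01 \<theta> \<sigma> u \<eta>" "alternating k u" "k < N" "q < N"
  obtains \<gamma> where "n < (n + 1 - k) + (k - n - 1) + 1 ==> \<gamma> = 0" "\<gamma> \<in> hor (n - ((n + 1 - k) + (k - n - 1) + 1))"
    "\<eta> = wedge \<theta> ((L ^^ (k - n - 1)) \<gamma>)" "(L ^^ (n + 1 - k)) (bproj N q u - (L ^^ (k - n - 1 + 1)) \<gamma>) = 0"
proof -
  define i j m where "i = n + 1 - k" and "j = k - n - 1" and "m = i + j + 1"
  obtain \<gamma> \<alpha> where *: "alternating k \<alpha>" "has_part q V10 V01 u \<alpha>"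
    "if n < m then \<gamma> = 0 else alternating (n - m) \<gamma>" "\<eta> = wedge \<theta> ((L ^^ j) \<gamma>)"
    "wedge \<theta> (wedge (wedge_power \<sigma> i) (\<alpha> - (L ^^ (j + 1)) \<gamma>)) = 0"
    using assms(1) unfolding corrects_def Let_def i_def j_def m_def wedge_power_funpow by blast
  have a: "alternating (n - m) \<gamma>" using *(3) by (auto split: if_splits)
  have ak: "alternating k (\<alpha> - (L ^^ (j + 1)) \<gamma>)"
  proof (cases "n < m")
    case True
    then show ?thesis using *(1,3) by (simp add: L_pow_0 del: funpow.simps)
  next
    case False
    then have "n - m + 2 * (j + 1) = k" by (cases "k \<le> n") (auto simp: m_def i_def j_def)
    then show ?thesis
      using alternating_diff[OF *(1)] alternating_wedge_funpow[OF sigma a, of "j + 1"] by metis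
  qed
  have "PH \<eta> = 0" using *(4) PH_wedge_theta by simp
  have "wedge \<theta> (PH ((L ^^ j) \<gamma>)) = wedge \<theta> ((L ^^ j) \<gamma>)"
    using arg_cong[OF hor_decomp[OF alternating_wedge_funpow[OF sigma a, of j]], of "wedge \<theta>"]
    by (simp add: wedge_1_1[OF theta])
  then have "\<eta> = wedge \<theta> ((L ^^ j) (PH \<gamma>))" using *(4) by (simp add: PH_L)
  moreover have "(L ^^ i) (bproj N q u - (L ^^ (j + 1)) (PH \<gamma>)) = 0"
    using *(5) unfolding wedge_theta_L_pow_iff[OF ak]
    by (simp only: pullback_simps PH_L has_part_PH[OF assms(2) *(1) assms(3,4) *(2)])
  moreover have "n < m ==> PH \<gamma> = 0" using *(3) by simp
  ultimately show thesis
    using that[of "PH \<gamma>"] pullback_dil_hor[OF a] unfolding i_def j_def m_def by blast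
qed

lemma correctsI:
  assumes "alternating k u" "k < N" "q < N"
    and "n < (n + 1 - k) + (k - n - 1) + 1 ==> \<gamma> = 0" "\<gamma> \<in> hor (n - ((n + 1 - k) + (k - n - 1) + 1))"
    and "(L ^^ (n + 1 - k)) (bproj N q u - (L ^^ (k - n - 1 + 1)) \<gamma>) = 0"
  shows "corrects n k q V10 V01 \<theta> \<sigma> u (wedge \<theta> ((L ^^ (k - n - 1)) \<gamma>))"
  unfolding corrects_def Let_def
proof (intro exI conjI)
  show "wedge \<theta> (wedge (wedge_power \<sigma> (n + 1 - k)) (bproj N q u - wedge (wedge_power \<sigma> (k - n - 1 + 1)) \<gamma>)) = 0"
    using assms(6) by (simp only: wedge_power_funpow wedge_simps)
qed (use assms bproj_alternating[OF assms(1)] has_part_bproj[OF assms(1-3)] hor_alternating in \<open>auto simp: wedge_power_funpow\<close>)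

text \<open>The difference of two choices of \<gamma> has degree n - m and is killed by L^i L^(j+1)
  = L^m, so Lefschetz injectivity applies.\<close>

lemma corrects_unique:
  assumes "corrects n k q V10 V01 \<theta> \<sigma> u \<eta>" "corrects n k q V10 V01 \<theta> \<sigma> u \<eta>'" "alternating k u"
  shows "\<eta> = \<eta>'"
proof -
  define i j m where "i = n + 1 - k" and "j = k - n - 1" and "m = i + j + 1"
  have N: "k < k + q + 1" "q < k + q + 1" by auto
  obtain \<gamma> where 1: "n < m ==> \<gamma> = 0" "\<gamma> \<in> hor (n - m)" "\<eta> = wedge \<theta> ((L ^^ j) \<gamma>)"
    "(L ^^ i) (bproj (k + q + 1) q u - (L ^^ (j + 1)) \<gamma>) = 0"
    using correctsE[OF assms(1,3) N] unfolding i_def j_def m_def by blast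
  obtain \<gamma>' where 2: "n < m ==> \<gamma>' = 0" "\<gamma>' \<in> hor (n - m)" "\<eta>' = wedge \<theta> ((L ^^ j) \<gamma>')"
    "(L ^^ i) (bproj (k + q + 1) q u - (L ^^ (j + 1)) \<gamma>') = 0"
    using correctsE[OF assms(2,3) N] unfolding i_def j_def m_def by blast
  have "\<gamma> = \<gamma>'"
  proof (cases "n < m")
    case False
    have "(L ^^ i) ((L ^^ (j + 1)) (\<gamma> - \<gamma>')) = 0"
      using 1(4) 2(4) by (simp only: L_pow_diff) (metis cancel_comm_monoid_add_class.diff_cancel eq_iff_diff_eq_0)
    then have "(L ^^ m) (\<gamma> - \<gamma>') = 0" unfolding m_def add.assoc funpow_add[of i] by simp
    then show ?thesis
      using L_pow_inj[OF hor_diff[OF 1(2) 2(2)], of m] False by simp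
  qed (use 1(1) 2(1) in simp)
  then show ?thesis using 1(3) 2(3) by simp
qed

text \<open>Without a horizontal part, u sees only the T-component \<theta>(v) T of v when the other
  arguments are horizontal.\<close>

lemma bideg_T:
  assumes "alternating (p + q) u" "PH u = 0"
  shows "(\<forall>v. has_bidegree V10 V01 (p - 1) q (contract v u)) \<longleftrightarrow> has_bidegree V10 V01 (p - 1) q (contract T u)"
proof -
  have "contract v u (Zs @ Ws) = \<theta> [v] * contract T u (Zs @ Ws)" if "set Zs \<subseteq> V10" "set Ws \<subseteq> V01" for v Zs Ws
  proof -
    have "contract v u = contract (\<theta> [v] *s T + dil 1 v) u" using frame_dil by metis
    also have "\<dots> = cscale (\<theta> [v]) (contract T u) + contract (dil 1 v) u"
      by (simp only: alternating_contract(1,2)[OF assms(1)])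
    finally have "contract v u (Zs @ Ws) = \<theta> [v] * contract T u (Zs @ Ws) + u (dil 1 v # Zs @ Ws)"
      by (simp add: fun_apply cscale_def contract_def)
    moreover have "map (dil 1) (Zs @ Ws) = Zs @ Ws"
      using that by (auto intro!: map_idI simp: dil_Z dil_W)
    then have "u (dil 1 v # Zs @ Ws) = PH u (v # Zs @ Ws)"
      by (simp add: pullback_def)
    ultimately show ?thesis by (simp add: assms(2) fun_apply)
  qed
  note eq = this
  show ?thesis
  proof (intro iffI allI)
    fix v assume T: "has_bidegree V10 V01 (p - 1) q (contract T u)"
    show "has_bidegree V10 V01 (p - 1) q (contract v u)"
      unfolding has_bidegree_def
    proof (intro allI impI)
      fix Zs Ws assume "set Zs \<subseteq> V10" "set Ws \<subseteq> V01" "(length Zs, length Ws) \<noteq> (p - 1, q)"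
      then show "contract v u (Zs @ Ws) = 0"
        using T eq[of Zs Ws v] unfolding has_bidegree_def by (metis mult_zero_right)
    qed
  qed blast
qed

end

section \<open>Local uniqueness and existence for representatives and correctors\<close>

context cr_local
begin

text \<open>Once the leading part of \<omega> vanishes, only the part of T contracted into \<omega>
  with q entries of type (0,1) obstructs the next filtration step. Its product with \<theta> has
  exactly this contraction and no horizontal part.\<close>

lemma theta_part_kills:
  assumes w: "lform k V \<omega>" and K: "\<And>x. x \<in> V ==> KK x (Suc q) (\<omega> x)"
    and z: "\<And>x. x \<in> V ==> bproj x N q (\<omega> x) = 0" and N: "k < N" "q < N"
  shows "lform k V (\<lambda>x. wedge (\<theta> x) (bproj x N q (contract (T x) (\<omega> x))))" (is "lform k V ?\<beta>")
    and "x \<in> V ==> KK x q (\<omega> x - wedge (\<theta> x) (bproj x N q (contract (T x) (\<omega> x))))"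
proof -
  show b: "lform k V ?\<beta>"
  proof (cases k)
    case 0
    then have "contract (T x) (\<omega> x) = 0" if "x \<in> V" for x
      using lform_alternating[OF V w that] by simp
    then show ?thesis
      by (intro lform_cong[OF V _ lform_0[OF V]]) (simp add: cr_point.bproj_0[OF point])
  next
    case (Suc l)
    then show ?thesis using lform_theta[OF lform_bproj[OF lform_T[OF w]]] by simp
  qed
  show "KK x q (\<omega> x - ?\<beta> x)" if x: "x \<in> V" for x
  proof -
    interpret p: cr_point n "V10 x" "V01 x" "\<theta> x" "ld \<theta> x" "T x" "\<lambda>i. Z i x" "\<lambda>i. W i x" by (rule point[OF x])
    note a = lform_alternating[OF V w x]
    note aT = alternating_contract_alternating[OF a, of "T x"]
    have h: "bproj x N q (contract (T x) (\<omega> x)) \<in> hor x (k - 1)" by (rule p.bproj_hor[OF aT])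
    show ?thesis
    proof (rule p.KK_intro[OF alternating_diff[OF a lform_alternating[OF V b x]] N(1)])
      fix b assume b: "q \<le> b" "b \<le> k"
      then show "bproj x N b (\<omega> x - ?\<beta> x) = 0"
        using p.KK_bproj[OF a N(1) K[OF x], of b] z[OF x] N
        by (cases "b = q") (auto simp: p.bproj_diff p.bproj_theta)
    next
      fix b assume b: "q \<le> b" "b < k"
      have "bproj x N b (contract (T x) (\<omega> x)) = 0" if "b \<noteq> q"
        using p.KK_bproj_T[OF a N(1) K[OF x], of b] that b N by simp
      moreover have "bproj x N b (bproj x N q (contract (T x) (\<omega> x))) =
          (if b = q then bproj x N q (contract (T x) (\<omega> x)) else 0)"
        by (rule p.bproj_bproj[OF aT]) (use b N in auto)
      ultimately show "bproj x N b (contract (T x) (\<omega> x - ?\<beta> x)) = 0"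
        using p.contract_T_wedge_theta[OF p.hor_T[OF h]] by (simp add: p.bproj_diff)
    qed
  qed
qed

text \<open>Only \<open>\<theta> \<and> \<beta>\<close> contributes to the leading part of \<open>d\<omega>\<close>, where \<open>\<beta>\<close> is the leading part of \<open>T \<lrcorner> \<omega>\<close>.\<close>

lemma bproj_ld_leading:
  assumes w: "lform k V \<omega>" and K: "\<And>x. x \<in> V ==> KK x (Suc q) (\<omega> x)"
    and z: "\<And>x. x \<in> V ==> bproj x N q (\<omega> x) = 0" and N: "k + 1 < N" "Suc q < N" and x: "x \<in> V"
  shows "bproj x N (Suc q) (ld \<omega> x) = L x (bproj x N q (contract (T x) (\<omega> x)))"
proof -
  interpret p: cr_point n "V10 x" "V01 x" "\<theta> x" "ld \<theta> x" "T x" "\<lambda>i. Z i x" "\<lambda>i. W i x" by (rule point[OF x])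
  define \<beta> where "\<beta> y = bproj y N q (contract (T y) (\<omega> y))" for y
  have N': "k < N" "q < N" "0 < N" using N by auto
  note tp = theta_part_kills[OF w K z N'(1,2), folded \<beta>_def]
  have b: "lform (k - 1) V \<beta>" unfolding \<beta>_def by (rule lform_bproj[OF lform_T[OF w]])
  note d = lform_diff[OF V w tp(1)]
  \<comment> \<open>The remainder lies one step deeper in the filtration, and by
    \<open>KK_ld\<close> its derivative does too.\<close>
  have "bproj x N (Suc q) (ld (\<lambda>y. \<omega> y - wedge (\<theta> y) (\<beta> y)) x) = 0"
    using KK_ld[OF d tp(2) x] N
    by (intro p.KK_bproj[OF lform_alternating[OF V lform_ld[OF V d] x], of N "Suc q"]) auto
  moreover have "ld (\<lambda>y. \<omega> y - wedge (\<theta> y) (\<beta> y)) x = ld \<omega> x - ld (\<lambda>y. wedge (\<theta> y) (\<beta> y)) x"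
    by (rule ld_diff[OF V lform_sfam[OF V w] lform_sfam[OF V tp(1)] x])
  moreover have "bproj x N q (\<beta> x) = \<beta> x"
    unfolding \<beta>_def
    using p.bproj_bproj[OF alternating_contract_alternating[OF lform_alternating[OF V w x]], of N q q] N' by simp
  ultimately show ?thesis
    using bproj_ld_theta[OF b x N'(3), of q] by (simp add: p.bproj_diff \<beta>_def)
qed

text \<open>In all cases f = \<theta> \<and> X. For 0 < k \<le> n the horizontal part of d f is
  d\<theta> \<and> X, and its primitivity gives L^(n-k+1) X = 0 with X of degree k - 1, a case of
  Lefschetz injectivity. For k > n the assumption is X = 0.\<close>

lemma eq_0_if_rumin:
  assumes f: "lform k V f" and R: "\<And>x. x \<in> V ==> prim x k (PH x (f x)) \<and> prim x (k + 1) (PH x (ld f x))"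
    and z: "\<And>x. x \<in> V ==> if k \<le> n then PH x (f x) = 0 else contract (T x) (f x) = 0" and x: "x \<in> V"
  shows "f x = 0"
proof -
  have PH0: "PH y (f y) = 0" if "y \<in> V" for y
    using R[OF that] z[OF that] cr_point.prim_def[OF point[OF that]] by (auto split: if_splits)
  have dec: "f y = wedge (\<theta> y) (contract (T y) (f y))" if "y \<in> V" for y
    using cr_point.hor_decomp[OF point[OF that] lform_alternating[OF V f that]] PH0[OF that] by simp
  interpret p: cr_point n "V10 x" "V01 x" "\<theta> x" "ld \<theta> x" "T x" "\<lambda>i. Z i x" "\<lambda>i. W i x" by (rule point[OF x])
  define X where "X y = contract (T y) (f y)" for y
  have X: "lform (k - 1) V X" unfolding X_def by (rule lform_T[OF f])
  have XT: "contract (T x) (X x) = 0" unfolding X_def by (rule alternating_contract[OF lform_alternating[OF V f x]])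
  have "X x = 0"
  proof (cases "k \<le> n \<and> 0 < k")
    case True
    have "ld f x = ld (\<lambda>y. wedge (\<theta> y) (X y)) x"
      by (rule ld_cong[OF V _ lform_sfam[OF V f] x]) (use dec X_def in simp)
    then have "PH x (ld f x) = L x (X x)" using PH_ld_theta[OF X x XT] by simp
    then have "(L x ^^ (n - k)) (L x (X x)) = 0"
      using R[OF x] True by (cases "k = n") (auto simp: p.prim_def)
    then have "(L x ^^ Suc (n - k)) (X x) = 0" by (simp add: funpow_swap1)
    then show ?thesis
      by (rule p.L_pow_inj[of "X x" "k - 1", rotated 2])
        (use True XT lform_alternating[OF V X x] in \<open>auto simp: p.hor_def\<close>)
  next
    case False
    then show ?thesis
      using z[OF x] lform_alternating[OF V f x] by (cases "k = 0") (auto simp: X_def)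
  qed
  then show ?thesis using dec[OF x] by (simp add: X_def)
qed

text \<open>The bidegree leaves only components with q entries of type (0,1), and the filtration
  condition kills precisely these. So the horizontal part, or above the middle degree the
  contraction with T, is zero and \<open>eq_0_if_rumin\<close> applies.\<close>

lemma eq_0_if_rumin_bidegree:
  assumes f: "lform (p + q) V f"
    and R: "\<And>x. x \<in> V ==> prim x (p + q) (PH x (f x)) \<and> prim x (p + q + 1) (PH x (ld f x))"
    and b: "\<And>x. x \<in> V ==> bideg n p q (V10 x) (V01 x) (f x)" and K: "\<And>x. x \<in> V ==> KK x q (f x)"
    and q: "q \<le> n" and x: "x \<in> V"
  shows "f x = 0"
proof (rule eq_0_if_rumin[OF f R _ x])
  fix y assume y: "y \<in> V"
  interpret p: cr_point n "V10 y" "V01 y" "\<theta> y" "ld \<theta> y" "T y" "\<lambda>i. Z i y" "\<lambda>i. W i y" by (rule point[OF y])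
  note a = lform_alternating[OF V f y]
  define N where "N = p + q + 1"
  have N: "p + q < N" "q < N" by (auto simp: N_def)
  show "if p + q \<le> n then PH y (f y) = 0 else contract (T y) (f y) = 0"
  proof (cases "p + q \<le> n")
    case True
    then have h: "has_bidegree (V10 y) (V01 y) p q (f y)" using b[OF y] by (simp add: bideg_def)
    have "PH y (f y) = 0"
    proof (rule p.hor_eq_0_bproj[OF p.pullback_dil_hor[OF a] N(1)])
      show "bproj y N c (PH y (f y)) = 0" if "c \<le> p + q" for c
        using h p.KK_bproj[OF a N(1) K[OF y]] that N
        unfolding p.has_bidegree_bproj[OF a N(1)] p.bproj_PH by (cases "c = q") auto
    qed
    then show ?thesis using True by simp
  next
    case False
    have p: "0 < p" using False q by simp
    note aT = alternating_contract_alternating[OF a, of "T y"]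
    have aT': "alternating (p - 1 + q) (contract (T y) (f y))" using aT p by simp
    have N2: "p - 1 + q < N" using N p by simp
    have h: "has_bidegree (V10 y) (V01 y) (p - 1) q (contract (T y) (f y))" using b[OF y] False by (simp add: bideg_def)
    have "contract (T y) (f y) = 0"
    proof (rule p.hor_eq_0_bproj[of _ "p - 1 + q" N])
      show "contract (T y) (f y) \<in> hor y (p - 1 + q)"
        using aT' alternating_contract(4)[OF a] by (simp add: p.hor_def)
      show "bproj y N c (contract (T y) (f y)) = 0" if "c \<le> p - 1 + q" for c
        using h[unfolded p.has_bidegree_bproj[OF aT' N2]] p.KK_bproj_T[OF a N(1) K[OF y], of c] that N2 N
        by (cases "c = q") auto
    qed (use N p in auto)
    then show ?thesis using False by simp
  qed
qed

text \<open>For p + q \<le> n only the horizontal part has a prescribed type, and excess entries of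
  type (0,1) could hide in B, the contraction with T. The derivative of the horizontal part stays in
  \<open>F^p\<close>, so for b > q the component b + 1 of d f is L applied to component b of B;
  primitivity and Lefschetz injectivity annihilate it. For p + q > n, f is \<theta> times a covector
  of pure type.\<close>

lemma rumin_bidegree_KK:
  assumes f: "lform (p + q) V f"
    and R: "\<And>x. x \<in> V ==> prim x (p + q) (PH x (f x)) \<and> prim x (p + q + 1) (PH x (ld f x))"
    and b: "\<And>x. x \<in> V ==> bideg n p q (V10 x) (V01 x) (f x)" and q: "q \<le> n" and x: "x \<in> V"
  shows "KK x (Suc q) (f x)"
proof -
  \<comment> \<open>N has to exceed the degrees of f and d f and the indices of the projections
    taken.\<close>
  define N where "N = p + q + 3"
  have N: "p + q < N" "0 < N" "p + q + 1 < N" by (auto simp: N_def)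
  interpret p: cr_point n "V10 x" "V01 x" "\<theta> x" "ld \<theta> x" "T x" "\<lambda>i. Z i x" "\<lambda>i. W i x" by (rule point[OF x])
  note a = lform_alternating[OF V f]
  have dec: "f y = PH y (f y) + wedge (\<theta> y) (contract (T y) (f y))" if "y \<in> V" for y
    by (rule cr_point.hor_decomp[OF point[OF that] a[OF that]])
  show ?thesis
  proof (cases "p + q \<le> n")
    case True
    define \<alpha> B where "\<alpha> y = PH y (f y)" and "B y = contract (T y) (f y)" for y
    have \<alpha>: "lform (p + q) V \<alpha>" unfolding \<alpha>_def by (rule lform_pullback_dil[OF f])
    have B: "lform (p + q - 1) V B" unfolding B_def by (rule lform_T[OF f])
    have bf: "bproj y N b (f y) = 0" if "y \<in> V" "b < N" "b \<noteq> q" for y b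
      using cr_point.has_bidegree_bproj[OF point[OF that(1)] a[OF that(1)] N(1)] b[OF that(1)] True that
      by (simp add: bideg_def)
    have K\<alpha>: "KK y (Suc q) (\<alpha> y)" if y: "y \<in> V" for y
    proof -
      interpret y: cr_point n "V10 y" "V01 y" "\<theta> y" "ld \<theta> y" "T y" "\<lambda>i. Z i y" "\<lambda>i. W i y" by (rule point[OF y])
      show ?thesis
        using N bf[OF y] y.contract_T_pullback_dil[OF a[OF y]]
        by (intro y.KK_intro[OF lform_alternating[OF V \<alpha> y] N(1)]) (auto simp: \<alpha>_def y.bproj_PH)
    qed
    show ?thesis
    proof (rule p.KK_intro[OF a[OF x] N(1)])
      show "bproj x N b (f x) = 0" if "Suc q \<le> b" "b \<le> p + q" for b
        using bf[OF x, of b] that N by auto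
      fix b assume b: "Suc q \<le> b" "b < p + q"
      define i where "i = n - (p + q)"
      have "ld f x = ld (\<lambda>y. \<alpha> y + wedge (\<theta> y) (B y)) x"
        by (rule ld_cong[OF V _ lform_sfam[OF V f] x]) (unfold \<alpha>_def B_def, rule dec)
      also have "\<dots> = ld \<alpha> x + ld (\<lambda>y. wedge (\<theta> y) (B y)) x"
        using b by (intro ld_add[OF V lform_sfam[OF V \<alpha>] lform_sfam[OF V lform_theta[OF B]] x]) auto
      finally have "bproj x N (Suc b) (ld f x) = bproj x N (Suc b) (ld \<alpha> x) + L x (bproj x N b (B x))"
        by (simp add: p.bproj_add bproj_ld_theta[OF B x N(2)])
      moreover have "bproj x N (Suc b) (ld \<alpha> x) = 0"
        using b N by (intro p.KK_bproj[OF lform_alternating[OF V lform_ld[OF V \<alpha>] x] _ KK_ld[OF \<alpha> K\<alpha> x]]) auto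
      moreover have "prim x (p + q + 1) (bproj x N (Suc b) (ld f x))"
        using p.prim_bproj[OF N(2)] R[OF x] by blast
      ultimately have "prim x (p + q + 1) (L x (bproj x N b (B x)))" by simp
      then have "(L x ^^ i) (L x (bproj x N b (B x))) = 0"
        using True by (auto simp: p.prim_def i_def split: if_splits)
      then have "(L x ^^ Suc i) (bproj x N b (B x)) = 0"
        by (simp add: funpow_swap1)
      then have "bproj x N b (B x) = 0"
        using b True by (intro p.L_pow_inj[OF p.bproj_hor[OF lform_alternating[OF V B x]], of "Suc i"]) (auto simp: i_def)
      then show "bproj x N b (contract (T x) (f x)) = 0" by (simp add: B_def)
    qed
  next
    case False
    then have P0: "PH x (f x) = 0" using R[OF x] by (auto simp: p.prim_def split: if_splits)
    have e: "f x = wedge (\<theta> x) (contract (T x) (f x))" using dec[OF x] unfolding P0 add_0 .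
    have a': "alternating (p - 1 + q) (contract (T x) (f x))"
      using alternating_contract_alternating[OF a[OF x], of "T x"] False q by (cases p) auto
    have "has_bidegree (V10 x) (V01 x) (p - 1) q (contract (T x) (f x))"
      using b[OF x] False by (simp add: bideg_def)
    then have "bproj x N b (contract (T x) (f x)) = 0" if "b < N" "b \<noteq> q" for b
      using p.has_bidegree_bproj[OF a', of N] N that by simp
    then show ?thesis
      using N by (intro p.KK_intro[OF a[OF x] N(1)]) (subst e, auto simp: p.bproj_theta)
  qed
qed

text \<open>For k \<le> n the representative is the leading part \<alpha> of \<omega>, completed by
  \<theta> \<and> B so that the second Rumin condition holds. For k > n the leading part is zero and
  the representative is \<theta> times the leading part of the contraction with T. The hypothesis on
  d\<omega> gives congruence in the first case and the Rumin condition in the second.\<close>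

lemma local_representative:
  assumes w: "lform (p + q) V \<omega>" and K: "\<And>x. x \<in> V ==> KK x (Suc q) (\<omega> x)"
    and P: "\<And>x. x \<in> V ==> prim x (p + q) (bproj x N q (\<omega> x))"
    and P': "\<And>x. x \<in> V ==> prim x (p + q + 1) (bproj x N (Suc q) (ld \<omega> x))"
    and N: "N = p + q + 3" and q: "q \<le> n"
  obtains f where "lform (p + q) V f"
    "\<And>x. x \<in> V ==> KK x (Suc q) (f x)" "\<And>x. x \<in> V ==> KK x q (\<omega> x - f x)"
    "\<And>x. x \<in> V ==> prim x (p + q) (PH x (f x)) \<and> prim x (p + q + 1) (PH x (ld f x))"
    "\<And>x. x \<in> V ==> bideg n p q (V10 x) (V01 x) (f x)"
proof -
  define k where "k = p + q"
  define \<alpha> where "\<alpha> x = bproj x N q (\<omega> x)" for x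
  have N': "k < N" "q < N" "0 < N" "k + 1 < N" "Suc q < N" by (auto simp: N k_def)
  note w = w[folded k_def] and P = P[folded k_def \<alpha>_def] and P' = P'[folded k_def]
  have a: "lform k V \<alpha>" unfolding \<alpha>_def by (rule lform_bproj[OF w])
  have ah: "\<alpha> x \<in> hor x k" if "x \<in> V" for x
    unfolding \<alpha>_def by (rule cr_point.bproj_hor[OF point[OF that] lform_alternating[OF V w that]])
  have bb: "bproj x N b (\<alpha> x) = (if b = q then \<alpha> x else 0)" if "x \<in> V" "b < N" for x b
    unfolding \<alpha>_def using cr_point.bproj_bproj[OF point[OF that(1)] lform_alternating[OF V w that(1)] N'(1,2) that(2)] .
  show thesis
  proof (cases "k \<le> n")
    case True
    \<comment> \<open>The horizontal part of d f is \<open>PH\<close> d\<alpha> + L B, so the second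
      Rumin condition prescribes L^(n-k+1) B, which lies in degree n + (n - k + 1): a Lefschetz
      isomorphism. For k = 0 the prescribed value has degree 2 n + 1 and is zero, and B = 0.\<close>
    obtain B where B: "lform (k - 1) V B" "\<And>x. x \<in> V ==> contract (T x) (B x) = 0"
      "\<And>x. x \<in> V ==> (L x ^^ Suc (n - k)) (B x) + (L x ^^ (n - k)) (PH x (ld \<alpha> x)) = 0"
      "lform k V (\<lambda>x. wedge (\<theta> x) (B x))" "\<And>x. k = 0 ==> B x = 0"
    proof -
      have v: "lform (n + (n - k + 1)) V (\<lambda>x. - (L x ^^ (n - k)) (PH x (ld \<alpha> x)))"
      proof -
        have "Suc k + 2 * (n - k) = n + (n - k + 1)" using True by simp
        then show ?thesis
          using lform_uminus[OF V lform_wedge_pow[OF V sigma_form lform_pullback_dil[OF lform_ld[OF V a]], of "n - k" 1]]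
          by (simp only:)
      qed
      have h: "PH x (ld \<alpha> x) \<in> hor x (Suc k)" if "x \<in> V" for x
        by (rule cr_point.pullback_dil_hor[OF point[OF that] lform_alternating[OF V lform_ld[OF V a] that]])
      have vh: "(L x ^^ (n - k)) (PH x (ld \<alpha> x)) \<in> hor x (Suc k + 2 * (n - k))" if "x \<in> V" for x
        by (rule cr_point.L_pow_hor[OF point[OF that] h[OF that]])
      show thesis
      proof (cases "k = 0")
        case True
        have "(L x ^^ (n - k)) (PH x (ld \<alpha> x)) = 0" if "x \<in> V" for x
          by (rule cr_point.hor_top[OF point[OF that] vh[OF that]]) (use True in simp)
        moreover have "(L x ^^ m) 0 = 0" for x m
          by (induction m) simp_all
        ultimately show thesis
          using that[of "\<lambda>x. 0"] lform_0[OF V] True by (simp del: funpow.simps)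
      next
        case False
        obtain B where B: "lform (n - (n - k + 1)) V B" "\<And>x. x \<in> V ==> contract (T x) (B x) = 0"
          "\<And>x. x \<in> V ==> (L x ^^ (n - k + 1)) (B x) = - (L x ^^ (n - k)) (PH x (ld \<alpha> x))"
          by (rule L_surj_local[OF v]) (use cr_point.hor_T[OF point vh] False True in auto)
        have "n - (n - k + 1) = k - 1" using True False by simp
        then show thesis using that[of B] B lform_theta[of k B] False by simp
      qed
    qed
    define f where "f x = \<alpha> x + wedge (\<theta> x) (B x)" for x
    have f: "lform k V f" unfolding f_def by (rule lform_add[OF V a B(4)])
    have PHf: "PH x (f x) = \<alpha> x" if "x \<in> V" for x
      using cr_point.PH_hor[OF point[OF that] ah[OF that]] cr_point.PH_wedge_theta[OF point[OF that]] by (simp add: f_def)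
    have PHdf: "PH x (ld f x) = PH x (ld \<alpha> x) + L x (B x)" if "x \<in> V" for x
      unfolding f_def ld_add[OF V lform_sfam[OF V a] lform_sfam[OF V B(4)] that]
      using PH_ld_theta[OF B(1) that B(2)[OF that]] by simp
    have Ldf: "(L x ^^ (n - k)) (PH x (ld f x)) = 0" if "x \<in> V" for x
      using B(3)[OF that] by (simp add: PHdf[OF that] cr_point.L_pow_add[OF point[OF that]] funpow_swap1 add.commute)
    have Rf: "prim x k (PH x (f x)) \<and> prim x (k + 1) (PH x (ld f x))" if "x \<in> V" for x
      using P[OF that] Ldf[OF that] True cr_point.prim_def[OF point[OF that]]
      by (cases "k = n") (auto simp: PHf[OF that])
    have bideg: "bideg n p q (V10 x) (V01 x) (f x)" if x: "x \<in> V" for x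
    proof -
      interpret p: cr_point n "V10 x" "V01 x" "\<theta> x" "ld \<theta> x" "T x" "\<lambda>i. Z i x" "\<lambda>i. W i x" by (rule point[OF x])
      have "has_bidegree (V10 x) (V01 x) p q (f x)"
        using p.has_bidegree_bproj[of p q "f x" N] lform_alternating[OF V f x] N' bb[OF x]
        by (simp add: k_def f_def p.bproj_add p.bproj_theta)
      then show ?thesis using True by (simp add: bideg_def k_def)
    qed
    have KKf: "KK x (Suc q) (f x)" if "x \<in> V" for x
      by (rule rumin_bidegree_KK[of p q f, folded k_def, OF f Rf bideg q that])
    define \<rho> where "\<rho> x = \<omega> x - f x" for x
    have r: "lform k V \<rho>" unfolding \<rho>_def by (rule lform_diff[OF V w f])
    have Kr: "KK x (Suc q) (\<rho> x)" if "x \<in> V" for x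
      unfolding \<rho>_def by (rule cr_point.KK_simps(3)[OF point[OF that] K[OF that] KKf[OF that]])
    have zr: "bproj x N q (\<rho> x) = 0" if "x \<in> V" for x
      using bb[OF that N'(2)] cr_point.bproj_theta[OF point[OF that]]
      by (simp add: \<rho>_def f_def cr_point.bproj_diff[OF point[OF that]] cr_point.bproj_add[OF point[OF that]] \<alpha>_def)
    have "KK x q (\<rho> x)" if x: "x \<in> V" for x
    proof -
      interpret p: cr_point n "V10 x" "V01 x" "\<theta> x" "ld \<theta> x" "T x" "\<lambda>i. Z i x" "\<lambda>i. W i x" by (rule point[OF x])
      \<comment> \<open>The last obstruction to \<rho> lying in \<open>F^(p+1)\<close>. L \<delta>
        is the difference of the leading parts of d\<omega> and d f, both killed by L^(n-k); hence
        L^(n-k+1) \<delta> = 0 in degree k - 1.\<close>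
      define \<delta> where "\<delta> = bproj x N q (contract (T x) (\<rho> x))"
      have "\<delta> = 0"
      proof (cases "k = 0")
        case True
        then show ?thesis using lform_alternating[OF V r x] by (simp add: \<delta>_def)
      next
        case False
        have d: "\<delta> \<in> hor x (k - 1)"
          unfolding \<delta>_def by (rule p.bproj_hor[OF alternating_contract_alternating[OF lform_alternating[OF V r x]]])
        have "(L x ^^ (n - k)) (bproj x N (Suc q) (ld f x)) = bproj x N (Suc q + (n - k)) ((L x ^^ (n - k)) (PH x (ld f x)))"
          by (simp only: p.bproj_L_pow[OF N'(3)] p.bproj_PH)
        then have 1: "(L x ^^ (n - k)) (bproj x N (Suc q) (ld f x)) = 0" using Ldf[OF x] by simp
        have 2: "(L x ^^ (n - k)) (bproj x N (Suc q) (ld \<omega> x)) = 0"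
          using P'[OF x] True by (cases "k = n") (auto simp: p.prim_def)
        have "ld \<rho> x = ld \<omega> x - ld f x"
          unfolding \<rho>_def by (rule ld_diff[OF V lform_sfam[OF V w] lform_sfam[OF V f] x])
        then have "L x \<delta> = bproj x N (Suc q) (ld \<omega> x) - bproj x N (Suc q) (ld f x)"
          using bproj_ld_leading[OF r Kr zr N'(4,5) x] by (simp add: \<delta>_def p.bproj_diff)
        then have "(L x ^^ Suc (n - k)) \<delta> = 0"
          using 1 2 by (simp add: funpow_swap1 p.L_pow_diff)
        then show ?thesis
          by (rule p.L_pow_inj[OF d, rotated]) (use True False in simp)
      qed
      then show ?thesis
        using theta_part_kills(2)[OF r Kr zr N'(1,2) x] by (simp add: \<delta>_def)
    qed
    then show thesis
      using that[of f] f KKf Rf bideg unfolding \<rho>_def k_def[symmetric] by blast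
  next
    case False
    \<comment> \<open>Above the middle degree a primitive part is zero.\<close>
    have z: "bproj x N q (\<omega> x) = 0" if "x \<in> V" for x
      using P[OF that] False cr_point.prim_def[OF point[OF that]] by (simp add: \<alpha>_def)
    define B where "B x = bproj x N q (contract (T x) (\<omega> x))" for x
    define f where "f x = wedge (\<theta> x) (B x)" for x
    have B: "lform (k - 1) V B" unfolding B_def by (rule lform_bproj[OF lform_T[OF w]])
    have f: "lform k V f" unfolding f_def using lform_theta[OF B] False by simp
    have Kr: "KK x q (\<omega> x - f x)" if "x \<in> V" for x
      using theta_part_kills(2)[OF w K z N'(1,2) that] by (simp add: f_def B_def)
    have aT: "alternating (k - 1) (contract (T x) (\<omega> x))" if "x \<in> V" for x
      by (rule alternating_contract_alternating[OF lform_alternating[OF V w that]])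
    have Bh: "B x \<in> hor x (k - 1)" if "x \<in> V" for x
      unfolding B_def by (rule cr_point.bproj_hor[OF point[OF that] aT[OF that]])
    have Tf: "contract (T x) (f x) = B x" if "x \<in> V" for x
      unfolding f_def by (rule cr_point.contract_T_wedge_theta[OF point[OF that] cr_point.hor_T[OF point[OF that] Bh[OF that]]])
    have bB: "bproj x N b (B x) = (if b = q then B x else 0)" if "x \<in> V" "b < N" for x b
      unfolding B_def using cr_point.bproj_bproj[OF point[OF that(1)] aT[OF that(1)] _ N'(2) that(2)] N' by simp
    \<comment> \<open>L B is the leading part of d\<omega>, which is primitive of degree above
      n.\<close>
    have "L x (B x) = 0" if x: "x \<in> V" for x
      using bproj_ld_leading[OF w K z N'(4,5) x] P'[OF x] False cr_point.prim_def[OF point[OF x]]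
      by (simp add: B_def)
    then have Rf: "prim x k (PH x (f x)) \<and> prim x (k + 1) (PH x (ld f x))" if "x \<in> V" for x
      using PH_ld_theta[OF B that cr_point.hor_T[OF point[OF that] Bh[OF that]]] that
        cr_point.PH_wedge_theta[OF point[OF that]] cr_point.prim_simps(1)[OF point[OF that]]
      unfolding f_def[abs_def] by simp
    have bideg: "bideg n p q (V10 x) (V01 x) (f x)" if x: "x \<in> V" for x
    proof -
      interpret p: cr_point n "V10 x" "V01 x" "\<theta> x" "ld \<theta> x" "T x" "\<lambda>i. Z i x" "\<lambda>i. W i x" by (rule point[OF x])
      have p: "0 < p" using False q by (simp add: k_def)
      have "alternating (p - 1 + q) (B x)" using p.hor_alternating[OF Bh[OF x]] p by (simp add: k_def)
      then have "has_bidegree (V10 x) (V01 x) (p - 1) q (B x)"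
        using p.has_bidegree_bproj[of "p - 1" q "B x" N] N' p bB[OF x] by (simp add: k_def)
      then have "\<forall>v. has_bidegree (V10 x) (V01 x) (p - 1) q (contract v (f x))"
        using p.bideg_T[of p q "f x"] lform_alternating[OF V f x] p.PH_wedge_theta Tf[OF x]
        by (simp add: k_def f_def)
      then show ?thesis using False by (simp add: bideg_def k_def)
    qed
    from that[of f] f rumin_bidegree_KK[of p q f, folded k_def, OF f Rf bideg q] Rf Kr bideg show thesis
      unfolding k_def[symmetric] by blast
  qed
qed

text \<open>Smooth solvability of L^m \<gamma> = L^i \<alpha> comes from
  \<open>L_surj_local\<close>. If n < m, both sides exceed the top degree and \<gamma> = 0. That
  \<eta> lies in \<open>F^p\<close> follows by comparing components in this equation, using
  injectivity of L^m.\<close>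

lemma local_corrector:
  assumes w: "lform (p + q) V \<omega>" and p: "p \<le> n + 1"
  obtains \<eta> where "lform (p + q - 1) V \<eta>" "\<And>x. x \<in> V ==> KK x q (\<eta> x)"
    "\<And>x. x \<in> V ==> corrects n (p + q) q (V10 x) (V01 x) (\<theta> x) (ld \<theta> x) (\<omega> x) (\<eta> x)"
proof -
  define k where "k = p + q"
  define i j m where "i = n + 1 - k" and "j = k - n - 1" and "m = i + j + 1"
  define N where "N = k + 3"
  have N: "k < N" "q < N" "0 < N" by (auto simp: N_def k_def)
  note w = w[folded k_def]
  define \<alpha> where "\<alpha> x = bproj x N q (\<omega> x)" for x
  have a: "lform k V \<alpha>" unfolding \<alpha>_def by (rule lform_bproj[OF w])
  have ah: "\<alpha> x \<in> hor x k" if "x \<in> V" for x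
    unfolding \<alpha>_def by (rule cr_point.bproj_hor[OF point[OF that] lform_alternating[OF V w that]])
  \<comment> \<open>Both sides of the equation for \<gamma> have degree n + m, which places \<gamma>
    in degree n - m, where L^m is the Lefschetz isomorphism.\<close>
  have km: "k + 2 * i = n + m" by (cases "k \<le> n") (auto simp: i_def j_def m_def)
  have vh: "(L x ^^ i) (\<alpha> x) \<in> hor x (n + m)" if "x \<in> V" for x
    using cr_point.L_pow_hor[OF point[OF that] ah[OF that], of i] by (simp only: km)
  have v: "lform (n + m) V (\<lambda>x. (L x ^^ i) (\<alpha> x))"
    using lform_wedge_pow[OF V sigma_form a, of i] by (simp only: km)
  obtain \<gamma> where g: "lform (n - m) V \<gamma>" "\<And>x. x \<in> V ==> contract (T x) (\<gamma> x) = 0"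
    "\<And>x. x \<in> V ==> (L x ^^ m) (\<gamma> x) = (L x ^^ i) (\<alpha> x)" "n < m ==> \<gamma> = (\<lambda>x. 0)"
  proof (cases "n < m")
    case True
    have "(L x ^^ i) (\<alpha> x) = 0" if "x \<in> V" for x
      by (rule cr_point.hor_top[OF point[OF that] vh[OF that]]) (use True in simp)
    moreover have "(L x ^^ m) 0 = 0" for x by (induction m) simp_all
    ultimately show thesis using that[of "\<lambda>x. 0"] lform_0[OF V] by simp
  next
    case False
    obtain \<gamma> where "lform (n - m) V \<gamma>" "\<And>x. x \<in> V ==> contract (T x) (\<gamma> x) = 0"
      "\<And>x. x \<in> V ==> (L x ^^ m) (\<gamma> x) = (L x ^^ i) (\<alpha> x)"
      by (rule L_surj_local[OF v]) (use cr_point.hor_T[OF point vh] False in auto)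
    then show thesis using that[of \<gamma>] False by blast
  qed
  have gh: "\<gamma> x \<in> hor x (n - m)" if "x \<in> V" for x
    using lform_alternating[OF V g(1) that] g(2)[OF that] cr_point.hor_def[OF point[OF that]] by simp
  define X where "X x = (L x ^^ j) (\<gamma> x)" for x
  have X: "lform (k - 2) V X"
  proof (cases "n < m")
    case True
    have "(L x ^^ j) 0 = 0" for x by (induction j) simp_all
    then have "X = (\<lambda>x. 0)" using g(4)[OF True] by (intro ext) (simp only: X_def)
    then show ?thesis using lform_0[OF V] by (simp only:)
  next
    case False
    then have "n - m + 2 * j = k - 2" by (cases "k \<le> n") (auto simp: i_def j_def m_def)
    then show ?thesis using lform_wedge_pow[OF V sigma_form g(1), of j] unfolding X_def[abs_def] by (simp only:)
  qed
  have eta: "lform (k - 1) V (\<lambda>x. wedge (\<theta> x) (X x))"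
  proof (cases "2 \<le> k")
    case True
    then have "k - 1 - 1 = k - 2" by simp
    then show ?thesis using lform_theta[of "k - 1" X] X True by simp
  next
    case False
    then have "n < m" by (auto simp: i_def j_def m_def)
    moreover have "(L x ^^ j) 0 = 0" for x by (induction j) simp_all
    ultimately have "X = (\<lambda>x. 0)" using g(4) by (intro ext) (simp only: X_def)
    then show ?thesis using lform_0[OF V] by simp
  qed
  have cor: "corrects n k q (V10 x) (V01 x) (\<theta> x) (ld \<theta> x) (\<omega> x) (wedge (\<theta> x) (X x))" if x: "x \<in> V" for x
  proof -
    interpret p: cr_point n "V10 x" "V01 x" "\<theta> x" "ld \<theta> x" "T x" "\<lambda>i. Z i x" "\<lambda>i. W i x" by (rule point[OF x])
    have "(L x ^^ i) ((L x ^^ (j + 1)) (\<gamma> x)) = (L x ^^ i) (\<alpha> x)"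
      using g(3)[OF x] unfolding m_def add.assoc funpow_add[of i] by simp
    then have "(L x ^^ i) (bproj x N q (\<omega> x) - (L x ^^ (j + 1)) (\<gamma> x)) = 0"
      by (simp only: p.L_pow_diff \<alpha>_def[symmetric] diff_self)
    then show ?thesis
      using p.correctsI[OF lform_alternating[OF V w x] N(1,2), of "\<gamma> x"] g(4) gh[OF x]
      unfolding X_def i_def[symmetric] j_def[symmetric] m_def[symmetric] by (auto simp: fun_eq_iff fun_apply)
  qed
  have "KK x q (wedge (\<theta> x) (X x))" if x: "x \<in> V" for x
  proof -
    interpret p: cr_point n "V10 x" "V01 x" "\<theta> x" "ld \<theta> x" "T x" "\<lambda>i. Z i x" "\<lambda>i. W i x" by (rule point[OF x])
    have XT: "contract (T x) (X x) = 0"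
      unfolding X_def using p.hor_T[OF p.L_pow_hor[OF gh[OF x]]] .
    have "KK x q (X x)"
    proof (rule p.KK_intro[OF lform_alternating[OF V X x], of N])
      fix b assume b: "q \<le> b" "b \<le> k - 2"
      have ba: "bproj x N (b + 1) (\<alpha> x) = 0"
        unfolding \<alpha>_def using p.bproj_bproj[OF lform_alternating[OF V w x] N(1,2), of "b + 1"] b by (simp add: N_def)
      \<comment> \<open>The bound p \<le> n + 1 yields j \<le> q.\<close>
      have jb: "j \<le> b" using b p by (simp add: j_def k_def)
      define c where "c = b - j"
      have c: "b = c + j" using jb by (simp add: c_def)
      \<comment> \<open>L^m takes component c of \<gamma> to component b + 1 + i of L^i \<alpha>,
        which is zero because \<alpha> is concentrated in the component q < b + 1.\<close>
      have "(L x ^^ m) (bproj x N c (\<gamma> x)) = bproj x N (c + m) ((L x ^^ i) (\<alpha> x))"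
        by (simp only: p.bproj_L_pow[OF N(3), symmetric] g(3)[OF x])
      also have "c + m = b + 1 + i" using c by (simp add: m_def)
      also have "bproj x N (b + 1 + i) ((L x ^^ i) (\<alpha> x)) = 0"
        by (simp only: p.bproj_L_pow[OF N(3)] ba p.L_pow_0)
      finally have "(L x ^^ m) (bproj x N c (\<gamma> x)) = 0" .
      then have "bproj x N c (\<gamma> x) = 0"
      proof (cases "n < m")
        case False
        assume "(L x ^^ m) (bproj x N c (\<gamma> x)) = 0"
        then show ?thesis
          by (rule p.L_pow_inj[OF p.bproj_hor[OF p.hor_alternating[OF gh[OF x]]], rotated]) (use False in simp)
      qed (simp add: g(4) p.bproj_0)
      then show "bproj x N b (X x) = 0"
        unfolding c X_def by (simp only: p.bproj_L_pow[OF N(3)] p.L_pow_0)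
    qed (use N XT p.bproj_0 in auto)
    then show ?thesis by (rule p.KK_theta)
  qed
  then show thesis using that[of "\<lambda>x. wedge (\<theta> x) (X x)"] eta cor unfolding k_def by blast
qed

text \<open>The horizontal part of d\<eta> is L^(j+1) \<gamma>, so the equation in
  \<open>corrects\<close> is the primitivity sought, up to projection to the leading
  component.\<close>

lemma prim_part_corrected:
  assumes w: "lform (p + q) V \<omega>" and e: "lform (p + q - 1) V \<eta>"
    and c: "\<And>x. x \<in> V ==> corrects n (p + q) q (V10 x) (V01 x) (\<theta> x) (ld \<theta> x) (\<omega> x) (\<eta> x)" and x: "x \<in> V"
  shows "prim_part n (p + q) q (V10 x) (V01 x) (\<theta> x) (ld \<theta> x) (\<omega> x - ld \<eta> x)"
proof -
  define k where "k = p + q"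
  define i j m where "i = n + 1 - k" and "j = k - n - 1" and "m = i + j + 1"
  define N where "N = k + 3"
  have N: "k < N" "q < N" "0 < N" by (auto simp: N_def k_def)
  note w = w[folded k_def] and e = e[folded k_def] and c = c[folded k_def]
  define X where "X y = contract (T y) (\<eta> y)" for y
  have X: "lform (k - 1 - 1) V X" unfolding X_def by (rule lform_T[OF e])
  have g: "\<exists>\<gamma>. (n < m --> \<gamma> = 0) \<and> \<gamma> \<in> hor y (n - m) \<and> \<eta> y = wedge (\<theta> y) ((L y ^^ j) \<gamma>) \<and>
      (L y ^^ i) (bproj y N q (\<omega> y) - (L y ^^ (j + 1)) \<gamma>) = 0" if y: "y \<in> V" for y
    using cr_point.correctsE[OF point[OF y] c[OF y] lform_alternating[OF V w y] N(1,2)]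
    unfolding i_def j_def m_def by metis
  have eX: "\<eta> y = wedge (\<theta> y) (X y)" if y: "y \<in> V" for y
  proof -
    obtain \<gamma> where \<gamma>: "\<gamma> \<in> hor y (n - m)" "\<eta> y = wedge (\<theta> y) ((L y ^^ j) \<gamma>)" using g[OF y] by blast
    have "X y = (L y ^^ j) \<gamma>"
      unfolding X_def \<gamma>(2)
      by (rule cr_point.contract_T_wedge_theta[OF point[OF y] cr_point.hor_T[OF point[OF y] cr_point.L_pow_hor[OF point[OF y] \<gamma>(1)]]])
    then show ?thesis using \<gamma>(2) by simp
  qed
  interpret p: cr_point n "V10 x" "V01 x" "\<theta> x" "ld \<theta> x" "T x" "\<lambda>i. Z i x" "\<lambda>i. W i x" by (rule point[OF x])
  obtain \<gamma> where \<gamma>: "n < m ==> \<gamma> = 0" "\<gamma> \<in> hor x (n - m)" "\<eta> x = wedge (\<theta> x) ((L x ^^ j) \<gamma>)"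
    "(L x ^^ i) (bproj x N q (\<omega> x) - (L x ^^ (j + 1)) \<gamma>) = 0" using g[OF x] by blast
  have Xg: "X x = (L x ^^ j) \<gamma>"
    unfolding X_def \<gamma>(3) by (rule p.contract_T_wedge_theta[OF p.hor_T[OF p.L_pow_hor[OF \<gamma>(2)]]])
  have XT: "contract (T x) (X x) = 0" unfolding Xg by (rule p.hor_T[OF p.L_pow_hor[OF \<gamma>(2)]])
  have "ld \<eta> x = ld (\<lambda>y. wedge (\<theta> y) (X y)) x"
    by (rule ld_cong[OF V eX lform_sfam[OF V e] x])
  then have PHd: "PH x (ld \<eta> x) = (L x ^^ (j + 1)) \<gamma>"
    using PH_ld_theta[OF X x XT] by (simp add: Xg)
  \<comment> \<open>The horizontal part of d\<eta> is not projected in the equation; taking the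
    component q + i of the whole equation isolates the leading component.\<close>
  have "bproj x N (q + i) ((L x ^^ i) (bproj x N q (\<omega> x) - PH x (ld \<eta> x))) = 0"
    by (simp only: PHd \<gamma>(4) p.bproj_0)
  moreover have "bproj x N q (bproj x N q (\<omega> x)) = bproj x N q (\<omega> x)"
    using p.bproj_bproj[OF lform_alternating[OF V w x] N(1,2,2)] by simp
  ultimately have L0: "(L x ^^ i) (bproj x N q (\<omega> x - ld \<eta> x)) = 0"
    by (simp only: p.bproj_L_pow[OF N(3)] p.bproj_diff p.bproj_PH)
  \<comment> \<open>For k = 0 the truncated degree k - 1 would give d\<eta> the degree 1; but then n
    < m, so \<gamma> and hence \<eta> vanish.\<close>
  have ak: "alternating k (\<omega> x - ld \<eta> x)"
  proof (cases "k = 0")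
    case True
    then have "n < m" by (simp add: i_def m_def)
    then have "\<eta> y = 0" if "y \<in> V" for y
      using g[OF that] cr_point.L_pow_0[OF point[OF that]] by auto
    then have "ld \<eta> x = ld (\<lambda>y. 0) x"
      by (rule ld_cong[OF V _ lform_sfam[OF V e] x])
    then show ?thesis using lform_alternating[OF V w x] by (simp add: ld_0[OF V])
  next
    case False
    then have "Suc (k - 1) = k" by simp
    then show ?thesis
      using alternating_diff[OF lform_alternating[OF V w x] lform_alternating[OF V lform_ld[OF V e] x, unfolded \<open>Suc (k - 1) = k\<close>]] by blast
  qed
  show ?thesis
    unfolding k_def[symmetric] p.prim_part_iff[OF ak N(1,2)] using L0 by (cases "k \<le> n") (auto simp: p.prim_def i_def)
qed

end

section \<open>Forms on a manifold\<close>

lemma form_add_plus: "form_add = (+)"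
  by (auto simp: form_add_def fun_eq_iff fun_apply)

lemma form_zero_0: "form_zero = 0"
  by (auto simp: form_zero_def fun_eq_iff fun_apply)

lemma form_scale_apply: "form_scale a \<omega> c x = cscale a (\<omega> c x)"
  by (auto simp: form_scale_def cscale_def)

lemma form_scale_simps [simp]:
  "form_scale a (\<omega> + \<eta>) = form_scale a \<omega> + form_scale a \<eta>" "form_scale (a + b) \<omega> = form_scale a \<omega> + form_scale b \<omega>"
  "form_scale a (form_scale b \<omega>) = form_scale (a * b) \<omega>" "form_scale 1 \<omega> = \<omega>" "form_scale a 0 = 0"
  "form_scale 0 \<omega> = 0" "form_scale a (- \<omega>) = - form_scale a \<omega>" "form_scale (- a) \<omega> = - form_scale a \<omega>"
  "form_scale a (\<omega> - \<eta>) = form_scale a \<omega> - form_scale a \<eta>"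
  by (auto simp: form_scale_def fun_eq_iff fun_apply algebra_simps)

lemma re_cext [simp]: "re_vec (cext L z) = L (re_vec z)" and im_cext [simp]: "im_vec (cext L z) = L (im_vec z)"
  by (simp_all add: cext_def)

lemma cext_compose: "cext L (cext K z) = cext (\<lambda>v. L (K v)) z"
  by (simp add: cext_def[of L] cext_def[of "\<lambda>v. L (K v)"])

lemma cext_ident: "cext (\<lambda>v. v) z = z"
  by (simp add: cext_def cvec_re_im)

lemma cnj_cext: "linear L ==> cnj_vec (cext L z) = cext L (cnj_vec z)"
  by (simp add: cext_def linear_neg)

lemma lform_subset: "lform k V f ==> V' \<subseteq> V ==> lform k V' f"
  unfolding lform_def sfam_def using smooth_on_subset by blast

context smooth_manifold
begin

section \<open>Charts, coordinate domains and transition maps\<close>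

lemma chart_topspace: "c \<in> A ==> fst c \<subseteq> topspace M"
  using chart_open openin_subset by blast

lemma inj_chart: "c \<in> A ==> inj_on (snd c) (fst c)"
  using homeomorphic_imp_injective_map[OF chart_homeomorphic, of c] Int_absorb1[OF chart_topspace, of c]
  by simp

lemma transition_chart: "c \<in> A ==> p \<in> fst c ==> transition c c' (snd c p) = snd c' p"
  by (simp add: transition_def inv_into_f_f inj_chart)

lemma open_coords:
  assumes "c \<in> A" "openin M U" shows "open (coords c U)"
proof -
  have "openin (subtopology M (fst c)) (fst c \<inter> U)"
    using assms by (auto simp: openin_subtopology)
  then have "openin (top_of_set (snd c ` fst c)) (snd c ` (fst c \<inter> U))"
    using homeomorphic_imp_open_map[OF chart_homeomorphic[OF assms(1)]] unfolding open_map_def by blast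
  then show ?thesis
    using chart_image_open[OF assms(1)] openin_open_eq unfolding coords_def by blast
qed

lemma coords_mono: "U \<subseteq> U' ==> coords c U \<subseteq> coords c U'"
  by (auto simp: coords_def)

lemma coords_top: "c \<in> A ==> coords c (topspace M) = snd c ` fst c"
  using chart_topspace[of c] by (auto simp: coords_def)

lemma coords_sub_top: "openin M U ==> coords c U \<subseteq> coords c (topspace M)"
  by (rule coords_mono) (rule openin_subset)

lemma coords_Int: "c \<in> A ==> coords c (U \<inter> U') = coords c U \<inter> coords c U'"
  using inj_chart[of c] by (auto simp: coords_def inj_on_def)

lemma coordsE:
  assumes "x \<in> coords c U" obtains p where "p \<in> fst c" "p \<in> U" "x = snd c p"
  using assms by (auto simp: coords_def)

lemma coordsI: "p \<in> fst c ==> p \<in> U ==> snd c p \<in> coords c U"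
  by (auto simp: coords_def)

lemma open_from_coords:
  assumes "c \<in> A" "open V" "V \<subseteq> coords c (topspace M)"
  obtains U where "openin M U" "U \<subseteq> fst c" "coords c U = V"
proof
  define U where "U = {p \<in> fst c. snd c p \<in> V}"
  have im: "snd c ` U = V"
    using assms(3) unfolding coords_top[OF assms(1)] by (auto simp: U_def)
  show "U \<subseteq> fst c" by (auto simp: U_def)
  have "openin (top_of_set (snd c ` fst c)) (snd c ` U)"
    using im assms chart_image_open[OF assms(1)] coords_top[OF assms(1)] openin_open_eq by blast
  then have "openin (subtopology M (fst c)) U"
    using homeomorphic_map_openness[OF chart_homeomorphic[OF assms(1)], of U] chart_topspace[OF assms(1)]
    by (auto simp: U_def)
  then show "openin M U"
    using chart_open[OF assms(1)] openin_open_subtopology by blast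
  show "coords c U = V" using im by (auto simp: coords_def U_def)
qed

lemma transition_mem: "c \<in> A ==> x \<in> coords c (U \<inter> fst c') ==> transition c c' x \<in> coords c' (U \<inter> fst c)"
  by (auto elim!: coordsE simp: transition_chart intro!: coordsI)

lemma smooth_transition: "c \<in> A ==> c' \<in> A ==> smooth_on (coords c (fst c')) (transition c c')"
  by (rule chart_compatible)

lemma transition_differentiable:
  "c \<in> A ==> c' \<in> A ==> x \<in> coords c (fst c') ==> transition c c' differentiable (at x)"
  using smooth_on_differentiable[OF smooth_transition] .

lemma dtransition_linear:
  "c \<in> A ==> c' \<in> A ==> x \<in> coords c (fst c') ==>
    dtransition c c' x (v + a *s w) = dtransition c c' x v + a *s dtransition c c' x w"
  unfolding dtransition_def by (rule cext_linear, rule linear_frechet_derivative, rule transition_differentiable)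

lemma dtransition_cnj:
  "c \<in> A ==> c' \<in> A ==> x \<in> coords c (fst c') ==>
    cnj_vec (dtransition c c' x v) = dtransition c c' x (cnj_vec v)"
  unfolding dtransition_def by (rule cnj_cext, rule linear_frechet_derivative, rule transition_differentiable)

lemma dtransition_compose:
  assumes "c \<in> A" "c' \<in> A" "c'' \<in> A" "x \<in> coords c (fst c' \<inter> fst c'')"
  shows "dtransition c' c'' (transition c c' x) (dtransition c c' x v) = dtransition c c'' x v"
proof -
  have x': "x \<in> coords c (fst c')" "transition c c' x \<in> coords c' (fst c'')"
    using assms by (auto elim!: coordsE simp: transition_chart intro!: coordsI)
  have "(transition c' c'' \<circ> transition c c' has_derivative
      frechet_derivative (transition c' c'') (at (transition c c' x)) \<circ> frechet_derivative (transition c c') (at x)) (at x)"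
    using transition_differentiable[OF assms(1,2) x'(1)] transition_differentiable[OF assms(2,3) x'(2)]
    unfolding frechet_derivative_works by (rule diff_chain_at)
  then have "(transition c c'' has_derivative
      frechet_derivative (transition c' c'') (at (transition c c' x)) \<circ> frechet_derivative (transition c c') (at x)) (at x)"
    by (rule has_derivative_transform_within_open[OF _ open_coords[OF assms(1) openin_Int[OF chart_open chart_open]] assms(4)])
      (use assms in \<open>auto elim!: coordsE simp: transition_chart\<close>)
  then have "frechet_derivative (transition c c'') (at x) =
      frechet_derivative (transition c' c'') (at (transition c c' x)) \<circ> frechet_derivative (transition c c') (at x)"
    by (rule frechet_derivative_at[symmetric])
  then show ?thesis
    unfolding dtransition_def cext_compose by (simp add: o_def)
qed

lemma dtransition_ident:
  assumes "c \<in> A" "x \<in> coords c (fst c)" shows "dtransition c c x v = v"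
proof -
  have "(transition c c has_derivative (\<lambda>v. v)) (at x)"
    by (rule has_derivative_transform_within_open[OF has_derivative_ident open_coords[OF assms(1) chart_open] assms(2)])
      (use assms in \<open>auto elim!: coordsE simp: transition_chart\<close>)
  then have "frechet_derivative (transition c c) (at x) = (\<lambda>v. v)"
    by (rule frechet_derivative_at[symmetric])
  then show ?thesis by (simp add: dtransition_def cext_ident)
qed

lemma dtransition_inverse:
  assumes "c \<in> A" "c' \<in> A" "x \<in> coords c (fst c')"
  shows "dtransition c' c (transition c c' x) (dtransition c c' x v) = v"
proof -
  have "x \<in> coords c (fst c' \<inter> fst c)" "x \<in> coords c (fst c)" using assms(3) by (auto simp: coords_def)
  then show ?thesis using dtransition_compose[OF assms(1,2,1)] dtransition_ident[OF assms(1)] by simp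
qed

lemma inj_dtransition: "c \<in> A ==> c' \<in> A ==> x \<in> coords c (fst c') ==> inj (dtransition c c' x)"
  by (metis dtransition_inverse injI)

section \<open>Forms and the exterior derivative in all charts\<close>

lemma forms_iff:
  "\<omega> \<in> forms k U \<longleftrightarrow>
    (\<forall>c x. \<not> (c \<in> A \<and> x \<in> coords c U) --> \<omega> c x = 0) \<and> (\<forall>c\<in>A. lform k (coords c U) (\<omega> c)) \<and>
    (\<forall>c\<in>A. \<forall>c'\<in>A. \<forall>x\<in>coords c (U \<inter> fst c'). \<omega> c x = pullback (dtransition c c' x) (\<omega> c' (transition c c' x)))"
  by (auto simp: forms_def lform_def sfam_def alt_covector_iff_alternating pullback_def fun_eq_iff fun_apply)

lemma forms_0: "\<omega> \<in> forms k U ==> \<not> (c \<in> A \<and> x \<in> coords c U) ==> \<omega> c x = 0"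
  and forms_lform: "\<omega> \<in> forms k U ==> c \<in> A ==> lform k (coords c U) (\<omega> c)"
  and forms_pullback: "\<omega> \<in> forms k U ==> c \<in> A ==> c' \<in> A ==> x \<in> coords c (U \<inter> fst c') ==>
    \<omega> c x = pullback (dtransition c c' x) (\<omega> c' (transition c c' x))"
  unfolding forms_iff by blast+

lemma forms_alternating: "\<omega> \<in> forms k U ==> alternating k (\<omega> c x)"
  using forms_0[of \<omega> k U c x] forms_lform[of \<omega> k U c] by (cases "c \<in> A \<and> x \<in> coords c U") (auto simp: lform_def)

lemma forms_add:
  assumes U: "openin M U" and w: "\<omega> \<in> forms k U" "\<eta> \<in> forms k U" shows "\<omega> + \<eta> \<in> forms k U"
proof -
  have e: "(\<omega> + \<eta>) c = (\<lambda>y. \<omega> c y + \<eta> c y)" "(\<omega> + \<eta>) c x = \<omega> c x + \<eta> c x" for c x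
    by (simp_all add: fun_eq_iff fun_apply)
  show ?thesis
    unfolding forms_iff
  proof (intro conjI ballI allI impI)
    show "lform k (coords c U) ((\<omega> + \<eta>) c)" if "c \<in> A" for c
      unfolding e(1) using lform_add[OF open_coords[OF that U] forms_lform[OF w(1) that] forms_lform[OF w(2) that]] .
    show "(\<omega> + \<eta>) c x = pullback (dtransition c c' x) ((\<omega> + \<eta>) c' (transition c c' x))"
      if "c \<in> A" "c' \<in> A" "x \<in> coords c (U \<inter> fst c')" for c c' x
      unfolding e(2) pullback_simps using forms_pullback[OF w(1) that] forms_pullback[OF w(2) that] by simp
    show "(\<omega> + \<eta>) c x = 0" if "\<not> (c \<in> A \<and> x \<in> coords c U)" for c x
      unfolding e(2) forms_0[OF w(1) that] forms_0[OF w(2) that] by simp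
  qed
qed

lemma forms_scale:
  assumes U: "openin M U" and w: "\<omega> \<in> forms k U" shows "form_scale a \<omega> \<in> forms k U"
proof -
  have e: "form_scale a \<omega> c = (\<lambda>y. cscale a (\<omega> c y))" for c
    by (simp add: fun_eq_iff form_scale_apply)
  show ?thesis
    unfolding forms_iff
  proof (intro conjI ballI allI impI)
    show "lform k (coords c U) (form_scale a \<omega> c)" if "c \<in> A" for c
      unfolding e using lform_cscale[OF open_coords[OF that U] smooth_on_const forms_lform[OF w that]] .
    show "form_scale a \<omega> c x = pullback (dtransition c c' x) (form_scale a \<omega> c' (transition c c' x))"
      if "c \<in> A" "c' \<in> A" "x \<in> coords c (U \<inter> fst c')" for c c' x
      unfolding form_scale_apply pullback_simps using forms_pullback[OF w that] by simp
    show "form_scale a \<omega> c x = 0" if "\<not> (c \<in> A \<and> x \<in> coords c U)" for c x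
      unfolding form_scale_apply forms_0[OF w that] by simp
  qed
qed

lemma forms_zero: "openin M U ==> 0 \<in> forms k U"
proof -
  assume U: "openin M U"
  have e: "(0 :: ('a, 'm) dform) c = (\<lambda>y. 0)" for c by (simp add: fun_eq_iff fun_apply)
  show ?thesis
    unfolding forms_iff e using lform_0[OF open_coords[OF _ U]] by simp
qed

lemma forms_uminus: "openin M U ==> \<omega> \<in> forms k U ==> - \<omega> \<in> forms k U"
  using forms_scale[of U \<omega> k "-1"] by simp

lemma forms_diff: "openin M U ==> \<omega> \<in> forms k U ==> \<eta> \<in> forms k U ==> \<omega> - \<eta> \<in> forms k U"
  using forms_add[of U \<omega> k "- \<eta>"] forms_uminus[of U \<eta> k] by simp

lemma forms_eqI:
  "\<omega> \<in> forms k U ==> \<eta> \<in> forms k U ==> (\<And>c x. c \<in> A ==> x \<in> coords c U ==> \<omega> c x = \<eta> c x) ==> \<omega> = \<eta>"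
proof (intro ext)
  fix c x vs
  assume *: "\<omega> \<in> forms k U" "\<eta> \<in> forms k U" "\<And>c x. c \<in> A ==> x \<in> coords c U ==> \<omega> c x = \<eta> c x"
  show "\<omega> c x vs = \<eta> c x vs"
    using *(3) forms_0[OF *(1)] forms_0[OF *(2)] by (cases "c \<in> A \<and> x \<in> coords c U") auto
qed

lemma ext_d_ld: "c \<in> A ==> x \<in> coords c U ==> ext_d U \<omega> c x = ld (\<omega> c) x"
proof
  fix vs assume "c \<in> A" "x \<in> coords c U"
  then show "ext_d U \<omega> c x vs = ld (\<omega> c) x vs"
    using altsum_const[of "\<lambda>ws. cderiv (\<lambda>y. \<omega> c y (tl ws)) x (hd ws)" vs] by (simp add: ext_d_def ld_def)
qed

lemma ext_d_0: "\<not> (c \<in> A \<and> x \<in> coords c U) ==> ext_d U \<omega> c x = 0"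
  by (auto simp: ext_d_def fun_eq_iff fun_apply)

text \<open>Compatibility with coordinate changes is the naturality \<open>ld_pullback\<close>,
  applied on the open overlap of two charts.\<close>

lemma ext_d_forms:
  assumes U: "openin M U" and w: "\<omega> \<in> forms k U"
  shows "ext_d U \<omega> \<in> forms (Suc k) U"
  unfolding forms_iff
proof (intro conjI ballI allI impI)
  show "lform (Suc k) (coords c U) (ext_d U \<omega> c)" if "c \<in> A" for c
    using that by (intro lform_cong[OF open_coords[OF that U] _ lform_ld[OF open_coords[OF that U] forms_lform[OF w that]]])
      (simp add: ext_d_ld)
  show "ext_d U \<omega> c x = pullback (dtransition c c' x) (ext_d U \<omega> c' (transition c c' x))"
    if c: "c \<in> A" "c' \<in> A" "x \<in> coords c (U \<inter> fst c')" for c c' x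
  proof -
    define V where "V = coords c (U \<inter> fst c')"
    have V: "open V" unfolding V_def by (intro open_coords c openin_Int U chart_open)
    have VU: "V \<subseteq> coords c U" "V \<subseteq> coords c (fst c')" unfolding V_def by (auto intro!: coords_mono)
    have im: "transition c c' ` V \<subseteq> coords c' U"
      using transition_mem[OF c(1)] coords_mono[of "U \<inter> fst c" U c'] unfolding V_def by blast
    have s: "sfam V (\<omega> c)"
      using lform_sfam[OF V lform_subset[OF forms_lform[OF w c(1)] VU(1)]] .
    have "ld (\<omega> c) x = ld (\<lambda>y. pullback (cext (frechet_derivative (transition c c') (at y))) (\<omega> c' (transition c c' y))) x"
      by (rule ld_cong[OF V _ s]) (use forms_pullback[OF w c(1,2)] c(3) in \<open>auto simp: V_def dtransition_def\<close>)
    also have "\<dots> = pullback (dtransition c c' x) (ld (\<omega> c') (transition c c' x))"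
      unfolding dtransition_def
      by (rule ld_pullback[OF V open_coords[OF c(2) U] smooth_on_subset[OF smooth_transition[OF c(1,2)] VU(2)] im forms_lform[OF w c(2)]])
        (use c(3) V_def in simp)
    finally show ?thesis
      using c(3) VU(1) im c(1,2) by (subst (1 2) ext_d_ld) (auto simp: V_def)
  qed
qed (use ext_d_0 in blast)

lemma ext_d_add:
  assumes "openin M U" "\<omega> \<in> forms k U" "\<eta> \<in> forms k U"
  shows "ext_d U (\<omega> + \<eta>) = ext_d U \<omega> + ext_d U \<eta>"
proof (intro ext)
  fix c x vs
  show "ext_d U (\<omega> + \<eta>) c x vs = (ext_d U \<omega> + ext_d U \<eta>) c x vs"
  proof (cases "c \<in> A \<and> x \<in> coords c U")
    case True
    have "(\<omega> + \<eta>) c = (\<lambda>y. \<omega> c y + \<eta> c y)" by (simp add: fun_eq_iff fun_apply)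
    with True show ?thesis
      using ld_add[OF open_coords[of c U] lform_sfam[OF _ forms_lform[OF assms(2)]] lform_sfam[OF _ forms_lform[OF assms(3)]]]
        open_coords[of c U] assms(1) by (simp add: ext_d_ld fun_apply)
  qed (simp add: ext_d_0 fun_apply)
qed

lemma ext_d_scale:
  assumes "openin M U" "\<omega> \<in> forms k U"
  shows "ext_d U (form_scale a \<omega>) = form_scale a (ext_d U \<omega>)"
proof (intro ext)
  fix c x vs
  show "ext_d U (form_scale a \<omega>) c x vs = form_scale a (ext_d U \<omega>) c x vs"
  proof (cases "c \<in> A \<and> x \<in> coords c U")
    case True
    have "form_scale a \<omega> c = (\<lambda>y. cscale a (\<omega> c y))" by (simp add: fun_eq_iff form_scale_apply)
    with True show ?thesis
      using ld_cmult[OF open_coords[of c U] lform_sfam[OF _ forms_lform[OF assms(2)]]]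
        open_coords[of c U] assms(1) by (simp add: ext_d_ld form_scale_apply)
  qed (simp add: ext_d_0 form_scale_apply)
qed

lemma ext_d_diff:
  assumes "openin M U" "\<omega> \<in> forms k U" "\<eta> \<in> forms k U"
  shows "ext_d U (\<omega> - \<eta>) = ext_d U \<omega> - ext_d U \<eta>"
  using ext_d_add[OF assms(1,2) forms_uminus[OF assms(1,3)]] ext_d_scale[OF assms(1,3), of "-1"] by simp

lemma ext_d_ext_d:
  assumes U: "openin M U" and w: "\<omega> \<in> forms k U"
  shows "ext_d U (ext_d U \<omega>) = 0"
proof (intro ext)
  fix c x vs
  show "ext_d U (ext_d U \<omega>) c x vs = 0 c x vs"
  proof (cases "c \<in> A \<and> x \<in> coords c U")
    case True
    then have V: "open (coords c U)" using open_coords U by blast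
    note s = lform_sfam[OF V forms_lform[OF w]]
    have "ld (ext_d U \<omega> c) x = ld (ld (\<omega> c)) x"
      using True by (intro ld_cong[OF V, symmetric, OF _ sfam_ld[OF V s]]) (auto simp: ext_d_ld)
    then show ?thesis using True ld_ld[OF V s] by (simp add: ext_d_ld fun_apply)
  qed (simp add: ext_d_0 fun_apply)
qed

text \<open>On an open set inside one chart, coordinates in that chart determine the form: elsewhere
  it is defined by pullback along the transition map, and the chain rule gives
  compatibility.\<close>

lemma forms_extend:
  assumes c0: "c0 \<in> A" and U: "openin M U" "U \<subseteq> fst c0" and f: "lform k (coords c0 U) f"
  obtains \<omega> where "\<omega> \<in> forms k U" "\<And>x. x \<in> coords c0 U ==> \<omega> c0 x = f x"
proof -
  define \<omega> where "\<omega> c x = (if c \<in> A \<and> x \<in> coords c U then pullback (dtransition c c0 x) (f (transition c c0 x)) else 0)" for c x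
  have c0U: "coords c U \<subseteq> coords c (fst c0)" for c using U(2) by (rule coords_mono)
  have 1: "\<omega> c0 x = f x" if "x \<in> coords c0 U" for x
  proof -
    have "x \<in> coords c0 (fst c0)" using that c0U by blast
    moreover from this have "transition c0 c0 x = x" by (auto elim!: coordsE simp: transition_chart[OF c0])
    ultimately show ?thesis using that c0 by (simp add: \<omega>_def pullback_id dtransition_ident)
  qed
  have 2: "\<omega> \<in> forms k U"
    unfolding forms_iff
  proof (intro conjI ballI allI impI)
    show "lform k (coords c U) (\<omega> c)" if c: "c \<in> A" for c
    proof -
      have im: "transition c c0 ` coords c U \<subseteq> coords c0 U"
        using U(2) by (auto elim!: coordsE simp: transition_chart[OF c] intro!: coordsI)
      show ?thesis
        by (rule lform_cong[OF open_coords[OF c U(1)] _ lform_pullback[OF open_coords[OF c U(1)] open_coords[OF c0 U(1)]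
              smooth_on_subset[OF smooth_transition[OF c c0] c0U] im f]]) (simp add: \<omega>_def dtransition_def c)
    qed
    fix c c' x assume c: "c \<in> A" "c' \<in> A" and x: "x \<in> coords c (U \<inter> fst c')"
    have 1: "x \<in> coords c U" "transition c c' x \<in> coords c' U" "x \<in> coords c (fst c' \<inter> fst c0)"
      using x U(2) by (auto elim!: coordsE simp: transition_chart[OF c(1)] intro!: coordsI)
    have 2: "transition c' c0 (transition c c' x) = transition c c0 x"
      using x by (auto elim!: coordsE simp: transition_chart[OF c(1)] transition_chart[OF c(2)])
    have "dtransition c' c0 (transition c c' x) \<circ> dtransition c c' x = dtransition c c0 x"
      using dtransition_compose[OF c c0 1(3)] by (simp add: fun_eq_iff)
    then show "\<omega> c x = pullback (dtransition c c' x) (\<omega> c' (transition c c' x))"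
      using 1 c by (simp add: \<omega>_def 2 pullback_pullback)
  qed (auto simp: \<omega>_def)
  show thesis using that[OF 2 1] .
qed

text \<open>Since any two local solutions agree wherever both are defined, the value at a point may
  be taken from an arbitrary one, selected by \<open>SOME\<close>. Smoothness and compatibility are
  local and are inherited.\<close>

lemma forms_glue:
  assumes ex: "\<And>p. p \<in> topspace M ==> \<exists>U f. openin M U \<and> p \<in> U \<and> f \<in> forms k U \<and> Q U f"
    and unique: "\<And>U f U' f' c x. openin M U ==> openin M U' ==> f \<in> forms k U ==> f' \<in> forms k U' ==>
      Q U f ==> Q U' f' ==> c \<in> A ==> x \<in> coords c (U \<inter> U') ==> f c x = f' c x"
  obtains \<omega> where "\<omega> \<in> forms k (topspace M)"
    "\<And>U f c x. openin M U ==> f \<in> forms k U ==> Q U f ==> c \<in> A ==> x \<in> coords c U ==> \<omega> c x = f c x"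
proof -
  define P where "P c x U f \<longleftrightarrow> openin M U \<and> x \<in> coords c U \<and> f \<in> forms k U \<and> Q U f" for c and x :: "real ^ 'm" and U f
  define \<omega> where "\<omega> c x = (if c \<in> A \<and> x \<in> coords c (topspace M) then (case SOME (U, f). P c x U f of (U, f) => f c x) else 0)" for c x
  have eq: "\<omega> c x = f c x" if f: "openin M U" "f \<in> forms k U" "Q U f" and c: "c \<in> A" "x \<in> coords c U" for U f c x
  proof -
    obtain U' f' where Uf: "(SOME (U, f). P c x U f) = (U', f')" by fastforce
    have "\<exists>Uf. case Uf of (U, f) => P c x U f" using f c by (intro exI[of _ "(U, f)"]) (simp add: P_def)
    then have "P c x U' f'" using someI_ex[of "\<lambda>(U, f). P c x U f"] Uf by (metis (mono_tags, lifting) case_prod_conv)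
    then have "f' c x = f c x"
      using unique[of U' U f' f c x] f c by (auto simp: P_def coords_Int)
    moreover have "x \<in> coords c (topspace M)" using c coords_sub_top[OF f(1), of c] by blast
    ultimately show ?thesis using c(1) Uf by (simp add: \<omega>_def)
  qed
  have local: "\<exists>U f. openin M U \<and> p \<in> U \<and> f \<in> forms k U \<and> (\<forall>c\<in>A. \<forall>x\<in>coords c U. \<omega> c x = f c x)" if "p \<in> topspace M" for p
    using ex[OF that] eq by blast
  have "\<omega> \<in> forms k (topspace M)"
    unfolding forms_iff
  proof (intro conjI ballI allI impI)
    show "lform k (coords c (topspace M)) (\<omega> c)" if c: "c \<in> A" for c
    proof -
      have 1: "\<exists>V. open V \<and> x \<in> V \<and> lform k V (\<omega> c)" if xc: "x \<in> coords c (topspace M)" for x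
      proof -
        obtain p where p: "p \<in> fst c" "p \<in> topspace M" "x = snd c p" using xc by (rule coordsE)
        obtain U f where U: "openin M U" "p \<in> U" "f \<in> forms k U" "\<forall>c\<in>A. \<forall>x\<in>coords c U. \<omega> c x = f c x"
          using local[OF p(2)] by blast
        then show ?thesis
          using open_coords[OF c U(1)] coordsI[OF p(1) U(2)] p(3) c
            lform_cong[OF open_coords[OF c U(1)] _ forms_lform[OF U(3) c], of "\<omega> c"] by (metis (no_types))
      qed
      show ?thesis
        unfolding lform_def sfam_def
      proof (intro conjI ballI allI)
        show "alternating k (\<omega> c x)" if "x \<in> coords c (topspace M)" for x
          using 1[OF that] by (auto simp: lform_def)
        show "smooth_on (coords c (topspace M)) (\<lambda>x. \<omega> c x vs)" for vs
          by (rule smooth_on_local) (use 1 in \<open>unfold lform_def sfam_def, blast\<close>)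
      qed
    qed
    fix c c' x assume c: "c \<in> A" "c' \<in> A" and x: "x \<in> coords c (topspace M \<inter> fst c')"
    obtain p where p: "p \<in> fst c" "p \<in> topspace M" "p \<in> fst c'" "x = snd c p" using x by (auto elim: coordsE)
    obtain U f where U: "openin M U" "p \<in> U" "f \<in> forms k U" "\<forall>c\<in>A. \<forall>x\<in>coords c U. \<omega> c x = f c x"
      using local[OF p(2)] by blast
    have "x \<in> coords c (U \<inter> fst c')" "x \<in> coords c U" "transition c c' x \<in> coords c' U"
      using p U(2) by (auto simp: transition_chart[OF c(1)] intro!: coordsI)
    then show "\<omega> c x = pullback (dtransition c c' x) (\<omega> c' (transition c c' x))"
      using forms_pullback[OF U(3) c] U(4) c by metis
  qed (auto simp: \<omega>_def)
  then show thesis using that[of \<omega>] eq by blast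
qed

end

subsection \<open>Complex conjugation\<close>

text \<open>Conjugating the arguments as well keeps the covector complex linear. By
  \<open>ccnj_eq_iff\<close> its fixed points are the covectors that are real on real
  vectors.\<close>

definition ccnj :: "'m::finite covector => 'm covector" where
  "ccnj \<alpha> = (\<lambda>vs. cnj (\<alpha> (map cnj_vec vs)))"

lemma ccnj_simps [simp]:
  "ccnj (\<alpha> + \<beta>) = ccnj \<alpha> + ccnj \<beta>" "ccnj (\<alpha> - \<beta>) = ccnj \<alpha> - ccnj \<beta>" "ccnj 0 = 0"
  "ccnj (cscale a \<alpha>) = cscale (cnj a) (ccnj \<alpha>)" "ccnj (ccnj \<alpha>) = \<alpha>"
  by (auto simp: ccnj_def cscale_def fun_eq_iff fun_apply o_def)

lemma contract_ccnj: "contract v (ccnj \<alpha>) = ccnj (contract (cnj_vec v) \<alpha>)"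
  by (simp add: contract_def ccnj_def fun_eq_iff)

lemma ccnj_wedge: "ccnj (wedge \<alpha> \<beta>) = wedge (ccnj \<alpha>) (ccnj \<beta>)"
  by (simp add: ccnj_def wedge_def nths_map fun_eq_iff)

lemma ccnj_wedge_power: "ccnj (wedge_power \<alpha> k) = wedge_power (ccnj \<alpha>) k"
  by (induction k) (simp_all add: ccnj_wedge, simp add: ccnj_def fun_eq_iff)

lemma alternating_ccnj: "alternating k \<alpha> ==> alternating k (ccnj \<alpha>)"
proof (induction k arbitrary: \<alpha>)
  case (Suc k)
  have "ccnj \<alpha> [] = 0" using Suc.prems by (simp add: ccnj_def)
  with Suc show ?case
    by (simp add: contract_ccnj alternating_contract_linear[OF Suc.prems] alternating_contract(4)[OF Suc.prems])
qed (simp add: contract_ccnj)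

lemma ccnj_eq_iff:
  assumes "alternating k \<alpha>" shows "ccnj \<alpha> = \<alpha> \<longleftrightarrow> (\<forall>vs. \<alpha> (map cvec vs) \<in> \<real>)"
proof
  assume "ccnj \<alpha> = \<alpha>"
  then have "cnj (\<alpha> (map cnj_vec (map cvec vs))) = \<alpha> (map cvec vs)" for vs
    by (metis ccnj_def)
  then have "cnj (\<alpha> (map cvec vs)) = \<alpha> (map cvec vs)" for vs
    by (simp add: o_def)
  then show "\<forall>vs. \<alpha> (map cvec vs) \<in> \<real>"
    using Reals_cnj_iff by blast
next
  assume "\<forall>vs. \<alpha> (map cvec vs) \<in> \<real>"
  then show "ccnj \<alpha> = \<alpha>"
    using assms
  proof (induction k arbitrary: \<alpha>)
    case 0
    have "\<alpha> [] \<in> \<real>" using 0(1)[rule_format, of "[]"] by simp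
    then have "cnj (\<alpha> []) = \<alpha> []" using Reals_cnj_iff by blast
    moreover have "\<alpha> (v # vs) = 0" for v vs using alternating_length[OF 0(2), of "v # vs"] by simp
    ultimately have "ccnj \<alpha> vs = \<alpha> vs" for vs by (cases vs) (simp_all add: ccnj_def)
    then show ?case by blast
  next
    case (Suc k)
    have r: "ccnj (contract (cvec v) \<alpha>) = contract (cvec v) \<alpha>" for v
    proof (rule Suc.IH)
      show "\<forall>vs. contract (cvec v) \<alpha> (map cvec vs) \<in> \<real>"
      proof
        show "contract (cvec v) \<alpha> (map cvec vs) \<in> \<real>" for vs
          using Suc.prems(1)[rule_format, of "v # vs"] by (simp add: contract_def)
      qed
      show "alternating k (contract (cvec v) \<alpha>)" using Suc.prems(2) by simp
    qed
    show ?case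
    proof (rule covector_eqI)
      show "ccnj \<alpha> [] = \<alpha> []" using Suc.prems(2) by (simp add: ccnj_def)
      fix v
      have "contract (cnj_vec v) \<alpha> = contract (cvec (re_vec v) + (- \<i>) *s cvec (im_vec v)) \<alpha>"
        by (rule arg_cong[of _ _ "\<lambda>v. contract v \<alpha>"])
          (simp add: vec_eq_iff re_vec_def im_vec_def cvec_def complex_eq_iff)
      also have "\<dots> = contract (cvec (re_vec v)) \<alpha> + cscale (- \<i>) (contract (cvec (im_vec v)) \<alpha>)"
        by (rule alternating_contract_linear[OF Suc.prems(2)])
      finally have "contract v (ccnj \<alpha>) = contract (cvec (re_vec v)) \<alpha> + cscale \<i> (contract (cvec (im_vec v)) \<alpha>)"
        by (simp only: contract_ccnj ccnj_simps r) simp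
      also have "\<dots> = contract v \<alpha>"
        by (simp only: alternating_contract_linear[OF Suc.prems(2), symmetric] cvec_re_im)
      finally show "contract v (ccnj \<alpha>) = contract v \<alpha>" .
    qed
  qed
qed

lemma altsum_cnj: "cnj (altsum f vs) = altsum (\<lambda>u us. cnj (f u us)) vs"
  by (induction vs arbitrary: f) auto

lemma ld_ccnj:
  assumes "open V" "sfam V \<alpha>" "x \<in> V" shows "ld (\<lambda>y. ccnj (\<alpha> y)) x = ccnj (ld \<alpha> x)"
proof
  fix vs
  show "ld (\<lambda>y. ccnj (\<alpha> y)) x vs = ccnj (ld \<alpha> x) vs"
    using cderiv_cnj[OF sfam_differentiable[OF assms]] by (simp add: ld_def ccnj_def altsum_map altsum_cnj)
qed

lemma lform_ccnj: "open V ==> lform k V \<alpha> ==> lform k V (\<lambda>x. ccnj (\<alpha> x))"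
  by (auto simp: lform_def sfam_def intro: alternating_ccnj) (auto simp: ccnj_def intro: smooth_on_cnj)

lemma rumin_cond_ccnj: "rumin_cond n k \<theta> \<sigma> u v ==> rumin_cond n k (ccnj \<theta>) (ccnj \<sigma>) (ccnj u) (ccnj v)"
  unfolding rumin_cond_def zero_fun_def[symmetric]
  by (auto simp: ccnj_wedge[symmetric] ccnj_wedge_power[symmetric])

lemma rumin_cond_add: "rumin_cond n k \<theta> \<sigma> u v ==> rumin_cond n k \<theta> \<sigma> u' v' ==> rumin_cond n k \<theta> \<sigma> (u + u') (v + v')"
  unfolding rumin_cond_def zero_fun_def[symmetric] by auto

lemma rumin_cond_cscale: "rumin_cond n k \<theta> \<sigma> u v ==> rumin_cond n k \<theta> \<sigma> (cscale a u) (cscale a v)"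
  unfolding rumin_cond_def zero_fun_def[symmetric] by auto

definition form_cnj :: "('a, 'm::finite) dform => ('a, 'm) dform" where
  "form_cnj \<omega> = (\<lambda>c x. ccnj (\<omega> c x))"

context smooth_manifold
begin

lemma form_cnj_forms:
  assumes U: "openin M U" and w: "\<omega> \<in> forms k U" shows "form_cnj \<omega> \<in> forms k U"
  unfolding forms_iff form_cnj_def
proof (intro conjI ballI allI impI)
  show "lform k (coords c U) (\<lambda>x. ccnj (\<omega> c x))" if "c \<in> A" for c
    using lform_ccnj[OF open_coords[OF that U] forms_lform[OF w that]] .
  show "ccnj (\<omega> c x) = pullback (dtransition c c' x) (ccnj (\<omega> c' (transition c c' x)))"
    if c: "c \<in> A" "c' \<in> A" "x \<in> coords c (U \<inter> fst c')" for c c' x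
  proof -
    have "x \<in> coords c (fst c')" using c(3) by (auto simp: coords_def)
    then show ?thesis
      unfolding forms_pullback[OF w c] by (simp add: ccnj_def pullback_def o_def dtransition_cnj c(1,2))
  qed
  show "ccnj (\<omega> c x) = 0" if "\<not> (c \<in> A \<and> x \<in> coords c U)" for c x
    unfolding forms_0[OF w that] by simp
qed

lemma ext_d_form_cnj:
  assumes U: "openin M U" and w: "\<omega> \<in> forms k U"
  shows "ext_d U (form_cnj \<omega>) = form_cnj (ext_d U \<omega>)"
proof (intro ext)
  fix c x vs
  show "ext_d U (form_cnj \<omega>) c x vs = form_cnj (ext_d U \<omega>) c x vs"
  proof (cases "c \<in> A \<and> x \<in> coords c U")
    case True
    have "form_cnj \<omega> c = (\<lambda>y. ccnj (\<omega> c y))" by (simp add: form_cnj_def)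
    with True show ?thesis
      using ld_ccnj[OF open_coords[of c U] lform_sfam[OF _ forms_lform[OF w]]] open_coords[of c U] U
      by (simp add: ext_d_ld form_cnj_def[of "ext_d U \<omega>"])
  qed (simp add: ext_d_0 form_cnj_def)
qed

lemma real_forms_iff: "\<omega> \<in> real_forms k U \<longleftrightarrow> \<omega> \<in> forms k U \<and> form_cnj \<omega> = \<omega>"
proof -
  have "(\<forall>c x vs. \<omega> c x (map cvec vs) \<in> \<real>) \<longleftrightarrow> form_cnj \<omega> = \<omega>" if "\<omega> \<in> forms k U"
    using ccnj_eq_iff[OF forms_alternating[OF that]] by (simp add: form_cnj_def fun_eq_iff[of "\<lambda>c x. ccnj (\<omega> c x)"] fun_eq_iff[of "\<lambda>x. ccnj (\<omega> _ x)"])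
  then show ?thesis by (auto simp: real_forms_def)
qed

end

section \<open>Complex Rumin forms without reference to real forms\<close>

context cr_manifold
begin

definition rumin_global :: "nat => ('a, 'm) dform => bool" where
  "rumin_global k \<omega> \<longleftrightarrow> (\<forall>U \<theta>. contact_form U \<theta> -->
     (\<forall>c\<in>A. \<forall>x\<in>coords c U. rumin_cond n k (\<theta> c x) (ext_d U \<theta> c x) (\<omega> c x) (dM \<omega> c x)))"

lemma openin_top [simp]: "openin M (topspace M)"
  by simp

lemma rumin_real_iff: "\<omega> \<in> rumin_real k \<longleftrightarrow> \<omega> \<in> forms k (topspace M) \<and> form_cnj \<omega> = \<omega> \<and> rumin_global k \<omega>"
  by (simp add: rumin_real_def real_forms_iff rumin_global_def rumin_cond_def conj_assoc)

lemma rumin_global_add: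
  assumes "\<omega> \<in> forms k (topspace M)" "\<eta> \<in> forms k (topspace M)" "rumin_global k \<omega>" "rumin_global k \<eta>"
  shows "rumin_global k (\<omega> + \<eta>)"
proof -
  have "(\<omega> + \<eta>) c x = \<omega> c x + \<eta> c x" "dM (\<omega> + \<eta>) c x = dM \<omega> c x + dM \<eta> c x" for c x
    by (simp_all add: ext_d_add[OF openin_top assms(1,2)] fun_apply)
  then show ?thesis using assms(3,4) unfolding rumin_global_def by (simp add: rumin_cond_add)
qed

lemma rumin_global_scale:
  assumes "\<omega> \<in> forms k (topspace M)" "rumin_global k \<omega>" shows "rumin_global k (form_scale a \<omega>)"
  using assms(2) unfolding rumin_global_def
  by (simp add: ext_d_scale[OF openin_top assms(1)] form_scale_apply rumin_cond_cscale)

lemma rumin_global_cnj: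
  assumes "\<omega> \<in> forms k (topspace M)" "rumin_global k \<omega>" shows "rumin_global k (form_cnj \<omega>)"
  unfolding rumin_global_def
proof (intro allI impI ballI)
  fix U \<theta> c x assume t: "contact_form U \<theta>" and c: "c \<in> A" "x \<in> coords c U"
  have U: "openin M U" "\<theta> \<in> forms 1 U" "form_cnj \<theta> = \<theta>"
    using t by (auto simp: contact_form_def real_forms_iff)
  have "ccnj (\<theta> c x) = \<theta> c x" "ccnj (ext_d U \<theta> c x) = ext_d U \<theta> c x"
    using fun_cong[OF fun_cong[OF U(3)]] fun_cong[OF fun_cong[OF ext_d_form_cnj[OF U(1,2), unfolded U(3)]]]
    by (simp_all add: form_cnj_def)
  moreover have "rumin_cond n k (\<theta> c x) (ext_d U \<theta> c x) (\<omega> c x) (dM \<omega> c x)"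
    using assms(2) t c unfolding rumin_global_def by blast
  ultimately show "rumin_cond n k (\<theta> c x) (ext_d U \<theta> c x) (form_cnj \<omega> c x) (dM (form_cnj \<omega>) c x)"
    using rumin_cond_ccnj[of n k "\<theta> c x" "ext_d U \<theta> c x"] ext_d_form_cnj[OF openin_top assms(1)]
    by (metis form_cnj_def)
qed

text \<open>The Rumin conditions are complex linear, and they are stable under conjugation because
  contact forms are real. The real and imaginary parts of a form that meets them therefore meet them
  too.\<close>

lemma rumin_complex_iff: "\<omega> \<in> rumin_complex k \<longleftrightarrow> \<omega> \<in> forms k (topspace M) \<and> rumin_global k \<omega>"
proof
  assume "\<omega> \<in> rumin_complex k"
  then obtain \<alpha> \<beta> where "\<omega> = \<alpha> + form_scale \<i> \<beta>" "\<alpha> \<in> rumin_real k" "\<beta> \<in> rumin_real k"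
    unfolding rumin_complex_def form_add_plus by blast
  then show "\<omega> \<in> forms k (topspace M) \<and> rumin_global k \<omega>"
    unfolding rumin_real_iff
    by (simp add: forms_add forms_scale rumin_global_add rumin_global_scale)
next
  assume w: "\<omega> \<in> forms k (topspace M) \<and> rumin_global k \<omega>"
  note c = form_cnj_forms[OF openin_top conjunct1[OF w]]
  define \<alpha> where "\<alpha> = form_scale (1/2) (\<omega> + form_cnj \<omega>)"
  define \<beta> where "\<beta> = form_scale (- \<i> / 2) (\<omega> + form_scale (-1) (form_cnj \<omega>))"
  have "\<alpha> \<in> rumin_real k"
    unfolding rumin_real_iff \<alpha>_def
    using w c by (intro conjI forms_scale forms_add rumin_global_scale rumin_global_add rumin_global_cnj openin_top)
      (auto simp: form_cnj_def form_scale_def ccnj_def o_def fun_eq_iff fun_apply algebra_simps)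
  moreover have "\<beta> \<in> rumin_real k"
    unfolding rumin_real_iff \<beta>_def
    using w c by (intro conjI forms_scale forms_add rumin_global_scale rumin_global_add rumin_global_cnj openin_top)
      (auto simp: form_cnj_def form_scale_def ccnj_def o_def fun_eq_iff fun_apply algebra_simps)
  moreover have "\<omega> = form_add \<alpha> (form_scale \<i> \<beta>)"
    by (auto simp: \<alpha>_def \<beta>_def form_add_plus form_scale_def fun_eq_iff fun_apply field_simps)
  ultimately show "\<omega> \<in> rumin_complex k" unfolding rumin_complex_def by blast
qed

end

section \<open>Frames and contact forms\<close>

lemma smooth_on_det:
  fixes A :: "'a::real_normed_vector => complex ^ 'm::finite ^ 'm"
  assumes "open V" "\<And>i j. smooth_on V (\<lambda>y. A y $ i $ j)"
  shows "smooth_on V (\<lambda>y. det (A y))"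
  unfolding det_def by (intro smooth_on_sum smooth_on_mult smooth_on_prod smooth_on_const assms)

lemma det_nz_ker: "det (A :: complex ^ 'm::finite ^ 'm) \<noteq> 0 \<longleftrightarrow> (\<forall>v. A *v v = 0 --> v = 0)"
  unfolding invertible_det_nz[symmetric] invertible_left_inverse matrix_left_invertible_ker ..

lemma cvec_linear_basis:
  assumes "\<And>v w a. f (v + a *s w) = f v + a * (f w :: complex)"
  shows "f v = (\<Sum>i\<in>UNIV. v $ i * f (axis i 1))"
proof -
  have "f 0 = 0" using assms[of 0 1 0] by simp
  then have "f (\<Sum>i\<in>I. (v $ i) *s axis i 1) = (\<Sum>i\<in>I. v $ i * f (axis i 1))" for I
    by (induction I rule: infinite_finite_induct) (auto simp: assms add.commute[of "_ *s _"])
  then show ?thesis using vec_basis_sum[of v] by metis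
qed

text \<open>Cramer's rule writes the solution of the linear system as quotients of determinants,
  which are smooth in the point. Trivial common kernel of as many functionals as the dimension makes
  the denominator nonzero.\<close>

lemma smooth_dual_vector:
  fixes \<phi> :: "nat => real ^ 'm::finite => complex ^ 'm => complex"
  assumes V: "open V" and lin: "\<And>j y v w a. j < CARD('m) ==> y \<in> V ==> \<phi> j y (v + a *s w) = \<phi> j y v + a * \<phi> j y w"
    and smooth: "\<And>j v. j < CARD('m) ==> smooth_on V (\<lambda>y. \<phi> j y v)"
    and inj: "\<And>y v. y \<in> V ==> (\<And>j. j < CARD('m) ==> \<phi> j y v = 0) ==> v = 0"
  obtains X where "smooth_on V X" "\<And>y j. y \<in> V ==> j < CARD('m) ==> \<phi> j y (X y) = t j"
proof -
  obtain e :: "'m => nat" where e: "bij_betw e UNIV {..<CARD('m)}"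
    using ex_bij_betw_finite_nat[of "UNIV :: 'm set"] by (auto simp: atLeast0LessThan)
  have e_less: "e i < CARD('m)" for i using e by (auto simp: bij_betw_def)
  define A where "A y = (\<chi> i j. \<phi> (e i) y (axis j 1))" for y
  define b :: "complex ^ 'm" where "b = (\<chi> i. t (e i))"
  have Av: "(A y *v v) $ i = \<phi> (e i) y v" if "y \<in> V" for y v i
    using cvec_linear_basis[of "\<phi> (e i) y" v, OF lin[OF e_less that]]
    by (simp add: A_def matrix_vector_mult_def mult.commute)
  have nz: "det (A y) \<noteq> 0" if y: "y \<in> V" for y
    unfolding det_nz_ker
  proof (intro allI impI)
    fix v assume "A y *v v = 0"
    then have 0: "\<phi> (e i) y v = 0" for i using Av[OF y, of v i] by simp
    show "v = 0"
    proof (rule inj[OF y])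
      fix j assume "j < CARD('m)"
      then obtain i where "j = e i" using e by (auto simp: bij_betw_def)
      then show "\<phi> j y v = 0" using 0 by simp
    qed
  qed
  define X where "X y = (\<chi> k. det (\<chi> i j. if j = k then b $ i else A y $ i $ j) / det (A y))" for y
  have sA: "smooth_on V (\<lambda>y. A y $ i $ j)" for i j
    unfolding A_def using smooth[OF e_less] by simp
  then have "smooth_on V (\<lambda>y. if j = k then b $ i else A y $ i $ j)" for i j k
    by (cases "j = k") (simp_all add: sA)
  then have "smooth_on V X"
    by (intro smooth_on_vec[OF V]) (auto simp: X_def nz intro!: smooth_on_divide smooth_on_det V sA)
  moreover have "\<phi> j y (X y) = t j" if y: "y \<in> V" and "j < CARD('m)" for y j
  proof -
    obtain i where i: "j = e i" using \<open>j < CARD('m)\<close> e by (auto simp: bij_betw_def)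
    have "A y *v X y = b" using cramer[OF nz[OF y], of "X y" b] by (simp add: X_def)
    then show ?thesis using Av[OF y, of "X y" i] by (simp add: i b_def)
  qed
  ultimately show thesis using that by blast
qed

text \<open>\<theta> is the coefficient of \<open>b 0\<close> in the basis b, smooth by Cramer's
  rule. Independence is known at x only, so the domain shrinks to the open set where the determinant
  is nonzero.\<close>

lemma smooth_dual_covector:
  fixes b :: "nat => real ^ 'm::finite => complex ^ 'm"
  assumes V: "open V" "x \<in> V" and smooth: "\<And>j. j < CARD('m) ==> smooth_on V (b j)"
    and indep: "\<And>u. (\<Sum>j<CARD('m). u j *s b j x) = 0 ==> \<forall>j<CARD('m). u j = 0"
  obtains V' \<theta> where "open V'" "x \<in> V'" "V' \<subseteq> V" "lform 1 V' \<theta>"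
    "\<And>y u. y \<in> V' ==> \<theta> y [\<Sum>j<CARD('m). u j *s b j y] = u 0"
    "\<And>y v. y \<in> V' ==> \<exists>u. v = (\<Sum>j<CARD('m). u j *s b j y)"
proof -
  obtain e :: "'m => nat" where e: "bij_betw e UNIV {..<CARD('m)}"
    using ex_bij_betw_finite_nat[of "UNIV :: 'm set"] by (auto simp: atLeast0LessThan)
  have e_less: "e i < CARD('m)" for i using e by (auto simp: bij_betw_def)
  obtain i0 where i0: "e i0 = 0" using e by (metis bij_betw_iff_bijections lessThan_iff zero_less_card_finite)
  define A where "A y = (\<chi> i j. b (e j) y $ i)" for y
  have Av: "A y *v (\<chi> i. u (e i)) = (\<Sum>j<CARD('m). u j *s b j y)" for y u
    using sum.reindex_bij_betw[OF e, of "\<lambda>j. u j *s b j y"] by (simp add: A_def matrix_mult_sum column_def)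
  have vec: "\<exists>u. v = (\<chi> i. u (e i))" for v :: "complex ^ 'm"
  proof
    show "v = (\<chi> i. (v $ inv_into UNIV e (e i)))"
      using e by (simp add: vec_eq_iff bij_betw_def inv_into_f_f)
  qed
  have sA: "smooth_on V (\<lambda>y. A y $ i $ j)" for i j
    unfolding A_def using smooth_on_nth[OF V(1) smooth[OF e_less]] by simp
  define V' where "V' = {y \<in> V. det (A y) \<noteq> 0}"
  have "V' = V \<inter> (\<lambda>y. det (A y)) -` (- {0})" by (auto simp: V'_def)
  then have 1: "open V'"
    using continuous_open_preimage[OF smooth_on_continuous[OF smooth_on_det[OF V(1) sA]] V(1), of "- {0}"] by auto
  have "det (A x) \<noteq> 0"
    unfolding det_nz_ker
  proof (intro allI impI)
    fix v assume 0: "A x *v v = 0"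
    obtain u where u: "v = (\<chi> i. u (e i))" using vec by blast
    have "\<forall>j<CARD('m). u j = 0" using indep 0 unfolding u Av .
    then show "v = 0" using e_less unfolding u by (simp add: vec_eq_iff)
  qed
  then have 2: "x \<in> V'" using V(2) by (simp add: V'_def)
  define co where "co y v k = det (\<chi> i j. if j = k then v $ i else A y $ i $ j) / det (A y)" for y v k
  have co: "A y *v w = v \<longleftrightarrow> w = (\<chi> k. co y v k)" if "y \<in> V'" for y v w
    unfolding co_def using cramer[of "A y" w v] that by (simp add: V'_def)
  define \<theta> where "\<theta> y vs = (case vs of [v] => co y v i0 | _ => 0)" for y vs
  have val: "\<theta> y [A y *v w] = w $ i0" if "y \<in> V'" for y w
    using co[OF that, of w "A y *v w"] unfolding \<theta>_def by (metis list.simps(4,5) vec_lambda_beta)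
  have surj: "\<exists>w. v = A y *v w" if "y \<in> V'" for y v
    using co[OF that, of "\<chi> k. co y v k" v] by (intro exI[of _ "\<chi> k. co y v k"]) simp
  have t: "\<theta> y [\<Sum>j<CARD('m). u j *s b j y] = u 0" if "y \<in> V'" for y u
    using val[OF that, of "\<chi> i. u (e i)"] by (simp add: Av i0)
  have s: "\<exists>u. v = (\<Sum>j<CARD('m). u j *s b j y)" if "y \<in> V'" for y v
    using surj[OF that, of v] vec Av by metis
  have "alternating 1 (\<theta> y)" if y: "y \<in> V'" for y
  proof -
    have "\<theta> y [v + a *s w] = \<theta> y [v] + a * \<theta> y [w]" for v a w
    proof -
      obtain v' w' where "v = A y *v v'" "w = A y *v w'" using surj[OF y] by metis
      then have "v + a *s w = A y *v (v' + a *s w')" by (simp add: matrix_vector_right_distrib vector_scalar_commute)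
      then show ?thesis using val[OF y] \<open>v = _\<close> \<open>w = _\<close> by simp
    qed
    moreover have "\<theta> y vs = 0" if "length vs \<noteq> 1" for vs using that by (auto simp: \<theta>_def split: list.splits)
    ultimately have "alt_covector 1 (\<theta> y)"
      unfolding alt_covector_def linear_cvec_iff by (auto simp: length_Suc_conv)
    then show ?thesis by (simp add: alt_covector_iff_alternating)
  qed
  moreover have "smooth_on V' (\<lambda>y. \<theta> y vs)" for vs
  proof (cases "\<exists>v. vs = [v]")
    case True
    then obtain v where v: "vs = [v]" by blast
    have sA': "smooth_on V' (\<lambda>y. A y $ i $ j)" for i j using smooth_on_subset[OF sA] by (auto simp: V'_def)
    then have "smooth_on V' (\<lambda>y. if j = k then v $ i else A y $ i $ j)" "smooth_on V' (\<lambda>y. A y $ i $ j)" for i j k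
      by (cases "j = k") (simp_all add: sA')
    then have "smooth_on V' (\<lambda>y. co y v i0)"
      unfolding co_def using sA' by (intro smooth_on_divide smooth_on_det 1) (auto simp: V'_def)
    then show ?thesis by (simp add: \<theta>_def v)
  next
    case False
    then have "\<theta> y vs = 0" for y by (auto simp: \<theta>_def split: list.splits)
    then show ?thesis by simp
  qed
  ultimately have "lform 1 V' \<theta>" by (simp add: lform_def sfam_def)
  then show thesis using that[OF 1 2 _ _ t s] by (auto simp: V'_def)
qed

context
  fixes \<theta> \<sigma> :: "'m::finite covector" and Z B :: "nat => complex ^ 'm" and n :: nat
  assumes theta: "alternating 1 \<theta>" and sigma: "alternating 2 \<sigma>"
    and ker: "\<And>v. \<theta> [v] = 0 \<longleftrightarrow> (\<exists>z w. z \<in> vec.span (Z ` {..<n}) \<and> w \<in> vec.span (B ` {..<n}) \<and> v = z + w)"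
    and ZZ: "\<And>i j. i < n ==> j < n ==> \<sigma> [Z i, Z j] = 0" and BB: "\<And>i j. i < n ==> j < n ==> \<sigma> [B i, B j] = 0"
    and nd10: "\<And>z. z \<in> vec.span (Z ` {..<n}) ==> \<forall>i<n. \<sigma> [z, B i] = 0 ==> z = 0"
    and nd01: "\<And>w. w \<in> vec.span (B ` {..<n}) ==> \<forall>i<n. \<sigma> [Z i, w] = 0 ==> w = 0"
begin

lemmas theta_lin = alternating_1_simps(1-4)[OF theta] and sigma_lin = alternating_2_simps(1-8)[OF sigma]
  and lin_sum = alternating_1_simps(5)[OF theta] alternating_2_simps(9,10)[OF sigma]

lemma span_sigma:
  "z \<in> vec.span (Z ` {..<n}) ==> i < n ==> \<sigma> [Z i, z] = 0" "w \<in> vec.span (B ` {..<n}) ==> i < n ==> \<sigma> [w, B i] = 0"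
proof -
  show "\<sigma> [Z i, z] = 0" if "z \<in> vec.span (Z ` {..<n})" "i < n"
    using that(1) by (rule vec.span_induct) (auto intro!: vec.subspaceI simp: sigma_lin ZZ that)
  show "\<sigma> [w, B i] = 0" if "w \<in> vec.span (B ` {..<n})" "i < n"
    using that(1) by (rule vec.span_induct) (auto intro!: vec.subspaceI simp: sigma_lin BB that)
qed

text \<open>As \<sigma> vanishes on pairs from the same span, pairing with Z tests only the
  B-component of v and pairing with B only the Z-component; nondegeneracy kills each.\<close>

lemma frame_injective:
  assumes "\<theta> [v] = 0" "\<And>i. i < n ==> \<sigma> [Z i, v] = 0" "\<And>i. i < n ==> \<sigma> [v, B i] = 0"
  shows "v = 0"
proof -
  obtain z w where v: "z \<in> vec.span (Z ` {..<n})" "w \<in> vec.span (B ` {..<n})" "v = z + w"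
    using assms(1) ker by blast
  have "w = 0" using assms(2) span_sigma(1)[OF v(1)] by (intro nd01[OF v(2)]) (simp add: v(3) sigma_lin)
  moreover have "z = 0" using assms(3) span_sigma(2)[OF v(2)] by (intro nd10[OF v(1)]) (simp add: v(3) sigma_lin)
  ultimately show ?thesis using v(3) by simp
qed

lemma theta_ZB: "i < n ==> \<theta> [Z i] = 0" "i < n ==> \<theta> [B i] = 0"
proof -
  show "i < n ==> \<theta> [Z i] = 0" unfolding ker
    by (intro exI[of _ "Z i"] exI[of _ 0]) (auto intro: vec.span_base vec.span_zero)
  show "i < n ==> \<theta> [B i] = 0" unfolding ker
    by (intro exI[of _ 0] exI[of _ "B i"]) (auto intro: vec.span_base vec.span_zero)
qed

text \<open>B is any frame of the second space, and W solves the duality equations. The Z-component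
  of W_j is \<sigma>-orthogonal to all of B, hence zero, so W_j lies in the span of B. The
  expansions hold because the difference of both sides is annihilated by all functionals of
  \<open>frame_injective\<close>.\<close>

lemma cr_pointI:
  assumes T: "\<theta> [T] = 1" "\<And>i. i < n ==> \<sigma> [Z i, T] = 0" "\<And>i. i < n ==> \<sigma> [T, B i] = 0"
    and W: "\<And>j. j < n ==> \<theta> [W j] = 0" "\<And>i j. i < n ==> j < n ==> \<sigma> [Z i, W j] = (if i = j then 1 else 0)"
      "\<And>i j. i < n ==> j < n ==> \<sigma> [W j, B i] = 0"
  shows "cr_point n (vec.span (Z ` {..<n})) (vec.span (B ` {..<n})) \<theta> \<sigma> T Z W"
proof -
  have W01: "W j \<in> vec.span (B ` {..<n})" if j: "j < n" for j
  proof -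
    obtain z w where v: "z \<in> vec.span (Z ` {..<n})" "w \<in> vec.span (B ` {..<n})" "W j = z + w"
      using W(1)[OF j] ker by blast
    have "z = 0" using W(3)[OF _ j] span_sigma(2)[OF v(2)] by (intro nd10[OF v(1)]) (simp add: v(3) sigma_lin)
    then show ?thesis using v by simp
  qed
  have delta: "(\<Sum>i<n. f i * (if j = i then 1 else 0)) = f j" if "j < n" for f :: "nat => complex" and j
    using that by (simp add: if_distrib[of "(*) _"] cong: if_cong)
  have v01: "v = (\<Sum>i<n. \<sigma> [Z i, v] *s W i)" if "\<theta> [v] = 0" "\<And>i. i < n ==> \<sigma> [v, B i] = 0" for v
  proof -
    have "v - (\<Sum>i<n. \<sigma> [Z i, v] *s W i) = 0"
      by (rule frame_injective) (simp_all add: theta_lin sigma_lin lin_sum W that delta)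
    then show ?thesis by simp
  qed
  have BW: "B j = (\<Sum>i<n. \<sigma> [Z i, B j] *s W i)" if "j < n" for j
    by (rule v01) (simp_all add: theta_ZB BB that)
  have span_W: "vec.span (B ` {..<n}) = vec.span (W ` {..<n})"
  proof
    have "B j \<in> vec.span (W ` {..<n})" if "j < n" for j
      by (subst BW[OF that]) (auto intro!: vec.span_sum vec.span_scale intro: vec.span_base)
    then show "vec.span (B ` {..<n}) \<subseteq> vec.span (W ` {..<n})"
      by (intro vec.span_minimal vec.subspace_span) auto
    show "vec.span (W ` {..<n}) \<subseteq> vec.span (B ` {..<n})"
      using W01 by (intro vec.span_minimal vec.subspace_span) auto
  qed
  have WW: "\<sigma> [W i, v] = 0" if "i < n" "v \<in> vec.span (B ` {..<n})" for i v
    using that(2) by (rule vec.span_induct) (auto intro!: vec.subspaceI simp: sigma_lin W(3) that)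
  have frame: "v = \<theta> [v] *s T + (\<Sum>i<n. \<sigma> [v, W i] *s Z i) + (\<Sum>i<n. \<sigma> [Z i, v] *s W i)" for v
  proof -
    have "\<sigma> [v, B j] = (\<Sum>i<n. \<sigma> [v, W i] * \<sigma> [Z i, B j])" if "j < n" for j
      by (subst BW[OF that]) (simp add: lin_sum sigma_lin mult.commute)
    then have "v - (\<theta> [v] *s T + (\<Sum>i<n. \<sigma> [v, W i] *s Z i) + (\<Sum>i<n. \<sigma> [Z i, v] *s W i)) = 0"
      by (intro frame_injective) (simp_all add: theta_lin sigma_lin lin_sum T W theta_ZB ZZ delta)
    then show ?thesis by simp
  qed
  show ?thesis
  proof
    show "\<sigma> [T, v] = 0" for v
    proof -
      have "\<sigma> [T, w] = 0" if "w \<in> vec.span (B ` {..<n})" for w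
        using that by (rule vec.span_induct) (auto intro!: vec.subspaceI simp: sigma_lin T)
      then have "\<sigma> [T, W i] = 0" if "i < n" for i using W01[OF that] by blast
      moreover have "\<sigma> [T, T] = 0" using alternating_2_swap[OF sigma, of T T] by simp
      moreover have "\<sigma> [T, Z i] = 0" if "i < n" for i using alternating_2_swap[OF sigma, of T "Z i"] T(2)[OF that] by simp
      ultimately show ?thesis by (subst frame[of v]) (simp add: sigma_lin lin_sum)
    qed
  qed (use theta sigma T W ZZ theta_ZB span_W frame WW[OF _ W01] in auto)
qed

end

lemma cnj_vec_span: "cnj_vec ` vec.span S = vec.span (cnj_vec ` (S :: (complex ^ 'm::finite) set))"
proof -
  have 1: "cnj_vec ` vec.span S \<subseteq> vec.span (cnj_vec ` S)" for S :: "(complex ^ 'm) set"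
  proof
    fix v assume "v \<in> cnj_vec ` vec.span S"
    then obtain z where z: "z \<in> vec.span S" "v = cnj_vec z" by blast
    from z(1) have "cnj_vec z \<in> vec.span (cnj_vec ` S)"
      by (rule vec.span_induct)
        (auto intro!: vec.subspaceI intro: vec.span_base vec.span_zero vec.span_add vec.span_scale)
    then show "v \<in> vec.span (cnj_vec ` S)" by (simp add: z(2))
  qed
  have "cnj_vec ` cnj_vec ` vec.span (cnj_vec ` S) \<subseteq> cnj_vec ` vec.span (cnj_vec ` cnj_vec ` S)"
    using 1[of "cnj_vec ` S"] by blast
  then show ?thesis using 1[of S] by (auto simp: image_image)
qed

lemma lie_bracket_cnj:
  assumes "open V" "smooth_on V X" "smooth_on V Y" "x \<in> V"
  shows "lie_bracket (\<lambda>y. cnj_vec (X y)) (\<lambda>y. cnj_vec (Y y)) x = cnj_vec (lie_bracket X Y x)"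
  using smooth_on_differentiable[OF smooth_on_nth[OF assms(1,2)] assms(4)]
    smooth_on_differentiable[OF smooth_on_nth[OF assms(1,3)] assms(4)]
  by (simp add: lie_bracket_def vec_eq_iff cderiv_cnj)

section \<open>The complexified distribution and the complex kernel of contact forms\<close>

context cr_manifold
begin

definition CH :: "('a, 'm) chart => real ^ 'm => (complex ^ 'm) set" where
  "CH c x = {z + w | z w. z \<in> T10 c x \<and> w \<in> T01 c x}"

lemma T10_subspace: "c \<in> A ==> x \<in> coords c (topspace M) ==> vec.subspace (T10 c x)"
  using distribution_frame[of c x] vec.subspace_span by metis

lemma cnj_T01: "cnj_vec v \<in> T01 c x \<longleftrightarrow> v \<in> T10 c x" "v \<in> T01 c x \<longleftrightarrow> cnj_vec v \<in> T10 c x"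
  unfolding T01_def by (auto simp: image_iff) (metis cnj_vec_simps(5))+

lemma T01_subspace: "c \<in> A ==> x \<in> coords c (topspace M) ==> vec.subspace (T01 c x)"
  using T10_subspace[of c x] unfolding vec.subspace_def by (simp add: cnj_T01(2))

lemma CH_subspace: "c \<in> A ==> x \<in> coords c (topspace M) ==> vec.subspace (CH c x)"
  unfolding CH_def by (rule vec.subspace_sums[OF T10_subspace T01_subspace])

lemma CH_cnj: "cnj_vec v \<in> CH c x \<longleftrightarrow> v \<in> CH c x"
proof -
  have "cnj_vec v \<in> CH c x" if "v \<in> CH c x" for v
  proof -
    obtain z w where "z \<in> T10 c x" "w \<in> T01 c x" "v = z + w" using \<open>v \<in> CH c x\<close> by (auto simp: CH_def)
    then have "cnj_vec v = cnj_vec w + cnj_vec z" "cnj_vec w \<in> T10 c x" "cnj_vec z \<in> T01 c x"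
      by (auto simp: cnj_T01 add.commute)
    then show ?thesis unfolding CH_def by blast
  qed
  from this[of v] this[of "cnj_vec v"] show ?thesis by auto
qed

lemma CH_re_im:
  assumes "c \<in> A" "x \<in> coords c (topspace M)"
  shows "v \<in> CH c x \<longleftrightarrow> cvec (re_vec v) \<in> CH c x \<and> cvec (im_vec v) \<in> CH c x"
proof
  note s = CH_subspace[OF assms]
  assume v: "v \<in> CH c x"
  have "cvec (re_vec v) = (1/2) *s (v + cnj_vec v)" "cvec (im_vec v) = (- \<i> / 2) *s (v - cnj_vec v)"
    by (simp_all add: vec_eq_iff cvec_def re_vec_def im_vec_def complex_eq_iff)
  then show "cvec (re_vec v) \<in> CH c x \<and> cvec (im_vec v) \<in> CH c x"
    using v CH_cnj by (simp add: vec.subspace_scale[OF s] vec.subspace_add[OF s] vec.subspace_diff[OF s])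
next
  note s = CH_subspace[OF assms]
  assume "cvec (re_vec v) \<in> CH c x \<and> cvec (im_vec v) \<in> CH c x"
  then have "cvec (re_vec v) + \<i> *s cvec (im_vec v) \<in> CH c x"
    by (intro vec.subspace_add[OF s] vec.subspace_scale[OF s]) auto
  then show "v \<in> CH c x" by (simp add: cvec_re_im)
qed

lemma H_iff:
  assumes "c \<in> A" "x \<in> coords c (topspace M)"
  shows "v \<in> H c x \<longleftrightarrow> cvec v \<in> CH c x"
proof
  assume "v \<in> H c x"
  then obtain z where "z \<in> CH c x" "v = re_vec z" unfolding H_def CH_def by blast
  then show "cvec v \<in> CH c x" using CH_re_im[OF assms] by blast
next
  assume "cvec v \<in> CH c x"
  then obtain z w where "z \<in> T10 c x" "w \<in> T01 c x" "cvec v = z + w" by (auto simp: CH_def)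
  moreover from this have "v = re_vec (z + w)" by (metis re_vec_simps(7))
  ultimately show "v \<in> H c x" unfolding H_def by blast
qed

text \<open>A real covector vanishes at v iff it vanishes at the real and imaginary parts of v, and
  \<open>CH\<close>, being stable under conjugation, splits in the same way. The kernel condition on
  real vectors is thus one on complex vectors.\<close>

lemma contact_form_iff:
  "contact_form U \<theta> \<longleftrightarrow> openin M U \<and> \<theta> \<in> forms 1 U \<and> form_cnj \<theta> = \<theta> \<and>
     (\<forall>c\<in>A. \<forall>x\<in>coords c U. \<forall>v. \<theta> c x [v] = 0 \<longleftrightarrow> v \<in> CH c x)"
proof -
  have "({v. \<theta> c x [cvec v] = 0} = H c x) \<longleftrightarrow> (\<forall>v. \<theta> c x [v] = 0 \<longleftrightarrow> v \<in> CH c x)"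
    if U: "openin M U" and t: "\<theta> \<in> real_forms 1 U" and c: "c \<in> A" "x \<in> coords c U" for c x
  proof -
    have x: "x \<in> coords c (topspace M)" using coords_sub_top[OF U] c(2) by blast
    have a: "alternating 1 (\<theta> c x)" using t unfolding real_forms_def by (blast intro: forms_alternating)
    have "\<theta> c x (map cvec [v]) \<in> \<real>" for v using t unfolding real_forms_def by blast
    then have r: "\<theta> c x [cvec v] \<in> \<real>" for v by simp
    have e: "\<theta> c x [v] = 0 \<longleftrightarrow> \<theta> c x [cvec (re_vec v)] = 0 \<and> \<theta> c x [cvec (im_vec v)] = 0" for v
    proof -
      obtain r s where rs: "\<theta> c x [cvec (re_vec v)] = complex_of_real r" "\<theta> c x [cvec (im_vec v)] = complex_of_real s"
        using r by (metis Reals_cases)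
      then have "\<theta> c x [v] = complex_of_real r + \<i> * complex_of_real s"
        using alternating_1_linear[OF a, of "cvec (re_vec v)" \<i> "cvec (im_vec v)"] by (simp add: cvec_re_im)
      then show ?thesis unfolding rs by (simp add: complex_eq_iff)
    qed
    show ?thesis
    proof
      assume "{v. \<theta> c x [cvec v] = 0} = H c x"
      then have h: "\<theta> c x [cvec v] = 0 \<longleftrightarrow> cvec v \<in> CH c x" for v
        using H_iff[OF c(1) x] by blast
      show "\<forall>v. \<theta> c x [v] = 0 \<longleftrightarrow> v \<in> CH c x"
      proof
        show "\<theta> c x [v] = 0 \<longleftrightarrow> v \<in> CH c x" for v
          using e[of v] h[of "re_vec v"] h[of "im_vec v"] CH_re_im[OF c(1) x, of v] by blast
      qed
    next
      assume "\<forall>v. \<theta> c x [v] = 0 \<longleftrightarrow> v \<in> CH c x"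
      then show "{v. \<theta> c x [cvec v] = 0} = H c x"
        using H_iff[OF c(1) x] by blast
    qed
  qed
  then show ?thesis
    unfolding contact_form_def using real_forms_iff[of \<theta> 1 U] by blast
qed

end

text \<open>d\<theta>(X, Y) = -\<theta>([X, Y]) for fields in the kernel of \<theta>: their
  contractions into \<theta> vanish on all of V, and only the bracket term of
  \<open>contract_lie\<close> is left.\<close>

lemma contact_bracket:
  assumes V: "open V" and a: "lform 1 V \<theta>" and X: "smooth_on V X" "smooth_on V Y" and x: "x \<in> V"
    and z: "\<And>y. y \<in> V ==> \<theta> y [X y] = 0" "\<And>y. y \<in> V ==> \<theta> y [Y y] = 0"
    and b: "\<theta> x [lie_bracket X Y x] = 0"
  shows "ld \<theta> x [X x, Y x] = 0"
proof -
  have c0: "contract (F y) (\<theta> y) = 0" if "y \<in> V" "\<theta> y [F y] = 0" for F y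
  proof (rule covector_eqI)
    show "contract (F y) (\<theta> y) [] = 0 []" using that(2) by (simp add: contract_def fun_apply)
    show "contract v (contract (F y) (\<theta> y)) = contract v 0" for v
      using lform_alternating[OF V a that(1)] by simp
  qed
  have s: "sfam V (\<lambda>y. 0)" by (rule sfam_0[OF V])
  have l0: "ld (\<lambda>y. contract (F y) (\<theta> y)) x = 0" if "\<And>y. y \<in> V ==> \<theta> y [F y] = 0" for F
  proof -
    have "ld (\<lambda>y. 0) x = ld (\<lambda>y. contract (F y) (\<theta> y)) x"
      by (rule ld_cong[OF V _ s x]) (simp add: c0 that)
    then show ?thesis by (simp only: ld_0[OF V])
  qed
  then have "contract (Y x) (lie X \<theta> x) = contract (Y x) (contract (X x) (ld \<theta> x))"
    using z by (simp add: lie_def)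
  moreover have "lie X (\<lambda>y. contract (Y y) (\<theta> y)) x [] = 0"
    using l0[OF z(2)] by (simp add: lie_def ld_Nil contract_def fun_apply)
  ultimately show ?thesis
    using fun_cong[OF contract_lie[OF V a X x], of "[]"] b by (simp add: contract_def fun_apply)
qed

section \<open>Local frames, the Reeb field and existence of contact forms\<close>

context cr_manifold
begin

lemma frame_span:
  assumes "c \<in> A" "x \<in> coords c (topspace M)"
  obtains V Z where "open V" "x \<in> V" "V \<subseteq> coords c (topspace M)" "\<And>i. i < n ==> smooth_on V (Z i)"
    "\<And>y. y \<in> V ==> T10 c y = vec.span ((\<lambda>i. Z i y) ` {..<n})"
    "\<And>y. y \<in> V ==> T01 c y = vec.span ((\<lambda>i. cnj_vec (Z i y)) ` {..<n})"
proof -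
  obtain V and Z :: "nat => real ^ 'm => complex ^ 'm" where *: "open V" "x \<in> V" "V \<subseteq> coords c (topspace M)" "\<forall>i<n. smooth_on V (Z i)"
    "\<forall>y\<in>V. T10 c y = vec.span ((\<lambda>i. Z i y) ` {..<n})"
    using distribution_frame[OF assms] by blast
  moreover from this have "T01 c y = vec.span ((\<lambda>i. cnj_vec (Z i y)) ` {..<n})" if "y \<in> V" for y
    using that by (simp add: T01_def cnj_vec_span image_image)
  ultimately show thesis using that by blast
qed

lemma contact_open: "contact_form U \<theta> ==> openin M U"
  and contact_forms: "contact_form U \<theta> ==> \<theta> \<in> forms 1 U"
  and contact_ker: "contact_form U \<theta> ==> c \<in> A ==> x \<in> coords c U ==> \<theta> c x [v] = 0 \<longleftrightarrow> v \<in> CH c x"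
  by (auto simp: contact_form_iff)

lemma contact_real:
  assumes "contact_form U \<theta>" shows "ccnj (\<theta> c x) = \<theta> c x" "ccnj (ext_d U \<theta> c x) = ext_d U \<theta> c x"
proof -
  have U: "openin M U" "\<theta> \<in> forms 1 U" "form_cnj \<theta> = \<theta>"
    using assms by (auto simp: contact_form_iff)
  show "ccnj (\<theta> c x) = \<theta> c x" "ccnj (ext_d U \<theta> c x) = ext_d U \<theta> c x"
    using fun_cong[OF fun_cong[OF U(3)]] fun_cong[OF fun_cong[OF ext_d_form_cnj[OF U(1,2), unfolded U(3)]]]
    by (simp_all add: form_cnj_def)
qed

text \<open>Nondegeneracy is assumed in the first slot of the Levi form; hermitian symmetry carries
  it over to the second.\<close>

lemma levi_zero:
  assumes t: "contact_form U \<theta>" "c \<in> A" "x \<in> coords c U"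
  shows "Z \<in> T10 c x ==> (\<And>W. W \<in> T01 c x ==> ext_d U \<theta> c x [Z, W] = 0) ==> Z = 0"
    and "W \<in> T01 c x ==> (\<And>Z. Z \<in> T10 c x ==> ext_d U \<theta> c x [Z, W] = 0) ==> W = 0"
proof -
  show "Z = 0" if "Z \<in> T10 c x" "\<And>W. W \<in> T01 c x ==> ext_d U \<theta> c x [Z, W] = 0"
    using that by (intro levi_nondegenerate[OF t]) (auto simp: levi_form_def cnj_T01)
  assume W: "W \<in> T01 c x" "\<And>Z. Z \<in> T10 c x ==> ext_d U \<theta> c x [Z, W] = 0"
  have "levi_form U \<theta> c x (cnj_vec W) Z = 0" if Z: "Z \<in> T10 c x" for Z
    using levi_hermitian[OF t Z, of "cnj_vec W"] W Z by (simp add: levi_form_def cnj_T01)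
  then have "cnj_vec W = 0"
    using W by (intro levi_nondegenerate[OF t]) (auto simp: cnj_T01)
  then show "W = 0" by (metis cnj_vec_simps(4,5))
qed

text \<open>Integrability makes d\<theta> vanish on pairs of equal type, and the Levi form is
  nondegenerate, so \<theta> together with d\<theta>(Z_i, _) and d\<theta>(_, B_i), where B_i is the
  conjugate of Z_i, has trivial common kernel. T and the W_i are the smooth dual vectors of this
  system.\<close>

lemma local_frame:
  assumes t: "contact_form U \<theta>" and c: "c \<in> A" "x \<in> coords c U"
  obtains V T Z W where "x \<in> V" "V \<subseteq> coords c U" "cr_local V n (T10 c) (T01 c) (\<theta> c) T Z W"
proof -
  have U: "openin M U" and tf: "\<theta> \<in> forms 1 U" using t by (auto simp: contact_form_iff)
  have cU: "coords c U \<subseteq> coords c (topspace M)" using coords_sub_top[OF U] .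
  obtain V0 Z where Z0: "open V0" "x \<in> V0" "V0 \<subseteq> coords c (topspace M)" "\<And>i. i < n ==> smooth_on V0 (Z i)"
    "\<And>y. y \<in> V0 ==> T10 c y = vec.span ((\<lambda>i. Z i y) ` {..<n})"
    "\<And>y. y \<in> V0 ==> T01 c y = vec.span ((\<lambda>i. cnj_vec (Z i y)) ` {..<n})"
    using frame_span[OF c(1) subsetD[OF cU c(2)]] by metis
  define V where "V = V0 \<inter> coords c U"
  have V: "open V" "x \<in> V" "V \<subseteq> coords c U" "V \<subseteq> V0"
    using Z0 c(2) open_coords[OF c(1) U] by (auto simp: V_def)
  note span10 = Z0(5)[OF subsetD[OF V(4)]] and span01 = Z0(6)[OF subsetD[OF V(4)]]
  define B where "B i y = cnj_vec (Z i y)" for i y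
  have sZ: "smooth_on V (Z i)" if "i < n" for i using smooth_on_subset[OF Z0(4)[OF that] V(4)] .
  have sB: "smooth_on V (B i)" if "i < n" for i unfolding B_def using smooth_on_cnj_vec[OF V(1) sZ[OF that]] .
  have ZT: "Z i y \<in> T10 c y" and BT: "B i y \<in> T01 c y" if "i < n" "y \<in> V" for i y
    using that span10[OF that(2)] span01[OF that(2)] by (auto simp: B_def intro: vec.span_base)
  note lt = lform_subset[OF forms_lform[OF tf c(1)] V(3)]
  have s2: "alternating 2 (ld (\<theta> c) y)" if "y \<in> V" for y
    using lform_alternating[OF V(1) lform_ld[OF V(1) lt] that] by (simp add: numeral_2_eq_2)
  have d: "ext_d U \<theta> c y = ld (\<theta> c) y" if "y \<in> V" for y using that V(3) c(1) by (intro ext_d_ld) auto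
  have ker: "\<theta> c y [v] = 0 \<longleftrightarrow> v \<in> CH c y" if "y \<in> V" for y v
    using contact_ker[OF t c(1)] that V(3) by blast
  have CH_T: "v \<in> T10 c y ==> v \<in> CH c y" "v \<in> T01 c y ==> v \<in> CH c y" if "y \<in> V" for y v
  proof -
    have y: "y \<in> coords c (topspace M)" using that V(3) cU by blast
    note vec.subspace_0[OF T10_subspace[OF c(1) y]] vec.subspace_0[OF T01_subspace[OF c(1) y]]
    then show "v \<in> T10 c y ==> v \<in> CH c y" "v \<in> T01 c y ==> v \<in> CH c y"
      unfolding CH_def by force+
  qed
  have brZ: "lie_bracket (Z i) (Z j) y \<in> T10 c y" if "y \<in> V" "i < n" "j < n" for i j y
    using integrable[OF c(1) V(1) _ sZ[OF that(2)] sZ[OF that(3)] _ that(1)] V(3) cU ZT that by blast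
  \<comment> \<open>Integrability of the conjugate distribution for general fields: it serves the
    conjugate frame B here and the dual frame W at the end.\<close>
  have br01: "lie_bracket X Y y \<in> T01 c y"
    if s: "smooth_on V X" "smooth_on V Y" and m: "\<And>y. y \<in> V ==> X y \<in> T01 c y \<and> Y y \<in> T01 c y" and y: "y \<in> V" for X Y y
  proof -
    note s' = smooth_on_cnj_vec[OF V(1) s(1)] smooth_on_cnj_vec[OF V(1) s(2)]
    have "lie_bracket (\<lambda>y. cnj_vec (X y)) (\<lambda>y. cnj_vec (Y y)) y \<in> T10 c y"
      using V(3) cU m by (intro integrable[OF c(1) V(1) _ s' _ y]) (auto simp: cnj_T01(2)[symmetric])
    then show ?thesis by (simp add: lie_bracket_cnj[OF V(1) s y] cnj_T01(2))
  qed
  have brB: "lie_bracket (B i) (B j) y \<in> T01 c y" if "y \<in> V" "i < n" "j < n" for i j y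
    using br01[OF sB sB] BT that by blast
  have ZZ: "ld (\<theta> c) y [Z i y, Z j y] = 0" if "y \<in> V" "i < n" "j < n" for i j y
    by (rule contact_bracket[OF V(1) lt sZ sZ]) (use that ker CH_T ZT brZ in auto)
  have BB: "ld (\<theta> c) y [B i y, B j y] = 0" if "y \<in> V" "i < n" "j < n" for i j y
    by (rule contact_bracket[OF V(1) lt sB sB]) (use that ker CH_T BT brB in auto)
  have nd10: "z = 0" if y: "y \<in> V" and z: "z \<in> T10 c y" "\<forall>i<n. ld (\<theta> c) y [z, B i y] = 0" for y z
  proof (rule levi_zero(1)[OF t c(1) _ z(1)])
    show "y \<in> coords c U" using y V(3) by blast
    fix W assume "W \<in> T01 c y"
    then have "W \<in> vec.span ((\<lambda>i. B i y) ` {..<n})" using span01[OF y] by (simp add: B_def)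
    then have "ld (\<theta> c) y [z, W] = 0"
    proof (rule vec.span_induct)
      show "vec.subspace {W. ld (\<theta> c) y [z, W] = 0}"
        by (auto intro!: vec.subspaceI simp: alternating_2_simps[OF s2[OF y]])
    qed (use z(2) in auto)
    then show "ext_d U \<theta> c y [z, W] = 0" by (simp add: d[OF y])
  qed
  have nd01: "w = 0" if y: "y \<in> V" and w: "w \<in> T01 c y" "\<forall>i<n. ld (\<theta> c) y [Z i y, w] = 0" for y w
  proof (rule levi_zero(2)[OF t c(1) _ w(1)])
    show "y \<in> coords c U" using y V(3) by blast
    fix z assume "z \<in> T10 c y"
    then have "z \<in> vec.span ((\<lambda>i. Z i y) ` {..<n})" using span10[OF y] by simp
    then have "ld (\<theta> c) y [z, w] = 0"
    proof (rule vec.span_induct)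
      show "vec.subspace {z. ld (\<theta> c) y [z, w] = 0}"
        by (auto intro!: vec.subspaceI simp: alternating_2_simps[OF s2[OF y]])
    qed (use w(2) in auto)
    then show "ext_d U \<theta> c y [z, w] = 0" by (simp add: d[OF y])
  qed
  have pt: "\<theta> c y [v] = 0 \<longleftrightarrow> (\<exists>z w. z \<in> vec.span ((\<lambda>i. Z i y) ` {..<n}) \<and> w \<in> vec.span ((\<lambda>i. B i y) ` {..<n}) \<and> v = z + w)"
    if y: "y \<in> V" for y v
    unfolding ker[OF y] CH_def span10[OF y] span01[OF y] B_def by blast
  have nd: "z \<in> vec.span ((\<lambda>i. Z i y) ` {..<n}) ==> \<forall>i<n. ld (\<theta> c) y [z, B i y] = 0 ==> z = 0"
    "z \<in> vec.span ((\<lambda>i. B i y) ` {..<n}) ==> \<forall>i<n. ld (\<theta> c) y [Z i y, z] = 0 ==> z = 0" if y: "y \<in> V" for y z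
    using nd10[OF y, of z] nd01[OF y, of z] unfolding span10[OF y] span01[OF y] B_def by blast+
  \<comment> \<open>Index 0 stands for \<theta>, 1 to n for pairing with the Z_i, n + 1 to 2 n for
    pairing with the B_i. T is dual to index 0 and W_i to index i + 1.\<close>
  define \<phi> where "\<phi> j y v = (if j = 0 then \<theta> c y [v] else if j \<le> n then ld (\<theta> c) y [Z (j - 1) y, v]
    else ld (\<theta> c) y [v, B (j - n - 1) y])" for j y v
  have phi: "\<phi> 0 y v = \<theta> c y [v]" "i < n ==> \<phi> (Suc i) y v = ld (\<theta> c) y [Z i y, v]"
    "i < n ==> \<phi> (Suc (n + i)) y v = ld (\<theta> c) y [v, B i y]" for i y v
    by (auto simp: \<phi>_def)
  have less_cases: "j = 0 \<or> (\<exists>i<n. j = Suc i) \<or> (\<exists>i<n. j = Suc (n + i))" if "j < CARD('m)" for j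
    using that unfolding dimension by presburger
  have dual: "\<exists>X. smooth_on V X \<and> (\<forall>y\<in>V. \<forall>j<CARD('m). \<phi> j y (X y) = t j)" for t
  proof (rule smooth_dual_vector[OF V(1), where \<phi>=\<phi> and t=t])
    fix j y v w a assume "j < CARD('m)" and y: "y \<in> V"
    then show "\<phi> j y (v + a *s w) = \<phi> j y v + a * \<phi> j y w"
      by (auto simp: \<phi>_def alternating_1_simps[OF lform_alternating[OF V(1) lt y]] alternating_2_simps[OF s2[OF y]])
  next
    fix j v assume "j < CARD('m)"
    note lld = lform_ld[OF V(1) lt]
    have "smooth_on V (\<lambda>y. \<theta> c y [v])" using lt by (auto simp: lform_def sfam_def)
    moreover have "smooth_on V (\<lambda>y. contract (Z i y) (ld (\<theta> c) y) [v])" if "i < n" for i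
      using lform_field[OF V(1) lld sZ[OF that]] by (auto simp: lform_def sfam_def)
    moreover have "smooth_on V (\<lambda>y. contract (B i y) (contract v (ld (\<theta> c) y)) [])" if "i < n" for i
      using lform_field[OF V(1) lform_contract[OF V(1) lld] sB[OF that]] by (auto simp: lform_def sfam_def)
    ultimately show "smooth_on V (\<lambda>y. \<phi> j y v)"
      using less_cases[OF \<open>j < _\<close>] by (auto simp: phi contract_def)
  next
    fix y v assume y: "y \<in> V" and z: "\<And>j. j < CARD('m) ==> \<phi> j y v = 0"
    show "v = 0"
    proof (rule frame_injective[OF lform_alternating[OF V(1) lt y] s2[OF y] pt[OF y] ZZ[OF y] BB[OF y] nd(1)[OF y] nd(2)[OF y]])
      show "\<theta> c y [v] = 0" using z[of 0] by (simp add: phi)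
      show "ld (\<theta> c) y [Z i y, v] = 0" "ld (\<theta> c) y [v, B i y] = 0" if "i < n" for i
        using z[of "Suc i"] z[of "Suc (n + i)"] that dimension by (simp_all add: phi)
    qed (assumption+)
  next
    fix X assume "smooth_on V X" "\<And>y j. y \<in> V ==> j < CARD('m) ==> \<phi> j y (X y) = t j"
    then show ?thesis by blast
  qed
  obtain T where T: "smooth_on V T" "\<forall>y\<in>V. \<forall>j<CARD('m). \<phi> j y (T y) = (if j = 0 then 1 else 0)"
    using dual[of "\<lambda>j. if j = 0 then 1 else 0"] by blast
  have "\<forall>i. \<exists>X. smooth_on V X \<and> (\<forall>y\<in>V. \<forall>j<CARD('m). \<phi> j y (X y) = (if j = Suc i then 1 else 0))"
    by (intro allI dual)
  from choice[OF this] obtain W where W: "smooth_on V (W i)" "\<forall>y\<in>V. \<forall>j<CARD('m). \<phi> j y (W i y) = (if j = Suc i then 1 else 0)" for i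
    by blast
  have cr: "cr_point n (T10 c y) (T01 c y) (\<theta> c y) (ld (\<theta> c) y) (T y) (\<lambda>i. Z i y) (\<lambda>i. W i y)" if y: "y \<in> V" for y
  proof -
    have "cr_point n (vec.span ((\<lambda>i. Z i y) ` {..<n})) (vec.span ((\<lambda>i. B i y) ` {..<n})) (\<theta> c y) (ld (\<theta> c) y)
        (T y) (\<lambda>i. Z i y) (\<lambda>i. W i y)"
    proof (rule cr_pointI[OF lform_alternating[OF V(1) lt y] s2[OF y] pt[OF y] ZZ[OF y] BB[OF y] nd(1)[OF y] nd(2)[OF y]])
      show "\<theta> c y [T y] = 1" "\<theta> c y [W j y] = 0" for j
        using T(2) W(2)[of j] y dimension by (auto simp: phi(1)[symmetric])
      show "ld (\<theta> c) y [Z i y, T y] = 0" "ld (\<theta> c) y [T y, B i y] = 0" if "i < n" for i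
        using T(2)[rule_format, OF y] that dimension by (simp_all add: phi(2,3)[symmetric])
      show "ld (\<theta> c) y [Z i y, W j y] = (if i = j then 1 else 0)" "ld (\<theta> c) y [W j y, B i y] = 0" if "i < n" "j < n" for i j
        using W(2)[of j, rule_format, OF y] that dimension by (simp_all add: phi(2,3)[symmetric])
    qed (assumption+)
    then show ?thesis
      unfolding span10[OF y] span01[OF y] B_def .
  qed
  have "cr_local V n (T10 c) (T01 c) (\<theta> c) T Z W"
  proof (rule cr_local.intro)
    fix y i j assume y: "y \<in> V" and ij: "i < n" "j < n"
    have "W j y \<in> T01 c y" if "j < n" "y \<in> V" for j y
      using cr_point.W_in[OF cr that(1)] that(2) by simp
    then show "lie_bracket (W i) (W j) y \<in> T01 c y"
      using ij by (intro br01 W(1) y) auto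
  qed (use V lt T W sZ cr in auto)
  then show thesis using that V(2,3) by blast
qed

lemma dtransition_T:
  assumes "c \<in> A" "c' \<in> A" "x \<in> coords c (fst c')"
  shows "dtransition c c' x ` T10 c x = T10 c' (transition c c' x)"
    "dtransition c c' x ` T01 c x = T01 c' (transition c c' x)"
    "dtransition c c' x v \<in> CH c' (transition c c' x) \<longleftrightarrow> v \<in> CH c x"
proof -
  show 1: "dtransition c c' x ` T10 c x = T10 c' (transition c c' x)"
    using distribution_compatible[OF assms] .
  show 2: "dtransition c c' x ` T01 c x = T01 c' (transition c c' x)"
    unfolding T01_def 1[symmetric] image_image dtransition_cnj[OF assms] ..
  have "dtransition c c' x ` CH c x = CH c' (transition c c' x)"
  proof
    have add: "dtransition c c' x (z + w) = dtransition c c' x z + dtransition c c' x w" for z w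
      using dtransition_linear[OF assms, of z 1 w] by simp
    show "dtransition c c' x ` CH c x \<subseteq> CH c' (transition c c' x)"
      unfolding CH_def using 1 2 add by blast
    show "CH c' (transition c c' x) \<subseteq> dtransition c c' x ` CH c x"
    proof
      fix u assume "u \<in> CH c' (transition c c' x)"
      then obtain z w where "z \<in> T10 c x" "w \<in> T01 c x" "u = dtransition c c' x z + dtransition c c' x w"
        unfolding CH_def 1[symmetric] 2[symmetric] by blast
      then show "u \<in> dtransition c c' x ` CH c x" unfolding CH_def add[symmetric] by blast
    qed
  qed
  then show "dtransition c c' x v \<in> CH c' (transition c c' x) \<longleftrightarrow> v \<in> CH c x"
    using inj_image_mem_iff[OF inj_dtransition[OF assms]] by metis
qed

text \<open>The defining equations determine T uniquely among complex vectors. Since \<theta> and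
  d\<theta> are real, the conjugate of T solves them too, so T is real and is the vector described
  by \<open>reeb\<close>.\<close>

lemma reeb_frame:
  assumes t: "contact_form U \<theta>" and f: "cr_local V n (T10 c) (T01 c) (\<theta> c) T Z W" and V: "V \<subseteq> coords c U"
    and c: "c \<in> A" and y: "y \<in> V"
  shows "cvec (reeb U \<theta> c y) = T y"
proof -
  interpret p: cr_point n "T10 c y" "T01 c y" "\<theta> c y" "ld (\<theta> c) y" "T y" "\<lambda>i. Z i y" "\<lambda>i. W i y"
    using cr_local.point[OF f y] .
  have d: "ext_d U \<theta> c y = ld (\<theta> c) y" using c y V by (intro ext_d_ld) auto
  have unique: "T' = T y" if "\<theta> c y [T'] = 1" "\<And>v. ld (\<theta> c) y [T', v] = 0" for T'
  proof -
    have "T' = \<theta> c y [T'] *s T y + (\<Sum>i<n. ld (\<theta> c) y [T', W i y] *s Z i y) + (\<Sum>i<n. ld (\<theta> c) y [Z i y, T'] *s W i y)"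
      by (rule p.frame)
    also have "\<dots> = T y" using that(1) p.sigma_swap[of _ T'] by (simp add: that)
    finally show ?thesis .
  qed
  have full: "ld (\<theta> c) y [T', v] = 0" if "\<forall>v. ld (\<theta> c) y [T', cvec v] = 0" for T' v
    using that p.sigma_linear(4)[of T' "cvec (re_vec v)" "\<i> *s cvec (im_vec v)"] by (simp add: cvec_re_im p.sigma_linear(5))
  have "\<theta> c y [cnj_vec (T y)] = 1"
    using fun_cong[OF contact_real(1)[OF t, of c y], of "[cnj_vec (T y)]"] by (simp add: ccnj_def p.theta_T)
  moreover have "ld (\<theta> c) y [cnj_vec (T y), v] = 0" for v
    using fun_cong[OF contact_real(2)[OF t, of c y], of "[cnj_vec (T y), v]"] by (simp add: ccnj_def p.sigma_T d)
  ultimately have "cnj_vec (T y) = T y" by (rule unique)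
  then have T: "cvec (re_vec (T y)) = T y"
    by (simp add: vec_eq_iff cvec_def re_vec_def complex_eq_iff)
  have "reeb U \<theta> c y = re_vec (T y)"
    unfolding reeb_def
  proof (rule the_equality)
    show "\<theta> c y [cvec (re_vec (T y))] = 1 \<and> (\<forall>v. ext_d U \<theta> c y [cvec (re_vec (T y)), cvec v] = 0)"
      by (simp add: T d p.theta_T p.sigma_T)
    fix R assume "\<theta> c y [cvec R] = 1 \<and> (\<forall>v. ext_d U \<theta> c y [cvec R, cvec v] = 0)"
    then have "cvec R = T y" using unique[of "cvec R"] full[of "cvec R"] by (simp add: d)
    then show "R = re_vec (T y)" by (metis re_vec_simps(7))
  qed
  then show ?thesis by (simp add: T)
qed

lemma alternating_1_eqI:
  assumes "alternating 1 \<alpha>" "alternating 1 \<beta>" "\<And>v. \<alpha> [v] = \<beta> [v]" shows "\<alpha> = \<beta>"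
proof
  fix vs show "\<alpha> vs = \<beta> vs"
    using assms(3) alternating_length[OF assms(1), of vs] alternating_length[OF assms(2), of vs]
    by (cases "\<exists>v. vs = [v]") (auto simp: length_Suc_conv)
qed

text \<open>Two contact forms have the same kernel and are proportional; the factor is the value of
  \<theta>' on the smooth Reeb field of \<theta>, hence smooth, and \<open>ld_scale\<close> supplies
  \<mu> as its differential.\<close>

lemma contact_change:
  assumes t: "contact_form U \<theta>" "contact_form U' \<theta>'" and c: "c \<in> A" and x: "x \<in> coords c U" "x \<in> coords c U'"
  obtains g \<mu> where "g \<noteq> 0" "alternating 1 \<mu>" "\<theta>' c x = cscale g (\<theta> c x)"
    "ext_d U' \<theta>' c x = cscale g (ext_d U \<theta> c x) + wedge \<mu> (\<theta> c x)"
proof -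
  obtain V0 T Z W where V0: "x \<in> V0" "V0 \<subseteq> coords c U" "cr_local V0 n (T10 c) (T01 c) (\<theta> c) T Z W"
    using local_frame[OF t(1) c x(1)] by blast
  interpret l: cr_local V0 n "T10 c" "T01 c" "\<theta> c" T Z W by fact
  define V where "V = V0 \<inter> coords c U'"
  have V: "open V" "x \<in> V" "V \<subseteq> V0" "V \<subseteq> coords c U'"
    using l.V V0(1) x(2) open_coords[OF c contact_open[OF t(2)]] by (auto simp: V_def)
  note f = lform_subset[OF l.theta_form V(3)] and f' = lform_subset[OF forms_lform[OF contact_forms[OF t(2)] c] V(4)]
  define g where "g y = \<theta>' c y [T y]" for y
  have sg: "smooth_on V g"
    using lform_field[OF V(1) f' smooth_on_subset[OF l.smooth_T V(3)]] by (auto simp: lform_def sfam_def g_def[abs_def] contract_def)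
  have ker: "\<theta> c y [v] = 0 \<longleftrightarrow> \<theta>' c y [v] = 0" if "y \<in> V" for y v
    using contact_ker[OF t(1) c] contact_ker[OF t(2) c] that V V0(2) by blast
  have eq: "\<theta>' c y = cscale (g y) (\<theta> c y)" if y: "y \<in> V" for y
  proof (rule alternating_1_eqI[OF lform_alternating[OF V(1) f' y] alternating_cscale[OF lform_alternating[OF V(1) f y]]])
    fix v
    have "\<theta> c y [T y] = 1" using cr_point.theta_T[OF l.point] y V(3) by blast
    then have "\<theta> c y [v + (- \<theta> c y [v]) *s T y] = 0"
      by (simp only: alternating_1_linear[OF lform_alternating[OF V(1) f y]]) simp
    then have "\<theta>' c y [v + (- \<theta> c y [v]) *s T y] = 0" using ker[OF y] by blast
    then show "\<theta>' c y [v] = cscale (g y) (\<theta> c y) [v]"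
      by (simp only: alternating_1_linear[OF lform_alternating[OF V(1) f' y]]) (simp add: g_def cscale_apply)
  qed
  have "g x \<noteq> 0"
    using ker[OF V(2), of "T x"] cr_point.theta_T[OF l.point[OF V0(1)]] by (simp add: g_def)
  moreover obtain \<mu> where "alternating 1 \<mu>" "ld (\<lambda>y. cscale (g y) (\<theta> c y)) x = wedge \<mu> (\<theta> c x) + cscale (g x) (ld (\<theta> c) x)"
    using ld_scale[OF V(1) sg lform_sfam[OF V(1) f] V(2)] by blast
  moreover have "ld (\<theta>' c) x = ld (\<lambda>y. cscale (g y) (\<theta> c y)) x"
    by (rule ld_cong[OF V(1) eq lform_sfam[OF V(1) f'] V(2)])
  ultimately show thesis
    using that[of "g x" \<mu>] eq[OF V(2)] c x by (simp add: ext_d_ld add.commute)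
qed

lemma sum_lessThan_add: "(\<Sum>j<a + b. f j) = (\<Sum>j<a. f j) + (\<Sum>j<b. f (a + j :: nat) :: 'z::comm_monoid_add)"
  by (induction b) (auto simp: add.assoc)

lemma cnj_vec_sum: "cnj_vec (\<Sum>i\<in>I. f i) = (\<Sum>i\<in>I. cnj_vec (f i))"
  by (induction I rule: infinite_finite_induct) auto

text \<open>A spanning family with as many members as the dimension is independent; in particular
  its members are distinct, which permits the reindexing.\<close>

lemma frame_independent:
  fixes Z :: "nat => complex ^ 'k::finite"
  assumes "vec.dim (vec.span (Z ` {..<n})) = n" "(\<Sum>i<n. u i *s Z i) = 0" "i < n"
  shows "u i = 0"
proof -
  let ?S = "Z ` {..<n}"
  have "card ?S \<le> n" using card_image_le[of "{..<n}" Z] by simp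
  then have ind: "vec.independent ?S"
    using assms(1) by (intro vec.card_le_dim_spanning[of ?S "vec.span ?S"]) (auto intro: vec.span_base)
  then have "card ?S = n" using vec.indep_card_eq_dim_span[OF ind] assms(1) by simp
  then have inj: "inj_on Z {..<n}" by (simp add: eq_card_imp_inj_on)
  have "(\<Sum>v\<in>?S. u (inv_into {..<n} Z v) *s v) = (\<Sum>i<n. u i *s Z i)"
    by (subst sum.reindex[OF inj]) (auto intro!: sum.cong simp: inv_into_f_f[OF inj])
  then have "u (inv_into {..<n} Z (Z i)) = 0"
    using assms by (intro vec.independentD[OF ind, of ?S]) auto
  then show ?thesis using inv_into_f_f[OF inj, of i] assms(3) by simp
qed

lemma forms_eqI_chart:
  assumes "c0 \<in> A" "U \<subseteq> fst c0" and w: "\<omega> \<in> forms k U" "\<eta> \<in> forms k U"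
    and eq: "\<And>x. x \<in> coords c0 U ==> \<omega> c0 x = \<eta> c0 x"
  shows "\<omega> = \<eta>"
proof (rule forms_eqI[OF w])
  fix c x assume c: "c \<in> A" "x \<in> coords c U"
  have "x \<in> coords c (U \<inter> fst c0)" using c(2) assms(2) by (auto simp: coords_def)
  moreover from this have "transition c c0 x \<in> coords c0 U"
    using transition_mem[OF c(1)] coords_mono[of "U \<inter> fst c" U c0] by blast
  ultimately show "\<omega> c x = \<eta> c x"
    using forms_pullback[OF w(1) c(1) assms(1)] forms_pullback[OF w(2) c(1) assms(1)] eq by simp
qed

text \<open>Otherwise 2 n vectors, the frame and its conjugate, would span a space of dimension 2 n
  + 1.\<close>

lemma H_proper:
  assumes "c \<in> A" "x \<in> coords c (topspace M)"
  obtains v where "cvec v \<notin> CH c x"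
proof (cases "\<forall>v. cvec v \<in> CH c x")
  case True
  then have all: "v \<in> CH c x" for v using CH_re_im[OF assms] by blast
  obtain V and Z :: "nat => real ^ 'm => complex ^ 'm" where
    Z: "x \<in> V" "\<And>y. y \<in> V ==> T10 c y = vec.span ((\<lambda>i. Z i y) ` {..<n})"
    "\<And>y. y \<in> V ==> T01 c y = vec.span ((\<lambda>i. cnj_vec (Z i y)) ` {..<n})"
    using frame_span[OF assms] by metis
  define S where "S = (\<lambda>i. Z i x) ` {..<n} \<union> (\<lambda>i. cnj_vec (Z i x)) ` {..<n}"
  have "card (f ` {..<n}) \<le> n" for f :: "nat => complex ^ 'm" using card_image_le[of "{..<n}" f] by simp
  then have "card S \<le> n + n" unfolding S_def by (intro order.trans[OF card_Un_le] add_mono)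
  moreover have "v \<in> vec.span S" for v
  proof -
    obtain z w where "z \<in> T10 c x" "w \<in> T01 c x" "v = z + w" using all[of v] by (auto simp: CH_def)
    moreover have "T10 c x \<subseteq> vec.span S" "T01 c x \<subseteq> vec.span S"
      unfolding Z(2,3)[OF Z(1)] S_def by (intro vec.span_mono; blast)+
    ultimately show ?thesis using vec.span_add by blast
  qed
  then have "vec.dim (UNIV :: (complex ^ 'm) set) \<le> card S"
    by (intro vec.dim_le_card) (auto simp: S_def)
  ultimately show thesis using dimension unfolding vec_dim_card by simp
qed (use that in blast)

text \<open>A real vector v0 outside H, the frame and its conjugate form a basis near the point by
  rank and transversality, and the coefficient of v0 has kernel \<open>CH\<close>. It is real
  because its kernel is stable under conjugation and its value at the real vector v0 is 1.\<close>

lemma exists_contact_form: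
  assumes p: "p \<in> topspace M"
  obtains U \<theta> where "p \<in> U" "contact_form U \<theta>"
proof -
  obtain c where c: "c \<in> A" "p \<in> fst c" using p cover by blast
  define x where "x = snd c p"
  have x: "x \<in> coords c (topspace M)" using c p by (auto simp: x_def intro: coordsI)
  obtain v0 where v0: "cvec v0 \<notin> CH c x" using H_proper[OF c(1) x] by blast
  obtain V and Z :: "nat => real ^ 'm => complex ^ 'm" where
    V: "open V" "x \<in> V" "V \<subseteq> coords c (topspace M)" and sZ: "\<And>i. i < n ==> smooth_on V (Z i)"
    and span10: "\<And>y. y \<in> V ==> T10 c y = vec.span ((\<lambda>i. Z i y) ` {..<n})"
    and span01: "\<And>y. y \<in> V ==> T01 c y = vec.span ((\<lambda>i. cnj_vec (Z i y)) ` {..<n})"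
    using frame_span[OF c(1) x] by metis
  define b where "b j y = (if j = 0 then cvec v0 else if j \<le> n then Z (j - 1) y else cnj_vec (Z (j - n - 1) y))" for j y
  have b: "b 0 y = cvec v0" "i < n ==> b (Suc i) y = Z i y" "i < n ==> b (Suc (n + i)) y = cnj_vec (Z i y)" for i y
    by (auto simp: b_def)
  have split: "(\<Sum>j<CARD('m). u j *s b j y) = u 0 *s cvec v0 + ((\<Sum>i<n. u (Suc i) *s Z i y) + (\<Sum>i<n. u (Suc (n + i)) *s cnj_vec (Z i y)))" for u y
    unfolding dimension Suc_eq_plus1[symmetric] sum.lessThan_Suc_shift mult_2 sum_lessThan_add by (simp add: b)
  have m10: "(\<Sum>i<n. u i *s Z i y) \<in> T10 c y" and m01: "(\<Sum>i<n. u i *s cnj_vec (Z i y)) \<in> T01 c y" if "y \<in> V" for u y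
    unfolding span10[OF that] span01[OF that] by (auto intro!: vec.span_sum vec.span_scale intro: vec.span_base)
  have indep: "\<forall>j<CARD('m). u j = 0" if "(\<Sum>j<CARD('m). u j *s b j x) = 0" for u
  proof -
    define z w where "z = (\<Sum>i<n. u (Suc i) *s Z i x)" and "w = (\<Sum>i<n. u (Suc (n + i)) *s cnj_vec (Z i x))"
    have zw: "z \<in> T10 c x" "w \<in> T01 c x" unfolding z_def w_def using m10[OF V(2)] m01[OF V(2)] by auto
    have e: "u 0 *s cvec v0 + (z + w) = 0" using that by (simp add: split z_def w_def)
    have u0: "u 0 = 0"
    proof (rule ccontr)
      assume "u 0 \<noteq> 0"
      then have "cvec v0 = (- 1 / u 0) *s (z + w)"
        using e by (simp add: vec_eq_iff field_simps) (metis add.commute add_eq_0_iff)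
      moreover have "z + w \<in> CH c x" using zw unfolding CH_def by blast
      ultimately show False using v0 vec.subspace_scale[OF CH_subspace[OF c(1) x]] by metis
    qed
    then have "z = - w" using e by (simp add: add_eq_0_iff2)
    then have "z \<in> T10 c x \<inter> T01 c x" using zw vec.subspace_neg[OF T01_subspace[OF c(1) x]] by auto
    then have z0: "z = 0" using transversal[OF c(1) x] by blast
    then have w0: "w = 0" using \<open>z = - w\<close> by simp
    note d = distribution_rank[OF c(1) x, unfolded span10[OF V(2)]]
    have "u (Suc i) = 0" if "i < n" for i
      using frame_independent[OF d, of "\<lambda>i. u (Suc i)"] z0 that unfolding z_def by blast
    moreover have "cnj (u (Suc (n + i))) = 0" if "i < n" for i
    proof (rule frame_independent[OF d _ that])
      have "cnj_vec w = (\<Sum>i<n. cnj (u (Suc (n + i))) *s Z i x)"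
        unfolding w_def cnj_vec_sum by simp
      then show "(\<Sum>i<n. cnj (u (Suc (n + i))) *s Z i x) = 0" using w0 by simp
    qed
    ultimately have *: "u (Suc i) = 0" "u (Suc (n + i)) = 0" if "i < n" for i using that by auto
    have "u j = 0" if "j < CARD('m)" for j
    proof -
      have "j = 0 \<or> (\<exists>i<n. j = Suc i) \<or> (\<exists>i<n. j = Suc (n + i))" using that unfolding dimension by presburger
      then show ?thesis using u0 * by auto
    qed
    then show ?thesis by blast
  qed
  have sb: "smooth_on V (b j)" if "j < CARD('m)" for j
  proof -
    have "j = 0 \<or> (\<exists>i<n. j = Suc i) \<or> (\<exists>i<n. j = Suc (n + i))" using that unfolding dimension by presburger
    moreover have "b 0 = (\<lambda>y. cvec v0)" by (simp add: b_def fun_eq_iff)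
    moreover have "b (Suc i) = Z i" "b (Suc (n + i)) = (\<lambda>y. cnj_vec (Z i y))" if "i < n" for i
      using that by (auto simp: b_def fun_eq_iff)
    ultimately show ?thesis using sZ smooth_on_cnj_vec[OF V(1) sZ] by auto
  qed
  obtain V' \<theta>0 where V': "open V'" "x \<in> V'" "V' \<subseteq> V" "lform 1 V' \<theta>0"
    and val: "\<And>y u. y \<in> V' ==> \<theta>0 y [\<Sum>j<CARD('m). u j *s b j y] = u 0"
    and surj: "\<And>y v. y \<in> V' ==> \<exists>u. v = (\<Sum>j<CARD('m). u j *s b j y)"
    by (rule smooth_dual_covector[OF V(1,2) sb indep]) (assumption, assumption, rule that)
  have lin: "\<theta>0 y [v + a *s w] = \<theta>0 y [v] + a * \<theta>0 y [w]" if "y \<in> V'" for y v a w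
    by (rule alternating_1_linear[OF lform_alternating[OF V'(1,4) that]])
  have val_b: "\<theta>0 y [b k y] = (if k = 0 then 1 else 0)" if "y \<in> V'" "k < CARD('m)" for y k
  proof -
    have "(\<Sum>j<CARD('m). (if j = k then 1 else 0) *s b j y) = b k y"
      using that(2) by (simp add: if_distrib[of "\<lambda>a. a *s _"] cong: if_cong)
    then show ?thesis using val[OF that(1), of "\<lambda>j. if j = k then 1 else 0"] by simp
  qed
  have ker: "\<theta>0 y [v] = 0 \<longleftrightarrow> v \<in> CH c y" if y: "y \<in> V'" for y v
  proof
    assume "\<theta>0 y [v] = 0"
    moreover obtain u where u: "v = (\<Sum>j<CARD('m). u j *s b j y)" using surj[OF y] by blast
    ultimately have "u 0 = 0" using val[OF y] by simp
    then show "v \<in> CH c y"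
      using m10[of y "\<lambda>i. u (Suc i)"] m01[of y "\<lambda>i. u (Suc (n + i))"] y V'(3) unfolding u split CH_def by auto
  next
    assume "v \<in> CH c y"
    then obtain z w where v: "z \<in> T10 c y" "w \<in> T01 c y" "v = z + w" by (auto simp: CH_def)
    have yV: "y \<in> V" using y V'(3) by blast
    have sub: "vec.subspace {z. \<theta>0 y [z] = 0}"
      using lin[OF y, of 0 1 0] lin[OF y, of 0] lin[OF y, of _ 1] by (auto intro!: vec.subspaceI)
    have "Z i y \<in> {z. \<theta>0 y [z] = 0}" "cnj_vec (Z i y) \<in> {z. \<theta>0 y [z] = 0}" if "i < n" for i
      using val_b[OF y, of "Suc i"] val_b[OF y, of "Suc (n + i)"] that dimension by (simp_all add: b)
    then have "(\<lambda>i. Z i y) ` {..<n} \<subseteq> {z. \<theta>0 y [z] = 0}" "(\<lambda>i. cnj_vec (Z i y)) ` {..<n} \<subseteq> {z. \<theta>0 y [z] = 0}"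
      by blast+
    note this[THEN vec.span_minimal, OF sub]
    then have "\<theta>0 y [z] = 0" "\<theta>0 y [w] = 0"
      using v(1,2) unfolding span10[OF yV] span01[OF yV] by blast+
    then show "\<theta>0 y [v] = 0" using lin[OF y, of z 1 w] v(3) by simp
  qed
  have real: "ccnj (\<theta>0 y) = \<theta>0 y" if y: "y \<in> V'" for y
  proof (rule alternating_1_eqI)
    show a: "alternating 1 (\<theta>0 y)" by (rule lform_alternating[OF V'(1,4) y])
    then show "alternating 1 (ccnj (\<theta>0 y))" by (rule alternating_ccnj)
    fix v
    have b0: "\<theta>0 y [cvec v0] = 1" using val_b[OF y, of 0] by (simp add: b)
    define h where "h = v + (- \<theta>0 y [v]) *s cvec v0"
    have "\<theta>0 y [h] = 0" unfolding h_def lin[OF y] b0 by simp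
    then have "\<theta>0 y [cnj_vec h] = 0" unfolding ker[OF y] CH_cnj .
    moreover have "cnj_vec v = cnj_vec h + cnj (\<theta>0 y [v]) *s cvec v0"
      by (simp add: h_def)
    ultimately have "\<theta>0 y [cnj_vec v] = cnj (\<theta>0 y [v])" using lin[OF y, of "cnj_vec h"] b0 by simp
    then show "ccnj (\<theta>0 y) [v] = \<theta>0 y [v]" by (simp add: ccnj_def)
  qed
  obtain U where U: "openin M U" "U \<subseteq> fst c" "coords c U = V'"
    using open_from_coords[OF c(1) V'(1)] V'(3) V(3) by (metis order.trans)
  obtain \<theta> where th: "\<theta> \<in> forms 1 U" "\<And>y. y \<in> V' ==> \<theta> c y = \<theta>0 y"
    using forms_extend[OF c(1) U(1,2), of 1 \<theta>0] V'(4) unfolding U(3) by blast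
  have "contact_form U \<theta>"
    unfolding contact_form_iff
  proof (intro conjI ballI allI)
    show "form_cnj \<theta> = \<theta>"
      by (rule forms_eqI_chart[OF c(1) U(2) form_cnj_forms[OF U(1) th(1)] th(1)]) (simp add: form_cnj_def U(3) th(2) real)
    fix c' y v assume c': "c' \<in> A" "y \<in> coords c' U"
    have y: "y \<in> coords c' (U \<inter> fst c)" "y \<in> coords c' (fst c)" using c'(2) U(2) by (auto simp: coords_def)
    have ty: "transition c' c y \<in> V'"
      using transition_mem[OF c'(1) y(1)] coords_mono[of "U \<inter> fst c'" U c] U(3) by blast
    have "\<theta> c' y [v] = \<theta>0 (transition c' c y) [dtransition c' c y v]"
      unfolding forms_pullback[OF th(1) c'(1) c(1) y(1)] pullback_def by (simp add: th(2) ty)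
    then show "\<theta> c' y [v] = 0 \<longleftrightarrow> v \<in> CH c' y"
      using ker[OF ty] dtransition_T(3)[OF c'(1) c(1) y(2)] by simp
  qed (use U th in auto)
  moreover have "p \<in> U"
  proof -
    have "snd c p \<in> coords c U" using V'(2) U(3) by (simp add: x_def)
    then obtain p' where "p' \<in> fst c" "p' \<in> U" "snd c p = snd c p'" by (auto elim: coordsE)
    then show ?thesis using inj_chart[OF c(1)] c(2) by (auto dest: inj_onD)
  qed
  ultimately show thesis using that by blast
qed

end

lemma cr_local_subset:
  assumes "cr_local V n V10 V01 \<theta> T Z W" "open V'" "V' \<subseteq> V"
  shows "cr_local V' n V10 V01 \<theta> T Z W"
proof -
  interpret cr_local V n V10 V01 \<theta> T Z W by fact
  show ?thesis
    using assms(2,3) point involutive lform_subset[OF theta_form] smooth_on_subset[OF smooth_T]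
      smooth_on_subset[OF smooth_Z] smooth_on_subset[OF smooth_W]
    by (intro cr_local.intro) blast+
qed

section \<open>Gluing local solutions over the manifold\<close>

context cr_manifold
begin

lemma ext_d_local:
  assumes "openin M U" "c \<in> A" "open V" "V \<subseteq> coords c U" "lform k V f" "\<And>y. y \<in> V ==> \<omega> c y = f y" "x \<in> V"
  shows "ext_d U \<omega> c x = ld f x"
proof -
  have "ld f x = ld (\<omega> c) x"
    by (rule ld_cong[OF assms(3) _ lform_sfam[OF assms(3,5)] assms(7)]) (simp add: assms(6))
  then show ?thesis using assms by (subst ext_d_ld) auto
qed

text \<open>By \<open>transport\<close> and \<open>scale\<close> the condition \<open>P\<close> depends neither on the chart nor on the contact form, so
  that local solutions need only be found in one chart and for one contact form.\<close>

lemma glue_solutions: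
  fixes P :: "('a, 'm) chart => real ^ 'm => 'm covector => 'm covector => 'm covector => 'm covector => bool"
  assumes ex: "\<And>U \<theta> c V T Z W. contact_form U \<theta> ==> c \<in> A ==> V \<subseteq> coords c U ==>
      cr_local V n (T10 c) (T01 c) (\<theta> c) T Z W ==>
      \<exists>f. lform k V f \<and> (\<forall>y\<in>V. P c y (\<theta> c y) (ld (\<theta> c) y) (f y) (ld f y))"
    and transport: "\<And>c c' x \<theta> \<sigma> u u'. c \<in> A ==> c' \<in> A ==> x \<in> coords c (fst c') ==>
      P c' (transition c c' x) \<theta> \<sigma> u u' ==> P c x (pullback (dtransition c c' x) \<theta>) (pullback (dtransition c c' x) \<sigma>)
        (pullback (dtransition c c' x) u) (pullback (dtransition c c' x) u')"
    and scale: "\<And>c x \<theta> \<sigma> \<mu> g u u'. alternating 1 \<theta> ==> alternating 2 \<sigma> ==> alternating 1 \<mu> ==> g \<noteq> 0 ==>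
      P c x \<theta> \<sigma> u u' ==> P c x (cscale g \<theta>) (cscale g \<sigma> + wedge \<mu> \<theta>) u u'"
    and unique: "\<And>U \<theta> c V T Z W f f' x. contact_form U \<theta> ==> c \<in> A ==> V \<subseteq> coords c U ==>
      cr_local V n (T10 c) (T01 c) (\<theta> c) T Z W ==> lform k V f ==> lform k V f' ==>
      (\<And>y. y \<in> V ==> P c y (\<theta> c y) (ld (\<theta> c) y) (f y) (ld f y)) ==>
      (\<And>y. y \<in> V ==> P c y (\<theta> c y) (ld (\<theta> c) y) (f' y) (ld f' y)) ==> x \<in> V ==> f x = f' x"
  obtains f where "f \<in> forms k (topspace M)"
    "\<And>U \<theta> c x. contact_form U \<theta> ==> c \<in> A ==> x \<in> coords c U ==> P c x (\<theta> c x) (ext_d U \<theta> c x) (f c x) (dM f c x)"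
proof -
  \<comment> \<open>Quantifying over all contact forms makes \<open>Q\<close> intrinsic; two local
    solutions can then be compared through any contact form near the point.\<close>
  define Q where "Q U f \<longleftrightarrow> (\<forall>U' \<theta> c x. contact_form U' \<theta> --> c \<in> A --> x \<in> coords c U --> x \<in> coords c U' -->
    P c x (\<theta> c x) (ext_d U' \<theta> c x) (f c x) (ext_d U f c x))" for U f
  have Q_ex: "\<exists>U f. openin M U \<and> a \<in> U \<and> f \<in> forms k U \<and> Q U f" if a: "a \<in> topspace M" for a
  proof -
    obtain U0 \<theta>0 where t: "a \<in> U0" "contact_form U0 \<theta>0" using exists_contact_form[OF a] by blast
    obtain c0 where c0: "c0 \<in> A" "a \<in> fst c0" using a cover by blast
    obtain V T Z W where V: "snd c0 a \<in> V" "V \<subseteq> coords c0 U0" "cr_local V n (T10 c0) (T01 c0) (\<theta>0 c0) T Z W"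
      using local_frame[OF t(2) c0(1) coordsI[OF c0(2) t(1)]] by blast
    have oV: "open V" using cr_local.V[OF V(3)] .
    obtain f0 where f0: "lform k V f0" "\<And>y. y \<in> V ==> P c0 y (\<theta>0 c0 y) (ld (\<theta>0 c0) y) (f0 y) (ld f0 y)"
      using ex[OF t(2) c0(1) V(2,3)] by blast
    obtain U where U: "openin M U" "U \<subseteq> fst c0" "coords c0 U = V"
      using open_from_coords[OF c0(1) oV] V(2) coords_sub_top[OF contact_open[OF t(2)]] by (metis order.trans)
    obtain f where f: "f \<in> forms k U" "\<And>y. y \<in> V ==> f c0 y = f0 y"
      using forms_extend[OF c0(1) U(1,2), of k f0] f0(1) unfolding U(3) by blast
    have aU: "a \<in> U" if "a \<in> fst c0" "snd c0 a \<in> V" for a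
    proof -
      obtain b where "b \<in> fst c0" "b \<in> U" "snd c0 a = snd c0 b" using \<open>snd c0 a \<in> V\<close>[folded U(3)] by (auto elim: coordsE)
      then show ?thesis using inj_chart[OF c0(1)] that(1) by (auto dest: inj_onD)
    qed
    have UU: "U \<subseteq> U0"
    proof
      fix b assume b: "b \<in> U"
      then have "snd c0 b \<in> coords c0 U0" using U V(2) coordsI[of b c0 U] by blast
      then obtain b' where "b' \<in> fst c0" "b' \<in> U0" "snd c0 b = snd c0 b'" by (auto elim: coordsE)
      then show "b \<in> U0" using inj_chart[OF c0(1)] b U(2) by (metis inj_onD subsetD)
    qed
    have "Q U f"
      unfolding Q_def
    proof (intro allI impI)
      fix U' \<theta> c x assume t': "contact_form U' \<theta>" and c: "c \<in> A" and x: "x \<in> coords c U" "x \<in> coords c U'"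
      have x0: "x \<in> coords c U0" "x \<in> coords c (U0 \<inter> fst c0)" "x \<in> coords c (U \<inter> fst c0)" "x \<in> coords c (fst c0)"
        using x(1) UU U(2) by (auto simp: coords_def)
      let ?x = "transition c c0 x" and ?F = "dtransition c c0 x"
      have xV: "?x \<in> V" using transition_mem[OF c x0(3)] coords_mono[of "U \<inter> fst c" U c0] U(3) by blast
      have e: "ext_d U0 \<theta>0 c0 ?x = ld (\<theta>0 c0) ?x" "ext_d U f c0 ?x = ld f0 ?x"
      proof -
        show "ext_d U0 \<theta>0 c0 ?x = ld (\<theta>0 c0) ?x" using ext_d_ld[OF c0(1)] xV V(2) by blast
        show "ext_d U f c0 ?x = ld f0 ?x"
          by (rule ext_d_local[OF U(1) c0(1) oV _ f0(1) _ xV]) (simp_all add: U(3) f(2))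
      qed
      have "P c x (\<theta>0 c x) (ext_d U0 \<theta>0 c x) (f c x) (ext_d U f c x)"
        using transport[OF c c0(1) x0(4) f0(2)[OF xV]]
        unfolding forms_pullback[OF contact_forms[OF t(2)] c c0(1) x0(2)] forms_pullback[OF f(1) c c0(1) x0(3)]
          forms_pullback[OF ext_d_forms[OF contact_open[OF t(2)] contact_forms[OF t(2)]] c c0(1) x0(2)]
          forms_pullback[OF ext_d_forms[OF U(1) f(1)] c c0(1) x0(3)] e f(2)[OF xV] .
      moreover obtain g \<mu> where "g \<noteq> 0" "alternating 1 \<mu>" "\<theta> c x = cscale g (\<theta>0 c x)"
          "ext_d U' \<theta> c x = cscale g (ext_d U0 \<theta>0 c x) + wedge \<mu> (\<theta>0 c x)"
        using contact_change[OF t(2) t' c x0(1) x(2)] by blast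
      moreover have "alternating 1 (\<theta>0 c x)" "alternating (Suc 1) (ext_d U0 \<theta>0 c x)"
        using forms_alternating[OF contact_forms[OF t(2)]]
          forms_alternating[OF ext_d_forms[OF contact_open[OF t(2)] contact_forms[OF t(2)]]] by blast+
      ultimately show "P c x (\<theta> c x) (ext_d U' \<theta> c x) (f c x) (ext_d U f c x)"
        using scale[of "\<theta>0 c x" "ext_d U0 \<theta>0 c x" \<mu> g] unfolding numeral_2_eq_2 One_nat_def by metis
    qed
    then show ?thesis using U(1) f(1) aU[OF c0(2) V(1)] by blast
  qed
  have Q_unique: "f c x = f' c x"
    if U: "openin M U" "openin M U'" and f: "f \<in> forms k U" "f' \<in> forms k U'" and Q: "Q U f" "Q U' f'"
      and c: "c \<in> A" and x: "x \<in> coords c (U \<inter> U')" for U f U' f' c x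
  proof -
    obtain a where a: "a \<in> fst c" "a \<in> U" "a \<in> U'" "x = snd c a" using x by (auto elim: coordsE)
    have "a \<in> topspace M" using a(2) openin_subset[OF U(1)] by blast
    then obtain U0 \<theta> where t: "a \<in> U0" "contact_form U0 \<theta>" using exists_contact_form by blast
    obtain V0 T Z W where V0: "x \<in> V0" "V0 \<subseteq> coords c U0" "cr_local V0 n (T10 c) (T01 c) (\<theta> c) T Z W"
      using local_frame[OF t(2) c coordsI[OF a(1) t(1)]] a(4) by metis
    define V where "V = V0 \<inter> coords c (U \<inter> U')"
    have V: "open V" "V \<subseteq> V0" "V \<subseteq> coords c U" "V \<subseteq> coords c U'" "x \<in> V"
      using cr_local.V[OF V0(3)] open_coords[OF c openin_Int[OF U]] V0(1) x by (auto simp: V_def coords_Int[OF c])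
    have "P c y (\<theta> c y) (ld (\<theta> c) y) (f c y) (ld (f c) y)" "P c y (\<theta> c y) (ld (\<theta> c) y) (f' c y) (ld (f' c) y)"
      if y: "y \<in> V" for y
    proof -
      have y: "y \<in> coords c U" "y \<in> coords c U'" "y \<in> coords c U0" using y V V0(2) by blast+
      show "P c y (\<theta> c y) (ld (\<theta> c) y) (f c y) (ld (f c) y)"
        using Q(1)[unfolded Q_def, rule_format, OF t(2) c y(1,3)] unfolding ext_d_ld[OF c y(3)] ext_d_ld[OF c y(1)] .
      show "P c y (\<theta> c y) (ld (\<theta> c) y) (f' c y) (ld (f' c) y)"
        using Q(2)[unfolded Q_def, rule_format, OF t(2) c y(2,3)] unfolding ext_d_ld[OF c y(3)] ext_d_ld[OF c y(2)] .
    qed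
    then show ?thesis
      using unique[OF t(2) c order.trans[OF V(2) V0(2)] cr_local_subset[OF V0(3) V(1,2)]
          lform_subset[OF forms_lform[OF f(1) c] V(3)] lform_subset[OF forms_lform[OF f(2) c] V(4)] _ _ V(5)] by blast
  qed
  obtain f where f: "f \<in> forms k (topspace M)"
    "\<And>U f' c x. openin M U ==> f' \<in> forms k U ==> Q U f' ==> c \<in> A ==> x \<in> coords c U ==> f c x = f' c x"
  proof (rule forms_glue[of k Q])
    show "f c x = f' c x"
      if "openin M U" "openin M U'" "f \<in> forms k U" "f' \<in> forms k U'" "Q U f" "Q U' f'" "c \<in> A" "x \<in> coords c (U \<inter> U')"
      for U f U' f' c x
      by (rule Q_unique[of U U' f f' c x]) (fact that)+
  qed (erule Q_ex, rule that)
  moreover have "P c x (\<theta> c x) (ext_d U \<theta> c x) (f c x) (dM f c x)"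
    if t: "contact_form U \<theta>" and c: "c \<in> A" and x: "x \<in> coords c U" for U \<theta> c x
  proof -
    obtain a where a: "a \<in> fst c" "a \<in> U" "x = snd c a" using x by (auto elim: coordsE)
    have "a \<in> topspace M" using a(2) openin_subset[OF contact_open[OF t]] by blast
    then obtain U' f' where U': "openin M U'" "a \<in> U'" "f' \<in> forms k U'" "Q U' f'" using Q_ex by blast
    have x': "x \<in> coords c U'" using coordsI[OF a(1) U'(2)] a(3) by simp
    have "ext_d U' f' c x = ld (f' c) x" by (rule ext_d_ld[OF c x'])
    also have "\<dots> = dM f c x"
      by (rule ext_d_local[symmetric, OF openin_top c open_coords[OF c U'(1)] coords_sub_top[OF U'(1)] forms_lform[OF U'(3) c] _ x'])
        (rule f(2)[OF U'(1,3,4) c])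
    finally show ?thesis
      using U'(4)[unfolded Q_def, rule_format, OF t c x' x] f(2)[OF U'(1,3,4) c x'] by simp
  qed
  ultimately show thesis using that by blast
qed

end

section \<open>The local results in terms of conditions free of frames\<close>

context cr_local
begin

lemma rumin_cond_iff:
  "lform k V u ==> x \<in> V ==> rumin_cond n k (\<theta> x) (ld \<theta> x) (u x) (ld u x) \<longleftrightarrow>
    prim x k (PH x (u x)) \<and> prim x (k + 1) (PH x (ld u x))"
  using cr_point.rumin_cond_prim[OF point lform_alternating[OF V]] lform_alternating[OF V lform_ld[OF V]] by simp

lemma kills_ld:
  "lform k V \<omega> ==> (\<And>x. x \<in> V ==> kills j (V01 x) (\<omega> x)) ==> x \<in> V ==> kills (Suc j) (V01 x) (ld \<omega> x)"
  using KK_ld[of k \<omega> j x] by (simp add: cr_point.kills_KK[OF point])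

lemma rumin_bidegree_kills:
  assumes "lform (p + q) V f" "\<And>x. x \<in> V ==> rumin_cond n (p + q) (\<theta> x) (ld \<theta> x) (f x) (ld f x)"
    "\<And>x. x \<in> V ==> bideg n p q (V10 x) (V01 x) (f x)" "q \<le> n" "x \<in> V"
  shows "kills (Suc q) (V01 x) (f x)"
  using rumin_bidegree_KK[OF assms(1) _ assms(3,4,5)] assms(2) rumin_cond_iff[OF assms(1)] cr_point.kills_KK[OF point[OF assms(5)]]
  by simp

lemma representative_exists:
  assumes w: "lform (p + q) V \<omega>" "\<And>x. x \<in> V ==> kills (Suc q) (V01 x) (\<omega> x)" and q: "q \<le> n"
    and P: "\<And>x. x \<in> V ==> prim_part n (p + q) q (V10 x) (V01 x) (\<theta> x) (ld \<theta> x) (\<omega> x)"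
      "\<And>x. x \<in> V ==> prim_part n (Suc (p + q)) (Suc q) (V10 x) (V01 x) (\<theta> x) (ld \<theta> x) (ld \<omega> x)"
  shows "\<exists>f. lform (p + q) V f \<and> (\<forall>x\<in>V. rumin_cond n (p + q) (\<theta> x) (ld \<theta> x) (f x) (ld f x) \<and>
    kills (Suc q) (V01 x) (f x) \<and> kills q (V01 x) (\<omega> x - f x) \<and> bideg n p q (V10 x) (V01 x) (f x))"
proof -
  define N where "N = p + q + 3"
  show ?thesis
  proof (rule local_representative[OF w(1) _ _ _ N_def q])
    fix x assume x: "x \<in> V"
    show "KK x (Suc q) (\<omega> x)" using w(2)[OF x] cr_point.kills_KK[OF point[OF x]] by simp
    show "prim x (p + q) (bproj x N q (\<omega> x))"
      using cr_point.prim_part_iff[OF point[OF x] lform_alternating[OF V w(1) x], of N q] P(1)[OF x] by (simp add: N_def)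
    show "prim x (p + q + 1) (bproj x N (Suc q) (ld \<omega> x))"
      using cr_point.prim_part_iff[OF point[OF x] lform_alternating[OF V lform_ld[OF V w(1)] x], of N "Suc q"] P(2)[OF x]
      by (simp add: N_def)
  next
    fix f assume "lform (p + q) V f" "\<And>x. x \<in> V ==> KK x (Suc q) (f x)" "\<And>x. x \<in> V ==> KK x q (\<omega> x - f x)"
      "\<And>x. x \<in> V ==> prim x (p + q) (PH x (f x)) \<and> prim x (p + q + 1) (PH x (ld f x))"
      "\<And>x. x \<in> V ==> bideg n p q (V10 x) (V01 x) (f x)"
    then show ?thesis
      by (intro exI[of _ f]) (simp add: rumin_cond_iff cr_point.kills_KK[OF point])
  qed
qed

lemma eq_0_if_kills:
  assumes "lform (p + q) V f" "\<And>x. x \<in> V ==> rumin_cond n (p + q) (\<theta> x) (ld \<theta> x) (f x) (ld f x)"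
    "\<And>x. x \<in> V ==> bideg n p q (V10 x) (V01 x) (f x)" "\<And>x. x \<in> V ==> kills q (V01 x) (f x)" "q \<le> n" "x \<in> V"
  shows "f x = 0"
  using assms(2,4) rumin_cond_iff[OF assms(1)]
  by (intro eq_0_if_rumin_bidegree[OF assms(1) _ assms(3) _ assms(5,6)]) (simp_all add: cr_point.kills_KK[OF point])

lemma corrector_exists:
  assumes w: "lform (p + q) V \<omega>" and p: "p \<le> n + 1"
  shows "\<exists>\<eta>. lform (p + q - 1) V \<eta> \<and>
    (\<forall>x\<in>V. kills q (V01 x) (\<eta> x) \<and> corrects n (p + q) q (V10 x) (V01 x) (\<theta> x) (ld \<theta> x) (\<omega> x) (\<eta> x))"
proof (rule local_corrector[OF w p])
  fix \<eta> assume "lform (p + q - 1) V \<eta>" "\<And>x. x \<in> V ==> KK x q (\<eta> x)"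
    "\<And>x. x \<in> V ==> corrects n (p + q) q (V10 x) (V01 x) (\<theta> x) (ld \<theta> x) (\<omega> x) (\<eta> x)"
  then show ?thesis by (intro exI[of _ \<eta>]) (simp add: cr_point.kills_KK[OF point])
qed

end

lemma kills_diff: "kills j V u ==> kills j V v ==> kills j V (u - v)"
  and kills_add: "kills j V u ==> kills j V v ==> kills j V (u + v)"
  and kills_cscale: "kills j V u ==> kills j V (cscale a u)"
  and kills_zero: "kills j V 0"
  by (simp_all add: kills_def fun_apply cscale_apply)

lemma kills_0: "kills 0 V u \<longleftrightarrow> u = 0"
  by (auto simp: kills_def fun_eq_iff fun_apply)

lemma kills_mono:
  assumes "kills j V u" "j \<le> i" shows "kills i V u"
  unfolding kills_def
proof (intro allI impI)
  fix Ws vs assume "length Ws = i" "set Ws \<subseteq> V"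
  then have "u (take j Ws @ (drop j Ws @ vs)) = 0"
    using assms set_take_subset[of j Ws] unfolding kills_def by (metis length_take min.absorb2 subset_trans)
  then show "u (Ws @ vs) = 0" by (metis append.assoc append_take_drop_id)
qed

lemma has_bidegree_diff: "has_bidegree V W p q u ==> has_bidegree V W p q v ==> has_bidegree V W p q (u - v)"
  and has_bidegree_add: "has_bidegree V W p q u ==> has_bidegree V W p q v ==> has_bidegree V W p q (u + v)"
  and has_bidegree_cscale: "has_bidegree V W p q u ==> has_bidegree V W p q (cscale a u)"
  and has_bidegree_zero: "has_bidegree V W p q 0"
  by (simp_all add: has_bidegree_def fun_apply cscale_apply)

lemma bideg_diff: "bideg n p q V W u ==> bideg n p q V W v ==> bideg n p q V W (u - v)"
  and bideg_add: "bideg n p q V W u ==> bideg n p q V W v ==> bideg n p q V W (u + v)"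
  and bideg_cscale: "bideg n p q V W u ==> bideg n p q V W (cscale a u)"
  and bideg_zero: "bideg n p q V W 0"
  by (auto simp: bideg_def has_bidegree_diff has_bidegree_add has_bidegree_cscale has_bidegree_zero)

lemma rumin_cond_diff: "rumin_cond n k \<theta> \<sigma> u v ==> rumin_cond n k \<theta> \<sigma> u' v' ==> rumin_cond n k \<theta> \<sigma> (u - u') (v - v')"
  unfolding rumin_cond_def zero_fun_def[symmetric] by auto

section \<open>The bigraded Rumin complex and the filtration\<close>

context cr_manifold
begin

definition kill_form :: "nat => ('a, 'm) dform => bool" where
  "kill_form j \<omega> \<longleftrightarrow> (\<forall>c\<in>A. \<forall>x\<in>coords c (topspace M). kills j (T01 c x) (\<omega> c x))"

definition bideg_form :: "nat => nat => ('a, 'm) dform => bool" where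
  "bideg_form p q \<omega> \<longleftrightarrow> (\<forall>c\<in>A. \<forall>x\<in>coords c (topspace M). bideg n p q (T10 c x) (T01 c x) (\<omega> c x))"

definition prim_form :: "nat => nat => ('a, 'm) dform => bool" where
  "prim_form k q \<omega> \<longleftrightarrow> (\<forall>U \<theta>. contact_form U \<theta> --> (\<forall>c\<in>A. \<forall>x\<in>coords c U.
     prim_part n k q (T10 c x) (T01 c x) (\<theta> c x) (ext_d U \<theta> c x) (\<omega> c x)))"

lemma contact_at:
  assumes "c \<in> A" "x \<in> coords c (topspace M)"
  obtains U \<theta> where "contact_form U \<theta>" "x \<in> coords c U"
proof -
  obtain a where a: "a \<in> fst c" "a \<in> topspace M" "x = snd c a" using assms(2) by (rule coordsE)
  then obtain U \<theta> where "a \<in> U" "contact_form U \<theta>" using exists_contact_form by blast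
  then show thesis using that coordsI[OF a(1)] a(3) by metis
qed

lemma frame_at:
  assumes "c \<in> A" "x \<in> coords c (topspace M)"
  obtains U \<theta> V T Z W where "contact_form U \<theta>" "x \<in> V" "V \<subseteq> coords c U" "V \<subseteq> coords c (topspace M)"
    "cr_local V n (T10 c) (T01 c) (\<theta> c) T Z W"
proof -
  obtain U \<theta> where t: "contact_form U \<theta>" "x \<in> coords c U" using contact_at[OF assms] by blast
  obtain V T Z W where "x \<in> V" "V \<subseteq> coords c U" "cr_local V n (T10 c) (T01 c) (\<theta> c) T Z W"
    using local_frame[OF t(1) assms(1) t(2)] by blast
  then show thesis using that t(1) coords_sub_top[OF contact_open[OF t(1)], of c] by blast
qed

lemma contact_top: "contact_form U \<theta> ==> x \<in> coords c U ==> x \<in> coords c (topspace M)"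
  using coords_sub_top[OF contact_open] by blast

lemma forms_lform_sub: "\<omega> \<in> forms k (topspace M) ==> c \<in> A ==> V \<subseteq> coords c (topspace M) ==> lform k V (\<omega> c)"
  by (rule lform_subset[OF forms_lform])

lemma dM_forms: "\<omega> \<in> forms k (topspace M) ==> dM \<omega> \<in> forms (Suc k) (topspace M)"
  by (rule ext_d_forms[OF openin_top])

text \<open>Above the middle degree a Rumin form has no horizontal part, so by
  \<open>bideg_T\<close> the condition on the Reeb contraction is the frame-free
  \<open>bideg\<close>. The cases below and above the middle then obey the same formalism.\<close>

lemma rumin_bi_iff:
  assumes pq: "p \<le> n + 1" "q \<le> n"
  shows "\<omega> \<in> rumin_bi p q \<longleftrightarrow> \<omega> \<in> forms (p + q) (topspace M) \<and> rumin_global (p + q) \<omega> \<and> bideg_form p q \<omega>"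
proof (cases "p + q \<le> n")
  case True
  then show ?thesis using pq by (auto simp: rumin_bi_def rumin_complex_iff bideg_form_def bideg_def)
next
  case False
  have *: "has_bidegree (T10 c x) (T01 c x) (p - 1) q (contract (cvec (reeb U \<theta> c x)) (\<omega> c x)) \<longleftrightarrow>
      bideg n p q (T10 c x) (T01 c x) (\<omega> c x)"
    if w: "\<omega> \<in> forms (p + q) (topspace M)" "rumin_global (p + q) \<omega>" and t: "contact_form U \<theta>" and c: "c \<in> A" "x \<in> coords c U"
    for U \<theta> c x
  proof -
    obtain V T Z W where V: "x \<in> V" "V \<subseteq> coords c U" "cr_local V n (T10 c) (T01 c) (\<theta> c) T Z W"
      using local_frame[OF t c] by blast
    note pt = cr_local.point[OF V(3,1)]
    have a: "alternating (p + q) (\<omega> c x)" "alternating (p + q + 1) (dM \<omega> c x)"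
      using forms_alternating[OF w(1)] forms_alternating[OF dM_forms[OF w(1)]] by simp_all
    have "rumin_cond n (p + q) (\<theta> c x) (ld (\<theta> c) x) (\<omega> c x) (dM \<omega> c x)"
      using w(2) t c ext_d_ld[OF c] unfolding rumin_global_def by metis
    then have "pullback (cr_point.dil n (ld (\<theta> c) x) (\<lambda>i. Z i x) (\<lambda>i. W i x) 1) (\<omega> c x) = 0"
      using cr_point.rumin_cond_prim[OF pt a] cr_point.prim_def[OF pt] False by simp
    from cr_point.bideg_T[OF pt a(1) this] show ?thesis
      using False by (simp add: bideg_def reeb_frame[OF t V(3,2) c(1) V(1)])
  qed
  show ?thesis
  proof
    assume w: "\<omega> \<in> rumin_bi p q"
    then have 1: "\<omega> \<in> forms (p + q) (topspace M)" "rumin_global (p + q) \<omega>"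
      using pq False by (auto simp: rumin_bi_def rumin_complex_iff)
    have "bideg n p q (T10 c x) (T01 c x) (\<omega> c x)" if c: "c \<in> A" "x \<in> coords c (topspace M)" for c x
    proof -
      obtain U \<theta> where t: "contact_form U \<theta>" "x \<in> coords c U" using contact_at[OF c] by blast
      then show ?thesis using *[OF 1 t(1) c(1) t(2)] w pq False c(1) by (simp add: rumin_bi_def)
    qed
    then show "\<omega> \<in> forms (p + q) (topspace M) \<and> rumin_global (p + q) \<omega> \<and> bideg_form p q \<omega>"
      using 1 by (simp add: bideg_form_def)
  next
    assume "\<omega> \<in> forms (p + q) (topspace M) \<and> rumin_global (p + q) \<omega> \<and> bideg_form p q \<omega>"
    then show "\<omega> \<in> rumin_bi p q"
      using * pq False contact_top by (simp add: rumin_bi_def rumin_complex_iff bideg_form_def) blast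
  qed
qed

lemma rumin_bi_outside: "\<not> (p \<le> n + 1 \<and> q \<le> n) ==> rumin_bi p q = {0}"
  unfolding rumin_bi_def form_zero_0 by (simp only: if_False)

lemma kill_form_zero: "kill_form j 0"
  and kill_form_add: "kill_form j \<omega> ==> kill_form j \<eta> ==> kill_form j (\<omega> + \<eta>)"
  and kill_form_diff: "kill_form j \<omega> ==> kill_form j \<eta> ==> kill_form j (\<omega> - \<eta>)"
  and kill_form_scale: "kill_form j \<omega> ==> kill_form j (form_scale a \<omega>)"
  and kill_form_mono: "kill_form j \<omega> ==> j \<le> i ==> kill_form i \<omega>"
  unfolding kill_form_def
  by (auto simp: fun_apply form_scale_apply intro: kills_zero kills_add kills_diff kills_cscale kills_mono)

lemma bideg_form_zero: "bideg_form p q 0"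
  and bideg_form_add: "bideg_form p q \<omega> ==> bideg_form p q \<eta> ==> bideg_form p q (\<omega> + \<eta>)"
  and bideg_form_scale: "bideg_form p q \<omega> ==> bideg_form p q (form_scale a \<omega>)"
  unfolding bideg_form_def
  by (auto simp: fun_apply form_scale_apply intro: bideg_zero bideg_add bideg_cscale)

lemma kill_form_0:
  assumes "\<omega> \<in> forms k (topspace M)" shows "kill_form 0 \<omega> \<longleftrightarrow> \<omega> = 0"
proof
  assume "kill_form 0 \<omega>"
  then show "\<omega> = 0"
    by (intro forms_eqI[OF assms forms_zero[OF openin_top]]) (auto simp: kill_form_def kills_0 fun_apply)
qed (simp add: kill_form_zero)

lemma ext_d_zero: "ext_d U 0 = 0"
proof (intro ext)
  fix c x vs
  have e: "(0 :: ('a, 'm) dform) c = (\<lambda>y. 0)" by (simp add: fun_eq_iff fun_apply)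
  have "ld ((0 :: ('a, 'm) dform) c) x = 0" unfolding e by (rule ld_0[OF open_UNIV])
  then have "ext_d U 0 c x = 0" using ext_d_ld[of c x U 0] ext_d_0[of c x U 0] by metis
  then show "ext_d U 0 c x vs = (0 :: ('a, 'm) dform) c x vs" by (simp add: fun_apply)
qed

lemma rumin_global_zero: "rumin_global k 0"
  unfolding rumin_global_def rumin_cond_def ext_d_zero zero_fun_def[symmetric] by (simp add: fun_apply)

lemma rumin_bi_zero: "0 \<in> rumin_bi p q"
  by (cases "p \<le> n + 1 \<and> q \<le> n")
    (simp_all add: rumin_bi_iff rumin_bi_outside forms_zero rumin_global_zero bideg_form_zero)

lemma rumin_bi_add: "\<omega> \<in> rumin_bi p q ==> \<eta> \<in> rumin_bi p q ==> \<omega> + \<eta> \<in> rumin_bi p q"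
  by (cases "p \<le> n + 1 \<and> q \<le> n")
    (auto simp: rumin_bi_iff rumin_bi_outside intro: forms_add rumin_global_add bideg_form_add)

lemma rumin_bi_scale: "\<omega> \<in> rumin_bi p q ==> form_scale a \<omega> \<in> rumin_bi p q"
  by (cases "p \<le> n + 1 \<and> q \<le> n")
    (auto simp: rumin_bi_iff rumin_bi_outside intro: forms_scale rumin_global_scale bideg_form_scale)

lemma rumin_bi_diff: "\<omega> \<in> rumin_bi p q ==> \<eta> \<in> rumin_bi p q ==> \<omega> - \<eta> \<in> rumin_bi p q"
  using rumin_bi_add[of \<omega> p q "- \<eta>"] rumin_bi_scale[of \<eta> p q "-1"] by simp

lemma rumin_bi_forms: "\<omega> \<in> rumin_bi p q ==> \<omega> \<in> forms (p + q) (topspace M)"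
  and rumin_bi_global: "\<omega> \<in> rumin_bi p q ==> rumin_global (p + q) \<omega>"
  by (cases "p \<le> n + 1 \<and> q \<le> n"; auto simp: rumin_bi_iff rumin_bi_outside forms_zero rumin_global_zero)+

lemma kill_form_d:
  assumes w: "\<omega> \<in> forms k (topspace M)" "kill_form j \<omega>" shows "kill_form (Suc j) (dM \<omega>)"
  unfolding kill_form_def
proof (intro ballI)
  fix c x assume c: "c \<in> A" "x \<in> coords c (topspace M)"
  obtain U \<theta> V T Z W where V: "x \<in> V" "V \<subseteq> coords c (topspace M)" "cr_local V n (T10 c) (T01 c) (\<theta> c) T Z W"
    using frame_at[OF c] by metis
  show "kills (Suc j) (T01 c x) (dM \<omega> c x)"
    using cr_local.kills_ld[OF V(3) forms_lform_sub[OF w(1) c(1) V(2)] _ V(1), of j] w(2) V(2) c(1)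
    unfolding ext_d_ld[OF c] kill_form_def by blast
qed

lemma local_rumin:
  assumes "\<omega> \<in> rumin_bi p q" "p \<le> n + 1" "q \<le> n" "contact_form U \<theta>" "c \<in> A" "V \<subseteq> coords c U" "y \<in> V"
  shows "rumin_cond n (p + q) (\<theta> c y) (ld (\<theta> c) y) (\<omega> c y) (ld (\<omega> c) y)" "bideg n p q (T10 c y) (T01 c y) (\<omega> c y)"
proof -
  have y: "y \<in> coords c U" "y \<in> coords c (topspace M)" using assms(6,7) contact_top[OF assms(4)] by blast+
  show "rumin_cond n (p + q) (\<theta> c y) (ld (\<theta> c) y) (\<omega> c y) (ld (\<omega> c) y)"
    using rumin_bi_global[OF assms(1), unfolded rumin_global_def, rule_format, OF assms(4,5) y(1)]
    unfolding ext_d_ld[OF assms(5) y(1)] ext_d_ld[OF assms(5) y(2)] .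
  show "bideg n p q (T10 c y) (T01 c y) (\<omega> c y)"
    using assms(1,2,3,5) y(2) by (simp add: rumin_bi_iff bideg_form_def)
qed

lemma rumin_bi_kill: 
  assumes w: "\<omega> \<in> rumin_bi p q" shows "kill_form (Suc q) \<omega>"
proof (cases "p \<le> n + 1 \<and> q \<le> n")
  case True
  then have pq: "p \<le> n + 1" "q \<le> n" by auto
  show ?thesis
    unfolding kill_form_def
  proof (intro ballI)
    fix c x assume c: "c \<in> A" "x \<in> coords c (topspace M)"
    obtain U \<theta> V T Z W where V: "contact_form U \<theta>" "x \<in> V" "V \<subseteq> coords c U" "V \<subseteq> coords c (topspace M)"
      "cr_local V n (T10 c) (T01 c) (\<theta> c) T Z W"
      using frame_at[OF c] by metis
    show "kills (Suc q) (T01 c x) (\<omega> c x)"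
      by (rule cr_local.rumin_bidegree_kills[OF V(5) forms_lform_sub[OF rumin_bi_forms[OF w] c(1) V(4)] _ _ pq(2) V(2)])
        (fact local_rumin[OF w pq V(1) c(1) V(3)])+
  qed
qed (use w in \<open>auto simp: rumin_bi_outside kill_form_zero\<close>)

lemma rumin_bi_eq_0:
  assumes w: "\<omega> \<in> rumin_bi p q" "kill_form q \<omega>" shows "\<omega> = 0"
proof (cases "p \<le> n + 1 \<and> q \<le> n")
  case True
  then have pq: "p \<le> n + 1" "q \<le> n" by auto
  show ?thesis
  proof (rule forms_eqI[OF rumin_bi_forms[OF w(1)] forms_zero[OF openin_top]])
    fix c x assume c: "c \<in> A" "x \<in> coords c (topspace M)"
    obtain U \<theta> V T Z W where V: "contact_form U \<theta>" "x \<in> V" "V \<subseteq> coords c U" "V \<subseteq> coords c (topspace M)"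
      "cr_local V n (T10 c) (T01 c) (\<theta> c) T Z W"
      using frame_at[OF c] by metis
    have k: "kills q (T01 c y) (\<omega> c y)" if "y \<in> V" for y
      using w(2) c(1) V(4) that unfolding kill_form_def by blast
    have "\<omega> c x = 0"
      by (rule cr_local.eq_0_if_kills[OF V(5) forms_lform_sub[OF rumin_bi_forms[OF w(1)] c(1) V(4)] _ _ k pq(2) V(2)])
        (fact local_rumin[OF w(1) pq V(1) c(1) V(3)])+
    then show "\<omega> c x = 0 c x" by (simp add: fun_apply)
  qed
qed (use w in \<open>auto simp: rumin_bi_outside\<close>)

text \<open>The Rumin conditions say that the horizontal parts of \<omega> and d\<omega> are
  primitive, and primitivity passes to bidegree components.\<close>

lemma prim_form_rumin:
  assumes w: "\<omega> \<in> forms k (topspace M)" "rumin_global k \<omega>"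
  shows "prim_form k b \<omega>" "prim_form (Suc k) b (dM \<omega>)"
proof -
  have "prim_part n k b (T10 c x) (T01 c x) (\<theta> c x) (ext_d U \<theta> c x) (\<omega> c x) \<and>
      prim_part n (Suc k) b (T10 c x) (T01 c x) (\<theta> c x) (ext_d U \<theta> c x) (dM \<omega> c x)"
    if t: "contact_form U \<theta>" and c: "c \<in> A" "x \<in> coords c U" for U \<theta> c x
  proof -
    obtain V T Z W where V: "x \<in> V" "V \<subseteq> coords c U" "cr_local V n (T10 c) (T01 c) (\<theta> c) T Z W"
      using local_frame[OF t c] by blast
    note pt = cr_local.point[OF V(3,1)]
    have a: "alternating k (\<omega> c x)" "alternating (k + 1) (dM \<omega> c x)"
      using forms_alternating[OF w(1)] forms_alternating[OF dM_forms[OF w(1)]] by simp_all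
    have r: "rumin_cond n k (\<theta> c x) (ld (\<theta> c) x) (\<omega> c x) (dM \<omega> c x)"
      using w(2) t c ext_d_ld[OF c] unfolding rumin_global_def by metis
    note r = r[unfolded cr_point.rumin_cond_prim[OF pt a]]
    show ?thesis
      unfolding ext_d_ld[OF c]
      using cr_point.prim_part_iff[OF pt a(1), of "k + b + 2" b] cr_point.prim_part_iff[OF pt a(2), of "k + b + 2" b]
        cr_point.prim_bproj[OF pt _ conjunct1[OF r], of "k + b + 2" b] cr_point.prim_bproj[OF pt _ conjunct2[OF r], of "k + b + 2" b]
      by simp
  qed
  then show "prim_form k b \<omega>" "prim_form (Suc k) b (dM \<omega>)" by (auto simp: prim_form_def)
qed

text \<open>Subtracting a form killed by q vectors of type (0,1) does not change the leading part,
  so primitivity depends only on the class.\<close>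

lemma prim_form_kill:
  assumes w: "\<omega> \<in> forms k (topspace M)" "\<omega>' \<in> forms k (topspace M)" and p: "prim_form k q \<omega>" and K: "kill_form q (\<omega>' - \<omega>)"
  shows "prim_form k q \<omega>'"
  unfolding prim_form_def
proof (intro allI impI ballI)
  fix U \<theta> c x assume t: "contact_form U \<theta>" and c: "c \<in> A" "x \<in> coords c U"
  obtain V T Z W where V: "x \<in> V" "V \<subseteq> coords c U" "cr_local V n (T10 c) (T01 c) (\<theta> c) T Z W"
    using local_frame[OF t c] by blast
  interpret l: cr_local V n "T10 c" "T01 c" "\<theta> c" T Z W by (rule V(3))
  note pt = l.point[OF V(1)]
  define N where "N = k + q + 1"
  have N: "k < N" "q < N" by (auto simp: N_def)
  have "prim_part n k q (T10 c x) (T01 c x) (\<theta> c x) (ext_d U \<theta> c x) (\<omega> c x)"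
    using p t c unfolding prim_form_def by blast
  then have 1: "l.prim x k (l.bproj x N q (\<omega> c x))"
    unfolding ext_d_ld[OF c] using cr_point.prim_part_iff[OF pt forms_alternating[OF w(1)] N] by blast
  have "kills q (T01 c x) (\<omega>' c x - \<omega> c x)"
    using K c(1) contact_top[OF t c(2)] by (simp add: kill_form_def fun_apply)
  then have "l.KK x q (\<omega>' c x - \<omega> c x)" by (simp only: cr_point.kills_KK[OF pt])
  then have "l.bproj x N q (\<omega>' c x - \<omega> c x) = 0"
    by (rule cr_point.KK_bproj[OF pt alternating_diff[OF forms_alternating[OF w(2)] forms_alternating[OF w(1)]] N(1) _ order.refl N(2)])
  then have "l.bproj x N q (\<omega>' c x) = l.bproj x N q (\<omega> c x)"
    by (simp add: cr_point.bproj_diff[OF pt])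
  with 1 show "prim_part n k q (T10 c x) (T01 c x) (\<theta> c x) (ext_d U \<theta> c x) (\<omega>' c x)"
    unfolding ext_d_ld[OF c] using cr_point.prim_part_iff[OF pt forms_alternating[OF w(2)] N] by simp
qed

lemma prim_form_zero: "prim_form k q 0"
  by (rule prim_form_rumin[OF forms_zero[OF openin_top] rumin_global_zero])

text \<open>The local conditions fix the solution: the difference of two of them is a Rumin form of
  bidegree (p,q) in \<open>F^(p+1)\<close>, hence zero, so \<open>glue_solutions\<close>
  applies.\<close>

lemma global_representative:
  assumes w: "\<omega> \<in> forms (p + q) (topspace M)" "kill_form (Suc q) \<omega>" and pq: "p \<le> n + 1" "q \<le> n"
    and P: "prim_form (p + q) q \<omega>" "prim_form (Suc (p + q)) (Suc q) (dM \<omega>)"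
  obtains f where "f \<in> rumin_bi p q" "kill_form q (\<omega> - f)"
proof -
  define Q where "Q c x \<theta> \<sigma> u u' \<longleftrightarrow> rumin_cond n (p + q) \<theta> \<sigma> u u' \<and> kills (Suc q) (T01 c x) u \<and>
    kills q (T01 c x) (\<omega> c x - u) \<and> bideg n p q (T10 c x) (T01 c x) u" for c x \<theta> \<sigma> u u'
  obtain f where f: "f \<in> forms (p + q) (topspace M)"
    "\<And>U \<theta> c x. contact_form U \<theta> ==> c \<in> A ==> x \<in> coords c U ==> Q c x (\<theta> c x) (ext_d U \<theta> c x) (f c x) (dM f c x)"
  proof (rule glue_solutions[of "p + q" Q])
    fix U \<theta> c V T Z W
    assume t: "contact_form U \<theta>" and c: "c \<in> A" and V: "V \<subseteq> coords c U" and l: "cr_local V n (T10 c) (T01 c) (\<theta> c) T Z W"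
    have top: "y \<in> coords c (topspace M)" "y \<in> coords c U" if "y \<in> V" for y using that V contact_top[OF t] by blast+
    show "\<exists>f. lform (p + q) V f \<and> (\<forall>y\<in>V. Q c y (\<theta> c y) (ld (\<theta> c) y) (f y) (ld f y))"
      unfolding Q_def
    proof (rule cr_local.representative_exists[OF l _ _ pq(2)])
      show "lform (p + q) V (\<omega> c)" by (rule forms_lform_sub[OF w(1) c]) (use top in blast)
      fix y assume y: "y \<in> V"
      show "kills (Suc q) (T01 c y) (\<omega> c y)" using w(2) c top(1)[OF y] by (simp add: kill_form_def)
      show "prim_part n (p + q) q (T10 c y) (T01 c y) (\<theta> c y) (ld (\<theta> c) y) (\<omega> c y)"
        using P(1)[unfolded prim_form_def, rule_format, OF t c top(2)[OF y]] unfolding ext_d_ld[OF c top(2)[OF y]] .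
      show "prim_part n (Suc (p + q)) (Suc q) (T10 c y) (T01 c y) (\<theta> c y) (ld (\<theta> c) y) (ld (\<omega> c) y)"
        using P(2)[unfolded prim_form_def, rule_format, OF t c top(2)[OF y]]
        unfolding ext_d_ld[OF c top(2)[OF y]] ext_d_ld[OF c top(1)[OF y]] .
    qed
    fix f f' x assume f: "lform (p + q) V f" "lform (p + q) V f'"
      and Q: "\<And>y. y \<in> V ==> Q c y (\<theta> c y) (ld (\<theta> c) y) (f y) (ld f y)"
        "\<And>y. y \<in> V ==> Q c y (\<theta> c y) (ld (\<theta> c) y) (f' y) (ld f' y)" and x: "x \<in> V"
    note oV = cr_local.V[OF l]
    have "f x - f' x = 0"
    proof (rule cr_local.eq_0_if_kills[OF l lform_diff[OF oV f] _ _ _ pq(2) x])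
      fix y assume y: "y \<in> V"
      show "rumin_cond n (p + q) (\<theta> c y) (ld (\<theta> c) y) (f y - f' y) (ld (\<lambda>y. f y - f' y) y)"
        unfolding ld_diff[OF oV lform_sfam[OF oV f(1)] lform_sfam[OF oV f(2)] y]
        using Q(1)[OF y] Q(2)[OF y] by (simp add: Q_def rumin_cond_diff)
      show "bideg n p q (T10 c y) (T01 c y) (f y - f' y)"
        using Q(1)[OF y] Q(2)[OF y] by (simp add: Q_def bideg_diff)
      have "kills q (T01 c y) (\<omega> c y - f' y - (\<omega> c y - f y))"
        using Q(1)[OF y] Q(2)[OF y] unfolding Q_def by (blast intro: kills_diff)
      then show "kills q (T01 c y) (f y - f' y)" by (simp add: algebra_simps)
    qed
    then show "f x = f' x" by simp
  next
    fix c c' x \<theta> \<sigma> u u'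
    assume c: "c \<in> A" "c' \<in> A" "x \<in> coords c (fst c')" and Q: "Q c' (transition c c' x) \<theta> \<sigma> u u'"
    note F = dtransition_linear[OF c] inj_dtransition[OF c] dtransition_T(1,2)[OF c]
    have "\<omega> c x = pullback (dtransition c c' x) (\<omega> c' (transition c c' x))"
      using c(3) by (intro forms_pullback[OF w(1) c(1,2)]) (auto simp: coords_def dest: subsetD[OF chart_topspace[OF c(1)]])
    then show "Q c x (pullback (dtransition c c' x) \<theta>) (pullback (dtransition c c' x) \<sigma>)
        (pullback (dtransition c c' x) u) (pullback (dtransition c c' x) u')"
      using Q rumin_cond_pullback[OF F] bideg_pullback[OF F] kills_pullback[OF F] unfolding Q_def by (metis pullback_simps(2))
  next
    fix c x and \<theta> \<sigma> \<mu> u u' :: "'m covector" and g :: complex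
    assume "alternating 1 \<theta>" "alternating 2 \<sigma>" "alternating 1 \<mu>" "g \<noteq> 0" "Q c x \<theta> \<sigma> u u'"
    then show "Q c x (cscale g \<theta>) (cscale g \<sigma> + wedge \<mu> \<theta>) u u'"
      unfolding Q_def using rumin_cond_scale by blast
  qed (rule that)
  have fQ: "\<exists>\<theta> \<sigma>. Q c x \<theta> \<sigma> (f c x) (dM f c x)" if c: "c \<in> A" "x \<in> coords c (topspace M)" for c x
    using contact_at[OF c] f(2)[OF _ c(1)] by metis
  have "f \<in> rumin_bi p q"
    unfolding rumin_bi_iff[OF pq] rumin_global_def bideg_form_def using f fQ unfolding Q_def by blast
  moreover have "kill_form q (\<omega> - f)"
    unfolding kill_form_def using fQ by (auto simp: Q_def fun_apply)
  ultimately show thesis using that by blast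
qed

text \<open>Here the uniqueness needed for gluing is pointwise, by \<open>corrects_unique\<close>,
  and does not involve derivatives of \<eta>.\<close>

lemma global_corrector:
  assumes w: "\<omega> \<in> forms (p + q) (topspace M)" and p: "p \<le> n + 1"
  obtains \<eta> where "\<eta> \<in> forms (p + q - 1) (topspace M)" "kill_form q \<eta>" "prim_form (p + q) q (\<omega> - dM \<eta>)"
proof -
  define Q where "Q c x \<theta> \<sigma> u u' \<longleftrightarrow> kills q (T01 c x) u \<and> corrects n (p + q) q (T10 c x) (T01 c x) \<theta> \<sigma> (\<omega> c x) u"
    for c x \<theta> \<sigma> and u u' :: "'m covector"
  obtain \<eta> where \<eta>: "\<eta> \<in> forms (p + q - 1) (topspace M)"
    "\<And>U \<theta> c x. contact_form U \<theta> ==> c \<in> A ==> x \<in> coords c U ==> Q c x (\<theta> c x) (ext_d U \<theta> c x) (\<eta> c x) (dM \<eta> c x)"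
  proof (rule glue_solutions[of "p + q - 1" Q])
    fix U \<theta> c V T Z W
    assume t: "contact_form U \<theta>" and c: "c \<in> A" and V: "V \<subseteq> coords c U" and l: "cr_local V n (T10 c) (T01 c) (\<theta> c) T Z W"
    show "\<exists>f. lform (p + q - 1) V f \<and> (\<forall>y\<in>V. Q c y (\<theta> c y) (ld (\<theta> c) y) (f y) (ld f y))"
      unfolding Q_def
    proof (rule cr_local.corrector_exists[OF l _ p])
      show "lform (p + q) V (\<omega> c)" by (rule forms_lform_sub[OF w c]) (use V contact_top[OF t] in blast)
    qed
    fix f f' x assume "\<And>y. y \<in> V ==> Q c y (\<theta> c y) (ld (\<theta> c) y) (f y) (ld f y)"
        "\<And>y. y \<in> V ==> Q c y (\<theta> c y) (ld (\<theta> c) y) (f' y) (ld f' y)" and x: "x \<in> V"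
    then show "f x = f' x"
      using cr_point.corrects_unique[OF cr_local.point[OF l x] _ _ forms_alternating[OF w]] unfolding Q_def by blast
  next
    fix c c' x \<theta> \<sigma> u u'
    assume c: "c \<in> A" "c' \<in> A" "x \<in> coords c (fst c')" and Q: "Q c' (transition c c' x) \<theta> \<sigma> u u'"
    note F = dtransition_linear[OF c] inj_dtransition[OF c] dtransition_T(1,2)[OF c]
    have "\<omega> c x = pullback (dtransition c c' x) (\<omega> c' (transition c c' x))"
      using c(3) by (intro forms_pullback[OF w c(1,2)]) (auto simp: coords_def dest: subsetD[OF chart_topspace[OF c(1)]])
    then show "Q c x (pullback (dtransition c c' x) \<theta>) (pullback (dtransition c c' x) \<sigma>)
        (pullback (dtransition c c' x) u) (pullback (dtransition c c' x) u')"
      using Q corrects_pullback[OF F] kills_pullback[OF F] unfolding Q_def by metis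
  next
    fix c x and \<theta> \<sigma> \<mu> u u' :: "'m covector" and g :: complex
    assume "alternating 1 \<theta>" "alternating 2 \<sigma>" "alternating 1 \<mu>" "g \<noteq> 0" "Q c x \<theta> \<sigma> u u'"
    then show "Q c x (cscale g \<theta>) (cscale g \<sigma> + wedge \<mu> \<theta>) u u'"
      unfolding Q_def using corrects_scale by blast
  qed (rule that)
  have "kill_form q \<eta>"
    unfolding kill_form_def
  proof (intro ballI)
    show "kills q (T01 c x) (\<eta> c x)" if c: "c \<in> A" "x \<in> coords c (topspace M)" for c x
      using contact_at[OF c] \<eta>(2)[OF _ c(1)] unfolding Q_def by metis
  qed
  moreover have "prim_form (p + q) q (\<omega> - dM \<eta>)"
    unfolding prim_form_def
  proof (intro allI impI ballI)
    fix U \<theta> c x assume t: "contact_form U \<theta>" and c: "c \<in> A" "x \<in> coords c U"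
    obtain V T Z W where V: "x \<in> V" "V \<subseteq> coords c U" "cr_local V n (T10 c) (T01 c) (\<theta> c) T Z W"
      using local_frame[OF t c] by blast
    have top: "V \<subseteq> coords c (topspace M)" using V(2) contact_top[OF t] by blast
    have "prim_part n (p + q) q (T10 c x) (T01 c x) (\<theta> c x) (ld (\<theta> c) x) (\<omega> c x - ld (\<eta> c) x)"
    proof (rule cr_local.prim_part_corrected[OF V(3) forms_lform_sub[OF w c(1) top] forms_lform_sub[OF \<eta>(1) c(1) top] _ V(1)])
      fix y assume "y \<in> V"
      then have y: "y \<in> coords c U" using V(2) by blast
      show "corrects n (p + q) q (T10 c y) (T01 c y) (\<theta> c y) (ld (\<theta> c) y) (\<omega> c y) (\<eta> c y)"
        using \<eta>(2)[OF t c(1) y] unfolding Q_def ext_d_ld[OF c(1) y] by blast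
    qed
    then show "prim_part n (p + q) q (T10 c x) (T01 c x) (\<theta> c x) (ext_d U \<theta> c x) ((\<omega> - dM \<eta>) c x)"
      by (simp add: fun_apply ext_d_ld[OF c] ext_d_ld[OF c(1) contact_top[OF t c(2)]])
  qed
  ultimately show thesis using that \<eta>(1) by blast
qed

section \<open>Decomposition of the Rumin complex and its differential\<close>

lemma rumin_global_diff:
  "\<omega> \<in> forms k (topspace M) ==> \<eta> \<in> forms k (topspace M) ==> rumin_global k \<omega> ==> rumin_global k \<eta> ==> rumin_global k (\<omega> - \<eta>)"
  using rumin_global_add[of \<omega> k "- \<eta>"] rumin_global_scale[of \<eta> k "-1"] forms_uminus[OF openin_top, of \<eta> k] by simp

text \<open>In the bidegrees where \<open>rumin_bi\<close> is zero the filtration does not jump, so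
  \<open>rumin_step\<close> can take f = 0 there.\<close>

lemma kill_form_top:
  assumes w: "\<omega> \<in> forms k (topspace M)" and "n < q \<or> n + 1 + q < k \<and> kill_form (Suc q) \<omega>" shows "kill_form q \<omega>"
  unfolding kill_form_def
proof (intro ballI)
  fix c x assume c: "c \<in> A" "x \<in> coords c (topspace M)"
  obtain U \<theta> V T Z W where V: "x \<in> V" "cr_local V n (T10 c) (T01 c) (\<theta> c) T Z W"
    using frame_at[OF c] by metis
  note pt = cr_local.point[OF V(2,1)]
  show "kills q (T01 c x) (\<omega> c x)"
    using assms(2) cr_point.KK_top[OF pt forms_alternating[OF w]] cr_point.KK_top10[OF pt forms_alternating[OF w]] c
    unfolding kill_form_def cr_point.kills_KK[OF pt, symmetric] by blast
qed

lemma rumin_step: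
  assumes w: "\<omega> \<in> forms k (topspace M)" "rumin_global k \<omega>" "kill_form (Suc q) \<omega>" and q: "q \<le> k"
  obtains f where "f \<in> rumin_bi (k - q) q" "kill_form q (\<omega> - f)"
proof (cases "k - q \<le> n + 1 \<and> q \<le> n")
  case True
  have k: "k - q + q = k" using q by simp
  show thesis
    using global_representative[of \<omega> "k - q" q, unfolded k, OF w(1,3)] True prim_form_rumin[OF w(1,2)] that by blast
next
  case False
  then have "kill_form q \<omega>" using w(3) q by (intro kill_form_top[OF w(1)]) auto
  then show thesis using that[OF rumin_bi_zero] by simp
qed

text \<open>Induction over the filtration: the component of bidegree (k - j, j) is split off by
  \<open>rumin_step\<close>, and the rest is one step deeper. The additional clause, that a form
  killed by j vectors has no components of second degree j or more, is used for d\<omega> in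
  \<open>rumin_dbar\<close>.\<close>

lemma rumin_decomposition:
  assumes "\<omega> \<in> forms k (topspace M)" "rumin_global k \<omega>" "kill_form j \<omega>" "j \<le> Suc k"
  shows "\<exists>f. (\<forall>a\<le>k. f a \<in> rumin_bi a (k - a)) \<and> (\<forall>a\<le>k. j \<le> k - a --> f a = 0) \<and> \<omega> = (\<Sum>a\<le>k. f a)"
  using assms
proof (induction j arbitrary: \<omega>)
  case 0
  then have "\<omega> = 0" using kill_form_0 by blast
  then show ?case by (intro exI[of _ "\<lambda>a. 0"]) (simp add: rumin_bi_zero)
next
  case (Suc j)
  obtain f where f: "f \<in> rumin_bi (k - j) j" "kill_form j (\<omega> - f)"
    using rumin_step[OF Suc.prems(1,2,3)] Suc.prems(4) by auto
  have k: "k - j + j = k" using Suc.prems(4) by simp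
  note ff = rumin_bi_forms[OF f(1), unfolded k] rumin_bi_global[OF f(1), unfolded k]
  obtain g where g: "\<forall>a\<le>k. g a \<in> rumin_bi a (k - a)" "\<forall>a\<le>k. j \<le> k - a --> g a = 0" "\<omega> - f = (\<Sum>a\<le>k. g a)"
    using Suc.IH[OF forms_diff[OF openin_top Suc.prems(1) ff(1)] rumin_global_diff[OF Suc.prems(1) ff(1) Suc.prems(2) ff(2)] f(2)]
      Suc.prems(4) by auto
  have "g (k - j) = 0" using g(2) Suc.prems(4) by auto
  then have "(\<Sum>a\<le>k. (g(k - j := f)) a) = (\<Sum>a\<le>k. g a) + f"
    using sum.remove[of "{..k}" "k - j" g] sum.remove[of "{..k}" "k - j" "g(k - j := f)"] by simp
  then have "\<omega> = (\<Sum>a\<le>k. (g(k - j := f)) a)" using g(3) by (simp add: algebra_simps)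
  moreover have "(g(k - j := f)) a \<in> rumin_bi a (k - a)" if "a \<le> k" for a
    using g(1) f(1) that Suc.prems(4) by auto
  moreover have "(g(k - j := f)) a = 0" if "a \<le> k" "Suc j \<le> k - a" for a
    using g(2) that Suc.prems(4) by auto
  ultimately show ?case by blast
qed

lemma kill_form_sum: "(\<And>i. i \<in> I ==> kill_form j (f i)) ==> kill_form j (\<Sum>i\<in>I. f i)"
  by (induction I rule: infinite_finite_induct) (auto intro: kill_form_zero kill_form_add)

text \<open>If the components before a vanish, component a is minus the sum of the later ones, which
  lie deeper in the filtration; \<open>rumin_bi_eq_0\<close> then applies.\<close>

lemma rumin_direct:
  assumes f: "\<And>a. a \<le> k ==> f a \<in> rumin_bi a (k - a)" and z: "(\<Sum>a\<le>k. f a) = 0"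
  shows "a \<le> k ==> f a = 0"
proof (induction a rule: less_induct)
  case (less a)
  have "f a + (\<Sum>b\<in>{..k} - {a}. f b) = 0" using sum.remove[of "{..k}" a f] z less.prems by simp
  then have e: "f a = form_scale (-1) (\<Sum>b\<in>{..k} - {a}. f b)" by (simp add: eq_neg_iff_add_eq_0)
  have "kill_form (k - a) (f b)" if b: "b \<in> {..k} - {a}" for b
  proof (cases "b < a")
    case True
    then show ?thesis using less.IH[of b] b kill_form_zero by simp
  next
    case False
    then show ?thesis using rumin_bi_kill[OF f, of b] b by (auto intro: kill_form_mono)
  qed
  then have "kill_form (k - a) (f a)" unfolding e by (intro kill_form_scale kill_form_sum)
  then show "f a = 0" using rumin_bi_eq_0[OF f[OF less.prems]] by blast
qed

lemma rumin_proj_eq: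
  assumes f: "\<forall>a\<le>p + q. f a \<in> rumin_bi a (p + q - a)" and w: "\<omega> = (\<Sum>a\<le>p + q. f a)"
  shows "rumin_proj p q \<omega> = f p"
proof -
  have e: "(\<lambda>c x vs. \<Sum>a\<le>p + q. g a c x vs) = (\<Sum>a\<le>p + q. g a)" for g :: "nat => ('a, 'm) dform"
    by (simp add: fun_eq_iff sum_apply)
  show ?thesis
    unfolding rumin_proj_def e
  proof (rule the_equality)
    show "\<exists>fa. (\<forall>a\<le>p + q. fa a \<in> rumin_bi a (p + q - a)) \<and> \<omega> = (\<Sum>a\<le>p + q. fa a) \<and> f p = fa p"
      using f w by blast
    fix \<eta> assume "\<exists>f. (\<forall>a\<le>p + q. f a \<in> rumin_bi a (p + q - a)) \<and> \<omega> = (\<Sum>a\<le>p + q. f a) \<and> \<eta> = f p"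
    then obtain g where g: "\<forall>a\<le>p + q. g a \<in> rumin_bi a (p + q - a)" "\<omega> = (\<Sum>a\<le>p + q. g a)" "\<eta> = g p" by blast
    have "g p - f p = 0"
      using rumin_direct[of "p + q" "\<lambda>a. g a - f a" p] f g w rumin_bi_diff by (simp add: sum_subtractf)
    then show "\<eta> = f p" using g(3) by simp
  qed
qed

lemma rumin_global_d:
  assumes w: "\<omega> \<in> forms k (topspace M)" "rumin_global k \<omega>" shows "rumin_global (Suc k) (dM \<omega>)"
  unfolding rumin_global_def
proof (intro allI impI ballI)
  fix U \<theta> c x assume t: "contact_form U \<theta>" and c: "c \<in> A" "x \<in> coords c U"
  obtain V T Z W where V: "x \<in> V" "cr_local V n (T10 c) (T01 c) (\<theta> c) T Z W"
    using local_frame[OF t c] by metis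
  note pt = cr_local.point[OF V(2,1)]
  have a: "alternating k (\<omega> c x)" "alternating (k + 1) (dM \<omega> c x)"
    using forms_alternating[OF w(1)] forms_alternating[OF dM_forms[OF w(1)]] by simp_all
  have "rumin_cond n k (\<theta> c x) (ld (\<theta> c) x) (\<omega> c x) (dM \<omega> c x)"
    using w(2) t c ext_d_ld[OF c] unfolding rumin_global_def by metis
  then have "rumin_cond n (k + 1) (\<theta> c x) (ld (\<theta> c) x) (dM \<omega> c x) 0"
    using cr_point.rumin_cond_prim[OF pt a] cr_point.rumin_cond_prim[OF pt a(2) alternating_0] cr_point.prim_simps(1)[OF pt]
    by simp
  then show "rumin_cond n (Suc k) (\<theta> c x) (ext_d U \<theta> c x) (dM \<omega> c x) (dM (dM \<omega>) c x)"
    by (simp add: ext_d_ld[OF c] ext_d_ext_d[OF openin_top w(1)] fun_apply)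
qed

text \<open>d\<omega> lies in \<open>F^p\<close>, so its components of first degree below p vanish,
  while those of first degree above p lie in \<open>F^(p+1)\<close>.\<close>

lemma rumin_dbar:
  assumes w: "\<omega> \<in> rumin_bi p q"
  shows "rumin_dbar p q \<omega> \<in> rumin_bi p (Suc q)" "kill_form (Suc q) (dM \<omega> - rumin_dbar p q \<omega>)"
proof -
  define k where "k = p + Suc q"
  note f = rumin_bi_forms[OF w] and r = rumin_bi_global[OF w]
  have d: "dM \<omega> \<in> forms k (topspace M)" "rumin_global k (dM \<omega>)" "kill_form (Suc (Suc q)) (dM \<omega>)"
    using dM_forms[OF f] rumin_global_d[OF f r] kill_form_d[OF f rumin_bi_kill[OF w]] by (simp_all add: k_def)
  obtain f where f: "\<forall>a\<le>k. f a \<in> rumin_bi a (k - a)" "\<forall>a\<le>k. Suc (Suc q) \<le> k - a --> f a = 0" "dM \<omega> = (\<Sum>a\<le>k. f a)"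
    using rumin_decomposition[OF d] by (auto simp: k_def)
  have e: "rumin_dbar p q \<omega> = f p"
    unfolding rumin_dbar_def Suc_eq_plus1[symmetric] by (rule rumin_proj_eq) (use f in \<open>simp_all add: k_def\<close>)
  show "rumin_dbar p q \<omega> \<in> rumin_bi p (Suc q)" using f(1)[rule_format, of p] by (simp add: e k_def)
  have "dM \<omega> - f p = (\<Sum>b\<in>{..k} - {p}. f b)"
    using sum.remove[of "{..k}" p f] f(3) by (simp add: k_def)
  moreover have "kill_form (Suc q) (f b)" if b: "b \<in> {..k} - {p}" for b
  proof (cases "b < p")
    case True
    then show ?thesis using f(2)[rule_format, of b] b kill_form_zero by (simp add: k_def)
  next
    case False
    then have "Suc (k - b) \<le> Suc q" using b by (auto simp: k_def)
    then show ?thesis using rumin_bi_kill[OF f(1)[rule_format, of b]] b by (auto intro: kill_form_mono)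
  qed
  ultimately show "kill_form (Suc q) (dM \<omega> - rumin_dbar p q \<omega>)"
    by (simp add: e) (rule kill_form_sum, simp)
qed

text \<open>The difference of two candidates is a Rumin form of bidegree (p, q + 1) in
  \<open>F^(p+1)\<close>, hence zero. This replaces all further work with the description of the
  projection.\<close>

lemma rumin_dbar_eqI:
  assumes "\<omega> \<in> rumin_bi p q" "g \<in> rumin_bi p (Suc q)" "kill_form (Suc q) (dM \<omega> - g)"
  shows "rumin_dbar p q \<omega> = g"
proof -
  have "kill_form (Suc q) (dM \<omega> - g - (dM \<omega> - rumin_dbar p q \<omega>))"
    by (rule kill_form_diff[OF assms(3) rumin_dbar(2)[OF assms(1)]])
  then have "rumin_dbar p q \<omega> - g = 0"
    by (intro rumin_bi_eq_0[OF rumin_bi_diff[OF rumin_dbar(1)[OF assms(1)] assms(2)]]) (simp add: algebra_simps)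
  then show ?thesis by simp
qed

lemma filtration_iff: "\<omega> \<in> filtration p k \<longleftrightarrow> \<omega> \<in> forms k (topspace M) \<and> kill_form (k + 1 - p) \<omega>"
  by (auto simp: filtration_def kill_form_def kills_def)

lemma filtration_iff':
  "\<omega> \<in> filtration p (p + q) \<longleftrightarrow> \<omega> \<in> forms (p + q) (topspace M) \<and> kill_form (Suc q) \<omega>"
  "\<omega> \<in> filtration (p + 1) (p + q) \<longleftrightarrow> \<omega> \<in> forms (p + q) (topspace M) \<and> kill_form q \<omega>"
  by (simp_all add: filtration_iff)

end

section \<open>Cohomology\<close>

definition lin :: "('a, 'm) dform set => bool" where
  "lin S \<longleftrightarrow> 0 \<in> S \<and> (\<forall>u\<in>S. \<forall>v\<in>S. u + v \<in> S) \<and> (\<forall>a. \<forall>u\<in>S. form_scale a u \<in> S)"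

lemma linD:
  assumes "lin S"
  shows "0 \<in> S" "u \<in> S ==> v \<in> S ==> u + v \<in> S" "u \<in> S ==> form_scale a u \<in> S"
    "u \<in> S ==> v \<in> S ==> u - v \<in> S" "u \<in> S ==> - u \<in> S"
proof -
  show *: "0 \<in> S" "u \<in> S ==> v \<in> S ==> u + v \<in> S" "u \<in> S ==> form_scale a u \<in> S" for u v a
    using assms by (auto simp: lin_def)
  show "- u \<in> S" if "u \<in> S" for u using *(3)[OF that, of "-1"] by simp
  then show "u \<in> S ==> v \<in> S ==> u - v \<in> S" using *(2)[of u "- v"] by simp
qed

definition coset :: "('a, 'm) dform set => ('a, 'm) dform => ('a, 'm) dform set" where
  "coset N x = {u. u - x \<in> N}"

lemma coset_image: "coset N x = (\<lambda>u. u + x) ` N"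
  by (force simp: coset_def image_iff)

lemma coset_eq_iff: "lin N ==> coset N x = coset N y \<longleftrightarrow> x - y \<in> N"
proof
  assume N: "lin N"
  show "x - y \<in> N" if "coset N x = coset N y"
  proof -
    have "x \<in> coset N x" using linD(1)[OF N] by (simp add: coset_def)
    then show ?thesis unfolding that by (simp add: coset_def)
  qed
  assume xy: "x - y \<in> N"
  have "u - x \<in> N \<longleftrightarrow> u - y \<in> N" for u
    using linD(2)[OF N _ xy, of "u - x"] linD(4)[OF N _ xy, of "u - y"] by auto
  then show "coset N x = coset N y" by (simp add: coset_def)
qed

lemma form_module_simps:
  "carrier (form_module S) = S" "ring.zero (form_module S) = 0" "ring.add (form_module S) = (+)"
  "module.smult (form_module S) = form_scale"
  by (simp_all add: form_module_def form_add_plus form_zero_0)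

lemma quot_module_simps:
  "carrier (quot_module Q N) = a_rcosets\<^bsub>Q\<^esub> N" "ring.zero (quot_module Q N) = N"
  "ring.add (quot_module Q N) = (\<lambda>X Y. X <+>\<^bsub>Q\<^esub> Y)"
  "module.smult (quot_module Q N) = (\<lambda>a X. \<Union>x\<in>X. N +>\<^bsub>Q\<^esub> (a \<odot>\<^bsub>Q\<^esub> x))"
  by (simp_all add: quot_module_def)

lemma a_r_coset_eq: "N +>\<^bsub>Q\<^esub> x = (\<lambda>u. u \<oplus>\<^bsub>Q\<^esub> x) ` N"
  by (auto simp: a_r_coset_def r_coset_def)

lemma a_rcosets_eq: "a_rcosets\<^bsub>Q\<^esub> N = (\<lambda>x. N +>\<^bsub>Q\<^esub> x) ` carrier Q"
  by (auto simp: A_RCOSETS_def RCOSETS_def a_r_coset_def)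

lemma set_add_eq: "X <+>\<^bsub>Q\<^esub> Y = (\<lambda>(x, y). x \<oplus>\<^bsub>Q\<^esub> y) ` (X \<times> Y)"
  by (auto simp: set_add_def set_mult_def)

lemma a_r_coset_form: "N +>\<^bsub>form_module S\<^esub> x = coset N x"
  by (simp add: a_r_coset_eq form_module_simps coset_image)

lemma coset_add: "lin N ==> coset N x <+>\<^bsub>form_module S\<^esub> coset N y = coset N (x + y)"
proof -
  assume N: "lin N"
  show ?thesis
  proof
    show "coset N x <+>\<^bsub>form_module S\<^esub> coset N y \<subseteq> coset N (x + y)"
    proof
      fix w assume "w \<in> coset N x <+>\<^bsub>form_module S\<^esub> coset N y"
      then obtain u v where "u - x \<in> N" "v - y \<in> N" "w = u + v"
        by (auto simp: set_add_eq coset_def form_module_simps)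
      then show "w \<in> coset N (x + y)" using linD(2)[OF N, of "u - x" "v - y"] by (simp add: coset_def algebra_simps)
    qed
    show "coset N (x + y) \<subseteq> coset N x <+>\<^bsub>form_module S\<^esub> coset N y"
    proof
      fix w assume "w \<in> coset N (x + y)"
      then have "w - y \<in> coset N x" "y \<in> coset N y" using linD(1)[OF N] by (simp_all add: coset_def algebra_simps)
      then show "w \<in> coset N x <+>\<^bsub>form_module S\<^esub> coset N y"
        unfolding set_add_eq form_module_simps by (intro image_eqI[of _ _ "(w - y, y)"]) auto
    qed
  qed
qed

lemma coset_smult:
  assumes N: "lin N" shows "(\<Union>u\<in>coset N x. coset N (form_scale a u)) = coset N (form_scale a x)"
proof -
  have "coset N (form_scale a u) = coset N (form_scale a x)" if "u \<in> coset N x" for u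
  proof -
    have "form_scale a u - form_scale a x \<in> N" using that linD(3)[OF N, of "u - x" a] by (simp add: coset_def)
    then show ?thesis by (simp only: coset_eq_iff[OF N])
  qed
  moreover have "x \<in> coset N x" using linD(1)[OF N] by (simp add: coset_def)
  ultimately show ?thesis by blast
qed

text \<open>The inclusion of K in Z induces a map to Z/(D + N). By \<open>inj\<close> and
  \<open>exact\<close> its kernel is B, and \<open>surj\<close> says Z = K + D + N. The target is
  encoded as a quotient of a quotient, whose elements are sets of cosets of N.\<close>

lemma module_isomorphic_quotients:
  fixes K B Z N D S :: "('a, 'm) dform set"
  assumes K: "lin K" and B: "lin B" "B \<subseteq> K" and Z: "lin Z" and N: "lin N" and D: "lin D" and KZ: "K \<subseteq> Z"
    and inj: "\<And>x d. x \<in> K ==> d \<in> D ==> x - d \<in> N ==> x \<in> B"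
    and exact: "\<And>x. x \<in> B ==> \<exists>d\<in>D. x - d \<in> N"
    and surj: "\<And>z. z \<in> Z ==> \<exists>x\<in>K. \<exists>d\<in>D. z - x - d \<in> N"
  shows "module_isomorphic complex_field (quot_module (form_module K) B)
    (quot_module ((quot_module (form_module S) N)\<lparr>carrier := coset N ` Z\<rparr>) (coset N ` D))"
proof -
  let ?Q = "(quot_module (form_module S) N)\<lparr>carrier := coset N ` Z\<rparr>"
  \<comment> \<open>The class of x in the iterated quotient.\<close>
  define \<Phi> where "\<Phi> x = (\<lambda>d. coset N (d + x)) ` D" for x
  have addQ: "X \<oplus>\<^bsub>?Q\<^esub> Y = X <+>\<^bsub>form_module S\<^esub> Y" for X Y by (simp add: quot_module_simps)
  have smQ: "a \<odot>\<^bsub>?Q\<^esub> coset N x = coset N (form_scale a x)" for a x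
    by (simp add: quot_module_simps a_r_coset_form form_module_simps coset_smult[OF N])
  have phi: "coset N ` D +>\<^bsub>?Q\<^esub> coset N x = \<Phi> x" for x
    unfolding a_r_coset_eq addQ \<Phi>_def image_image coset_add[OF N] ..
  have carrier: "carrier (quot_module ?Q (coset N ` D)) = \<Phi> ` Z"
    unfolding quot_module_simps(1) a_rcosets_eq by (simp add: image_image phi)
  have phi_mem: "C \<in> \<Phi> x \<longleftrightarrow> (\<exists>u. C = coset N u \<and> u - x \<in> D)" for C x
    unfolding \<Phi>_def by (force simp: image_iff)
  have phi_eq: "\<Phi> x = \<Phi> y \<longleftrightarrow> (\<exists>d\<in>D. x - y - d \<in> N)" for x y
  proof
    assume "\<Phi> x = \<Phi> y"
    moreover have "coset N x \<in> \<Phi> x" unfolding phi_mem using linD(1)[OF D] by (intro exI[of _ x]) simp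
    ultimately have "coset N x \<in> \<Phi> y" by simp
    then obtain u where u: "coset N x = coset N u" "u - y \<in> D" unfolding phi_mem by blast
    have "x - y - (u - y) \<in> N" using u(1) by (simp add: coset_eq_iff[OF N])
    then show "\<exists>d\<in>D. x - y - d \<in> N" using u(2) by blast
  next
    have sub: "\<Phi> x \<subseteq> \<Phi> y" if d: "d \<in> D" "x - y - d \<in> N" for x y d
    proof
      fix C assume "C \<in> \<Phi> x"
      then obtain u where u: "C = coset N u" "u - x \<in> D" unfolding phi_mem by blast
      \<comment> \<open>Shifting the representative by an element of N keeps its coset and makes its
        difference to y an element of D.\<close>
      have "C = coset N (u - (x - y - d))" 
        using coset_eq_iff[OF N, of u "u - (x - y - d)"] d(2) u(1) by (metis add_diff_cancel_left' diff_add_cancel)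
      moreover have "u - (x - y - d) - y \<in> D" using linD(2)[OF D u(2) d(1)] by (simp add: algebra_simps)
      ultimately show "C \<in> \<Phi> y" unfolding phi_mem by blast
    qed
    assume "\<exists>d\<in>D. x - y - d \<in> N"
    then obtain d where d: "d \<in> D" "x - y - d \<in> N" by blast
    have "y - x - (- d) \<in> N" using linD(5)[OF N d(2)] by (simp add: algebra_simps)
    then show "\<Phi> x = \<Phi> y" using sub[OF d] sub[OF linD(5)[OF D d(1)]] by blast
  qed
  have phi_iff: "\<Phi> x = \<Phi> y \<longleftrightarrow> x - y \<in> B" if "x \<in> K" "y \<in> K" for x y
    unfolding phi_eq using inj[OF linD(4)[OF K that]] exact[of "x - y"] by blast
  have phi_add: "\<Phi> x \<oplus>\<^bsub>quot_module ?Q (coset N ` D)\<^esub> \<Phi> y = \<Phi> (x + y)" for x y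
  proof -
    have "\<Phi> x <+>\<^bsub>?Q\<^esub> \<Phi> y = \<Phi> (x + y)"
    proof
      show "\<Phi> x <+>\<^bsub>?Q\<^esub> \<Phi> y \<subseteq> \<Phi> (x + y)"
      proof
        fix C assume "C \<in> \<Phi> x <+>\<^bsub>?Q\<^esub> \<Phi> y"
        then obtain X Y where XY: "X \<in> \<Phi> x" "Y \<in> \<Phi> y" "C = X <+>\<^bsub>form_module S\<^esub> Y"
          unfolding set_add_eq addQ by blast
        then obtain d e where de: "d \<in> D" "e \<in> D" "C = coset N (d + x) <+>\<^bsub>form_module S\<^esub> coset N (e + y)"
          unfolding \<Phi>_def by blast
        have "C = coset N ((d + e) + (x + y))" unfolding de(3) coset_add[OF N] by (simp add: add.assoc add.left_commute)
        then show "C \<in> \<Phi> (x + y)" unfolding \<Phi>_def using linD(2)[OF D de(1,2)] by blast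
      qed
      show "\<Phi> (x + y) \<subseteq> \<Phi> x <+>\<^bsub>?Q\<^esub> \<Phi> y"
      proof
        fix C assume "C \<in> \<Phi> (x + y)"
        then obtain d where d: "d \<in> D" "C = coset N (d + (x + y))" unfolding \<Phi>_def by blast
        have "C = coset N (d + x) <+>\<^bsub>form_module S\<^esub> coset N (0 + y)"
          unfolding d(2) coset_add[OF N] by (simp add: add.assoc)
        moreover have "coset N (d + x) \<in> \<Phi> x" "coset N (0 + y) \<in> \<Phi> y"
          unfolding \<Phi>_def using d(1) linD(1)[OF D] by blast+
        ultimately show "C \<in> \<Phi> x <+>\<^bsub>?Q\<^esub> \<Phi> y" unfolding set_add_eq addQ by blast
      qed
    qed
    then show ?thesis by (simp add: quot_module_simps(3))
  qed
  have phi_smult: "a \<odot>\<^bsub>quot_module ?Q (coset N ` D)\<^esub> \<Phi> x = \<Phi> (form_scale a x)" for a x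
  proof -
    have "a \<odot>\<^bsub>quot_module ?Q (coset N ` D)\<^esub> \<Phi> x = (\<Union>d\<in>D. \<Phi> (form_scale a (d + x)))"
      unfolding quot_module_simps(4)[of ?Q "coset N ` D"] \<Phi>_def[of x] by (simp only: image_image smQ phi)
    also have "\<dots> = \<Phi> (form_scale a x)"
    proof -
      have "\<Phi> (form_scale a (d + x)) = \<Phi> (form_scale a x)" if "d \<in> D" for d
        unfolding phi_eq using linD(3)[OF D that, of a] linD(1)[OF N] by (intro bexI[of _ "form_scale a d"]) simp_all
      then show ?thesis using linD(1)[OF D] by blast
    qed
    finally show ?thesis .
  qed
  \<comment> \<open>\<Phi> is constant on a coset of B inside K, so the union returns this common
    value.\<close>
  define h where "h X = (\<Union>x\<in>X. \<Phi> x)" for X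
  have h: "h (coset B x) = \<Phi> x" if "x \<in> K" for x
  proof -
    have "\<Phi> u = \<Phi> x" if "u \<in> coset B x" for u
    proof -
      have b: "u - x \<in> B" using that by (simp add: coset_def)
      then have "u - x + x \<in> K" using B(2) linD(2)[OF K _ \<open>x \<in> K\<close>] by blast
      then have "u \<in> K" by simp
      then show ?thesis using phi_iff[OF _ \<open>x \<in> K\<close>] b by blast
    qed
    moreover have "x \<in> coset B x" using linD(1)[OF B(1)] by (simp add: coset_def)
    ultimately show ?thesis unfolding h_def by blast
  qed
  have carrier1: "carrier (quot_module (form_module K) B) = coset B ` K"
    by (simp add: quot_module_simps a_rcosets_eq a_r_coset_form form_module_simps)
  have "bij_betw h (coset B ` K) (\<Phi> ` Z)"
    unfolding bij_betw_def
  proof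
    show "inj_on h (coset B ` K)"
      by (rule inj_onI) (clarify, simp only: h phi_iff coset_eq_iff[OF B(1)])
    have "\<Phi> z \<in> \<Phi> ` K" if z: "z \<in> Z" for z
    proof -
      obtain x d where "x \<in> K" "d \<in> D" "z - x - d \<in> N" using surj[OF z] by blast
      then have "\<Phi> z = \<Phi> x" unfolding phi_eq by blast
      then show ?thesis using \<open>x \<in> K\<close> by blast
    qed
    then have "\<Phi> ` Z = \<Phi> ` K" using KZ by blast
    then show "h ` coset B ` K = \<Phi> ` Z" by (simp add: image_image h)
  qed
  moreover have "h (X \<oplus>\<^bsub>quot_module (form_module K) B\<^esub> Y) = h X \<oplus>\<^bsub>quot_module ?Q (coset N ` D)\<^esub> h Y"
    if XY: "X \<in> coset B ` K" "Y \<in> coset B ` K" for X Y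
  proof -
    obtain x y where "x \<in> K" "y \<in> K" "X = coset B x" "Y = coset B y" using XY by blast
    then show ?thesis
      unfolding quot_module_simps(3)[of "form_module K"] by (simp only: coset_add[OF B(1)] h phi_add linD(2)[OF K])
  qed
  moreover have "h (a \<odot>\<^bsub>quot_module (form_module K) B\<^esub> X) = a \<odot>\<^bsub>quot_module ?Q (coset N ` D)\<^esub> h X"
    if X: "X \<in> coset B ` K" for X a
  proof -
    obtain x where "x \<in> K" "X = coset B x" using X by blast
    then show ?thesis
      unfolding quot_module_simps(4)[of "form_module K"]
      by (simp only: a_r_coset_form form_module_simps coset_smult[OF B(1)] h phi_smult linD(3)[OF K])
  qed
  ultimately show ?thesis
    unfolding module_isomorphic_def carrier carrier1 by blast
qed

section \<open>Comparison of cocycles and coboundaries\<close>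

context cr_manifold
begin

text \<open>Representatives of Kohn-Rossi coboundaries: the primitives are confined to
  \<open>F^p\<close>, and for q = 0 there are none.\<close>

definition exact_forms :: "nat => nat => ('a, 'm) dform set" where
  "exact_forms p q = (case q of 0 => {0} | Suc r => dM ` filtration p (p + r))"

text \<open>Representatives of Kohn-Rossi cocycles: d\<omega> only has to vanish modulo
  \<open>F^(p+1)\<close>.\<close>

definition closed_forms :: "nat => nat => ('a, 'm) dform set" where
  "closed_forms p q = {\<omega> \<in> filtration p (p + q). dM \<omega> \<in> filtration (p + 1) (p + q + 1)}"

lemma lin_filtration: "lin (filtration p k)"
  unfolding lin_def
  by (auto simp: filtration_iff intro: forms_zero forms_add forms_scale kill_form_zero kill_form_add kill_form_scale)

lemma filtration_forms: "\<omega> \<in> filtration p k ==> \<omega> \<in> forms k (topspace M)"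
  by (simp add: filtration_iff)

lemma filtration_d: "\<omega> \<in> filtration p k ==> p \<le> k + 1 ==> dM \<omega> \<in> filtration p (k + 1)"
  using kill_form_d[of \<omega> k "k + 1 - p"] by (simp add: filtration_iff dM_forms Suc_diff_le)

lemma d_add: "\<omega> \<in> forms k (topspace M) ==> \<eta> \<in> forms k (topspace M) ==> dM (\<omega> + \<eta>) = dM \<omega> + dM \<eta>"
  and d_diff: "\<omega> \<in> forms k (topspace M) ==> \<eta> \<in> forms k (topspace M) ==> dM (\<omega> - \<eta>) = dM \<omega> - dM \<eta>"
  and d_scale: "\<omega> \<in> forms k (topspace M) ==> dM (form_scale a \<omega>) = form_scale a (dM \<omega>)"
  and d_d: "\<omega> \<in> forms k (topspace M) ==> dM (dM \<omega>) = 0"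
  by (simp_all add: ext_d_add ext_d_diff ext_d_scale ext_d_ext_d)

lemma lin_d:
  assumes S: "lin S" "S \<subseteq> forms k (topspace M)"
  shows "lin (dM ` S)" "lin S' ==> lin {\<omega> \<in> S. dM \<omega> \<in> S'}"
proof -
  note l = linD[OF S(1)]
  have add: "dM (u + v) = dM u + dM v" if "u \<in> S" "v \<in> S" for u v using d_add that S(2) by blast
  have scale: "dM (form_scale a u) = form_scale a (dM u)" if "u \<in> S" for u a using d_scale that S(2) by blast
  show "lin (dM ` S)"
    unfolding lin_def
  proof (intro conjI ballI allI)
    show "0 \<in> dM ` S" using l(1) ext_d_zero[of "topspace M"] by (metis image_eqI)
    fix u assume "u \<in> dM ` S"
    then obtain x where x: "x \<in> S" "u = dM x" by blast
    show "form_scale a u \<in> dM ` S" for a using l(3)[OF x(1), of a] scale[OF x(1), of a] x(2) by (metis image_eqI)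
    fix v assume "v \<in> dM ` S"
    then obtain y where y: "y \<in> S" "v = dM y" by blast
    show "u + v \<in> dM ` S" using l(2)[OF x(1) y(1)] add[OF x(1) y(1)] x(2) y(2) by (metis image_eqI)
  qed
  assume S': "lin S'"
  show "lin {\<omega> \<in> S. dM \<omega> \<in> S'}"
    unfolding lin_def using l linD[OF S'] ext_d_zero[of "topspace M"] by (auto simp: add scale)
qed

lemma lin_closed_forms: "lin (closed_forms p q)"
  unfolding closed_forms_def using filtration_forms by (intro lin_d(2)[OF lin_filtration _ lin_filtration]) blast

lemma lin_exact_forms: "lin (exact_forms p q)"
proof (cases q)
  case (Suc r)
  have "lin (dM ` filtration p (p + r))" using filtration_forms by (intro lin_d(1)[OF lin_filtration]) blast
  then show ?thesis by (simp add: exact_forms_def Suc)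
qed (simp add: lin_def exact_forms_def)

text \<open>Subtracting d\<eta> with \<eta> in \<open>F^p\<close> makes the leading part primitive
  without changing d\<omega> or the class of \<omega> modulo coboundaries.\<close>

lemma corrected:
  assumes w: "\<omega> \<in> forms (p + q) (topspace M)" "kill_form (Suc q) \<omega>" and p: "p \<le> n + 1"
  obtains d where "d \<in> exact_forms p q" "\<omega> - d \<in> forms (p + q) (topspace M)" "kill_form (Suc q) (\<omega> - d)"
    "prim_form (p + q) q (\<omega> - d)" "dM (\<omega> - d) = dM \<omega>"
proof -
  obtain \<eta> where e: "\<eta> \<in> forms (p + q - 1) (topspace M)" "kill_form q \<eta>" "prim_form (p + q) q (\<omega> - dM \<eta>)"
    using global_corrector[OF w(1) p] by blast
  have d: "dM \<eta> \<in> exact_forms p q" "dM \<eta> \<in> forms (p + q) (topspace M)"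
  proof -
    \<comment> \<open>For q = 0 being killed by q vectors means being zero, in agreement with the
      convention in \<open>exact_forms\<close>.\<close>
    have "\<eta> = 0" if "q = 0" using e(1,2) kill_form_0 that by blast
    then show "dM \<eta> \<in> exact_forms p q" "dM \<eta> \<in> forms (p + q) (topspace M)"
      using e(1,2) dM_forms[OF e(1)] ext_d_zero[of "topspace M"] forms_zero[OF openin_top]
      by (cases q; simp add: exact_forms_def filtration_iff')+
  qed
  show thesis
  proof (rule that[OF d(1) forms_diff[OF openin_top w(1) d(2)] _ e(3)])
    show "kill_form (Suc q) (\<omega> - dM \<eta>)" by (rule kill_form_diff[OF w(2) kill_form_d[OF e(1,2)]])
    show "dM (\<omega> - dM \<eta>) = dM \<omega>" by (simp add: d_diff[OF w(1) d(2)] d_d[OF e(1)])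
  qed
qed

text \<open>If x is congruent to d\<eta>, then \<eta> is corrected to have primitive leading part.
  Its derivative has one already, being congruent to the Rumin form x. So \<eta> has a Rumin
  representative g, and d g is congruent to x, which identifies x as the Rumin differential of
  g.\<close>

lemma rumin_im_iff:
  assumes p: "p \<le> n + 1" and q: "q \<le> n"
  shows "x \<in> rumin_im p q \<longleftrightarrow> x \<in> rumin_bi p q \<and> (\<exists>d\<in>exact_forms p q. x - d \<in> filtration (p + 1) (p + q))"
proof
  assume x: "x \<in> rumin_im p q"
  show "x \<in> rumin_bi p q \<and> (\<exists>d\<in>exact_forms p q. x - d \<in> filtration (p + 1) (p + q))"
  proof (cases q)
    case 0
    then have "x = 0" using x by (simp add: rumin_im_def form_zero_0)
    then show ?thesis using linD(1)[OF lin_filtration, of "p + 1" p] by (simp add: rumin_bi_zero exact_forms_def 0)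
  next
    case (Suc r)
    then obtain g where g: "g \<in> rumin_bi p r" "x = rumin_dbar p r g" using x by (auto simp: rumin_im_def)
    note db = rumin_dbar[OF g(1), folded g(2)]
    have "g \<in> filtration p (p + r)" using rumin_bi_forms[OF g(1)] rumin_bi_kill[OF g(1)] by (simp add: filtration_iff')
    moreover have "kill_form (Suc r) (x - dM g)"
      using kill_form_diff[OF kill_form_zero db(2)] by simp
    then have "x - dM g \<in> filtration (p + 1) (p + q)"
      using rumin_bi_forms[OF db(1)] dM_forms[OF rumin_bi_forms[OF g(1)]]
      unfolding filtration_iff' Suc by (auto intro: forms_diff)
    ultimately show ?thesis using db(1) by (auto simp: exact_forms_def Suc)
  qed
next
  assume "x \<in> rumin_bi p q \<and> (\<exists>d\<in>exact_forms p q. x - d \<in> filtration (p + 1) (p + q))"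
  then obtain d where x: "x \<in> rumin_bi p q" and d: "d \<in> exact_forms p q" "kill_form q (x - d)"
    unfolding filtration_iff' by blast
  show "x \<in> rumin_im p q"
  proof (cases q)
    case 0
    then have "x = 0" using d rumin_bi_eq_0[OF x] by (simp add: exact_forms_def)
    then show ?thesis by (simp add: rumin_im_def 0 form_zero_0)
  next
    case (Suc r)
    obtain \<eta> where e: "\<eta> \<in> forms (p + r) (topspace M)" "kill_form (Suc r) \<eta>" "d = dM \<eta>"
      using d(1) by (auto simp: exact_forms_def Suc filtration_iff')
    obtain \<zeta> where z: "\<eta> - \<zeta> \<in> forms (p + r) (topspace M)" "kill_form (Suc r) (\<eta> - \<zeta>)"
      "prim_form (p + r) r (\<eta> - \<zeta>)" "dM (\<eta> - \<zeta>) = dM \<eta>"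
      using corrected[OF e(1,2) p] by blast
    note kx = d(2)[unfolded e(3) Suc]
    have xf: "x \<in> forms (Suc (p + r)) (topspace M)" and xr: "rumin_global (Suc (p + r)) x"
      using rumin_bi_forms[OF x] rumin_bi_global[OF x] by (simp_all add: Suc)
    have ke: "kill_form (Suc r) (dM \<eta> - x)" using kill_form_diff[OF kill_form_zero kx] by simp
    \<comment> \<open>d(\<eta> - \<zeta>) = d\<eta> shares its leading part with the Rumin form
      x.\<close>
    have "prim_form (Suc (p + r)) (Suc r) (dM (\<eta> - \<zeta>))"
      unfolding z(4) by (rule prim_form_kill[OF xf dM_forms[OF e(1)] prim_form_rumin(1)[OF xf xr] ke])
    then obtain g where g: "g \<in> rumin_bi p r" "kill_form r (\<eta> - \<zeta> - g)"
      using global_representative[OF z(1,2) p _ z(3)] q Suc by auto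
    have "dM (\<eta> - \<zeta> - g) = dM \<eta> - dM g" using d_diff[OF z(1) rumin_bi_forms[OF g(1)]] z(4) by simp
    then have "kill_form (Suc r) (dM \<eta> - dM g)"
      using kill_form_d[OF forms_diff[OF openin_top z(1) rumin_bi_forms[OF g(1)]] g(2)] by simp
    from kill_form_diff[OF ke this] have "kill_form (Suc r) (dM g - x)" by simp
    then have "rumin_dbar p r g = x" using x by (intro rumin_dbar_eqI[OF g(1)]) (simp_all add: Suc)
    then show ?thesis using g(1) by (auto simp: rumin_im_def Suc)
  qed
qed

definition rumin_ker :: "nat => nat => ('a, 'm) dform set" where
  "rumin_ker p q = {\<omega> \<in> rumin_bi p q. dM \<omega> \<in> filtration (p + 1) (p + q + 1)}"

lemma rumin_ker_closed: "rumin_ker p q \<subseteq> closed_forms p q"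
  using rumin_bi_forms rumin_bi_kill by (auto simp: rumin_ker_def closed_forms_def filtration_iff')

lemma rumin_dbar_eq_0_iff:
  assumes w: "\<omega> \<in> rumin_bi p q" shows "rumin_dbar p q \<omega> = 0 \<longleftrightarrow> dM \<omega> \<in> filtration (p + 1) (p + q + 1)"
proof -
  have "dM \<omega> \<in> filtration (p + 1) (p + q + 1) \<longleftrightarrow> kill_form (Suc q) (dM \<omega>)"
    using dM_forms[OF rumin_bi_forms[OF w]] by (simp add: filtration_iff)
  then show ?thesis using rumin_dbar(2)[OF w] rumin_dbar_eqI[OF w rumin_bi_zero] by auto
qed

lemma rumin_kernel:
  "a_kernel (form_module (rumin_bi p q)) (form_module (rumin_bi p (q + 1))) (rumin_dbar p q) = rumin_ker p q"
  using rumin_dbar_eq_0_iff by (auto simp: a_kernel_def kernel_def form_module_simps rumin_ker_def)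

lemma lin_rumin_bi: "lin (rumin_bi p q)"
  by (simp add: lin_def rumin_bi_zero rumin_bi_add rumin_bi_scale)

lemma lin_rumin_ker: "lin (rumin_ker p q)"
  unfolding rumin_ker_def using rumin_bi_forms by (intro lin_d(2)[OF lin_rumin_bi _ lin_filtration]) blast

lemma exact_formsD:
  assumes "d \<in> exact_forms p q" shows "d \<in> forms (p + q) (topspace M)" "dM d = 0"
proof -
  have "d \<in> forms (p + q) (topspace M) \<and> dM d = 0"
  proof (cases q)
    case 0
    then show ?thesis using assms by (simp add: exact_forms_def ext_d_zero forms_zero)
  next
    case (Suc r)
    then obtain \<eta> where "\<eta> \<in> filtration p (p + r)" "d = dM \<eta>" using assms by (auto simp: exact_forms_def)
    then show ?thesis using dM_forms[OF filtration_forms] d_d[OF filtration_forms] by (simp add: Suc)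
  qed
  then show "d \<in> forms (p + q) (topspace M)" "dM d = 0" by auto
qed

text \<open>Linearity is read off the characterisation in \<open>rumin_im_iff\<close> rather than
  from linearity of \<open>rumin_dbar\<close>.\<close>

lemma lin_rumin_im:
  assumes "p \<le> n + 1" "q \<le> n" shows "lin (rumin_im p q)" "rumin_im p q \<subseteq> rumin_ker p q"
proof -
  note b = linD[OF lin_rumin_bi[of p q]] and e = linD[OF lin_exact_forms[of p q]]
    and f = linD[OF lin_filtration[of "p + 1" "p + q"]]
  show "lin (rumin_im p q)"
    unfolding lin_def rumin_im_iff[OF assms]
  proof (intro conjI ballI allI)
    show "0 \<in> rumin_bi p q" by (rule b(1))
    show "\<exists>d\<in>exact_forms p q. 0 - d \<in> filtration (p + 1) (p + q)" using e(1) f(1) by (intro bexI[of _ 0]) simp_all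
    fix u assume "u \<in> rumin_im p q"
    then obtain d where u: "u \<in> rumin_bi p q" "d \<in> exact_forms p q" "u - d \<in> filtration (p + 1) (p + q)"
      unfolding rumin_im_iff[OF assms] by blast
    show "form_scale a u \<in> rumin_bi p q" for a by (rule b(3)[OF u(1)])
    show "\<exists>d\<in>exact_forms p q. form_scale a u - d \<in> filtration (p + 1) (p + q)" for a
      using f(3)[OF u(3), of a] e(3)[OF u(2), of a] by auto
    fix v assume "v \<in> rumin_im p q"
    then obtain d' where v: "v \<in> rumin_bi p q" "d' \<in> exact_forms p q" "v - d' \<in> filtration (p + 1) (p + q)"
      unfolding rumin_im_iff[OF assms] by blast
    show "u + v \<in> rumin_bi p q" by (rule b(2)[OF u(1) v(1)])
    have "u + v - (d + d') \<in> filtration (p + 1) (p + q)" using f(2)[OF u(3) v(3)] by (simp add: algebra_simps)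
    then show "\<exists>d\<in>exact_forms p q. u + v - d \<in> filtration (p + 1) (p + q)" using e(2)[OF u(2) v(2)] by blast
  qed
  show "rumin_im p q \<subseteq> rumin_ker p q"
  proof
    fix x assume "x \<in> rumin_im p q"
    then obtain d where x: "x \<in> rumin_bi p q" "d \<in> exact_forms p q" "x - d \<in> filtration (p + 1) (p + q)"
      unfolding rumin_im_iff[OF assms] by blast
    note d = exact_formsD[OF x(2)]
    have "dM (x - d) \<in> filtration (p + 1) (p + q + 1)" using x(3) by (intro filtration_d) auto
    then show "x \<in> rumin_ker p q" using x(1) d_diff[OF rumin_bi_forms[OF x(1)] d(1)] d(2) by (simp add: rumin_ker_def)
  qed
qed

section \<open>Kohn-Rossi cohomology through representatives, and the isomorphism\<close>

lemma kohn_rossi_space_carrier: "carrier (kohn_rossi_space p q) = coset (filtration (p + 1) (p + q)) ` filtration p (p + q)"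
  unfolding kohn_rossi_space_def quot_module_simps a_rcosets_eq a_r_coset_form form_module_simps ..

text \<open>d preserves \<open>F^(p+1)\<close>, so every member of the coset contributes the same
  set to the union.\<close>

lemma kohn_rossi_dbar_coset:
  assumes w: "\<omega> \<in> filtration p (p + q)"
  shows "kohn_rossi_dbar p q (coset (filtration (p + 1) (p + q)) \<omega>) = coset (filtration (p + 1) (p + q + 1)) (dM \<omega>)"
proof -
  let ?N = "filtration (p + 1) (p + q)" and ?N' = "filtration (p + 1) (p + q + 1)"
  have "coset ?N' (dM u) = coset ?N' (dM \<omega>)" if "u \<in> coset ?N \<omega>" for u
  proof -
    have u: "u - \<omega> \<in> ?N" using that by (simp add: coset_def)
    have "u - \<omega> + \<omega> \<in> forms (p + q) (topspace M)"
      by (rule forms_add[OF openin_top filtration_forms[OF u] filtration_forms[OF w]])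
    then have "dM (u - \<omega>) = dM u - dM \<omega>" using d_diff[OF _ filtration_forms[OF w]] by simp
    then show ?thesis using filtration_d[OF u] by (simp add: coset_eq_iff[OF lin_filtration])
  qed
  moreover have "\<omega> \<in> coset ?N \<omega>" using linD(1)[OF lin_filtration] by (simp add: coset_def)
  ultimately show ?thesis unfolding kohn_rossi_dbar_def a_r_coset_form by blast
qed

lemma kohn_rossi_kernel:
  "a_kernel (kohn_rossi_space p q) (kohn_rossi_space p (q + 1)) (kohn_rossi_dbar p q) =
    coset (filtration (p + 1) (p + q)) ` closed_forms p q"
proof -
  have zero: "\<zero>\<^bsub>kohn_rossi_space p (q + 1)\<^esub> = coset (filtration (p + 1) (p + q + 1)) 0"
    by (simp add: kohn_rossi_space_def quot_module_simps coset_def)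
  have "kohn_rossi_dbar p q (coset (filtration (p + 1) (p + q)) \<omega>) = \<zero>\<^bsub>kohn_rossi_space p (q + 1)\<^esub> \<longleftrightarrow>
      dM \<omega> \<in> filtration (p + 1) (p + q + 1)" if "\<omega> \<in> filtration p (p + q)" for \<omega>
    unfolding kohn_rossi_dbar_coset[OF that] zero coset_eq_iff[OF lin_filtration] by simp
  then show ?thesis
    unfolding a_kernel_def kernel_def closed_forms_def by (auto simp: kohn_rossi_space_carrier)
qed

lemma kohn_rossi_im_eq: "kohn_rossi_im p q = coset (filtration (p + 1) (p + q)) ` exact_forms p q"
proof (cases q)
  case 0
  then show ?thesis
    by (simp add: kohn_rossi_im_def exact_forms_def kohn_rossi_space_def quot_module_simps coset_def)
next
  case (Suc r)
  have "kohn_rossi_dbar p r ` carrier (kohn_rossi_space p r) = coset (filtration (p + 1) (p + r + 1)) ` dM ` filtration p (p + r)"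
    unfolding kohn_rossi_space_carrier image_image by (rule image_cong[OF refl kohn_rossi_dbar_coset])
  then show ?thesis by (simp add: kohn_rossi_im_def exact_forms_def Suc)
qed

text \<open>\<open>rumin_im_iff\<close> settles the kernel of the comparison map. For surjectivity,
  a cocycle is corrected to have primitive leading part and replaced by its Rumin representative f;
  d f is congruent to the derivative of the cocycle, so f is a Rumin cocycle.\<close>

lemma cohomology_isomorphic:
  assumes p: "p \<le> n + 1" and q: "q \<le> n"
  shows "module_isomorphic complex_field (rumin_cohomology p q) (kohn_rossi_cohomology p q)"
  unfolding rumin_cohomology_def rumin_kernel kohn_rossi_cohomology_def kohn_rossi_kernel kohn_rossi_im_eq
  unfolding kohn_rossi_space_def
proof (rule module_isomorphic_quotients[OF lin_rumin_ker lin_rumin_im[OF p q] lin_closed_forms lin_filtration lin_exact_forms rumin_ker_closed])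
  show "x \<in> rumin_im p q" if "x \<in> rumin_ker p q" "d \<in> exact_forms p q" "x - d \<in> filtration (p + 1) (p + q)" for x d
    using that unfolding rumin_im_iff[OF p q] rumin_ker_def by blast
  show "\<exists>d\<in>exact_forms p q. x - d \<in> filtration (p + 1) (p + q)" if "x \<in> rumin_im p q" for x
    using that unfolding rumin_im_iff[OF p q] by blast
  fix z assume "z \<in> closed_forms p q"
  then have z: "z \<in> forms (p + q) (topspace M)" "kill_form (Suc q) z" "kill_form (Suc q) (dM z)"
    by (auto simp: closed_forms_def filtration_iff)
  obtain d where d: "d \<in> exact_forms p q" "z - d \<in> forms (p + q) (topspace M)" "kill_form (Suc q) (z - d)"
    "prim_form (p + q) q (z - d)" "dM (z - d) = dM z"
    using corrected[OF z(1,2) p] by blast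
  \<comment> \<open>Since d z lies in \<open>F^(p+1)\<close>, its leading part is that of the zero
    form.\<close>
  have "prim_form (Suc (p + q)) (Suc q) (dM (z - d))"
    unfolding d(5) using z(3)
    by (intro prim_form_kill[OF forms_zero[OF openin_top] dM_forms[OF z(1)] prim_form_zero]) simp
  then obtain f where f: "f \<in> rumin_bi p q" "kill_form q (z - d - f)"
    using global_representative[OF d(2,3) p q d(4)] by blast
  have "dM (z - d - f) = dM z - dM f" using d_diff[OF d(2) rumin_bi_forms[OF f(1)]] d(5) by simp
  then have "kill_form (Suc q) (dM z - dM f)"
    using kill_form_d[OF forms_diff[OF openin_top d(2) rumin_bi_forms[OF f(1)]] f(2)] by simp
  from kill_form_diff[OF z(3) this] have "kill_form (Suc q) (dM f)" by simp
  then have "f \<in> rumin_ker p q"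
    using f(1) dM_forms[OF rumin_bi_forms[OF f(1)]] by (simp add: rumin_ker_def filtration_iff)
  moreover have e: "z - f - d = z - d - f" by (simp add: algebra_simps)
  have "z - f - d \<in> filtration (p + 1) (p + q)"
    unfolding e filtration_iff' using f(2) forms_diff[OF openin_top d(2) rumin_bi_forms[OF f(1)]] by simp
  ultimately show "\<exists>x\<in>rumin_ker p q. \<exists>d\<in>exact_forms p q. z - x - d \<in> filtration (p + 1) (p + q)"
    using d(1) by blast
qed

end

theorem theorem9p2:
  fixes M :: "'a topology" and A :: "('a, 'm::finite) chart set" and n p q :: nat
    and T10 :: "('a, 'm) chart \<Rightarrow> real ^ 'm \<Rightarrow> (complex ^ 'm) set"
  assumes "cr_manifold M A n T10" and "p \<le> n + 1" and "q \<le> n"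
  shows "module_isomorphic complex_field
           (cr_manifold.rumin_cohomology M A n T10 p q)
           (cr_manifold.kohn_rossi_cohomology M A T10 p q)"
proof -
  interpret cr_manifold M A n T10 by (rule assms(1))
  show ?thesis by (rule cohomology_isomorphic[OF assms(2,3)])
qed

end
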